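(* Let $m\ge2$ be an integer, let $\zeta$ be a primitive $m$th root of unity, and let $C_m^\zeta$ be the subgroup of $SU(2)$ generated by $\begin{pmatrix}\zeta&0\\0&\zeta^{-1}\end{pmatrix}$. Then the category $\mathcal{C}_{m,1}$ (defined in the context) is monoidally equivalent to $\mathrm{Rep}(C_m^\zeta)$, the category of finite-dimensional complex representations of $C_m^\zeta$.
   Context: Unshaded planar algebras. An unshaded planar algebra is the notion obtained from Jones' planar algebras by dropping the shading: a family of complex vector spaces with a compatible action of unshaded planar tangles (outer box, inner boxes, non-crossing strands, a star at each box; isotopy invariant, compatible with composition of tangles). Boxes may have any number of boundary points, divided into bottom and top points; $\mathcal P_k$ is the space of elements with $k$ strands on top and $k$ on the bottom, star on the left. The planar algebra with given generators and relations is the quotient of the free planar algebra on the generators by the planar ideal generated by the relations. $fg$ is $f$ stacked on top of $g$; $\otimes$ is horizontal juxtaposition; $\overline{T}$ is rotation by $\pi$; $\emptyset$ is the empty diagram; $X\in\mathcal P_1$ is the vertical strand. Number the boundary points of a box clockwise from the star (top from left to right, then bottom from right to left). The click $\mathcal F$ is the one-step rotation, keeping the numbers of top and bottom points, for which the $i$-th boundary point of $T$ becomes the $(i+1)$-st (cyclically) boundary point of $\mathcal F(T)$. The planar algebra $\mathcal P^{(m,\lambda)}$, for $m\ge2$ and $\lambda$ an $m$th root of unity. Put $n=\lfloor m/2\rfloor$ and $a=m-n$. It is the unshaded planar algebra generated by $P_1\in\mathcal P_1$, $U$ and $U^*$ as follows. $P_1$ is drawn as an upward oriented strand and $Q_1:=\overline{P}_1$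 as a downward oriented strand (up to isotopy). $U$ has $a$ bottom strands coloured $P_1$ and $n$ top strands coloured $Q_1$ (all strands oriented into $U$; $U=Q_1^{\otimes n}UP_1^{\otimes a}$); $U^*$ has $n$ bottom strands coloured $Q_1$ and $a$ top strands coloured $P_1$. Relations: (i) closed oriented loops of either orientation equal $1$; (ii) $X=P_1+Q_1$; (iii) $P_1Q_1=0=Q_1P_1$; (iv) the element of $\mathcal P_2$ consisting of an oriented arc joining the two top points and an oriented arc joining the two bottom points, with orientations at the four boundary points equal to those of $P_1\otimes Q_1$ (resp. $Q_1\otimes P_1$), equals $P_1\otimes Q_1$ (resp. $Q_1\otimes P_1$); (v) $UU^*=Q_1^{\otimes n}$, $U^*U=P_1^{\otimes a}$; (vi) $\mathcal F(U)=\lambda U$, $\mathcal F(U^* )=\lambda U^*$. The adjoint $*$ is antilinear, reflects diagrams over a horizontal line, fixes $P_1$ and swaps $U$ and $U^*$. The category $\mathcal C_{m,\lambda}$ is the additive envelope (formal finite direct sums, matrices of morphisms) of the following strict monoidal category: objects are the projections $p=p^2=p^*$ in all $\mathcal P^{(m,\lambda)}_k$, $k\ge0$; $\mathrm{Hom}(p,q)$ is the space of diagrams $f$ with bottom boundary that of $p$, top boundary that of $q$ and $qfp=f$; composition is vertical stacking; tensor product is horizontal juxtaposition; the unit is $\emptyset$. In the claim $\lambda=1$. *)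

theory Defs
  imports
    "HOL-Library.Poly_Mapping"
    "HOL-Algebra.Generated_Groups"
    "Jordan_Normal_Form.Schur_Decomposition"
begin

section \<open>\<open>\<complex>\<close>-linear monoidal categories and their equivalences\<close>

text \<open>Hom-sets of different pairs of objects may overlap, so every operation on morphisms takes
  the objects as arguments: \<^term>\<open>Comp C X Y Z g f\<close> is \<open>g \<circ> f\<close> for \<open>f : X \<rightarrow> Y\<close> and \<open>g : Y \<rightarrow> Z\<close>,
  and \<^term>\<open>TenM C X X' Y Y' f g\<close> is \<open>f \<otimes> g\<close> for \<open>f : X \<rightarrow> X'\<close> and \<open>g : Y \<rightarrow> Y'\<close>.\<close>

record ('o, 'm) lmcat =
  Obj :: "'o set"
  Hom :: "'o \<Rightarrow> 'o \<Rightarrow> 'm set"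
  Idm :: "'o \<Rightarrow> 'm"
  Comp :: "'o \<Rightarrow> 'o \<Rightarrow> 'o \<Rightarrow> 'm \<Rightarrow> 'm \<Rightarrow> 'm"
  Zero :: "'o \<Rightarrow> 'o \<Rightarrow> 'm"
  Add :: "'o \<Rightarrow> 'o \<Rightarrow> 'm \<Rightarrow> 'm \<Rightarrow> 'm"
  Scale :: "'o \<Rightarrow> 'o \<Rightarrow> complex \<Rightarrow> 'm \<Rightarrow> 'm"
  Unit :: "'o"
  TenO :: "'o \<Rightarrow> 'o \<Rightarrow> 'o"
  TenM :: "'o \<Rightarrow> 'o \<Rightarrow> 'o \<Rightarrow> 'o \<Rightarrow> 'm \<Rightarrow> 'm \<Rightarrow> 'm"
  Assoc :: "'o \<Rightarrow> 'o \<Rightarrow> 'o \<Rightarrow> 'm"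
  LUnit :: "'o \<Rightarrow> 'm"
  RUnit :: "'o \<Rightarrow> 'm"

definition is_iso :: "('o, 'm) lmcat \<Rightarrow> 'o \<Rightarrow> 'o \<Rightarrow> 'm \<Rightarrow> bool" where
  "is_iso C X Y f \<longleftrightarrow> f \<in> Hom C X Y \<and>
     (\<exists>g \<in> Hom C Y X. Comp C X Y X g f = Idm C X \<and> Comp C Y X Y f g = Idm C Y)"

locale linear_category =
  fixes C :: "('o, 'm) lmcat"
  assumes Id_closed: "X \<in> Obj C \<Longrightarrow> Idm C X \<in> Hom C X X"
    and Comp_closed:
      "\<lbrakk>X \<in> Obj C; Y \<in> Obj C; Z \<in> Obj C; f \<in> Hom C X Y; g \<in> Hom C Y Z\<rbrakk>
        \<Longrightarrow> Comp C X Y Z g f \<in> Hom C X Z"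
    and Comp_assoc:
      "\<lbrakk>W \<in> Obj C; X \<in> Obj C; Y \<in> Obj C; Z \<in> Obj C;
        f \<in> Hom C W X; g \<in> Hom C X Y; h \<in> Hom C Y Z\<rbrakk>
        \<Longrightarrow> Comp C W Y Z h (Comp C W X Y g f) = Comp C W X Z (Comp C X Y Z h g) f"
    and Comp_Id_left:
      "\<lbrakk>X \<in> Obj C; Y \<in> Obj C; f \<in> Hom C X Y\<rbrakk> \<Longrightarrow> Comp C X Y Y (Idm C Y) f = f"
    and Comp_Id_right:
      "\<lbrakk>X \<in> Obj C; Y \<in> Obj C; f \<in> Hom C X Y\<rbrakk> \<Longrightarrow> Comp C X X Y f (Idm C X) = f"
    and Zero_closed: "\<lbrakk>X \<in> Obj C; Y \<in> Obj C\<rbrakk> \<Longrightarrow> Zero C X Y \<in> Hom C X Y"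
    and Add_closed:
      "\<lbrakk>X \<in> Obj C; Y \<in> Obj C; f \<in> Hom C X Y; g \<in> Hom C X Y\<rbrakk> \<Longrightarrow> Add C X Y f g \<in> Hom C X Y"
    and Scale_closed:
      "\<lbrakk>X \<in> Obj C; Y \<in> Obj C; f \<in> Hom C X Y\<rbrakk> \<Longrightarrow> Scale C X Y c f \<in> Hom C X Y"
    and Add_assoc:
      "\<lbrakk>X \<in> Obj C; Y \<in> Obj C; f \<in> Hom C X Y; g \<in> Hom C X Y; h \<in> Hom C X Y\<rbrakk>
        \<Longrightarrow> Add C X Y (Add C X Y f g) h = Add C X Y f (Add C X Y g h)"
    and Add_comm:
      "\<lbrakk>X \<in> Obj C; Y \<in> Obj C; f \<in> Hom C X Y; g \<in> Hom C X Y\<rbrakk> \<Longrightarrow> Add C X Y f g = Add C X Y g f"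
    and Add_Zero:
      "\<lbrakk>X \<in> Obj C; Y \<in> Obj C; f \<in> Hom C X Y\<rbrakk> \<Longrightarrow> Add C X Y (Zero C X Y) f = f"
    and Add_inverse:
      "\<lbrakk>X \<in> Obj C; Y \<in> Obj C; f \<in> Hom C X Y\<rbrakk> \<Longrightarrow> \<exists>g \<in> Hom C X Y. Add C X Y f g = Zero C X Y"
    and Scale_one:
      "\<lbrakk>X \<in> Obj C; Y \<in> Obj C; f \<in> Hom C X Y\<rbrakk> \<Longrightarrow> Scale C X Y 1 f = f"
    and Scale_Scale:
      "\<lbrakk>X \<in> Obj C; Y \<in> Obj C; f \<in> Hom C X Y\<rbrakk>
        \<Longrightarrow> Scale C X Y c (Scale C X Y d f) = Scale C X Y (c * d) f"
    and Scale_add_left: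
      "\<lbrakk>X \<in> Obj C; Y \<in> Obj C; f \<in> Hom C X Y\<rbrakk>
        \<Longrightarrow> Scale C X Y (c + d) f = Add C X Y (Scale C X Y c f) (Scale C X Y d f)"
    and Scale_add_right:
      "\<lbrakk>X \<in> Obj C; Y \<in> Obj C; f \<in> Hom C X Y; g \<in> Hom C X Y\<rbrakk>
        \<Longrightarrow> Scale C X Y c (Add C X Y f g) = Add C X Y (Scale C X Y c f) (Scale C X Y c g)"
    and Comp_add_left:
      "\<lbrakk>X \<in> Obj C; Y \<in> Obj C; Z \<in> Obj C; f \<in> Hom C X Y; g \<in> Hom C Y Z; g' \<in> Hom C Y Z\<rbrakk>
        \<Longrightarrow> Comp C X Y Z (Add C Y Z g g') f
            = Add C X Z (Comp C X Y Z g f) (Comp C X Y Z g' f)"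
    and Comp_add_right:
      "\<lbrakk>X \<in> Obj C; Y \<in> Obj C; Z \<in> Obj C; f \<in> Hom C X Y; f' \<in> Hom C X Y; g \<in> Hom C Y Z\<rbrakk>
        \<Longrightarrow> Comp C X Y Z g (Add C X Y f f')
            = Add C X Z (Comp C X Y Z g f) (Comp C X Y Z g f')"
    and Comp_scale_left:
      "\<lbrakk>X \<in> Obj C; Y \<in> Obj C; Z \<in> Obj C; f \<in> Hom C X Y; g \<in> Hom C Y Z\<rbrakk>
        \<Longrightarrow> Comp C X Y Z (Scale C Y Z c g) f = Scale C X Z c (Comp C X Y Z g f)"
    and Comp_scale_right:
      "\<lbrakk>X \<in> Obj C; Y \<in> Obj C; Z \<in> Obj C; f \<in> Hom C X Y; g \<in> Hom C Y Z\<rbrakk>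
        \<Longrightarrow> Comp C X Y Z g (Scale C X Y c f) = Scale C X Z c (Comp C X Y Z g f)"

locale linear_monoidal_category = linear_category +
  assumes Unit_closed: "Unit C \<in> Obj C"
    and TenO_closed: "\<lbrakk>X \<in> Obj C; Y \<in> Obj C\<rbrakk> \<Longrightarrow> TenO C X Y \<in> Obj C"
    and TenM_closed:
      "\<lbrakk>X \<in> Obj C; X' \<in> Obj C; Y \<in> Obj C; Y' \<in> Obj C; f \<in> Hom C X X'; g \<in> Hom C Y Y'\<rbrakk>
        \<Longrightarrow> TenM C X X' Y Y' f g \<in> Hom C (TenO C X Y) (TenO C X' Y')"
    and TenM_Id:
      "\<lbrakk>X \<in> Obj C; Y \<in> Obj C\<rbrakk> \<Longrightarrow> TenM C X X Y Y (Idm C X) (Idm C Y) = Idm C (TenO C X Y)"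
    and TenM_Comp:
      "\<lbrakk>X \<in> Obj C; X' \<in> Obj C; X'' \<in> Obj C; Y \<in> Obj C; Y' \<in> Obj C; Y'' \<in> Obj C;
        f \<in> Hom C X X'; f' \<in> Hom C X' X''; g \<in> Hom C Y Y'; g' \<in> Hom C Y' Y''\<rbrakk>
        \<Longrightarrow> TenM C X X'' Y Y'' (Comp C X X' X'' f' f) (Comp C Y Y' Y'' g' g)
            = Comp C (TenO C X Y) (TenO C X' Y') (TenO C X'' Y'')
                (TenM C X' X'' Y' Y'' f' g') (TenM C X X' Y Y' f g)"
    and TenM_add_left:
      "\<lbrakk>X \<in> Obj C; X' \<in> Obj C; Y \<in> Obj C; Y' \<in> Obj C;
        f \<in> Hom C X X'; f' \<in> Hom C X X'; g \<in> Hom C Y Y'\<rbrakk>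
        \<Longrightarrow> TenM C X X' Y Y' (Add C X X' f f') g
            = Add C (TenO C X Y) (TenO C X' Y')
                (TenM C X X' Y Y' f g) (TenM C X X' Y Y' f' g)"
    and TenM_add_right:
      "\<lbrakk>X \<in> Obj C; X' \<in> Obj C; Y \<in> Obj C; Y' \<in> Obj C;
        f \<in> Hom C X X'; g \<in> Hom C Y Y'; g' \<in> Hom C Y Y'\<rbrakk>
        \<Longrightarrow> TenM C X X' Y Y' f (Add C Y Y' g g')
            = Add C (TenO C X Y) (TenO C X' Y')
                (TenM C X X' Y Y' f g) (TenM C X X' Y Y' f g')"
    and TenM_scale_left:
      "\<lbrakk>X \<in> Obj C; X' \<in> Obj C; Y \<in> Obj C; Y' \<in> Obj C; f \<in> Hom C X X'; g \<in> Hom C Y Y'\<rbrakk>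
        \<Longrightarrow> TenM C X X' Y Y' (Scale C X X' c f) g
            = Scale C (TenO C X Y) (TenO C X' Y') c (TenM C X X' Y Y' f g)"
    and TenM_scale_right:
      "\<lbrakk>X \<in> Obj C; X' \<in> Obj C; Y \<in> Obj C; Y' \<in> Obj C; f \<in> Hom C X X'; g \<in> Hom C Y Y'\<rbrakk>
        \<Longrightarrow> TenM C X X' Y Y' f (Scale C Y Y' c g)
            = Scale C (TenO C X Y) (TenO C X' Y') c (TenM C X X' Y Y' f g)"
    and Assoc_iso:
      "\<lbrakk>X \<in> Obj C; Y \<in> Obj C; Z \<in> Obj C\<rbrakk>
        \<Longrightarrow> is_iso C (TenO C (TenO C X Y) Z) (TenO C X (TenO C Y Z)) (Assoc C X Y Z)"
    and Assoc_natural: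
      "\<lbrakk>X \<in> Obj C; X' \<in> Obj C; Y \<in> Obj C; Y' \<in> Obj C; Z \<in> Obj C; Z' \<in> Obj C;
        f \<in> Hom C X X'; g \<in> Hom C Y Y'; h \<in> Hom C Z Z'\<rbrakk>
        \<Longrightarrow> Comp C (TenO C (TenO C X Y) Z) (TenO C (TenO C X' Y') Z') (TenO C X' (TenO C Y' Z'))
              (Assoc C X' Y' Z')
              (TenM C (TenO C X Y) (TenO C X' Y') Z Z' (TenM C X X' Y Y' f g) h)
            = Comp C (TenO C (TenO C X Y) Z) (TenO C X (TenO C Y Z)) (TenO C X' (TenO C Y' Z'))
              (TenM C X X' (TenO C Y Z) (TenO C Y' Z') f (TenM C Y Y' Z Z' g h))
              (Assoc C X Y Z)"
    and LUnit_iso: "X \<in> Obj C \<Longrightarrow> is_iso C (TenO C (Unit C) X) X (LUnit C X)"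
    and LUnit_natural:
      "\<lbrakk>X \<in> Obj C; Y \<in> Obj C; f \<in> Hom C X Y\<rbrakk>
        \<Longrightarrow> Comp C (TenO C (Unit C) X) (TenO C (Unit C) Y) Y
              (LUnit C Y) (TenM C (Unit C) (Unit C) X Y (Idm C (Unit C)) f)
            = Comp C (TenO C (Unit C) X) X Y f (LUnit C X)"
    and RUnit_iso: "X \<in> Obj C \<Longrightarrow> is_iso C (TenO C X (Unit C)) X (RUnit C X)"
    and RUnit_natural:
      "\<lbrakk>X \<in> Obj C; Y \<in> Obj C; f \<in> Hom C X Y\<rbrakk>
        \<Longrightarrow> Comp C (TenO C X (Unit C)) (TenO C Y (Unit C)) Y
              (RUnit C Y) (TenM C X Y (Unit C) (Unit C) f (Idm C (Unit C)))
            = Comp C (TenO C X (Unit C)) X Y f (RUnit C X)"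
    and pentagon:
      "\<lbrakk>W \<in> Obj C; X \<in> Obj C; Y \<in> Obj C; Z \<in> Obj C\<rbrakk>
        \<Longrightarrow> Comp C (TenO C (TenO C (TenO C W X) Y) Z) (TenO C (TenO C W X) (TenO C Y Z))
                  (TenO C W (TenO C X (TenO C Y Z)))
              (Assoc C W X (TenO C Y Z)) (Assoc C (TenO C W X) Y Z)
            = Comp C (TenO C (TenO C (TenO C W X) Y) Z) (TenO C W (TenO C (TenO C X Y) Z))
                  (TenO C W (TenO C X (TenO C Y Z)))
              (TenM C W W (TenO C (TenO C X Y) Z) (TenO C X (TenO C Y Z))
                (Idm C W) (Assoc C X Y Z))
              (Comp C (TenO C (TenO C (TenO C W X) Y) Z) (TenO C (TenO C W (TenO C X Y)) Z)
                  (TenO C W (TenO C (TenO C X Y) Z))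
                (Assoc C W (TenO C X Y) Z)
                (TenM C (TenO C (TenO C W X) Y) (TenO C W (TenO C X Y)) Z Z
                  (Assoc C W X Y) (Idm C Z)))"
    and triangle:
      "\<lbrakk>X \<in> Obj C; Y \<in> Obj C\<rbrakk>
        \<Longrightarrow> Comp C (TenO C (TenO C X (Unit C)) Y) (TenO C X (TenO C (Unit C) Y)) (TenO C X Y)
              (TenM C X X (TenO C (Unit C) Y) Y (Idm C X) (LUnit C Y))
              (Assoc C X (Unit C) Y)
            = TenM C (TenO C X (Unit C)) X Y Y (RUnit C X) (Idm C Y)"

text \<open>A functor is given by its object map \<open>F\<close> and its morphism map, where \<open>Fm X Y f\<close> is the image
  of \<open>f : X \<rightarrow> Y\<close>.\<close>

locale linear_functor =
  fixes C :: "('o, 'm) lmcat" and D :: "('p, 'n) lmcat"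
    and F :: "'o \<Rightarrow> 'p" and Fm :: "'o \<Rightarrow> 'o \<Rightarrow> 'm \<Rightarrow> 'n"
  assumes F_Obj: "X \<in> Obj C \<Longrightarrow> F X \<in> Obj D"
    and F_Hom: "\<lbrakk>X \<in> Obj C; Y \<in> Obj C; f \<in> Hom C X Y\<rbrakk> \<Longrightarrow> Fm X Y f \<in> Hom D (F X) (F Y)"
    and F_Id: "X \<in> Obj C \<Longrightarrow> Fm X X (Idm C X) = Idm D (F X)"
    and F_Comp:
      "\<lbrakk>X \<in> Obj C; Y \<in> Obj C; Z \<in> Obj C; f \<in> Hom C X Y; g \<in> Hom C Y Z\<rbrakk>
        \<Longrightarrow> Fm X Z (Comp C X Y Z g f) = Comp D (F X) (F Y) (F Z) (Fm Y Z g) (Fm X Y f)"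
    and F_Add:
      "\<lbrakk>X \<in> Obj C; Y \<in> Obj C; f \<in> Hom C X Y; g \<in> Hom C X Y\<rbrakk>
        \<Longrightarrow> Fm X Y (Add C X Y f g) = Add D (F X) (F Y) (Fm X Y f) (Fm X Y g)"
    and F_Scale:
      "\<lbrakk>X \<in> Obj C; Y \<in> Obj C; f \<in> Hom C X Y\<rbrakk>
        \<Longrightarrow> Fm X Y (Scale C X Y c f) = Scale D (F X) (F Y) c (Fm X Y f)"

locale natural_isomorphism =
  fixes C :: "('o, 'm) lmcat" and D :: "('p, 'n) lmcat"
    and F :: "'o \<Rightarrow> 'p" and Fm :: "'o \<Rightarrow> 'o \<Rightarrow> 'm \<Rightarrow> 'n"
    and G :: "'o \<Rightarrow> 'p" and Gm :: "'o \<Rightarrow> 'o \<Rightarrow> 'm \<Rightarrow> 'n"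
    and \<eta> :: "'o \<Rightarrow> 'n"
  assumes component_iso: "X \<in> Obj C \<Longrightarrow> is_iso D (F X) (G X) (\<eta> X)"
    and naturality:
      "\<lbrakk>X \<in> Obj C; Y \<in> Obj C; f \<in> Hom C X Y\<rbrakk>
        \<Longrightarrow> Comp D (F X) (F Y) (G Y) (\<eta> Y) (Fm X Y f)
            = Comp D (F X) (G X) (G Y) (Gm X Y f) (\<eta> X)"

text \<open>Strong monoidal functors; \<open>J X Y : F X \<otimes> F Y \<rightarrow> F (X \<otimes> Y)\<close> and \<open>u : 1 \<rightarrow> F 1\<close> are the
  structure isomorphisms.\<close>

locale linear_monoidal_functor = linear_functor +
  fixes J :: "'o \<Rightarrow> 'o \<Rightarrow> 'n" and u :: "'n"
  assumes J_iso:
      "\<lbrakk>X \<in> Obj C; Y \<in> Obj C\<rbrakk> \<Longrightarrow> is_iso D (TenO D (F X) (F Y)) (F (TenO C X Y)) (J X Y)"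
    and J_natural:
      "\<lbrakk>X \<in> Obj C; X' \<in> Obj C; Y \<in> Obj C; Y' \<in> Obj C; f \<in> Hom C X X'; g \<in> Hom C Y Y'\<rbrakk>
        \<Longrightarrow> Comp D (TenO D (F X) (F Y)) (TenO D (F X') (F Y')) (F (TenO C X' Y'))
              (J X' Y') (TenM D (F X) (F X') (F Y) (F Y') (Fm X X' f) (Fm Y Y' g))
            = Comp D (TenO D (F X) (F Y)) (F (TenO C X Y)) (F (TenO C X' Y'))
              (Fm (TenO C X Y) (TenO C X' Y') (TenM C X X' Y Y' f g)) (J X Y)"
    and u_iso: "is_iso D (Unit D) (F (Unit C)) u"
    and J_assoc:
      "\<lbrakk>X \<in> Obj C; Y \<in> Obj C; Z \<in> Obj C\<rbrakk>
        \<Longrightarrow> Comp D (TenO D (TenO D (F X) (F Y)) (F Z)) (F (TenO C (TenO C X Y) Z))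
                  (F (TenO C X (TenO C Y Z)))
              (Fm (TenO C (TenO C X Y) Z) (TenO C X (TenO C Y Z)) (Assoc C X Y Z))
              (Comp D (TenO D (TenO D (F X) (F Y)) (F Z)) (TenO D (F (TenO C X Y)) (F Z))
                  (F (TenO C (TenO C X Y) Z))
                (J (TenO C X Y) Z)
                (TenM D (TenO D (F X) (F Y)) (F (TenO C X Y)) (F Z) (F Z)
                  (J X Y) (Idm D (F Z))))
            = Comp D (TenO D (TenO D (F X) (F Y)) (F Z)) (TenO D (F X) (F (TenO C Y Z)))
                  (F (TenO C X (TenO C Y Z)))
              (J X (TenO C Y Z))
              (Comp D (TenO D (TenO D (F X) (F Y)) (F Z)) (TenO D (F X) (TenO D (F Y) (F Z)))
                  (TenO D (F X) (F (TenO C Y Z)))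
                (TenM D (F X) (F X) (TenO D (F Y) (F Z)) (F (TenO C Y Z))
                  (Idm D (F X)) (J Y Z))
                (Assoc D (F X) (F Y) (F Z)))"
    and J_LUnit:
      "X \<in> Obj C
        \<Longrightarrow> Comp D (TenO D (Unit D) (F X)) (F (TenO C (Unit C) X)) (F X)
              (Fm (TenO C (Unit C) X) X (LUnit C X))
              (Comp D (TenO D (Unit D) (F X)) (TenO D (F (Unit C)) (F X)) (F (TenO C (Unit C) X))
                (J (Unit C) X)
                (TenM D (Unit D) (F (Unit C)) (F X) (F X) u (Idm D (F X))))
            = LUnit D (F X)"
    and J_RUnit:
      "X \<in> Obj C
        \<Longrightarrow> Comp D (TenO D (F X) (Unit D)) (F (TenO C X (Unit C))) (F X)
              (Fm (TenO C X (Unit C)) X (RUnit C X))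
              (Comp D (TenO D (F X) (Unit D)) (TenO D (F X) (F (Unit C))) (F (TenO C X (Unit C)))
                (J X (Unit C))
                (TenM D (F X) (F X) (Unit D) (F (Unit C)) (Idm D (F X)) u))
            = RUnit D (F X)"

definition monoidally_equivalent :: "('o, 'm) lmcat \<Rightarrow> ('p, 'n) lmcat \<Rightarrow> bool" where
  "monoidally_equivalent C D \<longleftrightarrow>
     linear_monoidal_category C \<and> linear_monoidal_category D \<and>
     (\<exists>F Fm J u G Gm \<eta> \<epsilon>.
        linear_monoidal_functor C D F Fm J u \<and>
        linear_functor D C G Gm \<and>
        natural_isomorphism C C (\<lambda>X. X) (\<lambda>X Y f. f)
          (\<lambda>X. G (F X)) (\<lambda>X Y f. Gm (F X) (F Y) (Fm X Y f)) \<eta> \<and>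
        natural_isomorphism D D (\<lambda>X. F (G X)) (\<lambda>X Y f. Fm (G X) (G Y) (Gm X Y f))
          (\<lambda>X. X) (\<lambda>X Y f. f) \<epsilon>)"


section \<open>The additive envelope\<close>

text \<open>Objects are finite lists \<open>[X\<^sub>0, \<dots>]\<close>, standing for \<open>X\<^sub>0 \<oplus> \<dots>\<close>. A morphism \<open>Xs \<rightarrow> Ys\<close> is a matrix
  whose \<open>(i, j)\<close> entry is a morphism \<open>Xs ! j \<rightarrow> Ys ! i\<close>. The summands of a tensor product are
  ordered lexicographically.\<close>

definition env_tensor :: "('o, 'm) lmcat \<Rightarrow> 'o list \<Rightarrow> 'o list \<Rightarrow> 'o list" where
  "env_tensor C Xs Ys = concat (map (\<lambda>X. map (TenO C X) Ys) Xs)"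

definition env_diag ::
    "('o, 'm) lmcat \<Rightarrow> 'o list \<Rightarrow> 'o list \<Rightarrow> (nat \<Rightarrow> 'm) \<Rightarrow> 'm mat" where
  "env_diag C Xs Ys d =
     mat (length Ys) (length Xs) (\<lambda>(i, j). if i = j then d i else Zero C (Xs ! j) (Ys ! i))"

definition additive_envelope :: "('o, 'm) lmcat \<Rightarrow> ('o list, 'm mat) lmcat" where
  "additive_envelope C = \<lparr>
     Obj = {Xs. set Xs \<subseteq> Obj C},
     Hom = (\<lambda>Xs Ys. {f \<in> carrier_mat (length Ys) (length Xs).
        \<forall>i < length Ys. \<forall>j < length Xs. f $$ (i, j) \<in> Hom C (Xs ! j) (Ys ! i)}),
     Idm = (\<lambda>Xs. env_diag C Xs Xs (\<lambda>i. Idm C (Xs ! i))),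
     Comp = (\<lambda>Xs Ys Zs g f. mat (length Zs) (length Xs) (\<lambda>(i, k).
        foldr (\<lambda>j. Add C (Xs ! k) (Zs ! i)
                 (Comp C (Xs ! k) (Ys ! j) (Zs ! i) (g $$ (i, j)) (f $$ (j, k))))
          [0..<length Ys] (Zero C (Xs ! k) (Zs ! i)))),
     Zero = (\<lambda>Xs Ys. mat (length Ys) (length Xs) (\<lambda>(i, j). Zero C (Xs ! j) (Ys ! i))),
     Add = (\<lambda>Xs Ys f g. mat (length Ys) (length Xs) (\<lambda>(i, j).
        Add C (Xs ! j) (Ys ! i) (f $$ (i, j)) (g $$ (i, j)))),
     Scale = (\<lambda>Xs Ys c f. mat (length Ys) (length Xs) (\<lambda>(i, j).
        Scale C (Xs ! j) (Ys ! i) c (f $$ (i, j)))),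
     Unit = [Unit C],
     TenO = env_tensor C,
     TenM = (\<lambda>Xs Xs' Ys Ys' f g.
        mat (length Xs' * length Ys') (length Xs * length Ys) (\<lambda>(i, j).
          TenM C (Xs ! (j div length Ys)) (Xs' ! (i div length Ys'))
                 (Ys ! (j mod length Ys)) (Ys' ! (i mod length Ys'))
            (f $$ (i div length Ys', j div length Ys))
            (g $$ (i mod length Ys', j mod length Ys)))),
     Assoc = (\<lambda>Xs Ys Zs.
        env_diag C (env_tensor C (env_tensor C Xs Ys) Zs) (env_tensor C Xs (env_tensor C Ys Zs))
          (\<lambda>i. Assoc C (Xs ! (i div (length Ys * length Zs)))
                        (Ys ! ((i div length Zs) mod length Ys))
                        (Zs ! (i mod length Zs)))),
     LUnit = (\<lambda>Xs. env_diag C (env_tensor C [Unit C] Xs) Xs (\<lambda>i. LUnit C (Xs ! i))),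
     RUnit = (\<lambda>Xs. env_diag C (env_tensor C Xs [Unit C]) Xs (\<lambda>i. RUnit C (Xs ! i))) \<rparr>"


section \<open>Unshaded planar tangles\<close>

text \<open>A tangle is drawn in a rectangle, in general position with respect to the height function:
  it is built from vertical strands, local maxima (\<^term>\<open>Cap\<close>), local minima (\<^term>\<open>Cup\<close>) and inner
  boxes by vertical stacking and horizontal juxtaposition. \<^term>\<open>Box l b t\<close> is an inner box carrying
  the label \<open>l\<close>, with \<open>b\<close> bottom and \<open>t\<close> top boundary points and its star on the left.
  \<^term>\<open>Stack d e\<close> is \<open>d\<close> on top of \<open>e\<close>.\<close>

datatype 'l diagram =
    Strands nat
  | Cup
  | Cap
  | Box 'l nat nat
  | Stack "'l diagram" "'l diagram"
  | Juxt "'l diagram" "'l diagram"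

fun bot_points :: "'l diagram \<Rightarrow> nat" where
  "bot_points (Strands k) = k"
| "bot_points Cup = 0"
| "bot_points Cap = 2"
| "bot_points (Box l b t) = b"
| "bot_points (Stack d e) = bot_points e"
| "bot_points (Juxt d e) = bot_points d + bot_points e"

fun top_points :: "'l diagram \<Rightarrow> nat" where
  "top_points (Strands k) = k"
| "top_points Cup = 2"
| "top_points Cap = 0"
| "top_points (Box l b t) = t"
| "top_points (Stack d e) = top_points d"
| "top_points (Juxt d e) = top_points d + top_points e"

fun well_formed :: "'l diagram \<Rightarrow> bool" where
  "well_formed (Stack d e) \<longleftrightarrow> well_formed d \<and> well_formed e \<and> bot_points d = top_points e"
| "well_formed (Juxt d e) \<longleftrightarrow> well_formed d \<and> well_formed e"
| "well_formed _ \<longleftrightarrow> True"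

fun box_list :: "'l diagram \<Rightarrow> ('l \<times> nat \<times> nat) list" where
  "box_list (Box l b t) = [(l, b, t)]"
| "box_list (Stack d e) = box_list d @ box_list e"
| "box_list (Juxt d e) = box_list d @ box_list e"
| "box_list _ = []"

text \<open>\<open>k\<close> nested caps and cups.\<close>

fun caps :: "nat \<Rightarrow> 'l diagram" where
  "caps 0 = Strands 0"
| "caps (Suc k) = Stack Cap (Juxt (Strands 1) (Juxt (caps k) (Strands 1)))"

fun cups :: "nat \<Rightarrow> 'l diagram" where
  "cups 0 = Strands 0"
| "cups (Suc k) = Stack (Juxt (Strands 1) (Juxt (cups k) (Strands 1))) Cup"

text \<open>Rotation by \<open>\<pi>\<close>, counterclockwise and clockwise.\<close>

definition turn_left :: "'l diagram \<Rightarrow> 'l diagram" where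
  "turn_left d =
     Stack (Juxt (caps (top_points d)) (Strands (bot_points d)))
       (Stack (Juxt (Strands (top_points d)) (Juxt d (Strands (bot_points d))))
         (Juxt (Strands (top_points d)) (cups (bot_points d))))"

definition turn_right :: "'l diagram \<Rightarrow> 'l diagram" where
  "turn_right d =
     Stack (Juxt (Strands (bot_points d)) (caps (top_points d)))
       (Stack (Juxt (Strands (bot_points d)) (Juxt d (Strands (top_points d))))
         (Juxt (cups (bot_points d)) (Strands (top_points d))))"

text \<open>Planar isotopy relative to the boundary of the outer box. Rule \<open>rotate\<close> is the isotopy that
  turns an inner box by \<open>2\<pi>\<close>; the remaining rules move parts of the diagram past each other
  and straighten strands.\<close>

inductive isotopic :: "'l diagram \<Rightarrow> 'l diagram \<Rightarrow> bool" where
  refl: "isotopic d d"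
| sym: "isotopic d e \<Longrightarrow> isotopic e d"
| trans: "isotopic d e \<Longrightarrow> isotopic e f \<Longrightarrow> isotopic d f"
| stack_cong: "isotopic d d' \<Longrightarrow> isotopic e e' \<Longrightarrow> isotopic (Stack d e) (Stack d' e')"
| juxt_cong: "isotopic d d' \<Longrightarrow> isotopic e e' \<Longrightarrow> isotopic (Juxt d e) (Juxt d' e')"
| stack_assoc: "isotopic (Stack (Stack d e) f) (Stack d (Stack e f))"
| stack_strands_left: "isotopic (Stack (Strands (top_points d)) d) d"
| stack_strands_right: "isotopic (Stack d (Strands (bot_points d))) d"
| juxt_assoc: "isotopic (Juxt (Juxt d e) f) (Juxt d (Juxt e f))"
| juxt_empty_left: "isotopic (Juxt (Strands 0) d) d"
| juxt_empty_right: "isotopic (Juxt d (Strands 0)) d"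
| juxt_strands: "isotopic (Juxt (Strands j) (Strands k)) (Strands (j + k))"
| interchange: "bot_points d = top_points d' \<Longrightarrow> bot_points e = top_points e'
    \<Longrightarrow> isotopic (Stack (Juxt d e) (Juxt d' e')) (Juxt (Stack d d') (Stack e e'))"
| zigzag_left: "isotopic (Stack (Juxt Cap (Strands 1)) (Juxt (Strands 1) Cup)) (Strands 1)"
| zigzag_right: "isotopic (Stack (Juxt (Strands 1) Cap) (Juxt Cup (Strands 1))) (Strands 1)"
| rotate: "isotopic (turn_left (Box l b t)) (turn_right (Box l b t))"

lemma isotopic_points:
  assumes "isotopic d e"
  shows "bot_points d = bot_points e \<and> top_points d = top_points e"
proof -
  have *: "top_points (cups k :: 'a diagram) = 2 * k \<and> bot_points (cups k :: 'a diagram) = 0 \<and>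
     top_points (caps k :: 'a diagram) = 0 \<and> bot_points (caps k :: 'a diagram) = 2 * k" for k
    by (induction k) auto
  show ?thesis
    using assms by induction (auto simp: turn_left_def turn_right_def *)
qed

lemma isotopic_boxes:
  assumes "isotopic d e"
  shows "set (box_list d) = set (box_list e)"
proof -
  have *: "box_list (cups k :: 'a diagram) = []" "box_list (caps k :: 'a diagram) = []" for k
    by (induction k) auto
  show ?thesis
    using assms by induction (auto simp: turn_left_def turn_right_def *)
qed

lemma isotopic_well_formed:
  assumes "isotopic d e"
  shows "well_formed d = well_formed e"
proof -
  have *: "top_points (cups k :: 'a diagram) = 2 * k \<and> bot_points (cups k :: 'a diagram) = 0 \<and>
     top_points (caps k :: 'a diagram) = 0 \<and> bot_points (caps k :: 'a diagram) = 2 * k \<and>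
     well_formed (cups k :: 'a diagram) \<and> well_formed (caps k :: 'a diagram)" for k
    by (induction k) auto
  show ?thesis
    using assms
    by induction (auto simp: turn_left_def turn_right_def * isotopic_points)
qed

text \<open>Reflection over a horizontal line, applying an involution to the labels.\<close>

fun reflect_diagram :: "('l \<Rightarrow> 'l) \<Rightarrow> 'l diagram \<Rightarrow> 'l diagram" where
  "reflect_diagram s (Strands k) = Strands k"
| "reflect_diagram s Cup = Cap"
| "reflect_diagram s Cap = Cup"
| "reflect_diagram s (Box l b t) = Box (s l) t b"
| "reflect_diagram s (Stack d e) = Stack (reflect_diagram s e) (reflect_diagram s d)"
| "reflect_diagram s (Juxt d e) = Juxt (reflect_diagram s d) (reflect_diagram s e)"

lemma isotopic_reflect:
  assumes "isotopic d e"
  shows "isotopic (reflect_diagram s d) (reflect_diagram s e)"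
proof -
  have p: "bot_points (reflect_diagram s d) = top_points d"
    "top_points (reflect_diagram s d) = bot_points d" for d
    by (induction d) auto
  have c: "reflect_diagram s (caps k) = cups k" "reflect_diagram s (cups k) = caps k" for k
    by (induction k) auto
  show ?thesis
    using assms
  proof induction
    case (stack_strands_left d)
    show ?case using isotopic.stack_strands_right[of "reflect_diagram s d"] by (simp add: p)
  next
    case (stack_strands_right d)
    show ?case using isotopic.stack_strands_left[of "reflect_diagram s d"] by (simp add: p)
  next
    case zigzag_left
    show ?case using isotopic.zigzag_right by simp
  next
    case zigzag_right
    show ?case using isotopic.zigzag_left by simp
  next
    case (rotate l b t)
    have "isotopic (turn_right (Box (s l) t b)) (turn_left (Box (s l) t b))"
      by (rule isotopic.sym[OF isotopic.rotate])
    then show ?case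
      by (simp add: turn_left_def turn_right_def c)
        (meson isotopic.stack_assoc isotopic.sym isotopic.trans)
  qed (auto intro: isotopic.intros simp: p)
qed

quotient_type 'l tangle = "'l diagram" / isotopic
  by (rule equivpI) (auto intro!: reflpI sympI transpI intro: isotopic.intros)

lift_definition t_stack :: "'l tangle \<Rightarrow> 'l tangle \<Rightarrow> 'l tangle" is Stack
  by (rule isotopic.stack_cong)

lift_definition t_juxt :: "'l tangle \<Rightarrow> 'l tangle \<Rightarrow> 'l tangle" is Juxt
  by (rule isotopic.juxt_cong)

lift_definition t_bot :: "'l tangle \<Rightarrow> nat" is bot_points
  by (simp add: isotopic_points)

lift_definition t_top :: "'l tangle \<Rightarrow> nat" is top_points
  by (simp add: isotopic_points)

lift_definition t_well_formed :: "'l tangle \<Rightarrow> bool" is well_formed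
  by (rule isotopic_well_formed)

lift_definition t_boxes :: "'l tangle \<Rightarrow> ('l \<times> nat \<times> nat) set" is "\<lambda>d. set (box_list d)"
  by (rule isotopic_boxes)

lift_definition t_reflect :: "('l \<Rightarrow> 'l) \<Rightarrow> 'l tangle \<Rightarrow> 'l tangle" is reflect_diagram
  by (rule isotopic_reflect)


section \<open>Planar algebras given by generators and relations\<close>

text \<open>Formal linear combinations of labelled tangles.\<close>

type_synonym 'l lin = "'l tangle \<Rightarrow>\<^sub>0 complex"

definition lin_of :: "'l diagram \<Rightarrow> 'l lin" where
  "lin_of d = Poly_Mapping.single (abs_tangle d) 1"

definition lin_scale :: "complex \<Rightarrow> 'l lin \<Rightarrow> 'l lin" where
  "lin_scale c x = Poly_Mapping.map (\<lambda>z. c * z) x"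

definition lin_stack :: "'l lin \<Rightarrow> 'l lin \<Rightarrow> 'l lin"  (infixr \<open>\<circ>\<^sub>t\<close> 70) where
  "x \<circ>\<^sub>t y = (\<Sum>S \<in> Poly_Mapping.keys x. \<Sum>T \<in> Poly_Mapping.keys y.
     Poly_Mapping.single (t_stack S T) (Poly_Mapping.lookup x S * Poly_Mapping.lookup y T))"

definition lin_juxt :: "'l lin \<Rightarrow> 'l lin \<Rightarrow> 'l lin"  (infixr \<open>\<otimes>\<^sub>t\<close> 75) where
  "x \<otimes>\<^sub>t y = (\<Sum>S \<in> Poly_Mapping.keys x. \<Sum>T \<in> Poly_Mapping.keys y.
     Poly_Mapping.single (t_juxt S T) (Poly_Mapping.lookup x S * Poly_Mapping.lookup y T))"

definition lin_adjoint :: "('l \<Rightarrow> 'l) \<Rightarrow> 'l lin \<Rightarrow> 'l lin" where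
  "lin_adjoint s x = (\<Sum>T \<in> Poly_Mapping.keys x.
     Poly_Mapping.single (t_reflect s T) (cnj (Poly_Mapping.lookup x T)))"

primrec lin_power :: "'l lin \<Rightarrow> nat \<Rightarrow> 'l lin" where
  "lin_power x 0 = lin_of (Strands 0)"
| "lin_power x (Suc k) = x \<otimes>\<^sub>t lin_power x k"

text \<open>A set of generators is a set of triples consisting of a label and the numbers of bottom and
  top boundary points. \<^term>\<open>free_planar G b t\<close> is the \<open>(b, t)\<close> box space of the free planar algebra.\<close>

definition free_planar :: "('l \<times> nat \<times> nat) set \<Rightarrow> nat \<Rightarrow> nat \<Rightarrow> 'l lin set" where
  "free_planar G b t = {x. \<forall>T \<in> Poly_Mapping.keys x.
     t_well_formed T \<and> t_bot T = b \<and> t_top T = t \<and> t_boxes T \<subseteq> G}"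

text \<open>The action of a planar tangle, whose inner boxes are numbered, on one element \<open>\<sigma> h\<close> for each
  inner box \<open>h\<close>.\<close>

fun tangle_action :: "(nat \<Rightarrow> 'l lin) \<Rightarrow> nat diagram \<Rightarrow> 'l lin" where
  "tangle_action \<sigma> (Strands k) = lin_of (Strands k)"
| "tangle_action \<sigma> Cup = lin_of Cup"
| "tangle_action \<sigma> Cap = lin_of Cap"
| "tangle_action \<sigma> (Box h b t) = \<sigma> h"
| "tangle_action \<sigma> (Stack d e) = tangle_action \<sigma> d \<circ>\<^sub>t tangle_action \<sigma> e"
| "tangle_action \<sigma> (Juxt d e) = tangle_action \<sigma> d \<otimes>\<^sub>t tangle_action \<sigma> e"

definition planar_ideal ::
    "('l \<times> nat \<times> nat) set \<Rightarrow> (nat \<Rightarrow> nat \<Rightarrow> 'l lin set) \<Rightarrow> bool" where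
  "planar_ideal G I \<longleftrightarrow>
     (\<forall>b t. I b t \<subseteq> free_planar G b t \<and> 0 \<in> I b t \<and>
        (\<forall>x \<in> I b t. \<forall>y \<in> I b t. x + y \<in> I b t) \<and>
        (\<forall>c. \<forall>x \<in> I b t. lin_scale c x \<in> I b t)) \<and>
     (\<forall>d \<sigma>. well_formed d \<longrightarrow> distinct (map fst (box_list d)) \<longrightarrow>
        (\<forall>(h, b, t) \<in> set (box_list d). \<sigma> h \<in> free_planar G b t) \<longrightarrow>
        (\<exists>(h, b, t) \<in> set (box_list d). \<sigma> h \<in> I b t) \<longrightarrow>
        tangle_action \<sigma> d \<in> I (bot_points d) (top_points d))"

text \<open>A relation \<open>(b, t, x)\<close> asserts \<open>x = 0\<close> in the \<open>(b, t)\<close> box space.\<close>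

definition generated_ideal ::
    "('l \<times> nat \<times> nat) set \<Rightarrow> (nat \<times> nat \<times> 'l lin) set \<Rightarrow> nat \<Rightarrow> nat \<Rightarrow> 'l lin set" where
  "generated_ideal G R b t =
     {x. \<forall>I. planar_ideal G I \<longrightarrow> (\<forall>(b', t', r) \<in> R. r \<in> I b' t') \<longrightarrow> x \<in> I b t}"

definition planar_class ::
    "('l \<times> nat \<times> nat) set \<Rightarrow> (nat \<times> nat \<times> 'l lin) set \<Rightarrow> nat \<Rightarrow> nat \<Rightarrow> 'l lin \<Rightarrow> 'l lin set" where
  "planar_class G R b t x = {y \<in> free_planar G b t. y - x \<in> generated_ideal G R b t}"

definition planar_algebra ::
    "('l \<times> nat \<times> nat) set \<Rightarrow> (nat \<times> nat \<times> 'l lin) set \<Rightarrow> nat \<Rightarrow> nat \<Rightarrow> 'l lin set set" where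
  "planar_algebra G R b t = planar_class G R b t ` free_planar G b t"

text \<open>Rotation by \<open>\<pi>\<close>, and the click, of an element with \<open>b\<close> bottom and \<open>t\<close> top boundary points.
  For the click, the last top point is moved to the bottom right and the last (leftmost) bottom
  point to the top left. The formula is meant for \<open>b, t \<ge> 1\<close>.\<close>

definition rotation :: "nat \<Rightarrow> nat \<Rightarrow> 'l lin \<Rightarrow> 'l lin" where
  "rotation b t x =
     (lin_of (caps t) \<otimes>\<^sub>t lin_of (Strands b))
     \<circ>\<^sub>t (lin_of (Strands t) \<otimes>\<^sub>t x \<otimes>\<^sub>t lin_of (Strands b))
     \<circ>\<^sub>t (lin_of (Strands t) \<otimes>\<^sub>t lin_of (cups b))"

definition click :: "nat \<Rightarrow> nat \<Rightarrow> 'l lin \<Rightarrow> 'l lin" where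
  "click b t x =
     (lin_of (Strands t) \<otimes>\<^sub>t lin_of Cap)
     \<circ>\<^sub>t (lin_of (Strands 1) \<otimes>\<^sub>t x \<otimes>\<^sub>t lin_of (Strands 1))
     \<circ>\<^sub>t (lin_of Cup \<otimes>\<^sub>t lin_of (Strands b))"


section \<open>The planar algebra \<open>\<P>\<^sup>(\<^sup>m\<^sup>,\<^sup>\<omega>\<^sup>)\<close>\<close>

datatype gen = Gen_P | Gen_U | Gen_Ustar

fun gen_star :: "gen \<Rightarrow> gen" where
  "gen_star Gen_P = Gen_P"
| "gen_star Gen_U = Gen_Ustar"
| "gen_star Gen_Ustar = Gen_U"

definition n_of :: "nat \<Rightarrow> nat" where "n_of m = m div 2"
definition a_of :: "nat \<Rightarrow> nat" where "a_of m = m - n_of m"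

definition gens :: "nat \<Rightarrow> (gen \<times> nat \<times> nat) set" where
  "gens m = {(Gen_P, 1, 1), (Gen_U, a_of m, n_of m), (Gen_Ustar, n_of m, a_of m)}"

definition P1 :: "gen lin" where "P1 = lin_of (Box Gen_P 1 1)"
definition Q1 :: "gen lin" where "Q1 = rotation 1 1 P1"
definition U :: "nat \<Rightarrow> gen lin" where "U m = lin_of (Box Gen_U (a_of m) (n_of m))"
definition Ustar :: "nat \<Rightarrow> gen lin" where "Ustar m = lin_of (Box Gen_Ustar (n_of m) (a_of m))"

text \<open>An oriented arc is an arc one of whose legs carries a \<^term>\<open>P1\<close> if that leg is
  oriented upwards, or a \<^term>\<open>Q1\<close> if it is oriented downwards. The first two relations are the
  closed loops, clockwise and counterclockwise.\<close>

definition rels :: "nat \<Rightarrow> complex \<Rightarrow> (nat \<times> nat \<times> gen lin) set" where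
  "rels m \<omega> = (let n = n_of m; a = a_of m; X = lin_of (Strands 1) in
    {(0, 0, lin_of Cap \<circ>\<^sub>t (P1 \<otimes>\<^sub>t X) \<circ>\<^sub>t lin_of Cup - lin_of (Strands 0)),
     (0, 0, lin_of Cap \<circ>\<^sub>t (Q1 \<otimes>\<^sub>t X) \<circ>\<^sub>t lin_of Cup - lin_of (Strands 0)),
     (1, 1, X - (P1 + Q1)),
     (1, 1, P1 \<circ>\<^sub>t Q1),
     (1, 1, Q1 \<circ>\<^sub>t P1),
     (2, 2, (P1 \<otimes>\<^sub>t X) \<circ>\<^sub>t lin_of Cup \<circ>\<^sub>t lin_of Cap \<circ>\<^sub>t (P1 \<otimes>\<^sub>t X) - P1 \<otimes>\<^sub>t Q1),
     (2, 2, (Q1 \<otimes>\<^sub>t X) \<circ>\<^sub>t lin_of Cup \<circ>\<^sub>t lin_of Cap \<circ>\<^sub>t (Q1 \<otimes>\<^sub>t X) - Q1 \<otimes>\<^sub>t P1),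
     (a, n, U m - lin_power Q1 n \<circ>\<^sub>t U m \<circ>\<^sub>t lin_power P1 a),
     (n, a, Ustar m - lin_power P1 a \<circ>\<^sub>t Ustar m \<circ>\<^sub>t lin_power Q1 n),
     (n, n, U m \<circ>\<^sub>t Ustar m - lin_power Q1 n),
     (a, a, Ustar m \<circ>\<^sub>t U m - lin_power P1 a),
     (a, n, click a n (U m) - lin_scale \<omega> (U m)),
     (n, a, click n a (Ustar m) - lin_scale \<omega> (Ustar m))})"

text \<open>The operations of \<open>\<P>\<^sup>(\<^sup>m\<^sup>,\<^sup>\<omega>\<^sup>)\<close> on classes of the quotient; the numeric arguments
  \<open>b t\<close> give the box space in which the result lies.\<close>

definition pcls :: "nat \<Rightarrow> complex \<Rightarrow> nat \<Rightarrow> nat \<Rightarrow> gen lin \<Rightarrow> gen lin set" where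
  "pcls m \<omega> = planar_class (gens m) (rels m \<omega>)"

definition pspace :: "nat \<Rightarrow> complex \<Rightarrow> nat \<Rightarrow> nat \<Rightarrow> gen lin set set" where
  "pspace m \<omega> = planar_algebra (gens m) (rels m \<omega>)"

definition padd ::
    "nat \<Rightarrow> complex \<Rightarrow> nat \<Rightarrow> nat \<Rightarrow> gen lin set \<Rightarrow> gen lin set \<Rightarrow> gen lin set" where
  "padd m \<omega> b t f g = (\<Union>x \<in> f. \<Union>y \<in> g. pcls m \<omega> b t (x + y))"

definition pscale ::
    "nat \<Rightarrow> complex \<Rightarrow> nat \<Rightarrow> nat \<Rightarrow> complex \<Rightarrow> gen lin set \<Rightarrow> gen lin set" where
  "pscale m \<omega> b t c f = (\<Union>x \<in> f. pcls m \<omega> b t (lin_scale c x))"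

definition pstack ::
    "nat \<Rightarrow> complex \<Rightarrow> nat \<Rightarrow> nat \<Rightarrow> gen lin set \<Rightarrow> gen lin set \<Rightarrow> gen lin set" where
  "pstack m \<omega> b t f g = (\<Union>x \<in> f. \<Union>y \<in> g. pcls m \<omega> b t (x \<circ>\<^sub>t y))"

definition pjuxt ::
    "nat \<Rightarrow> complex \<Rightarrow> nat \<Rightarrow> nat \<Rightarrow> gen lin set \<Rightarrow> gen lin set \<Rightarrow> gen lin set" where
  "pjuxt m \<omega> b t f g = (\<Union>x \<in> f. \<Union>y \<in> g. pcls m \<omega> b t (x \<otimes>\<^sub>t y))"

definition padjoint :: "nat \<Rightarrow> complex \<Rightarrow> nat \<Rightarrow> nat \<Rightarrow> gen lin set \<Rightarrow> gen lin set" where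
  "padjoint m \<omega> b t f = (\<Union>x \<in> f. pcls m \<omega> b t (lin_adjoint gen_star x))"


section \<open>The category \<open>\<C>\<^sub>m\<^sub>,\<^sub>\<omega>\<close>\<close>

text \<open>An object is a pair \<open>(k, p)\<close> of a number \<open>k\<close> and a projection \<open>p\<close> in the \<open>(k, k)\<close> box space.
  The category is strict, so the associativity and unit isomorphisms are identities; the identity
  of \<open>(k, p)\<close> is \<open>p\<close>.\<close>

type_synonym pobj = "nat \<times> gen lin set"

definition ptensor :: "nat \<Rightarrow> complex \<Rightarrow> pobj \<Rightarrow> pobj \<Rightarrow> pobj" where
  "ptensor m \<omega> X Y =
     (fst X + fst Y, pjuxt m \<omega> (fst X + fst Y) (fst X + fst Y) (snd X) (snd Y))"

definition projection_category :: "nat \<Rightarrow> complex \<Rightarrow> (pobj, gen lin set) lmcat" where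
  "projection_category m \<omega> = \<lparr>
     Obj = {(k, p). p \<in> pspace m \<omega> k k \<and> pstack m \<omega> k k p p = p \<and> padjoint m \<omega> k k p = p},
     Hom = (\<lambda>(k, p) (l, q). {f \<in> pspace m \<omega> k l. pstack m \<omega> k l q (pstack m \<omega> k l f p) = f}),
     Idm = snd,
     Comp = (\<lambda>X Y Z g f. pstack m \<omega> (fst X) (fst Z) g f),
     Zero = (\<lambda>X Y. pcls m \<omega> (fst X) (fst Y) 0),
     Add = (\<lambda>X Y. padd m \<omega> (fst X) (fst Y)),
     Scale = (\<lambda>X Y. pscale m \<omega> (fst X) (fst Y)),
     Unit = (0, pcls m \<omega> 0 0 (lin_of (Strands 0))),
     TenO = ptensor m \<omega>,
     TenM = (\<lambda>X X' Y Y'. pjuxt m \<omega> (fst X + fst Y) (fst X' + fst Y')),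
     Assoc = (\<lambda>X Y Z. snd (ptensor m \<omega> (ptensor m \<omega> X Y) Z)),
     LUnit = snd,
     RUnit = snd \<rparr>"

definition planar_category :: "nat \<Rightarrow> complex \<Rightarrow> (pobj list, gen lin set mat) lmcat" where
  "planar_category m \<omega> = additive_envelope (projection_category m \<omega>)"


section \<open>Finite-dimensional complex representations\<close>

text \<open>The Kronecker product, i.e. the tensor product of linear maps between coordinate spaces with
  respect to the lexicographically ordered bases.\<close>

definition kron :: "complex mat \<Rightarrow> complex mat \<Rightarrow> complex mat" where
  "kron A B = mat (dim_row A * dim_row B) (dim_col A * dim_col B) (\<lambda>(i, j).
     A $$ (i div dim_row B, j div dim_col B) * B $$ (i mod dim_row B, j mod dim_col B))"

text \<open>A representation \<open>(d, \<rho>)\<close> acts on \<open>\<complex>\<^sup>d\<close>. The identification of \<open>\<complex>\<^sup>d \<otimes> \<complex>\<^sup>e\<close> with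
  \<open>\<complex>\<^sup>d\<^sup>e\<close> by lexicographic ordering makes the associativity and unit isomorphisms identity
  matrices.\<close>

type_synonym 'g rep = "nat \<times> ('g \<Rightarrow> complex mat)"

definition is_rep :: "('g, 'x) monoid_scheme \<Rightarrow> 'g rep \<Rightarrow> bool" where
  "is_rep G V \<longleftrightarrow> snd V \<in> extensional (carrier G) \<and>
     (\<forall>g \<in> carrier G. snd V g \<in> carrier_mat (fst V) (fst V)) \<and>
     snd V \<one>\<^bsub>G\<^esub> = 1\<^sub>m (fst V) \<and>
     (\<forall>g \<in> carrier G. \<forall>h \<in> carrier G. snd V (g \<otimes>\<^bsub>G\<^esub> h) = snd V g * snd V h)"

definition Rep :: "('g, 'x) monoid_scheme \<Rightarrow> ('g rep, complex mat) lmcat" where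
  "Rep G = \<lparr>
     Obj = {V. is_rep G V},
     Hom = (\<lambda>V W. {A \<in> carrier_mat (fst W) (fst V). \<forall>g \<in> carrier G. A * snd V g = snd W g * A}),
     Idm = (\<lambda>V. 1\<^sub>m (fst V)),
     Comp = (\<lambda>V W Z B A. B * A),
     Zero = (\<lambda>V W. 0\<^sub>m (fst W) (fst V)),
     Add = (\<lambda>V W. (+)),
     Scale = (\<lambda>V W c A. c \<cdot>\<^sub>m A),
     Unit = (1, \<lambda>g \<in> carrier G. 1\<^sub>m 1),
     TenO = (\<lambda>V W. (fst V * fst W, \<lambda>g \<in> carrier G. kron (snd V g) (snd W g))),
     TenM = (\<lambda>V V' W W'. kron),
     Assoc = (\<lambda>V W Z. 1\<^sub>m (fst V * fst W * fst Z)),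
     LUnit = (\<lambda>V. 1\<^sub>m (fst V)),
     RUnit = (\<lambda>V. 1\<^sub>m (fst V)) \<rparr>"


section \<open>Cyclic subgroups of \<open>SU(2)\<close>\<close>

definition SU2 :: "complex mat monoid" where
  "SU2 = \<lparr>carrier = {A \<in> carrier_mat 2 2. A * mat_adjoint A = 1\<^sub>m 2 \<and> det A = 1},
          monoid.mult = (*), one = 1\<^sub>m 2\<rparr>"

definition cyclic_subgroup :: "complex \<Rightarrow> complex mat monoid" where
  "cyclic_subgroup \<zeta> =
     SU2\<lparr>carrier := generate SU2 {mat_of_rows_list 2 [[\<zeta>, 0], [0, inverse \<zeta>]]}\<rparr>"

end

theory Submission
  imports Defs "Jordan_Normal_Form.Jordan_Normal_Form_Existence"
begin

text \<open>Represent the planar algebra on \<open>V = \<complex>\<^sup>2\<close>: the two orientations of a strand are the two basis vectors,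
  an element with \<open>b\<close> bottom and \<open>t\<close> top points is a matrix indexed by signed words of lengths \<open>t\<close>
  and \<open>b\<close>, and \<open>U\<close> is the matrix unit between \<open>+\<^sup>a\<close> and \<open>-\<^sup>n\<close>. All generators preserve the degree (number
  of positive minus number of negative letters) modulo \<open>m\<close>, so every matrix that occurs commutes with
  the cyclic group, for which the degree of a word is its weight on \<open>V\<^sup>\<otimes>\<^sup>k\<close>.

  The heart of the proof is that this representation is faithful with image exactly the
  degree-preserving matrices (\<open>faithful\<close>, \<open>cval_surj\<close>). Since a strand is the sum of its two orientations,
  every diagram is a sum of oriented diagrams between words, and each of these is a product of
  invertible pieces: cups, caps, \<open>U\<close> and \<open>U\<^sup>*\<close>. The relations leave at most one
  such monomial between two given words (\<open>S_unique\<close>). Indeed a word can be rewritten canonically to fewer than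
  \<open>m\<close> positive letters, and every monomial is absorbed by this normal form (\<open>S_natural\<close>). The only
  obstacle is the box \<open>V : +\<^sup>m \<rightarrow> \<emptyset>\<close> obtained from \<open>U\<close> by bending its outputs: it has to pass through a
  strand, which is the content of the click relation with \<open>\<lambda> = 1\<close> (\<open>V_central\<close>). A monomial
  exists whenever the degrees agree, so the monomials are a system of matrix units that
  spans the quotient (\<open>span\<close>) and is mapped to the standard matrix units.

  Thus a projection of the planar algebra is an equivariant idempotent on a tensor power of \<open>V\<close>, and
  morphisms between projections are the equivariant maps between the images. Sending a formal
  direct sum of projections to the sum of their images is a fully faithful monoidal functor
  (\<open>rep_embedding\<close>). It is essentially surjective since every representation of a finite cyclic group is diagonalisable
  (\<open>periodic_diagonalizable\<close>), and each character is the image of some \<open>P\<^sub>1\<^sup>\<otimes>\<^sup>j\<close> (\<open>E_ess\<close>).\<close>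

section \<open>Matrices indexed by signed words\<close>

abbreviation pos :: "nat \<Rightarrow> bool list" where "pos k \<equiv> replicate k True"
abbreviation neg :: "nat \<Rightarrow> bool list" where "neg k \<equiv> replicate k False"

text \<open>The vector space \<open>V = \<complex>\<^sup>2\<close> has a basis indexed by the two signs \<open>True\<close> (an upward strand) and \<open>False\<close>
  (a downward strand), so \<open>V\<^sup>\<otimes>\<^sup>k\<close> has a basis indexed by the words of length \<open>k\<close>. A linear map is kept as
  a function of the row word \<open>w\<close> and the column word \<open>v\<close>; the sizes live in the predicate \<open>supp\<close>.\<close>

type_synonym wmat = "bool list \<Rightarrow> bool list \<Rightarrow> complex"

definition words :: "nat \<Rightarrow> bool list set" where "words k = {w. length w = k}"

lemma finite_words [simp]: "finite (words k)"
  unfolding words_def using finite_lists_length_eq[of "UNIV :: bool set" k] by simp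

lemma in_words [simp]: "w \<in> words k \<longleftrightarrow> length w = k" by (simp add: words_def)

lemma words_0 [simp]: "words 0 = {[]}" by auto

lemma sum_words_add:
  "(\<Sum>u\<in>words (k + l). h u) = (\<Sum>u\<in>words k. \<Sum>v\<in>words l. h (u @ v))"
proof -
  have "(\<Sum>u\<in>words k. \<Sum>v\<in>words l. h (u @ v)) = (\<Sum>(u, v)\<in>words k \<times> words l. h (u @ v))"
    by (simp add: sum.cartesian_product)
  also have "\<dots> = (\<Sum>u\<in>words (k + l). h u)"
    by (rule sum.reindex_bij_witness[of _ "\<lambda>u. (take k u, drop k u)" "\<lambda>(u, v). u @ v"]) auto
  finally show ?thesis by simp
qed

lemma sum_words_Suc: "(\<Sum>u\<in>words (Suc k). h u) = (\<Sum>u\<in>words k. h (True # u)) + (\<Sum>u\<in>words k. h (False # u))"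
proof -
  have 1: "words (Suc 0) = {[True], [False]}"
    by (auto simp: length_Suc_conv)
  show ?thesis using sum_words_add[of h 1 k] by (simp add: 1)
qed

definition supp :: "nat \<Rightarrow> nat \<Rightarrow> wmat \<Rightarrow> bool" where
  "supp b t f \<longleftrightarrow> (\<forall>w v. f w v \<noteq> 0 \<longrightarrow> length w = t \<and> length v = b)"

definition wid :: "nat \<Rightarrow> wmat" where "wid k w v = (if w = v \<and> length w = k then 1 else 0)"
definition wcomp :: "nat \<Rightarrow> wmat \<Rightarrow> wmat \<Rightarrow> wmat" where
  "wcomp k f g w v = (\<Sum>u\<in>words k. f w u * g u v)"
definition wten :: "nat \<Rightarrow> nat \<Rightarrow> wmat \<Rightarrow> wmat \<Rightarrow> wmat" where
  "wten t b f g w v = f (take t w) (take b v) * g (drop t w) (drop b v)"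

definition wunit :: "bool list \<Rightarrow> bool list \<Rightarrow> wmat" where
  "wunit w0 v0 w v = (if w = w0 \<and> v = v0 then 1 else 0)"

lemma suppD: "supp b t f \<Longrightarrow> length w \<noteq> t \<or> length v \<noteq> b \<Longrightarrow> f w v = 0"
  by (auto simp: supp_def)

lemma supp_wid: "supp k k (wid k)" by (auto simp: supp_def wid_def)
lemma supp_wcomp: "supp k t f \<Longrightarrow> supp b k' g \<Longrightarrow> supp b t (wcomp k f g)"
  unfolding supp_def wcomp_def by (metis (no_types, lifting) mult_eq_0_iff sum.neutral)
lemma supp_wten: "supp b t f \<Longrightarrow> supp b' t' g \<Longrightarrow> supp (b + b') (t + t') (wten t b f g)"
  unfolding supp_def wten_def
proof (intro allI impI)
  fix w v assume f: "\<forall>w v. f w v \<noteq> 0 \<longrightarrow> length w = t \<and> length v = b"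
    and g: "\<forall>w v. g w v \<noteq> 0 \<longrightarrow> length w = t' \<and> length v = b'"
    and n: "f (take t w) (take b v) * g (drop t w) (drop b v) \<noteq> 0"
  from n have "f (take t w) (take b v) \<noteq> 0" "g (drop t w) (drop b v) \<noteq> 0" by simp_all
  with f g have "length (take t w) = t \<and> length (take b v) = b" "length (drop t w) = t' \<and> length (drop b v) = b'"
    by blast+
  then show "length w = t + t' \<and> length v = b + b'" by auto
qed

lemma wcomp_assoc: "wcomp k (wcomp l f g) h = wcomp l f (wcomp k g h)"
  unfolding wcomp_def by (intro ext) (simp add: sum_distrib_left sum_distrib_right mult.assoc, rule sum.swap)

lemma wcomp_wid_left: assumes "supp b t f" shows "wcomp t (wid t) f = f"
proof (intro ext)
  fix w v
  have "wcomp t (wid t) f w v = (\<Sum>u\<in>words t. if u = w then f w v else 0)"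
    unfolding wcomp_def wid_def by (intro sum.cong) auto
  then show "wcomp t (wid t) f w v = f w v" using suppD[OF assms] by auto
qed

lemma wcomp_wid_right: assumes "supp b t f" shows "wcomp b f (wid b) = f"
proof (intro ext)
  fix w v
  have "wcomp b f (wid b) w v = (\<Sum>u\<in>words b. if u = v then f w v else 0)"
    unfolding wcomp_def wid_def by (intro sum.cong) auto
  then show "wcomp b f (wid b) w v = f w v" using suppD[OF assms] by auto
qed

lemma wten_assoc: "wten (t + t') (b + b') (wten t b f g) h = wten t b f (wten t' b' g h)"
  unfolding wten_def by (intro ext) (simp add: min_def add.commute drop_take)

lemma wten_id: "wten j j (wid j) (wid k) = wid (j + k)"
proof (intro ext)
  fix w v :: "bool list"
  have "take j w = take j v \<and> drop j w = drop j v \<longleftrightarrow> w = v" by (metis append_take_drop_id)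
  moreover have "length (take j w) = j \<and> length (drop j w) = k \<longleftrightarrow> length w = j + k" by auto
  ultimately show "wten j j (wid j) (wid k) w v = wid (j + k) w v"
    unfolding wten_def wid_def by (simp only: mult_1_left mult_zero_left split: if_split) blast
qed

lemma wten_0_left: "wten 0 0 (wid 0) f = f"
  by (intro ext) (simp add: wten_def wid_def)

lemma wten_0_right: assumes "supp b t f" shows "wten t b f (wid 0) = f"
proof (intro ext)
  fix w v show "wten t b f (wid 0) w v = f w v"
  proof (cases "length w \<le> t \<and> length v \<le> b")
    case True then show ?thesis by (simp add: wten_def wid_def)
  next
    case False
    then have l: "length w \<noteq> t \<or> length v \<noteq> b" by linarith
    have "\<not> (drop t w = drop b v \<and> length (drop t w) = 0)"
      using False by (metis drop_eq_Nil length_0_conv)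
    then have "wid 0 (drop t w) (drop b v) = 0" by (simp only: wid_def if_False)
    then show ?thesis using suppD[OF assms l] by (simp only: wten_def mult_zero_right)
  qed
qed

lemma wten_append: "length w = t \<Longrightarrow> length v = b \<Longrightarrow> wten t b f g (w @ w') (v @ v') = f w v * g w' v'"
  by (simp add: wten_def)

lemma w_interchange:
  "wcomp (k + l) (wten t k f g) (wten k b f' g') = wten t b (wcomp k f f') (wcomp l g g')"
  unfolding wcomp_def wten_def
  by (intro ext) (simp add: sum_words_add sum_product mult_ac)

text \<open>Turning a diagram by a half turn reverses the order of its boundary points and every orientation.\<close>

definition rv :: "bool list \<Rightarrow> bool list" where "rv w = rev (map Not w)"

lemma rv_rv [simp]: "rv (rv w) = w" by (simp add: rv_def rev_map o_def)
lemma length_rv [simp]: "length (rv w) = length w" by (simp add: rv_def)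
lemma rv_eq: "rv w = v \<longleftrightarrow> w = rv v" by (metis rv_rv)

text \<open>A minimum creates the two orientations of an arc, each with coefficient 1: this is forced by the
  relation that splits a strand into its two orientations.\<close>

definition wcup :: wmat where
  "wcup w v = (if v = [] \<and> (w = [True, False] \<or> w = [False, True]) then 1 else 0)"
definition wcap :: wmat where "wcap w v = wcup v w"

text \<open>The projection \<open>P\<^sub>1\<close> acts as the projection onto the first basis vector, and \<open>U\<close> as the matrix unit between
  the constant words \<open>+\<^sup>a\<close> and \<open>-\<^sup>n\<close>. These two words have degrees \<open>a\<close> and \<open>-n\<close>, which agree modulo
  \<open>m = a + n\<close>. Boxes of any other shape do not occur in the free planar algebra and get the value 0.\<close>

definition gval :: "nat \<Rightarrow> gen \<Rightarrow> nat \<Rightarrow> nat \<Rightarrow> wmat" where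
  "gval m l b t = (case l of
     Gen_P \<Rightarrow> if b = 1 \<and> t = 1 then wunit [True] [True] else (\<lambda>w v. 0)
   | Gen_U \<Rightarrow> if b = a_of m \<and> t = n_of m then wunit (neg (n_of m)) (pos (a_of m)) else (\<lambda>w v. 0)
   | Gen_Ustar \<Rightarrow> if b = n_of m \<and> t = a_of m then wunit (pos (a_of m)) (neg (n_of m)) else (\<lambda>w v. 0))"

fun val :: "nat \<Rightarrow> gen diagram \<Rightarrow> wmat" where
  "val m (Strands k) = wid k"
| "val m Cup = wcup"
| "val m Cap = wcap"
| "val m (Box l b t) = gval m l b t"
| "val m (Stack d e) = wcomp (bot_points d) (val m d) (val m e)"
| "val m (Juxt d e) = wten (top_points d) (bot_points d) (val m d) (val m e)"

lemma supp_wcup: "supp 0 2 wcup" "supp 2 0 wcap" by (auto simp: supp_def wcup_def wcap_def)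
lemma supp_gval: "supp b t (gval m l b t)"
  by (cases l) (auto simp: supp_def gval_def wunit_def)

lemma supp_val: "supp (bot_points d) (top_points d) (val m d)"
  by (induction d) (auto intro: supp_wid supp_wcup supp_gval supp_wcomp supp_wten)

lemma caps_points [simp]: "bot_points (caps k) = 2 * k" "top_points (caps k) = 0"
  "bot_points (cups k) = 0" "top_points (cups k) = 2 * k"
  by (induction k) auto

lemma val_caps: "length x = k \<Longrightarrow> length y = k \<Longrightarrow> val m (caps k) [] (x @ y) = (if y = rv x then 1 else 0)"
proof (induction k arbitrary: x y)
  case 0 then show ?case by (simp add: wid_def rv_def)
next
  case (Suc k)
  obtain p x' where x: "x = p # x'" using Suc.prems by (cases x) auto
  obtain y' q where y: "y = y' @ [q]" using Suc.prems by (cases y rule: rev_cases) auto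
  have l: "length x' = k" "length y' = k" using Suc.prems x y by auto
  have "val m (caps (Suc k)) [] (x @ y) = (\<Sum>u\<in>words 2. wcap [] u *
     (wid 1 (take 1 u) [p] * (val m (caps k) [] (x' @ y') * wid 1 (drop 1 u) [q])))"
    by (simp add: x y wcomp_def wten_def l mult_2)
  also have "\<dots> = (if y = rv x then 1 else 0)"
    using Suc.IH[OF l] by (cases p; cases q) (simp_all add: numeral_2_eq_2 sum_words_Suc wcap_def wcup_def wid_def x y rv_def)
  finally show ?case .
qed

lemma val_cups: "length x = k \<Longrightarrow> length y = k \<Longrightarrow> val m (cups k) (x @ y) [] = (if y = rv x then 1 else 0)"
proof (induction k arbitrary: x y)
  case 0 then show ?case by (simp add: wid_def rv_def)
next
  case (Suc k)
  obtain p x' where x: "x = p # x'" using Suc.prems by (cases x) auto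
  obtain y' q where y: "y = y' @ [q]" using Suc.prems by (cases y rule: rev_cases) auto
  have l: "length x' = k" "length y' = k" using Suc.prems x y by auto
  have "val m (cups (Suc k)) (x @ y) [] = (\<Sum>u\<in>words 2. 
     (wid 1 [p] (take 1 u) * (val m (cups k) (x' @ y') [] * wid 1 [q] (drop 1 u))) * wcup u [])"
    by (simp add: x y wcomp_def wten_def l mult_2) (simp add: numeral_2_eq_2)
  also have "\<dots> = (if y = rv x then 1 else 0)"
    using Suc.IH[OF l] by (cases p; cases q) (simp_all add: numeral_2_eq_2 sum_words_Suc wcap_def wcup_def wid_def x y rv_def)
  finally show ?case .
qed

lemma sum_delta_words: "length x = k \<Longrightarrow> (\<Sum>u\<in>words k. (if u = x then 1 else 0) * h u) = (h x :: complex)"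
  "length x = k \<Longrightarrow> (\<Sum>u\<in>words k. h u * (if u = x then 1 else 0)) = (h x :: complex)"
  by (simp_all add: if_distrib[of "\<lambda>c. c * _"] if_distrib[of "\<lambda>c. _ * c"] cong: if_cong)

lemma sum_wid: "length w = b \<Longrightarrow> (\<Sum>z\<in>words b. wid b w z * h z) = h w"
  "length w = b \<Longrightarrow> (\<Sum>z\<in>words b. h z * wid b z w) = h w"
proof -
  assume w: "length w = b"
  have "(\<Sum>z\<in>words b. wid b w z * h z) = (\<Sum>z\<in>words b. (if z = w then 1 else 0) * h z)"
    using w by (intro sum.cong) (auto simp: wid_def)
  then show "(\<Sum>z\<in>words b. wid b w z * h z) = h w" using w by (simp only: sum_delta_words)
  have "(\<Sum>z\<in>words b. h z * wid b z w) = (\<Sum>z\<in>words b. h z * (if z = w then 1 else 0))"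
    using w by (intro sum.cong) (auto simp: wid_def)
  then show "(\<Sum>z\<in>words b. h z * wid b z w) = h w" using w by (simp only: sum_delta_words)
qed

lemma sum_caps: assumes "length x = t"
  shows "(\<Sum>y\<in>words t. val m (caps t) [] (x @ y) * h y) = h (rv x)"
proof -
  have "(\<Sum>y\<in>words t. val m (caps t) [] (x @ y) * h y) = (\<Sum>y\<in>words t. (if y = rv x then 1 else 0) * h y)"
    by (intro sum.cong[OF HOL.refl]) (simp only: val_caps[OF assms] in_words)
  also have "\<dots> = h (rv x)" by (rule sum_delta_words(1)) (use assms in simp)
  finally show ?thesis .
qed

lemma sum_cups: assumes "length x = t"
  shows "(\<Sum>y\<in>words t. h y * val m (cups t) (x @ y) []) = h (rv x)"
proof -
  have "(\<Sum>y\<in>words t. h y * val m (cups t) (x @ y) []) = (\<Sum>y\<in>words t. h y * (if y = rv x then 1 else 0))"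
    by (intro sum.cong[OF HOL.refl]) (simp only: val_cups[OF assms] in_words)
  also have "\<dots> = h (rv x)" by (rule sum_delta_words(2)) (use assms in simp)
  finally show ?thesis .
qed

lemma caps_left: assumes "length w = b"
  shows "wcomp (2 * t + b) (wten 0 (2 * t) (val m (caps t)) (wid b)) F w v
     = (\<Sum>x\<in>words t. F (x @ rv x @ w) v)"
  unfolding wcomp_def mult_2
  by (simp add: sum_words_add wten_def mult.assoc sum_distrib_left[symmetric] sum_wid(1)[OF assms] sum_caps)

lemma caps_right: assumes "length w = b"
  shows "wcomp (b + 2 * t) (wten b b (wid b) (val m (caps t))) F w v
     = (\<Sum>x\<in>words t. F (w @ x @ rv x) v)"
  unfolding wcomp_def mult_2 using assms
  by (simp add: sum_words_add wten_def mult.assoc sum_distrib_left[symmetric] sum_caps)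
    (simp add: sum_distrib_left[symmetric] sum_wid)

lemma cups_right: assumes "length v = t"
  shows "wcomp (t + 2 * b) F (wten t t (wid t) (val m (cups b))) w v
     = (\<Sum>y\<in>words b. F w (v @ y @ rv y))"
  unfolding wcomp_def mult_2 using assms
  by (simp add: sum_words_add wten_def mult.assoc[symmetric] sum_cups)
    (simp add: sum_distrib_right[symmetric] sum_wid)

lemma cups_left: assumes "length v = t"
  shows "wcomp (2 * b + t) F (wten (2 * b) 0 (val m (cups b)) (wid t)) w v
     = (\<Sum>y\<in>words b. F w (y @ rv y @ v))"
  unfolding wcomp_def mult_2
  by (simp add: sum_words_add wten_def mult.assoc[symmetric] sum_wid(2)[OF assms] sum_cups)

text \<open>Rotation by \<open>\<pi>\<close> is the transposed matrix read backwards with opposite signs, as each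
  cup and cap pairs a letter only with its opposite.\<close>

lemma val_turn:
  assumes "length w = bot_points d" "length v = top_points d"
  shows "val m (turn_left d) w v = val m d (rv v) (rv w)"
    and "val m (turn_right d) w v = val m d (rv v) (rv w)"
proof -
  let ?b = "bot_points d" and ?t = "top_points d" and ?A = "val m d"
  have "val m (turn_left d) w v = (\<Sum>x\<in>words ?t. \<Sum>y\<in>words ?b.
      wten ?t ?t (wid ?t) (wten ?t ?b ?A (wid ?b)) (x @ rv x @ w) (v @ y @ rv y))"
    unfolding turn_left_def using assms
    by (simp add: caps_left[unfolded mult_2] cups_right[unfolded mult_2] mult_2)
  also have "\<dots> = (\<Sum>x\<in>words ?t. (if x = v then 1 else 0) * (\<Sum>y\<in>words ?b. ?A (rv x) y * (if y = rv w then 1 else 0)))"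
    unfolding sum_distrib_left using assms by (intro sum.cong[OF HOL.refl]) (auto simp: wten_append wid_def)
  also have "\<dots> = ?A (rv v) (rv w)"
    using assms by (simp add: sum_delta_words)
  finally show "val m (turn_left d) w v = val m d (rv v) (rv w)" .
  have "val m (turn_right d) w v = (\<Sum>x\<in>words ?t. \<Sum>y\<in>words ?b.
      wten ?b ?b (wid ?b) (wten ?t ?b ?A (wid ?t)) (w @ x @ rv x) (y @ rv y @ v))"
    unfolding turn_right_def using assms
    by (simp add: caps_right[unfolded mult_2] cups_left[unfolded mult_2 add.assoc] mult_2)
  also have "\<dots> = (\<Sum>x\<in>words ?t. (\<Sum>y\<in>words ?b. (if y = w then 1 else 0) * ?A x (rv y)) * (if x = rv v then 1 else 0))"
    unfolding sum_distrib_right using assms by (intro sum.cong[OF HOL.refl]) (auto simp: wten_append wid_def)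
  also have "\<dots> = ?A (rv v) (rv w)"
    using assms by (simp add: sum_delta_words)
  finally show "val m (turn_right d) w v = val m d (rv v) (rv w)" .
qed

lemma wmat_eqI: assumes "supp b t f" "supp b t g" "\<And>w v. length w = t \<Longrightarrow> length v = b \<Longrightarrow> f w v = g w v" shows "f = g"
proof (intro ext)
  fix w v show "f w v = g w v"
  proof (cases "length w = t \<and> length v = b")
    case False
    then have l: "length w \<noteq> t \<or> length v \<noteq> b" by blast
    show ?thesis using suppD[OF assms(1) l] suppD[OF assms(2) l] by simp
  qed (use assms(3) in blast)
qed

text \<open>Every generating isotopy is a matrix identity: the zigzags and the turning of a box are the
  computations above, the rest are the axioms of a strict monoidal category.\<close>

lemma val_isotopic: "isotopic d e \<Longrightarrow> val m d = val m e"
proof (induction rule: isotopic.induct)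
  case (stack_cong d d' e e') then show ?case using isotopic_points[OF stack_cong(1)] by simp
next
  case (juxt_cong d d' e e') then show ?case using isotopic_points[OF juxt_cong(1)] by simp
next
  case (interchange d d' e e') then show ?case by (simp add: w_interchange)
next
  case zigzag_left
  show ?case
  proof (rule wmat_eqI[of 1 1])
    fix w v :: "bool list" assume "length w = 1" "length v = 1"
    then obtain x y where "w = [x]" "v = [y]" by (auto simp: length_Suc_conv)
    then show "val m (Stack (Juxt Cap (Strands 1)) (Juxt (Strands 1) Cup)) w v = val m (Strands 1) w v"
      by (cases x; cases y) (simp_all add: wcomp_def wten_def numeral_3_eq_3 sum_words_Suc wcap_def wcup_def wid_def)
  qed (use supp_val[of "Stack (Juxt Cap (Strands 1)) (Juxt (Strands 1) Cup)" m] supp_val[of "Strands 1" m] in auto)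
next
  case zigzag_right
  show ?case
  proof (rule wmat_eqI[of 1 1])
    fix w v :: "bool list" assume "length w = 1" "length v = 1"
    then obtain x y where "w = [x]" "v = [y]" by (auto simp: length_Suc_conv)
    then show "val m (Stack (Juxt (Strands 1) Cap) (Juxt Cup (Strands 1))) w v = val m (Strands 1) w v"
      by (cases x; cases y) (simp_all add: wcomp_def wten_def numeral_3_eq_3 sum_words_Suc wcap_def wcup_def wid_def)
  qed (use supp_val[of "Stack (Juxt (Strands 1) Cap) (Juxt Cup (Strands 1))" m] supp_val[of "Strands 1" m] in auto)
next
  case (rotate l b t)
  show ?case
  proof (rule wmat_eqI[of t b])
    show "supp t b (val m (turn_left (Box l b t)))" "supp t b (val m (turn_right (Box l b t)))"
      using supp_val[of "turn_left (Box l b t)" m] supp_val[of "turn_right (Box l b t)" m]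
      by (auto simp: turn_left_def turn_right_def)
  qed (simp add: val_turn)
qed (auto simp: wcomp_assoc wcomp_wid_left[OF supp_val] wcomp_wid_right[OF supp_val] wten_assoc wten_0_left
   wten_0_right[OF supp_val] wten_id)

lift_definition tval :: "nat \<Rightarrow> gen tangle \<Rightarrow> wmat" is val by (rule val_isotopic)

section \<open>Formal linear combinations of tangles\<close>

abbreviation sgl :: "'l tangle \<Rightarrow> complex \<Rightarrow> 'l lin" where "sgl \<equiv> Poly_Mapping.single"

text \<open>Linear extension of a function on tangles. All operations on linear combinations are instances, so
  that additivity is proved once.\<close>

definition lext :: "('l tangle \<Rightarrow> complex \<Rightarrow> 'b) \<Rightarrow> 'l lin \<Rightarrow> 'b::comm_monoid_add" where
  "lext F x = (\<Sum>T \<in> Poly_Mapping.keys x. F T (Poly_Mapping.lookup x T))"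

lemma lext_add:
  assumes "\<And>T c d. F T (c + d) = F T c + F T d" "\<And>T. F T 0 = 0"
  shows "lext F (x + y) = lext F x + lext F y"
proof -
  let ?A = "Poly_Mapping.keys x \<union> Poly_Mapping.keys y"
  have *: "lext F z = (\<Sum>T \<in> ?A. F T (Poly_Mapping.lookup z T))" if "Poly_Mapping.keys z \<subseteq> ?A" for z
    unfolding lext_def using that assms(2)
    by (intro sum.mono_neutral_left) (auto simp: in_keys_iff)
  show ?thesis
    using *[of x] *[of y] *[OF Poly_Mapping.keys_add] by (simp add: lookup_add assms(1) sum.distrib)
qed

lemma lext_zero [simp]: "lext F 0 = 0" by (simp add: lext_def)

lemma lext_single: "F T 0 = 0 \<Longrightarrow> lext F (sgl T c) = F T c"
  by (simp add: lext_def)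

lemma lin_induct [case_names zero single add]:
  assumes "P 0" "\<And>T c. P (sgl T c)" "\<And>x y. P x \<Longrightarrow> P y \<Longrightarrow> P (x + y)"
  shows "P (x :: 'l lin)"
proof -
  have "x = (\<Sum>T \<in> Poly_Mapping.keys x. sgl T (Poly_Mapping.lookup x T))"
    by (rule poly_mapping_eqI) (simp add: lookup_sum lookup_single when_def in_keys_iff)
  moreover have "P (\<Sum>T \<in> A. sgl T (Poly_Mapping.lookup x T))" if "finite A" for A
    using that by induction (use assms in auto)
  ultimately show ?thesis by (metis finite_keys)
qed

lemma fp_induct [consumes 1, case_names zero single add]:
  assumes "x \<in> free_planar G b t" and "P 0"
    "\<And>T c. t_well_formed T \<Longrightarrow> t_bot T = b \<Longrightarrow> t_top T = t \<Longrightarrow> t_boxes T \<subseteq> G \<Longrightarrow> P (sgl T c)"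
    "\<And>x y. x \<in> free_planar G b t \<Longrightarrow> y \<in> free_planar G b t \<Longrightarrow> P x \<Longrightarrow> P y \<Longrightarrow> P (x + y)"
  shows "P (x :: 'l lin)"
proof -
  have *: "x = (\<Sum>T \<in> Poly_Mapping.keys x. sgl T (Poly_Mapping.lookup x T))"
    by (rule poly_mapping_eqI) (simp add: lookup_sum lookup_single when_def in_keys_iff)
  have "P (\<Sum>T \<in> A. sgl T (Poly_Mapping.lookup x T)) \<and> (\<Sum>T \<in> A. sgl T (Poly_Mapping.lookup x T)) \<in> free_planar G b t"
    if "finite A" "A \<subseteq> Poly_Mapping.keys x" for A
    using that
  proof induction
    case empty then show ?case using assms(2) by (simp add: free_planar_def)
  next
    case (insert T A)
    then have T: "t_well_formed T" "t_bot T = b" "t_top T = t" "t_boxes T \<subseteq> G"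
      using assms(1) by (auto simp: free_planar_def)
    have s: "sgl T (Poly_Mapping.lookup x T) \<in> free_planar G b t" using T by (auto simp: free_planar_def)
    have "y + z \<in> free_planar G b t" if "y \<in> free_planar G b t" "z \<in> free_planar G b t" for y z
      using that Poly_Mapping.keys_add[of y z] unfolding free_planar_def by blast
    then show ?case using insert s assms(3)[OF T] assms(4) by auto
  qed
  from this[of "Poly_Mapping.keys x"] * show ?thesis by simp
qed

lemma fp_0 [simp]: "0 \<in> free_planar G b t" by (simp add: free_planar_def)
lemma fp_add: "x \<in> free_planar G b t \<Longrightarrow> y \<in> free_planar G b t \<Longrightarrow> x + y \<in> free_planar G b t"
  using Poly_Mapping.keys_add[of x y] unfolding free_planar_def by blast

lemma lookup_scale: "Poly_Mapping.lookup (lin_scale c x) T = c * Poly_Mapping.lookup x T"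
  by (simp add: lin_scale_def Poly_Mapping.map.rep_eq when_def)

lemma scale_single [simp]: "lin_scale c (sgl T d) = sgl T (c * d)"
  by (rule poly_mapping_eqI) (simp add: lookup_scale lookup_single when_def)
lemma scale_add: "lin_scale c (x + y) = lin_scale c x + lin_scale c y"
  and scale_add_left: "lin_scale (c + d) x = lin_scale c x + lin_scale d x"
  and scale_0 [simp]: "lin_scale c 0 = 0"
  and scale_zero [simp]: "lin_scale 0 x = 0"
  and scale_1 [simp]: "lin_scale 1 x = x"
  and scale_scale: "lin_scale c (lin_scale d x) = lin_scale (c * d) x"
  and scale_diff: "lin_scale c (x - y) = lin_scale c x - lin_scale c y"
  and scale_minus_1: "lin_scale (-1) x = - x"
  by (rule poly_mapping_eqI; simp add: lookup_scale lookup_add lookup_minus lookup_uminus algebra_simps)+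

lemma fp_scale: "x \<in> free_planar G b t \<Longrightarrow> lin_scale c x \<in> free_planar G b t"
  unfolding free_planar_def by (auto simp: in_keys_iff lookup_scale)
lemma fp_diff: "x \<in> free_planar G b t \<Longrightarrow> y \<in> free_planar G b t \<Longrightarrow> x - y \<in> free_planar G b t"
  using keys_diff[of x y] unfolding free_planar_def by blast
lemma fp_sum: "(\<And>i. i \<in> A \<Longrightarrow> h i \<in> free_planar G b t) \<Longrightarrow> sum h A \<in> free_planar G b t"
  by (induction A rule: infinite_finite_induct) (auto intro: fp_add)
lemma fp_single: "t_well_formed T \<Longrightarrow> t_bot T = b \<Longrightarrow> t_top T = t \<Longrightarrow> t_boxes T \<subseteq> G \<Longrightarrow> sgl T c \<in> free_planar G b t"
  by (simp add: free_planar_def)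
lemma fp_lin_of: "well_formed d \<Longrightarrow> bot_points d = b \<Longrightarrow> top_points d = t \<Longrightarrow> set (box_list d) \<subseteq> G \<Longrightarrow> lin_of d \<in> free_planar G b t"
  unfolding lin_of_def by (rule fp_single) (simp_all add: t_well_formed.abs_eq t_bot.abs_eq t_top.abs_eq t_boxes.abs_eq)

lemma stack_lext: "x \<circ>\<^sub>t y = lext (\<lambda>S c. lext (\<lambda>T d. sgl (t_stack S T) (c * d)) y) x"
  by (simp add: lin_stack_def lext_def)
lemma juxt_lext: "x \<otimes>\<^sub>t y = lext (\<lambda>S c. lext (\<lambda>T d. sgl (t_juxt S T) (c * d)) y) x"
  by (simp add: lin_juxt_def lext_def)

lemma lext_zero_fun: "(\<And>T c. F T c = 0) \<Longrightarrow> lext F x = 0" by (simp add: lext_def)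
lemma lext_plus_fun: "lext (\<lambda>T c. F T c + H T c) x = lext F x + lext H x" by (simp add: lext_def sum.distrib)

lemma stack_add_left: "(x + x') \<circ>\<^sub>t y = x \<circ>\<^sub>t y + x' \<circ>\<^sub>t y"
  unfolding stack_lext by (rule lext_add) (simp_all add: distrib_right single_add lext_plus_fun lext_zero_fun)
lemma stack_add_right: "x \<circ>\<^sub>t (y + y') = x \<circ>\<^sub>t y + x \<circ>\<^sub>t y'"
  unfolding stack_lext by (subst lext_add) (simp_all add: distrib_left single_add lext_plus_fun)
lemma juxt_add_left: "(x + x') \<otimes>\<^sub>t y = x \<otimes>\<^sub>t y + x' \<otimes>\<^sub>t y"
  unfolding juxt_lext by (rule lext_add) (simp_all add: distrib_right single_add lext_plus_fun lext_zero_fun)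
lemma juxt_add_right: "x \<otimes>\<^sub>t (y + y') = x \<otimes>\<^sub>t y + x \<otimes>\<^sub>t y'"
  unfolding juxt_lext by (subst lext_add) (simp_all add: distrib_left single_add lext_plus_fun)

lemma stack_single [simp]: "sgl S c \<circ>\<^sub>t sgl T d = sgl (t_stack S T) (c * d)"
  unfolding stack_lext by (simp add: lext_single)
lemma juxt_single [simp]: "sgl S c \<otimes>\<^sub>t sgl T d = sgl (t_juxt S T) (c * d)"
  unfolding juxt_lext by (simp add: lext_single)
lemma stack_zero [simp]: "0 \<circ>\<^sub>t y = 0" "y \<circ>\<^sub>t 0 = 0" unfolding stack_lext by (simp_all add: lext_zero_fun)
lemma juxt_zero [simp]: "0 \<otimes>\<^sub>t y = 0" "y \<otimes>\<^sub>t 0 = 0" unfolding juxt_lext by (simp_all add: lext_zero_fun)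

lemma stack_scale_left: "lin_scale c x \<circ>\<^sub>t y = lin_scale c (x \<circ>\<^sub>t y)"
proof (induction x rule: lin_induct)
  case (single T d) show ?case
    by (induction y rule: lin_induct) (auto simp: stack_add_right scale_add mult.assoc)
qed (auto simp: stack_add_left scale_add)
lemma stack_scale_right: "x \<circ>\<^sub>t lin_scale c y = lin_scale c (x \<circ>\<^sub>t y)"
proof (induction x rule: lin_induct)
  case (single T d) show ?case
    by (induction y rule: lin_induct) (auto simp: stack_add_right scale_add mult_ac)
qed (auto simp: stack_add_left scale_add)
lemma juxt_scale_left: "lin_scale c x \<otimes>\<^sub>t y = lin_scale c (x \<otimes>\<^sub>t y)"
proof (induction x rule: lin_induct)
  case (single T d) show ?case
    by (induction y rule: lin_induct) (auto simp: juxt_add_right scale_add mult.assoc)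
qed (auto simp: juxt_add_left scale_add)
lemma juxt_scale_right: "x \<otimes>\<^sub>t lin_scale c y = lin_scale c (x \<otimes>\<^sub>t y)"
proof (induction x rule: lin_induct)
  case (single T d) show ?case
    by (induction y rule: lin_induct) (auto simp: juxt_add_right scale_add mult_ac)
qed (auto simp: juxt_add_left scale_add)

lemma stack_diff: "(x - x') \<circ>\<^sub>t y = x \<circ>\<^sub>t y - x' \<circ>\<^sub>t y" "y \<circ>\<^sub>t (x - x') = y \<circ>\<^sub>t x - y \<circ>\<^sub>t x'"
  using stack_add_left[of "x - x'" x' y] stack_add_right[of y "x - x'" x'] by simp_all
lemma juxt_diff: "(x - x') \<otimes>\<^sub>t y = x \<otimes>\<^sub>t y - x' \<otimes>\<^sub>t y" "y \<otimes>\<^sub>t (x - x') = y \<otimes>\<^sub>t x - y \<otimes>\<^sub>t x'"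
  using juxt_add_left[of "x - x'" x' y] juxt_add_right[of y "x - x'" x'] by simp_all

lemma stack_sum: "sum h A \<circ>\<^sub>t y = (\<Sum>i\<in>A. h i \<circ>\<^sub>t y)" "y \<circ>\<^sub>t sum h A = (\<Sum>i\<in>A. y \<circ>\<^sub>t h i)"
  by (induction A rule: infinite_finite_induct) (auto simp: stack_add_left stack_add_right)
lemma juxt_sum: "sum h A \<otimes>\<^sub>t y = (\<Sum>i\<in>A. h i \<otimes>\<^sub>t y)" "y \<otimes>\<^sub>t sum h A = (\<Sum>i\<in>A. y \<otimes>\<^sub>t h i)"
  by (induction A rule: infinite_finite_induct) (auto simp: juxt_add_left juxt_add_right)
lemma scale_sum: "lin_scale c (sum h A) = (\<Sum>i\<in>A. lin_scale c (h i))"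
  by (induction A rule: infinite_finite_induct) (auto simp: scale_add)

lemma lin_of_stack: "lin_of d \<circ>\<^sub>t lin_of e = lin_of (Stack d e)"
  by (simp add: lin_of_def t_stack.abs_eq)
lemma lin_of_juxt: "lin_of d \<otimes>\<^sub>t lin_of e = lin_of (Juxt d e)"
  by (simp add: lin_of_def t_juxt.abs_eq)
lemma lin_of_isotopic: "isotopic d e \<Longrightarrow> lin_of d = lin_of e"
  using tangle.abs_eq_iff[of d e] by (simp add: lin_of_def)

lemma t_simps: "t_well_formed (t_stack S T) = (t_well_formed S \<and> t_well_formed T \<and> t_bot S = t_top T)"
  "t_well_formed (t_juxt S T) = (t_well_formed S \<and> t_well_formed T)"
  "t_bot (t_stack S T) = t_bot T" "t_top (t_stack S T) = t_top S"
  "t_bot (t_juxt S T) = t_bot S + t_bot T" "t_top (t_juxt S T) = t_top S + t_top T"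
  "t_boxes (t_stack S T) = t_boxes S \<union> t_boxes T" "t_boxes (t_juxt S T) = t_boxes S \<union> t_boxes T"
  by (transfer; simp)+

lemma fp_stack: assumes "x \<in> free_planar G k t" "y \<in> free_planar G b k" shows "x \<circ>\<^sub>t y \<in> free_planar G b t"
  using assms(1)
proof (induction rule: fp_induct)
  case (single S c) note S = single
  show ?case using assms(2)
    by (induction rule: fp_induct) (simp_all add: stack_add_right S t_simps fp_add fp_single)
qed (auto simp: stack_add_left intro: fp_add)

lemma fp_juxt: assumes "x \<in> free_planar G b t" "y \<in> free_planar G b' t'" shows "x \<otimes>\<^sub>t y \<in> free_planar G (b + b') (t + t')"
  using assms(1)
proof (induction rule: fp_induct)
  case (single S c) note S = single
  show ?case using assms(2)
    by (induction rule: fp_induct) (simp_all add: juxt_add_right S t_simps fp_add fp_single)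
qed (auto simp: juxt_add_left intro: fp_add)

lemma t_laws: "t_stack (t_stack S T) R = t_stack S (t_stack T R)"
  "t_juxt (t_juxt S T) R = t_juxt S (t_juxt T R)"
  "t_stack (abs_tangle (Strands (t_top S))) S = S" "t_stack S (abs_tangle (Strands (t_bot S))) = S"
  "t_juxt (abs_tangle (Strands 0)) S = S" "t_juxt S (abs_tangle (Strands 0)) = S"
  by (transfer, blast intro: isotopic.intros)+

lemma t_interchange: "t_bot S = t_top S' \<Longrightarrow> t_bot T = t_top T' \<Longrightarrow>
   t_stack (t_juxt S T) (t_juxt S' T') = t_juxt (t_stack S S') (t_stack T T')"
  by (transfer, blast intro: isotopic.intros)

lemma lin_stack_assoc: "(x \<circ>\<^sub>t y) \<circ>\<^sub>t z = x \<circ>\<^sub>t (y \<circ>\<^sub>t z)"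
proof (induction x rule: lin_induct)
  case (single S c) show ?case
  proof (induction y rule: lin_induct)
    case (single T d) show ?case
      by (induction z rule: lin_induct) (auto simp: stack_add_right t_laws mult.assoc)
  qed (auto simp: stack_add_right stack_add_left)
qed (auto simp: stack_add_left)

lemma lin_juxt_assoc: "(x \<otimes>\<^sub>t y) \<otimes>\<^sub>t z = x \<otimes>\<^sub>t (y \<otimes>\<^sub>t z)"
proof (induction x rule: lin_induct)
  case (single S c) show ?case
  proof (induction y rule: lin_induct)
    case (single T d) show ?case
      by (induction z rule: lin_induct) (auto simp: juxt_add_right t_laws mult.assoc)
  qed (auto simp: juxt_add_right juxt_add_left)
qed (auto simp: juxt_add_left)

lemma lin_strands: assumes "x \<in> free_planar G b t"
  shows "lin_of (Strands t) \<circ>\<^sub>t x = x" "x \<circ>\<^sub>t lin_of (Strands b) = x"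
  using assms by (induction rule: fp_induct)
    (auto simp: stack_add_right stack_add_left lin_of_def t_laws(3,4))

lemma lin_juxt_empty: "lin_of (Strands 0) \<otimes>\<^sub>t x = x" "x \<otimes>\<^sub>t lin_of (Strands 0) = x"
  by (induction x rule: lin_induct) (auto simp: juxt_add_right juxt_add_left lin_of_def t_laws)

lemma lin_strands_add: "lin_of (Strands j) \<otimes>\<^sub>t lin_of (Strands k) = lin_of (Strands (j + k))"
  unfolding lin_of_juxt by (rule lin_of_isotopic) (rule isotopic.juxt_strands)

lemma lin_interchange:
  assumes "x \<in> free_planar G k t" "x' \<in> free_planar G b k" "y \<in> free_planar G l s" "y' \<in> free_planar G c l"
  shows "(x \<otimes>\<^sub>t y) \<circ>\<^sub>t (x' \<otimes>\<^sub>t y') = (x \<circ>\<^sub>t x') \<otimes>\<^sub>t (y \<circ>\<^sub>t y')"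
  using assms(1)
proof (induction rule: fp_induct)
  case (single S) note S = this
  show ?case using assms(2)
  proof (induction rule: fp_induct)
    case (single S') note S' = this
    show ?case using assms(3)
    proof (induction rule: fp_induct)
      case (single T) note T = this
      show ?case using assms(4)
      proof (induction rule: fp_induct)
        case (single T')
        then show ?case using S S' T by (simp add: t_interchange mult_ac)
      qed (auto simp: stack_add_right juxt_add_right)
    qed (auto simp: stack_add_right juxt_add_right stack_add_left)
  qed (auto simp: stack_add_right juxt_add_left stack_add_left)
qed (auto simp: juxt_add_left stack_add_left)

definition lval :: "nat \<Rightarrow> gen lin \<Rightarrow> wmat" where
  "lval m x w v = lext (\<lambda>T c. c * tval m T w v) x"

lemma lval_add: "lval m (x + y) w v = lval m x w v + lval m y w v"
  unfolding lval_def by (rule lext_add) (simp_all add: distrib_right)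
lemma lval_0 [simp]: "lval m 0 w v = 0" by (simp add: lval_def)
lemma lval_single [simp]: "lval m (sgl T c) w v = c * tval m T w v" by (simp add: lval_def lext_single)
lemma lval_scale: "lval m (lin_scale c x) w v = c * lval m x w v"
  by (induction x rule: lin_induct) (auto simp: scale_add lval_add algebra_simps)
lemma lval_diff: "lval m (x - y) w v = lval m x w v - lval m y w v"
  using lval_add[of m "x - y" y w v] by simp
lemma lval_sum: "lval m (sum h A) w v = (\<Sum>i\<in>A. lval m (h i) w v)"
  by (induction A rule: infinite_finite_induct) (auto simp: lval_add)
lemma lval_lin_of: "lval m (lin_of d) = val m d" by (intro ext) (simp add: lin_of_def tval.abs_eq)

lemma tval_stack: "tval m (t_stack S T) = wcomp (t_bot S) (tval m S) (tval m T)"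
  by transfer simp
lemma tval_juxt: "tval m (t_juxt S T) = wten (t_top S) (t_bot S) (tval m S) (tval m T)"
  by transfer simp
lemma supp_tval: "supp (t_bot T) (t_top T) (tval m T)" by transfer (rule supp_val)

lemma lval_stack: assumes "x \<in> free_planar G k t"
  shows "lval m (x \<circ>\<^sub>t y) = wcomp k (lval m x) (lval m y)"
  using assms
proof (induction rule: fp_induct)
  case (single S c) note S = single
  show ?case
    by (induction y rule: lin_induct)
     (auto simp: stack_add_right S lval_add fun_eq_iff wcomp_def tval_stack sum_distrib_left algebra_simps sum.distrib)
qed (auto simp: stack_add_left fun_eq_iff lval_add wcomp_def algebra_simps sum.distrib)

lemma lval_juxt: assumes "x \<in> free_planar G b t"
  shows "lval m (x \<otimes>\<^sub>t y) = wten t b (lval m x) (lval m y)"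
  using assms
proof (induction rule: fp_induct)
  case (single S c) note S = single
  show ?case
    by (induction y rule: lin_induct)
     (auto simp: juxt_add_right S lval_add fun_eq_iff wten_def tval_juxt algebra_simps)
qed (auto simp: juxt_add_left fun_eq_iff lval_add wten_def algebra_simps)

lemma supp_lval: "x \<in> free_planar G b t \<Longrightarrow> supp b t (lval m x)"
proof (induction rule: fp_induct)
  case (single T c) then show ?case using supp_tval[of T m] by (auto simp: supp_def)
next
  case (add x y) then show ?case unfolding supp_def by (metis lval_add add.right_neutral)
qed (auto simp: supp_def)

lemma cnj_val: "cnj (val m d w v) = val m d w v"
proof (induction d arbitrary: w v)
  case (Box l b t) then show ?case by (cases l) (simp_all add: gval_def wunit_def)
qed (simp_all add: wid_def wcap_def wcup_def wcomp_def wten_def)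

lemma reflect_points [simp]: "bot_points (reflect_diagram s d) = top_points d" "top_points (reflect_diagram s d) = bot_points d"
  by (induction d) auto

lemma val_reflect: "well_formed d \<Longrightarrow> val m (reflect_diagram gen_star d) w v = val m d v w"
proof (induction d arbitrary: w v)
  case (Box l b t) then show ?case by (cases l) (simp_all add: gval_def wunit_def conj_commute)
next
  case (Stack d e) then show ?case by (simp add: wcomp_def mult.commute)
qed (auto simp: wid_def wcap_def wten_def)

lemma tval_reflect: "t_well_formed T \<Longrightarrow> tval m (t_reflect gen_star T) w v = tval m T v w"
  by transfer (rule val_reflect)
lemma cnj_tval: "cnj (tval m T w v) = tval m T w v" by transfer (rule cnj_val)

lemma adjoint_lext: "lin_adjoint s x = lext (\<lambda>T c. sgl (t_reflect s T) (cnj c)) x"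
  by (simp add: lin_adjoint_def lext_def)
lemma adjoint_add: "lin_adjoint s (x + y) = lin_adjoint s x + lin_adjoint s y"
  unfolding adjoint_lext by (rule lext_add) (simp_all add: single_add)
lemma adjoint_single: "lin_adjoint s (sgl T c) = sgl (t_reflect s T) (cnj c)"
  unfolding adjoint_lext by (simp add: lext_single)
lemma adjoint_0 [simp]: "lin_adjoint s 0 = 0" unfolding adjoint_lext by simp

lemma lval_adjoint: assumes "x \<in> free_planar G b t"
  shows "lval m (lin_adjoint gen_star x) w v = cnj (lval m x v w)"
  using assms by (induction rule: fp_induct) (auto simp: adjoint_single adjoint_add lval_add tval_reflect cnj_tval)

lemma reflect_boxes: "set (box_list (reflect_diagram s d)) = (\<lambda>(l, b, t). (s l, t, b)) ` set (box_list d)"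
  by (induction d) (simp_all only: reflect_diagram.simps box_list.simps set_append image_Un Un_commute list.set image_insert image_empty case_prod_conv)
lemma reflect_wf: "well_formed d \<Longrightarrow> well_formed (reflect_diagram s d)" by (induction d) auto

lemma t_reflect_simps: "t_bot (t_reflect s T) = t_top T" "t_top (t_reflect s T) = t_bot T"
  "t_well_formed T \<Longrightarrow> t_well_formed (t_reflect s T)"
  "t_boxes (t_reflect s T) = (\<lambda>(l, b, t). (s l, t, b)) ` t_boxes T"
  by (transfer; simp add: reflect_boxes reflect_wf)+

lemma fp_adjoint: assumes "x \<in> free_planar (gens m) b t" shows "lin_adjoint gen_star x \<in> free_planar (gens m) t b"
  using assms
proof (induction rule: fp_induct)
  case (single T c)
  have "(\<lambda>(l, b, t). (gen_star l, t, b)) ` t_boxes T \<subseteq> gens m"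
    using single by (fastforce simp: gens_def)
  then show ?case using single by (auto simp: adjoint_single t_reflect_simps intro!: fp_single)
qed (auto simp: adjoint_add intro: fp_add)

section \<open>The kernel of the representation\<close>

definition ker :: "nat \<Rightarrow> nat \<Rightarrow> nat \<Rightarrow> gen lin set" where
  "ker m b t = {x \<in> free_planar (gens m) b t. lval m x = (\<lambda>w v. 0)}"

lemma action_fp:
  assumes "well_formed d" "\<forall>(h, b, t) \<in> set (box_list d). \<sigma> h \<in> free_planar G b t"
  shows "tangle_action \<sigma> d \<in> free_planar G (bot_points d) (top_points d)"
  using assms by (induction d) (auto intro!: fp_lin_of intro: fp_stack fp_juxt)

lemma wcomp_0 [simp]: "wcomp k (\<lambda>w v. 0) f = (\<lambda>w v. 0)" "wcomp k f (\<lambda>w v. 0) = (\<lambda>w v. 0)"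
  by (simp_all add: wcomp_def fun_eq_iff)
lemma wten_0 [simp]: "wten k l (\<lambda>w v. 0) f = (\<lambda>w v. 0)" "wten k l f (\<lambda>w v. 0) = (\<lambda>w v. 0)"
  by (simp_all add: wten_def fun_eq_iff)

text \<open>The kernel of a representation of the free planar algebra is a planar ideal; with \<open>rels_ker\<close> it
  therefore contains the ideal generated by the relations.\<close>

lemma planar_ideal_ker: "planar_ideal (gens m) (ker m)"
proof -
  have "lval m (tangle_action \<sigma> d) = (\<lambda>w v. 0)"
    if "well_formed d" "\<forall>(h, b, t) \<in> set (box_list d). \<sigma> h \<in> free_planar (gens m) b t"
      "\<exists>(h, b, t) \<in> set (box_list d). \<sigma> h \<in> ker m b t" for d \<sigma>
    using that
  proof (induction d)
    case (Stack d e)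
    have d: "tangle_action \<sigma> d \<in> free_planar (gens m) (bot_points d) (top_points d)"
      using Stack.prems by (intro action_fp) auto
    have "lval m (tangle_action \<sigma> d) = (\<lambda>w v. 0) \<or> lval m (tangle_action \<sigma> e) = (\<lambda>w v. 0)"
      using Stack by (simp only: box_list.simps set_append well_formed.simps ball_Un bex_Un) blast
    then show ?case by (auto simp: lval_stack[OF d])
  next
    case (Juxt d e)
    have d: "tangle_action \<sigma> d \<in> free_planar (gens m) (bot_points d) (top_points d)"
      using Juxt.prems by (intro action_fp) auto
    have "lval m (tangle_action \<sigma> d) = (\<lambda>w v. 0) \<or> lval m (tangle_action \<sigma> e) = (\<lambda>w v. 0)"
      using Juxt by (simp only: box_list.simps set_append well_formed.simps ball_Un bex_Un) blast
    then show ?case by (auto simp: lval_juxt[OF d])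
  qed (auto simp: ker_def)
  then show ?thesis
    unfolding planar_ideal_def using action_fp
    by (auto simp: ker_def lval_add lval_scale fun_eq_iff intro: fp_add fp_scale)
qed

lemma wunit_comp: "wcomp k (wunit w u) (wunit u' v) = (if u = u' \<and> length u = k then wunit w v else (\<lambda>w v. 0))"
proof -
  have "(\<Sum>s\<in>words k. wunit w u x s * wunit u' v s y) = (if u = u' \<and> length u = k then wunit w v x y else 0)" for x y
  proof -
    have "(\<Sum>s\<in>words k. wunit w u x s * wunit u' v s y) = (\<Sum>s\<in>words k. if s = u then (if u = u' then wunit w v x y else 0) else 0)"
      by (intro sum.cong) (auto simp: wunit_def)
    then show ?thesis by auto
  qed
  then show ?thesis by (auto simp: wcomp_def fun_eq_iff)
qed

lemma wunit_ten: "length w = t \<Longrightarrow> length v = b \<Longrightarrow> wten t b (wunit w v) (wunit w' v') = wunit (w @ w') (v @ v')"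
proof -
  assume l: "length w = t" "length v = b"
  have "take t x = w \<and> drop t x = w' \<longleftrightarrow> x = w @ w'" "take b y = v \<and> drop b y = v' \<longleftrightarrow> y = v @ v'" for x y
    using l by (metis append_eq_conv_conj append_take_drop_id)+
  then show ?thesis unfolding wten_def wunit_def fun_eq_iff
    by (simp only: mult_1_left mult_zero_left split: if_split) blast
qed

definition P_diag :: "gen diagram" where "P_diag = Box Gen_P 1 1"
definition Q_diag :: "gen diagram" where "Q_diag = turn_left P_diag"

lemma P1_diag: "P1 = lin_of P_diag" by (simp add: P1_def P_diag_def)
lemma Q1_diag: "Q1 = lin_of Q_diag"
  by (simp add: Q1_def Q_diag_def rotation_def turn_left_def P1_diag lin_of_stack lin_of_juxt P_diag_def)

primrec dpow :: "gen diagram \<Rightarrow> nat \<Rightarrow> gen diagram" where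
  "dpow d 0 = Strands 0"
| "dpow d (Suc k) = Juxt d (dpow d k)"

lemma lin_power_diag: "lin_power (lin_of d) k = lin_of (dpow d k)"
  by (induction k) (auto simp: lin_of_juxt)

lemma PQ_points [simp]: "bot_points P_diag = 1" "top_points P_diag = 1" "bot_points Q_diag = 1" "top_points Q_diag = 1"
  "well_formed P_diag" "well_formed Q_diag" "box_list P_diag = [(Gen_P, 1, 1)]" "box_list Q_diag = [(Gen_P, 1, 1)]"
  by (simp_all add: P_diag_def Q_diag_def turn_left_def numeral_eq_Suc)

lemma dpow_points [simp]: assumes "bot_points d = 1" "top_points d = 1"
  shows "bot_points (dpow d k) = k" "top_points (dpow d k) = k" "well_formed d \<Longrightarrow> well_formed (dpow d k)"
    "set (box_list (dpow d k)) \<subseteq> set (box_list d)"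
  using assms by (induction k) auto

lemma val_P [simp]: "val m P_diag = wunit [True] [True]" by (simp add: P_diag_def gval_def)
lemma val_Q [simp]: "val m Q_diag = wunit [False] [False]"
proof (rule wmat_eqI[of 1 1])
  show "supp 1 1 (val m Q_diag)" using supp_val[of Q_diag m] by simp
  fix w v :: "bool list" assume "length w = 1" "length v = 1"
  then have "val m Q_diag w v = val m P_diag (rv v) (rv w)" unfolding Q_diag_def by (intro val_turn) auto
  then show "val m Q_diag w v = wunit [False] [False] w v" by (auto simp: wunit_def rv_eq) (auto simp: rv_def)
qed (auto simp: supp_def wunit_def)

lemma val_dpow: "val m d = wunit [x] [x] \<Longrightarrow> bot_points d = 1 \<Longrightarrow> top_points d = 1 \<Longrightarrow>
   val m (dpow d k) = wunit (replicate k x) (replicate k x)"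
proof (induction k)
  case 0 show ?case by (auto simp: wid_def wunit_def fun_eq_iff)
next
  case (Suc k) then show ?case by (simp add: wunit_ten)
qed

lemma length_1: "length w = Suc 0 \<longleftrightarrow> w = [True] \<or> w = [False]"
  by (auto simp: length_Suc_conv)
lemma length_2: "length w = 2 \<longleftrightarrow> w = [True, True] \<or> w = [True, False] \<or> w = [False, True] \<or> w = [False, False]"
  by (auto simp: length_Suc_conv numeral_2_eq_2)

lemma sum_words_1: "(\<Sum>u\<in>words 1. h u) = h [True] + h [False]" for h :: "bool list \<Rightarrow> complex"
  using sum_words_Suc[of h 0] by simp
lemma sum_words_2: "(\<Sum>u\<in>words 2. h u) = h [True, True] + h [True, False] + h [False, True] + h [False, False]" for h :: "bool list \<Rightarrow> complex"
  by (simp add: numeral_2_eq_2 sum_words_Suc)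

lemma val_loop: "val m (Stack Cap (Stack (Juxt d (Strands 1)) Cup)) = wid 0" if "d = P_diag \<or> d = Q_diag"
  using that by (intro wmat_eqI[of 0 0])
    (use supp_val[of "Stack Cap (Stack (Juxt d (Strands 1)) Cup)" m] supp_wid[of 0] in \<open>auto simp: wcomp_def wten_def sum_words_2 sum_words_2[unfolded numeral_2_eq_2] wcup_def wcap_def wid_def wunit_def\<close>)

lemma val_arcs:
  "val m (Stack (Juxt P_diag (Strands 1)) (Stack Cup (Stack Cap (Juxt P_diag (Strands 1))))) = wunit [True, False] [True, False]" (is "val m ?d = _")
  "val m (Stack (Juxt Q_diag (Strands 1)) (Stack Cup (Stack Cap (Juxt Q_diag (Strands 1))))) = wunit [False, True] [False, True]" (is "val m ?e = _")
  by (intro wmat_eqI[of 2 2]; use supp_val[of ?d m] supp_val[of ?e m] in \<open>auto simp: numeral_2_eq_2[symmetric] supp_def wunit_def; fail | auto simp: wcomp_def wten_def sum_words_2 sum_words_2[unfolded numeral_2_eq_2] wcup_def wcap_def wid_def wunit_def length_2\<close>)+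

text \<open>The click moves the first bottom strand around; on the matrix unit of \<open>U\<close>, whose words are
  constant, this returns the same matrix unit. Hence the representation exists for \<open>\<lambda> = 1\<close>.\<close>

lemma val_click:
  assumes n: "n > 0" "a > 0" and d: "bot_points d = a" "top_points d = n" and v: "val m d = wunit (replicate n x) (replicate a (\<not> x))"
  shows "val m (Stack (Juxt (Strands n) Cap) (Stack (Juxt (Strands 1) (Juxt d (Strands 1))) (Juxt Cup (Strands a)))) = val m d"
proof (rule wmat_eqI[of a n])
  let ?D = "Stack (Juxt (Strands n) Cap) (Stack (Juxt (Strands 1) (Juxt d (Strands 1))) (Juxt Cup (Strands a)))"
  show "supp a n (val m ?D)" "supp a n (val m d)" using supp_val[of ?D m] supp_val[of d m] d by auto
  fix w u :: "bool list" assume l: "length w = n" "length u = a"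
  obtain p w' where w: "w = p # w'" "length w' = n - 1" using l n by (cases w) auto
  obtain q u' where u: "u = u' @ [q]" "length u' = a - 1" using l n by (cases u rule: rev_cases) auto
  have c: "val m (cups 1) = wcup" "val m (caps 1) = wcap"
    by (auto simp: wcomp_wid_right[OF supp_wcup(2)] wcomp_wid_left[OF supp_wcup(1)] wten_id wten_0_left numeral_2_eq_2[symmetric])
  have "val m ?D w u = (\<Sum>x\<in>words 1. \<Sum>y\<in>words 1. wten 1 1 (wid 1) (wten n a (val m d) (wid 1)) (w @ x @ rv x) (y @ rv y @ u))"
    using caps_right[where t = 1 and m = m, OF l(1), unfolded c] cups_left[where b = 1 and m = m, OF l(2), unfolded c] d
    by simp
  also have "\<dots> = (\<Sum>x\<in>words 1. \<Sum>y\<in>words 1. if x = [\<not> q] \<and> y = [p] then val m d (w' @ x) (rv y @ u') else 0)"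
  proof (intro sum.cong[OF HOL.refl])
    fix x y assume "x \<in> words 1" "y \<in> words 1"
    then obtain p' q' where x: "x = [p']" "y = [q']" by (auto simp: length_Suc_conv)
    have "take n (w' @ [p', \<not> p']) = w' @ [p']" "drop n (w' @ [p', \<not> p']) = [\<not> p']"
      "take a ((\<not> q') # u' @ [q]) = (\<not> q') # u'" "drop a ((\<not> q') # u' @ [q]) = [q]"
      using w u n by (auto simp: take_Cons drop_Cons split: nat.split)
    then show "wten 1 1 (wid 1) (wten n a (val m d) (wid 1)) (w @ x @ rv x) (y @ rv y @ u)
      = (if x = [\<not> q] \<and> y = [p] then val m d (w' @ x) (rv y @ u') else 0)"
      unfolding x w(1) u(1) wten_def wid_def rv_def
      by (cases p'; cases q'; cases p; cases q; simp)
  qed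
  also have "\<dots> = val m d (w' @ [\<not> q]) ((\<not> p) # u')"
    by (simp only: sum_words_1 list.inject simp_thms rv_def rev.simps list.map append.simps) (cases p; cases q; simp only: simp_thms if_True if_False add_0_left add_0_right not_True_eq_False not_False_eq_True)
  also have "\<dots> = val m d w u"
  proof -
    have r: "ys = replicate k y \<longleftrightarrow> length ys = k \<and> (\<forall>z\<in>set ys. z = y)" for ys k and y :: bool
      using replicate_eqI[of ys k y] by fastforce
    have "w' @ [\<not> q] = replicate n x \<and> (\<not> p) # u' = replicate a (\<not> x)
      \<longleftrightarrow> p # w' = replicate n x \<and> u' @ [q] = replicate a (\<not> x)"
      unfolding r using w(2) u(2) n by (cases p; cases q; cases x) auto
    then show ?thesis unfolding v wunit_def w(1) u(1) by simp
  qed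
  finally show "val m ?D w u = val m d w u" .
qed

section \<open>Uniqueness of monomial morphisms between signed words\<close>

text \<open>A strict monoidal category in the single-sorted style, so that morphisms of different types can be
  composed in equational proofs without dependent indices.\<close>

locale strict_monoidal =
  fixes arr :: "'c \<Rightarrow> bool" and dom cod :: "'c \<Rightarrow> 'o"
    and oplus :: "'o \<Rightarrow> 'o \<Rightarrow> 'o" (infixr \<open>\<oplus>\<close> 65) and ozero :: 'o
    and I :: "'o \<Rightarrow> 'c" and cmp :: "'c \<Rightarrow> 'c \<Rightarrow> 'c" (infixr \<open>\<bullet>\<close> 70)
    and ten :: "'c \<Rightarrow> 'c \<Rightarrow> 'c" (infixr \<open>\<star>\<close> 75)
  assumes oplus_assoc [simp]: "(x \<oplus> y) \<oplus> z = x \<oplus> (y \<oplus> z)"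
    and oplus_zero_left [simp]: "ozero \<oplus> x = x"
    and oplus_zero_right [simp]: "x \<oplus> ozero = x"
    and arr_I [simp]: "arr (I x)" and dom_I [simp]: "dom (I x) = x" and cod_I [simp]: "cod (I x) = x"
    and arr_cmp [simp]: "\<lbrakk>arr g; arr f; dom g = cod f\<rbrakk> \<Longrightarrow> arr (g \<bullet> f)"
    and dom_cmp [simp]: "dom (g \<bullet> f) = dom f" and cod_cmp [simp]: "cod (g \<bullet> f) = cod g"
    and arr_ten [simp]: "\<lbrakk>arr f; arr g\<rbrakk> \<Longrightarrow> arr (f \<star> g)"
    and dom_ten [simp]: "dom (f \<star> g) = dom f \<oplus> dom g"
    and cod_ten [simp]: "cod (f \<star> g) = cod f \<oplus> cod g"
    and cmp_assoc: "\<lbrakk>arr h; arr g; arr f; dom h = cod g; dom g = cod f\<rbrakk>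
      \<Longrightarrow> (h \<bullet> g) \<bullet> f = h \<bullet> (g \<bullet> f)"
    and cmp_I_left [simp]: "\<lbrakk>arr f; cod f = x\<rbrakk> \<Longrightarrow> I x \<bullet> f = f"
    and cmp_I_right [simp]: "\<lbrakk>arr f; dom f = x\<rbrakk> \<Longrightarrow> f \<bullet> I x = f"
    and ten_assoc: "\<lbrakk>arr f; arr g; arr h\<rbrakk> \<Longrightarrow> (f \<star> g) \<star> h = f \<star> (g \<star> h)"
    and ten_I: "I x \<star> I y = I (x \<oplus> y)"
    and ten_zero_left [simp]: "arr f \<Longrightarrow> I ozero \<star> f = f"
    and ten_zero_right [simp]: "arr f \<Longrightarrow> f \<star> I ozero = f"
    and interchange: "\<lbrakk>arr f; arr g; arr f'; arr g'; dom f = cod f'; dom g = cod g'\<rbrakk>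
      \<Longrightarrow> (f \<star> g) \<bullet> (f' \<star> g') = (f \<bullet> f') \<star> (g \<bullet> g')"
begin

lemma ten_cmp_I: "\<lbrakk>arr f; arr g; dom g = cod f\<rbrakk> \<Longrightarrow> (g \<bullet> f) \<star> I x = (g \<star> I x) \<bullet> (f \<star> I x)"
  and I_ten_cmp: "\<lbrakk>arr f; arr g; dom g = cod f\<rbrakk> \<Longrightarrow> I x \<star> (g \<bullet> f) = (I x \<star> g) \<bullet> (I x \<star> f)"
  by (simp_all add: interchange)

lemma slide: "\<lbrakk>arr f; arr g; cod f = x; dom g = y; dom f = x'; cod g = y'\<rbrakk>
   \<Longrightarrow> (f \<star> I y') \<bullet> (I x' \<star> g) = f \<star> g"
  "\<lbrakk>arr f; arr g; cod f = x; dom g = y; dom f = x'; cod g = y'\<rbrakk>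
   \<Longrightarrow> (I x \<star> g) \<bullet> (f \<star> I y) = f \<star> g"
  by (simp_all add: interchange)

lemma I_ten_I: "arr f \<Longrightarrow> I x \<star> (I y \<star> f) = I (x \<oplus> y) \<star> f"
  by (simp add: ten_assoc[symmetric] ten_I)

definition inverse_arrs :: "'c \<Rightarrow> 'c \<Rightarrow> bool" where
  "inverse_arrs f g \<longleftrightarrow> arr f \<and> arr g \<and> dom f = cod g \<and> cod f = dom g
     \<and> f \<bullet> g = I (dom g) \<and> g \<bullet> f = I (dom f)"

lemma inverse_sym: "inverse_arrs f g \<Longrightarrow> inverse_arrs g f"
  by (simp add: inverse_arrs_def)

lemma inverse_I [simp]: "inverse_arrs (I x) (I x)"
  by (simp add: inverse_arrs_def)

lemma inverse_ten: "inverse_arrs f f' \<Longrightarrow> inverse_arrs g g' \<Longrightarrow> inverse_arrs (f \<star> g) (f' \<star> g')"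
  by (auto simp: inverse_arrs_def interchange ten_I)

lemma cancel_left:
  "\<lbrakk>arr h; arr g; arr f; dom h = cod g; dom g = cod f; h \<bullet> g = I (cod f)\<rbrakk> \<Longrightarrow> h \<bullet> (g \<bullet> f) = f"
  by (metis cmp_I_left cmp_assoc)

lemma inverse_cmp:
  assumes "inverse_arrs f f'" "inverse_arrs g g'" "dom g = cod f"
  shows "inverse_arrs (g \<bullet> f) (f' \<bullet> g')"
proof -
  have "(g \<bullet> f) \<bullet> (f' \<bullet> g') = g \<bullet> (f \<bullet> (f' \<bullet> g'))"
    using assms by (auto simp: inverse_arrs_def cmp_assoc)
  also have "f \<bullet> (f' \<bullet> g') = g'"
    using assms by (intro cancel_left) (auto simp: inverse_arrs_def)
  finally have 1: "(g \<bullet> f) \<bullet> (f' \<bullet> g') = g \<bullet> g'" .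
  have "(f' \<bullet> g') \<bullet> (g \<bullet> f) = f' \<bullet> (g' \<bullet> (g \<bullet> f))"
    using assms by (auto simp: inverse_arrs_def cmp_assoc)
  also have "g' \<bullet> (g \<bullet> f) = f"
    using assms by (intro cancel_left) (auto simp: inverse_arrs_def)
  finally have 2: "(f' \<bullet> g') \<bullet> (g \<bullet> f) = f' \<bullet> f" .
  show ?thesis using 1 2 assms by (auto simp: inverse_arrs_def)
qed

end


text \<open>The degree of a word modulo \<open>m\<close>, computed letter by letter as the number of positive letters left
  after cancelling \<open>+-\<close> pairs and blocks of \<open>m\<close> positive letters.\<close>

fun step :: "nat \<Rightarrow> nat \<Rightarrow> bool \<Rightarrow> nat" where
  "step m d True = (if Suc d = m then 0 else Suc d)"
| "step m d False = (if d = 0 then m - 1 else d - 1)"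

definition run :: "nat \<Rightarrow> nat \<Rightarrow> bool list \<Rightarrow> nat" where
  "run m = foldl (step m)"

lemma run_simps [simp]: "run m d [] = d" "run m d (x # v) = run m (step m d x) v"
   "run m d (v @ w) = run m (run m d v) w"
  by (simp_all add: run_def)

lemma step_less: "d < m \<Longrightarrow> step m d x < m"
  by (cases x) auto

lemma run_less: "d < m \<Longrightarrow> run m d w < m"
  by (induction w arbitrary: d) (auto simp: step_less)

lemma run_plus: "d + k < m \<Longrightarrow> run m d (pos k) = d + k"
  by (induction k arbitrary: d) auto

text \<open>Invertible cups and caps between signed words, together with an isomorphism \<open>V\<close> from \<open>+\<^sup>m\<close> to the empty
  word. The last axiom says that \<open>V\<close> slides past a positive strand. The locale is about all
  morphisms generated by these; the point is that there is at most one between two words.\<close>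

locale word_category =
  strict_monoidal arr dom cod "(@)" "[]" I cmp ten
  for arr :: "'c \<Rightarrow> bool" and dom cod :: "'c \<Rightarrow> bool list"
    and I :: "bool list \<Rightarrow> 'c" and cmp :: "'c \<Rightarrow> 'c \<Rightarrow> 'c" (infixr \<open>\<bullet>\<close> 70)
    and ten :: "'c \<Rightarrow> 'c \<Rightarrow> 'c" (infixr \<open>\<star>\<close> 75) +
  fixes m :: nat and cupP cupM capP capM V V' :: 'c
  assumes m: "m > 0"
    and typs [simp]: "dom cupP = []" "cod cupP = [True, False]" "dom cupM = []" "cod cupM = [False, True]"
      "dom capP = [True, False]" "cod capP = []" "dom capM = [False, True]" "cod capM = []"
      "dom V = pos m" "cod V = []" "dom V' = []" "cod V' = pos m"
    and invP: "inverse_arrs cupP capP" and invM: "inverse_arrs cupM capM" and invV: "inverse_arrs V V'"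
    and zigzag: "(capP \<star> I [True]) \<bullet> (I [True] \<star> cupM) = I [True]"
    and V_central: "V \<star> I [True] = I [True] \<star> V"
begin

lemma arrs [simp]: "arr cupP" "arr cupM" "arr capP" "arr capM" "arr V" "arr V'"
  using invP invM invV by (auto simp: inverse_arrs_def)

lemma inv_simps [simp]: "capP \<bullet> cupP = I []" "cupP \<bullet> capP = I [True, False]"
  "capM \<bullet> cupM = I []" "cupM \<bullet> capM = I [False, True]"
  "V \<bullet> V' = I []" "V' \<bullet> V = I (pos m)"
  using invP invM invV by (auto simp: inverse_arrs_def)

inductive S :: "'c \<Rightarrow> bool" where
  S_I: "S (I v)"
| S_gen: "f \<in> {cupP, cupM, capP, capM, V, V'} \<Longrightarrow> S f"
| S_cmp: "S g \<Longrightarrow> S f \<Longrightarrow> dom g = cod f \<Longrightarrow> S (g \<bullet> f)"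
| S_ten: "S f \<Longrightarrow> S g \<Longrightarrow> S (f \<star> g)"

lemma S_arr [simp]: "S f \<Longrightarrow> arr f"
  by (induction rule: S.induct) auto

lemma S_inverse: "S f \<Longrightarrow> \<exists>g. S g \<and> inverse_arrs f g"
proof (induction rule: S.induct)
  case (S_I v) show ?case using S.S_I inverse_I by blast
next
  case (S_gen f)
  then have "f \<in> {cupP, cupM, capP, capM, V, V'}" by simp
  moreover have "S cupP" "S cupM" "S capP" "S capM" "S V" "S V'" by (auto intro: S.S_gen)
  ultimately show ?case using invP invM invV inverse_sym by blast
next
  case (S_cmp g f) then show ?case using inverse_cmp S.S_cmp by (metis inverse_arrs_def)
next
  case (S_ten f g) then show ?case using inverse_ten S.S_ten by blast
qed

text \<open>A negative letter is exchanged for \<open>m - 1\<close> positive ones: insert \<open>m\<close> positive letters and cancel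
  the last of them.\<close>

definition W :: 'c where
  "W = (I (pos (m - 1)) \<star> capP) \<bullet> (V' \<star> I [False])"

fun red :: "nat \<Rightarrow> bool \<Rightarrow> 'c" where
  "red d True = (if Suc d = m then V else I (pos (Suc d)))"
| "red d False = (if d = 0 then W else I (pos (d - 1)) \<star> capP)"

lemma plus_snoc: "pos k @ [True] = pos (Suc k)" "pos k @ (True # w) = pos (Suc k) @ w"
  by (induction k) auto

lemma plus_split: "0 < k \<Longrightarrow> pos k = pos (k - 1) @ [True]"
  by (metis One_nat_def Suc_pred plus_snoc(1))

lemma W_typ [simp]: "arr W" "dom W = [False]" "cod W = pos (m - 1)"
  using m by (auto simp: W_def plus_split[OF m])

lemma red_typ: assumes "d < m"
  shows "arr (red d x)" "dom (red d x) = pos d @ [x]" "cod (red d x) = pos (step m d x)"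
proof -
  have "pos (d - 1) @ True # w = pos d @ w" if "d > 0" for w
    using that by (simp add: plus_snoc)
  with assms show "arr (red d x)" "dom (red d x) = pos d @ [x]" "cod (red d x) = pos (step m d x)"
    by (cases x; auto simp: plus_snoc)+
qed

text \<open>The normal form of a word: \<open>N d v\<close> reads \<open>v\<close> from left to right, starting with \<open>d\<close> positive letters,
  and rewrites everything read so far to fewer than \<open>m\<close> positive letters.\<close>

fun N :: "nat \<Rightarrow> bool list \<Rightarrow> 'c" where
  "N d [] = I (pos d)"
| "N d (x # v) = N (step m d x) v \<bullet> (red d x \<star> I v)"

lemma N_typ: "d < m \<Longrightarrow> arr (N d v) \<and> dom (N d v) = pos d @ v \<and> cod (N d v) = pos (run m d v)"
  by (induction v arbitrary: d) (auto simp: red_typ step_less)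

lemmas N_typ' [simp] = N_typ[THEN conjunct1] N_typ[THEN conjunct2, THEN conjunct1]
  N_typ[THEN conjunct2, THEN conjunct2]

lemma N_append: "d < m \<Longrightarrow> N d (v @ w) = N (run m d v) w \<bullet> (N d v \<star> I w)"
proof (induction v arbitrary: d)
  case Nil then show ?case by (simp add: ten_I)
next
  case (Cons x v)
  have "N d ((x # v) @ w) = (N (run m (step m d x) v) w \<bullet> (N (step m d x) v \<star> I w)) \<bullet> (red d x \<star> I (v @ w))"
    using Cons by (simp add: step_less)
  also have "\<dots> = N (run m (step m d x) v) w \<bullet> (N (step m d x) v \<star> I w) \<bullet> ((red d x \<star> I v) \<star> I w)"
    using Cons.prems by (simp add: step_less cmp_assoc red_typ run_less ten_assoc ten_I)
  also have "\<dots> = N (run m (step m d x) v) w \<bullet> ((N (step m d x) v \<bullet> (red d x \<star> I v)) \<star> I w)"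
    using Cons.prems by (simp add: step_less red_typ run_less ten_cmp_I)
  finally show ?case by simp
qed

lemma S_red: "d < m \<Longrightarrow> S (red d x)"
proof -
  assume d: "d < m"
  have "S W" unfolding W_def using m
    by (intro S_cmp S_ten S_I S_gen) (auto simp: plus_split[OF m])
  moreover have "S capP" "S V" by (auto intro: S_gen)
  ultimately show ?thesis using d by (cases x) (auto intro!: S_I S_ten)
qed

lemma S_N: "d < m \<Longrightarrow> S (N d v)"
  by (induction v arbitrary: d) (auto intro!: S_I S_cmp S_ten S_red simp: step_less red_typ)

lemma N_plus: "d + k < m \<Longrightarrow> N d (pos k) = I (pos (d + k))"
  by (induction k arbitrary: d) (auto simp: ten_I plus_snoc replicate_add[symmetric])

lemma I_plus_V: "I (pos d) \<star> V = V \<star> I (pos d)"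
proof (induction d)
  case (Suc d)
  have "I (pos (Suc d)) \<star> V = (I [True] \<star> I (pos d)) \<star> V" by (simp add: ten_I)
  also have "\<dots> = (I [True] \<star> V) \<star> I (pos d)" by (simp only: ten_assoc arrs arr_I Suc)
  also have "\<dots> = (V \<star> I [True]) \<star> I (pos d)" by (simp only: V_central)
  finally show ?case by (simp add: ten_assoc ten_I)
qed simp

lemma N_V: assumes d: "d < m" shows "N d (pos m) = I (pos d) \<star> V" "run m d (pos m) = d"
proof -
  define k where "k = m - 1 - d"
  have pm: "pos m = pos k @ True # pos d"
    using d by (simp add: k_def replicate_add[symmetric] flip: replicate_Suc)
  have r: "run m d (pos k) = m - 1" using run_plus[of d k m] d by (simp add: k_def)
  have n: "N d (pos k) = I (pos (m - 1))" using N_plus[of d k] d by (simp add: k_def)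
  have "N d (pos m) = N (m - 1) (True # pos d) \<bullet> (N d (pos k) \<star> I (True # pos d))"
    unfolding pm by (simp only: N_append[OF d] r)
  also have "\<dots> = N 0 (pos d) \<bullet> (V \<star> I (pos d)) \<bullet> I (pos (m - 1) @ (True # pos d))"
    using m by (simp add: n ten_I plus_snoc cmp_assoc N_plus d replicate_add[symmetric])
  also have "\<dots> = V \<star> I (pos d)"
    using m by (simp add: N_plus d plus_snoc replicate_add[symmetric])
  finally show "N d (pos m) = I (pos d) \<star> V" by (simp add: I_plus_V)
  show "run m d (pos m) = d" unfolding pm using m d r run_plus[of 0 d m] by simp
qed

text \<open>The normal form absorbs \<open>f\<close>, with any number of positive letters to its left. That
  generality makes the property stable under tensor products.\<close>

definition natural :: "'c \<Rightarrow> bool" where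
  "natural f \<longleftrightarrow> (\<forall>d<m. run m d (dom f) = run m d (cod f) \<and> N d (cod f) \<bullet> (I (pos d) \<star> f) = N d (dom f))"

lemma natural_cmp:
  assumes "natural g" "natural f" and [simp]: "arr f" "arr g" "dom g = cod f"
  shows "natural (g \<bullet> f)"
  unfolding natural_def
proof (intro allI impI conjI)
  fix d assume d: "d < m"
  show "run m d (dom (g \<bullet> f)) = run m d (cod (g \<bullet> f))" using assms(1,2) d by (simp add: natural_def)
  have "N d (cod (g \<bullet> f)) \<bullet> (I (pos d) \<star> (g \<bullet> f)) = (N d (cod g) \<bullet> (I (pos d) \<star> g)) \<bullet> (I (pos d) \<star> f)"
    using d by (simp add: I_ten_cmp cmp_assoc)
  also have "\<dots> = N d (dom (g \<bullet> f))" using assms(1,2) d by (simp add: natural_def)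
  finally show "N d (cod (g \<bullet> f)) \<bullet> (I (pos d) \<star> (g \<bullet> f)) = N d (dom (g \<bullet> f))" .
qed

lemma natural_ten:
  assumes f: "natural f" and g: "natural g" and a [simp]: "arr f" "arr g" shows "natural (f \<star> g)"
  unfolding natural_def
proof (intro allI impI conjI)
  fix d assume d: "d < m"
  let ?w = "cod f" and ?w' = "cod g" and ?v = "dom f" and ?v' = "dom g"
  have r: "run m d ?v = run m d ?w" and nf: "N d ?w \<bullet> (I (pos d) \<star> f) = N d ?v"
    using f d by (auto simp: natural_def)
  define e where "e = run m d ?w"
  have e: "e < m" using d run_less by (simp add: e_def)
  have r': "run m e ?v' = run m e ?w'" and ng: "N e ?w' \<bullet> (I (pos e) \<star> g) = N e ?v'"
    using g e by (auto simp: natural_def)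
  show "run m d (dom (f \<star> g)) = run m d (cod (f \<star> g))" using r r' by (simp add: e_def)
  have "N d (cod (f \<star> g)) \<bullet> (I (pos d) \<star> (f \<star> g))
      = (N e ?w' \<bullet> (N d ?w \<star> I ?w')) \<bullet> ((I (pos d) \<star> f) \<star> g)"
    using d by (simp add: N_append e_def ten_assoc)
  also have "\<dots> = N e ?w' \<bullet> (N d ?w \<star> I ?w') \<bullet> ((I (pos d) \<star> f) \<star> g)"
    using d e by (intro cmp_assoc) (simp_all add: e_def)
  also have "\<dots> = N e ?w' \<bullet> (N d ?v \<star> g)"
    using d e by (simp add: interchange e_def nf)
  also have "\<dots> = N e ?w' \<bullet> (I (pos e) \<star> g) \<bullet> (N d ?v \<star> I ?v')"
    using d e r by (subst slide(2)) (simp_all add: e_def)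
  also have "\<dots> = N d (dom (f \<star> g))"
    using d e r by (subst cmp_assoc[symmetric]) (simp_all add: e_def[symmetric] ng N_append)
  finally show "N d (cod (f \<star> g)) \<bullet> (I (pos d) \<star> (f \<star> g)) = N d (dom (f \<star> g))" .
qed

lemma natural_inverse:
  assumes "natural f" "inverse_arrs f g" shows "natural g"
  unfolding natural_def
proof (intro allI impI conjI)
  fix d assume d: "d < m"
  have t: "arr f" "arr g" "dom f = cod g" "cod f = dom g" "f \<bullet> g = I (dom g)"
    using assms(2) by (auto simp: inverse_arrs_def)
  show "run m d (dom g) = run m d (cod g)" using assms d t by (simp add: natural_def)
  have "N d (cod g) \<bullet> (I (pos d) \<star> g) = (N d (dom g) \<bullet> (I (pos d) \<star> f)) \<bullet> (I (pos d) \<star> g)"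
    using assms d t by (simp add: natural_def)
  also have "\<dots> = N d (dom g)" using d t by (simp add: cmp_assoc interchange ten_I)
  finally show "N d (cod g) \<bullet> (I (pos d) \<star> g) = N d (dom g)" .
qed

text \<open>The arc \<open>-+\<close> is not an elementary step of the normal form; the zigzag reduces it to \<open>V\<close>.\<close>

lemma plus_capP_W: "(W \<star> I [True]) \<bullet> cupM = V'"
proof -
  let ?p = "pos (m - 1)"
  have pm: "pos m = ?p @ [True]" using plus_split[OF m] .
  have "(W \<star> I [True]) \<bullet> cupM = ((I ?p \<star> capP \<star> I [True]) \<bullet> (V' \<star> I [False] \<star> I [True])) \<bullet> cupM"
    unfolding W_def by (subst ten_cmp_I) (simp_all add: pm ten_assoc)
  also have "\<dots> = (I ?p \<star> capP \<star> I [True]) \<bullet> (V' \<star> I [False, True]) \<bullet> (I [] \<star> cupM)"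
    by (simp add: cmp_assoc ten_I pm)
  also have "(V' \<star> I [False, True]) \<bullet> (I [] \<star> cupM) = (I (pos m) \<star> cupM) \<bullet> (V' \<star> I [])"
    by (simp only: slide[where x = "pos m" and y = "[]"] typs arrs)
  also have "\<dots> = (I ?p \<star> I [True] \<star> cupM) \<bullet> V'"
    by (simp only: pm ten_I[symmetric] ten_assoc arr_I arrs ten_zero_right)
  also have "(I ?p \<star> capP \<star> I [True]) \<bullet> (I ?p \<star> I [True] \<star> cupM) \<bullet> V' =
     (I ?p \<star> ((capP \<star> I [True]) \<bullet> (I [True] \<star> cupM))) \<bullet> V'"
    by (subst cmp_assoc[symmetric]) (simp_all add: interchange pm)
  also have "\<dots> = V'" by (simp add: zigzag ten_I pm)
  finally show ?thesis .
qed

lemma natural_gens: "natural cupP" "natural cupM" "natural V"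
proof -
  show "natural V" using N_V by (simp add: natural_def)
  show "natural cupP" unfolding natural_def
  proof (intro allI impI conjI)
    fix d assume d: "d < m"
    show "run m d (dom cupP) = run m d (cod cupP)" using d by auto
    show "N d (cod cupP) \<bullet> (I (pos d) \<star> cupP) = N d (dom cupP)"
    proof (cases "Suc d = m")
      case False
      with d show ?thesis
        by (simp add: ten_I plus_snoc cmp_assoc interchange)
    next
      case True
      then have pm: "pos m = pos d @ [True]" and d': "m - 1 = d" using plus_snoc by auto
      have "N d (cod cupP) \<bullet> (I (pos d) \<star> cupP) = ((I (pos d) \<star> capP) \<bullet> (V' \<star> I [False]) \<bullet> (V \<star> I [False])) \<bullet> (I (pos d) \<star> cupP)"
        using True by (simp add: W_def d'[unfolded One_nat_def] cmp_assoc pm ten_I)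
      also have "\<dots> = (I (pos d) \<star> capP) \<bullet> (I (pos d) \<star> cupP)"
        by (simp add: interchange ten_I pm)
      also have "\<dots> = I (pos d)" by (simp add: interchange ten_I)
      finally show ?thesis by simp
    qed
  qed
  show "natural cupM" unfolding natural_def
  proof (intro allI impI conjI)
    fix d assume d: "d < m"
    show "run m d (dom cupM) = run m d (cod cupM)" using d by auto
    show "N d (cod cupM) \<bullet> (I (pos d) \<star> cupM) = N d (dom cupM)"
    proof (cases "d = 0")
      case True
      then show ?thesis using m plus_capP_W
        by (simp add: ten_I cmp_assoc plus_split[OF m, unfolded One_nat_def, symmetric])
    next
      case False
      then have pd: "pos d = pos (d - 1) @ [True]" using plus_split by simp
      have s: "step m d False = d - 1" "step m (d - 1) True = d" using False d by auto
      have "N d (cod cupM) \<bullet> (I (pos d) \<star> cupM) = (I (pos (d - 1)) \<star> capP \<star> I [True]) \<bullet> (I (pos (d - 1)) \<star> I [True] \<star> cupM)"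
        using False d by (simp add: ten_I ten_assoc cmp_assoc pd[symmetric] plus_snoc I_ten_I)
      also have "\<dots> = I (pos d)" using False by (simp add: interchange zigzag ten_I plus_snoc)
      finally show ?thesis by simp
    qed
  qed
qed

text \<open>A normal form is invertible, so absorption determines \<open>f\<close> from its two boundary words. It suffices
  to check the generators; for \<open>V\<close> this is exactly its centrality.\<close>

lemma S_natural: "S f \<Longrightarrow> natural f"
proof (induction rule: S.induct)
  case (S_I v) then show ?case by (auto simp: natural_def ten_I)
next
  case (S_gen f)
  then show ?case using natural_gens natural_inverse invP invM invV by auto
qed (auto intro: natural_cmp natural_ten)

lemma S_unique:
  assumes "S f" "S g" "dom f = dom g" "cod f = cod g" shows "f = g"
proof -
  obtain K where K: "S K" "inverse_arrs (N 0 (cod f)) K" using S_inverse S_N m by blast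
  have *: "h = K \<bullet> N 0 (dom f)" if "S h" "dom h = dom f" "cod h = cod f" for h
  proof -
    have "N 0 (cod f) \<bullet> h = N 0 (dom f)"
      using S_natural[OF that(1)] m that by (auto simp: natural_def)
    then have "K \<bullet> N 0 (dom f) = K \<bullet> (N 0 (cod f) \<bullet> h)" by simp
    also have "\<dots> = h" using K that m by (intro cancel_left) (auto simp: inverse_arrs_def)
    finally show ?thesis by simp
  qed
  show ?thesis using *[of f] *[of g] assms by simp
qed

lemma S_exists: assumes "run m 0 v = run m 0 w" shows "\<exists>f. S f \<and> dom f = v \<and> cod f = w"
proof -
  obtain K where K: "S K" "inverse_arrs (N 0 w) K" using S_inverse S_N m by blast
  have "S (K \<bullet> N 0 v)" using K S_N m assms by (intro S_cmp) (auto simp: inverse_arrs_def)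
  then show ?thesis using K m by (intro exI[of _ "K \<bullet> N 0 v"]) (auto simp: inverse_arrs_def)
qed

lemma S_run: "S f \<Longrightarrow> run m 0 (dom f) = run m 0 (cod f)"
  using S_natural m by (auto simp: natural_def)

end

locale unitary_word_category =
  strict_monoidal arr dom cod "(@)" "[]" I cmp ten
  for arr :: "'c \<Rightarrow> bool" and dom cod :: "'c \<Rightarrow> bool list"
    and I :: "bool list \<Rightarrow> 'c" and cmp :: "'c \<Rightarrow> 'c \<Rightarrow> 'c" (infixr \<open>\<bullet>\<close> 70)
    and ten :: "'c \<Rightarrow> 'c \<Rightarrow> 'c" (infixr \<open>\<star>\<close> 75) +
  fixes n a :: nat and cupP cupM capP capM U U' :: 'c
  assumes n: "n > 0"
    and gtyp [simp]: "dom cupP = []" "cod cupP = [True, False]" "dom cupM = []" "cod cupM = [False, True]"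
      "dom capP = [True, False]" "cod capP = []" "dom capM = [False, True]" "cod capM = []"
      "dom U = pos a" "cod U = neg n" "dom U' = neg n" "cod U' = pos a"
    and ginvP: "inverse_arrs cupP capP" and ginvM: "inverse_arrs cupM capM" and ginvU: "inverse_arrs U U'"
    and gzigzag: "(capP \<star> I [True]) \<bullet> (I [True] \<star> cupM) = I [True]"
    and click: "U = (I (neg n) \<star> capM) \<bullet> (I [False] \<star> U \<star> I [True]) \<bullet> (cupM \<star> I (pos a))"
begin

lemma garrs [simp]: "arr cupP" "arr cupM" "arr capP" "arr capM" "arr U" "arr U'"
  using ginvP ginvM ginvU by (auto simp: inverse_arrs_def)

lemma ginv_simps [simp]: "capP \<bullet> cupP = I []" "cupP \<bullet> capP = I [True, False]"
  "capM \<bullet> cupM = I []" "cupM \<bullet> capM = I [False, True]"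
  using ginvP ginvM by (auto simp: inverse_arrs_def)

lemma swap: "capP \<star> I [True] = I [True] \<star> capM"
proof -
  have "capP \<star> I [True] = (capP \<star> I [True]) \<bullet> (I [True] \<star> cupM) \<bullet> (I [True] \<star> capM)"
    by (simp add: interchange ten_I)
  also have "\<dots> = I [True] \<star> capM"
    by (subst cmp_assoc[symmetric]) (simp_all add: gzigzag)
  finally show ?thesis .
qed

fun nest :: "nat \<Rightarrow> 'c" where
  "nest 0 = I []"
| "nest (Suc k) = capP \<bullet> (I [True] \<star> nest k \<star> I [False])"

fun nest' :: "nat \<Rightarrow> 'c" where
  "nest' 0 = I []"
| "nest' (Suc k) = (I [True] \<star> nest' k \<star> I [False]) \<bullet> cupP"

fun nestM :: "nat \<Rightarrow> 'c" where
  "nestM 0 = I []"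
| "nestM (Suc k) = capM \<bullet> (I [False] \<star> nestM k \<star> I [True])"

fun nestM' :: "nat \<Rightarrow> 'c" where
  "nestM' 0 = I []"
| "nestM' (Suc k) = (I [False] \<star> nestM' k \<star> I [True]) \<bullet> cupM"

lemma snoc: "pos k @ [True] = True # pos k" "neg k @ [False] = False # neg k"
  "pos k @ True # w = True # pos k @ w" "neg k @ False # w = False # neg k @ w"
  by (induction k) auto

lemma nest_typ [simp]: "arr (nest k)" "dom (nest k) = pos k @ neg k" "cod (nest k) = []"
  "arr (nest' k)" "cod (nest' k) = pos k @ neg k" "dom (nest' k) = []"
  "arr (nestM k)" "dom (nestM k) = neg k @ pos k" "cod (nestM k) = []"
  "arr (nestM' k)" "cod (nestM' k) = neg k @ pos k" "dom (nestM' k) = []"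
  by (induction k) (auto simp: snoc)

lemma nest_inverse: "inverse_arrs (nest k) (nest' k)"
  by (induction k) (auto intro!: inverse_cmp inverse_ten ginvP[THEN inverse_sym])

lemma nestM_inverse: "inverse_arrs (nestM k) (nestM' k)"
  by (induction k) (auto intro!: inverse_cmp inverse_ten ginvM[THEN inverse_sym])

lemma nest_inner: "nest (Suc k) = nest k \<bullet> (I (pos k) \<star> capP \<star> I (neg k))"
proof (induction k)
  case 0 then show ?case by (simp add: ten_I)
next
  case (Suc k)
  have "nest (Suc (Suc k)) = capP \<bullet> (I [True] \<star> (nest k \<bullet> (I (pos k) \<star> capP \<star> I (neg k))) \<star> I [False])"
    by (subst nest.simps(2)) (simp only: Suc)
  also have "\<dots> = capP \<bullet> (I [True] \<star> nest k \<star> I [False]) \<bullet> (I [True] \<star> (I (pos k) \<star> capP \<star> I (neg k)) \<star> I [False])"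
    by (simp add: ten_cmp_I I_ten_cmp snoc)
  also have "I [True] \<star> (I (pos k) \<star> capP \<star> I (neg k)) \<star> I [False] = I (pos (Suc k)) \<star> capP \<star> I (neg (Suc k))"
    by (simp add: ten_assoc ten_I I_ten_I snoc)
  finally show ?case by (simp add: cmp_assoc snoc)
qed

lemma nest_move: "nest (Suc k) \<star> I [True] = (I [True] \<star> nest k) \<bullet> (I (pos (Suc k) @ neg k) \<star> capM)"
proof -
  have "nest (Suc k) \<star> I [True] = (capP \<star> I [True]) \<bullet> (I [True] \<star> nest k \<star> I [False] \<star> I [True])"
    by (simp add: ten_cmp_I ten_assoc)
  also have "\<dots> = I [True] \<star> (capM \<bullet> (nest k \<star> I [False, True]))"
    by (simp add: swap ten_I interchange)
  also have "capM \<bullet> (nest k \<star> I [False, True]) = nest k \<bullet> (I (pos k @ neg k) \<star> capM)"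
    using slide[of "nest k" capM "[]" "[False, True]" "pos k @ neg k" "[]"] by simp
  finally show ?thesis by (simp add: I_ten_cmp I_ten_I)
qed

text \<open>The click relation in a form without a strand passing around the box: a positive strand on the
  left of \<open>U\<close> that closes up with the first output equals one on the right that closes up with the last.\<close>

lemma rotate_U: "(capP \<star> I (neg (n - 1))) \<bullet> (I [True] \<star> U) = (I (neg (n - 1)) \<star> capM) \<bullet> (U \<star> I [True])"
proof -
  let ?q = "neg (n - 1)"
  have nn: "neg n = False # ?q" using n by (metis Suc_pred' replicate_Suc)
  have "(capP \<star> I ?q) \<bullet> (I [True] \<star> U) = (capP \<star> I ?q) \<bullet> (I [True] \<star> ((I (neg n) \<star> capM) \<bullet> (I [False] \<star> U \<star> I [True]) \<bullet> (cupM \<star> I (pos a))))"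
    by (rule arg_cong[OF click])
  also have "\<dots> = ((capP \<star> I ?q) \<bullet> (I (True # neg n) \<star> capM)) \<bullet> (I [True, False] \<star> (U \<star> I [True])) \<bullet> (I [True] \<star> cupM \<star> I (pos a))"
    by (simp add: I_ten_cmp snoc nn I_ten_I cmp_assoc ten_assoc)
  also have "(capP \<star> I ?q) \<bullet> (I (True # neg n) \<star> capM) = (I ?q \<star> capM) \<bullet> (capP \<star> I (?q @ [False, True]))"
  proof -
    have "I (True # neg n) = I [True, False] \<star> I ?q" by (simp add: ten_I nn)
    then have "(capP \<star> I ?q) \<bullet> (I (True # neg n) \<star> capM) = capP \<star> (I ?q \<star> capM)"
      by (simp add: ten_assoc interchange)
    also have "\<dots> = (I ?q \<star> capM) \<bullet> (capP \<star> I (?q @ [False, True]))"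
      using slide(2)[of capP "I ?q \<star> capM" "[]"] by simp
    finally show ?thesis .
  qed
  also have "((I ?q \<star> capM) \<bullet> (capP \<star> I (?q @ [False, True]))) \<bullet> (I [True, False] \<star> (U \<star> I [True])) \<bullet> (I [True] \<star> cupM \<star> I (pos a))
     = (I ?q \<star> capM) \<bullet> ((capP \<star> I (neg n @ [True])) \<bullet> (I [True, False] \<star> (U \<star> I [True]))) \<bullet> (I [True] \<star> cupM \<star> I (pos a))"
    by (simp add: cmp_assoc nn snoc)
  also have "(capP \<star> I (neg n @ [True])) \<bullet> (I [True, False] \<star> (U \<star> I [True])) = (U \<star> I [True]) \<bullet> (capP \<star> I (pos a @ [True]))"
    using slide(1)[of capP "U \<star> I [True]" "[]" "pos a @ [True]"] slide(2)[of capP "U \<star> I [True]" "[]"] by simp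
  also have "(I ?q \<star> capM) \<bullet> ((U \<star> I [True]) \<bullet> (capP \<star> I (pos a @ [True]))) \<bullet> (I [True] \<star> cupM \<star> I (pos a))
     = (I ?q \<star> capM) \<bullet> (U \<star> I [True]) \<bullet> ((capP \<star> I [True]) \<bullet> (I [True] \<star> cupM)) \<star> I (pos a)"
    by (simp add: cmp_assoc snoc ten_cmp_I ten_assoc ten_I nn)
  also have "\<dots> = (I ?q \<star> capM) \<bullet> (U \<star> I [True])"
    by (simp add: gzigzag ten_I snoc nn)
  finally show ?thesis .
qed

text \<open>Bending the outputs of \<open>U\<close> down to the left gives a box with \<open>m\<close> positive inputs and no outputs.\<close>

definition V :: 'c where "V = nest n \<bullet> (I (pos n) \<star> U)"
definition V' :: 'c where "V' = (I (pos n) \<star> U') \<bullet> nest' n"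

lemma V_typ: "dom V = pos (n + a)" "cod V = []" "dom V' = []" "cod V' = pos (n + a)"
  by (auto simp: V_def V'_def replicate_add)

text \<open>The strand crosses the nested caps from one side to the other because \<open>U\<close> exchanges its outermost
  arcs. This is where the value \<open>\<lambda> = 1\<close> enters: a general \<open>\<lambda>\<close> would appear as a factor.\<close>

lemma V_central: "V \<star> I [True] = I [True] \<star> V"
proof -
  obtain k where k: "n = Suc k" using n by (cases n) auto
  have "V \<star> I [True] = (nest n \<star> I [True]) \<bullet> (I (pos n) \<star> (U \<star> I [True]))"
    by (simp add: V_def ten_cmp_I ten_assoc)
  also have "\<dots> = (I [True] \<star> nest k) \<bullet> (I (pos n) \<star> ((I (neg k) \<star> capM) \<bullet> (U \<star> I [True])))"
    unfolding k nest_move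
    by (simp add: I_ten_cmp cmp_assoc snoc I_ten_I k del: nest.simps)
  also have "\<dots> = (I [True] \<star> nest k) \<bullet> (I (pos n) \<star> ((capP \<star> I (neg k)) \<bullet> (I [True] \<star> U)))"
    using rotate_U by (simp add: k)
  also have "\<dots> = (I [True] \<star> (nest k \<bullet> (I (pos k) \<star> capP \<star> I (neg k)))) \<bullet> (I (pos n @ [True]) \<star> U)"
    by (simp add: I_ten_cmp cmp_assoc snoc I_ten_I k del: nest.simps)
  also have "\<dots> = I [True] \<star> V"
    unfolding nest_inner[symmetric] V_def by (simp add: I_ten_cmp k snoc I_ten_I del: nest.simps)
  finally show ?thesis .
qed

sublocale word_category arr dom cod I cmp ten "n + a" cupP cupM capP capM V V'
proof unfold_locales
  show "inverse_arrs V V'" unfolding V_def V'_def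
    by (intro inverse_cmp inverse_ten inverse_I ginvU nest_inverse) auto
qed (use n V_typ V_central gzigzag ginvP ginvM in auto)

lemma S_U: "S U" "S U'"
proof -
  have c: "S capP" "S cupP" "S capM" "S cupM" "S V" by (auto intro: S_gen)
  have s: "S (nest k)" "S (nest' k)" "S (nestM k)" "S (nestM' k)" for k
    by (induction k) (use c in \<open>auto intro!: S_I S_cmp S_ten simp: snoc\<close>)
  have "nest' n \<bullet> V = (nest' n \<bullet> nest n) \<bullet> (I (pos n) \<star> U)"
    by (simp add: V_def cmp_assoc)
  also have "\<dots> = I (pos n) \<star> U" using nest_inverse[of n] by (simp add: inverse_arrs_def)
  finally have "S (I (pos n) \<star> U)" using S_cmp[OF s(2) c(5), of n] by (simp add: V_typ)
  then have "S (I (neg n) \<star> I (pos n) \<star> U)" by (rule S_ten[OF S_I])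
  then have 1: "S ((nestM n \<star> I (neg n)) \<bullet> (I (neg n) \<star> I (pos n) \<star> U) \<bullet> (nestM' n \<star> I (pos a)))"
    by (intro S_cmp S_ten[of "nestM n" "I (neg n)"] S_ten[of "nestM' n" "I (pos a)"] S_I s) auto
  have "(nestM n \<star> I (neg n)) \<bullet> (I (neg n) \<star> I (pos n) \<star> U) \<bullet> (nestM' n \<star> I (pos a))
      = (nestM n \<bullet> nestM' n) \<star> U"
    by (simp add: I_ten_I interchange)
  also have "\<dots> = U" using nestM_inverse[of n] by (simp add: inverse_arrs_def)
  finally show U: "S U" using 1 by simp
  then obtain g where g: "S g" "inverse_arrs U g" using S_inverse by blast
  have "g = g \<bullet> (U \<bullet> U')" using g ginvU by (auto simp: inverse_arrs_def)
  also have "\<dots> = U'" using g ginvU by (intro cancel_left) (auto simp: inverse_arrs_def)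
  finally show "S U'" using g by simp
qed

end

section \<open>Orienting strands by complementary projections\<close>

text \<open>The relations between the two projections, the cup and the cap, without reference to diagrams.
  Morphisms that are absorbed by the projections of two words form the category of signed words.\<close>

locale oriented_category =
  strict_monoidal arr dom cod "(+)" "0 :: nat" I cmp ten
  for arr :: "'c \<Rightarrow> bool" and dom cod :: "'c \<Rightarrow> nat"
    and I :: "nat \<Rightarrow> 'c" and cmp :: "'c \<Rightarrow> 'c \<Rightarrow> 'c" (infixr \<open>\<bullet>\<close> 70)
    and ten :: "'c \<Rightarrow> 'c \<Rightarrow> 'c" (infixr \<open>\<star>\<close> 75) +
  fixes n a :: nat and p q cup cap u u' :: 'c
  assumes n: "n > 0" and a: "a > 0"
    and arrs [simp]: "arr p" "arr q" "arr cup" "arr cap" "arr u" "arr u'"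
    and typs [simp]: "dom p = 1" "cod p = 1" "dom q = 1" "cod q = 1" "dom cup = 0" "cod cup = 2"
      "dom cap = 2" "cod cap = 0" "dom u = a" "cod u = n" "dom u' = n" "cod u' = a"
    and zigzag_left: "(cap \<star> I 1) \<bullet> (I 1 \<star> cup) = I 1"
    and zigzag_right: "(I 1 \<star> cap) \<bullet> (cup \<star> I 1) = I 1"
    and q_left: "q = (cap \<star> I 1) \<bullet> (I 1 \<star> p \<star> I 1) \<bullet> (I 1 \<star> cup)"
    and q_right: "q = (I 1 \<star> cap) \<bullet> (I 1 \<star> p \<star> I 1) \<bullet> (cup \<star> I 1)"
    and pp [simp]: "p \<bullet> p = p" and qq [simp]: "q \<bullet> q = q"
    and loops: "cap \<bullet> (p \<star> I 1) \<bullet> cup = I 0" "cap \<bullet> (q \<star> I 1) \<bullet> cup = I 0"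
    and arcs: "(p \<star> I 1) \<bullet> cup \<bullet> cap \<bullet> (p \<star> I 1) = p \<star> q"
      "(q \<star> I 1) \<bullet> cup \<bullet> cap \<bullet> (q \<star> I 1) = q \<star> p"
begin

fun pw :: "bool list \<Rightarrow> 'c" where
  "pw [] = I 0"
| "pw (x # w) = (if x then p else q) \<star> pw w"

lemma pw_typ [simp]: "arr (pw w)" "dom (pw w) = length w" "cod (pw w) = length w"
  by (induction w) auto

lemma pw_idem [simp]: "pw w \<bullet> pw w = pw w"
  by (induction w) (auto simp: interchange)

lemma pw_append: "pw (v @ w) = pw v \<star> pw w"
  by (induction v) (auto simp: ten_assoc)

lemma two_caps: "cap \<bullet> (cap \<star> I 2) = cap \<bullet> (I 2 \<star> cap)"
  using slide(2)[of cap cap 0 2 2 0] slide(1)[of cap cap 0 2 2 0] by simp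

lemma two_cups: "(cup \<star> I 2) \<bullet> cup = (I 2 \<star> cup) \<bullet> cup"
  using slide(2)[of cup cup 2 0 0 2] slide(1)[of cup cup 2 0 0 2] by simp

text \<open>The projection \<open>q\<close> is \<open>p\<close> turned by a half turn, so a projection on one leg of a cap is the
  opposite projection on the other leg.\<close>

lemma cap_slides: "cap \<bullet> (q \<star> I 1) = cap \<bullet> (I 1 \<star> p)" "cap \<bullet> (I 1 \<star> q) = cap \<bullet> (p \<star> I 1)"
proof -
  have "cap \<bullet> (q \<star> I 1) = cap \<bullet> (((cap \<star> I 1) \<bullet> (I 1 \<star> p \<star> I 1) \<bullet> (I 1 \<star> cup)) \<star> I 1)"
    by (rule arg_cong[OF q_left])
  also have "\<dots> = (cap \<bullet> (cap \<star> I 2)) \<bullet> (I 1 \<star> p \<star> I 2) \<bullet> (I 1 \<star> cup \<star> I 1)"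
    by (simp add: ten_cmp_I ten_assoc cmp_assoc ten_I numeral_2_eq_2)
  also have "\<dots> = cap \<bullet> (I 1 \<star> I 1 \<star> cap) \<bullet> (I 1 \<star> p \<star> I 2) \<bullet> (I 1 \<star> cup \<star> I 1)"
    unfolding two_caps by (simp add: cmp_assoc I_ten_I numeral_2_eq_2)
  also have "\<dots> = cap \<bullet> (I 1 \<star> ((I 1 \<star> cap) \<bullet> (p \<star> I 2) \<bullet> (cup \<star> I 1)))"
    by (simp add: interchange)
  also have "(I 1 \<star> cap) \<bullet> (p \<star> I 2) \<bullet> (cup \<star> I 1) = p \<bullet> (I 1 \<star> cap) \<bullet> (cup \<star> I 1)"
    using slide(1)[of p cap 1 2 1 0] slide(2)[of p cap 1 2 1 0] by (simp flip: cmp_assoc)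
  finally show "cap \<bullet> (q \<star> I 1) = cap \<bullet> (I 1 \<star> p)" by (simp add: zigzag_right[unfolded One_nat_def])
  have "cap \<bullet> (I 1 \<star> q) = cap \<bullet> (I 1 \<star> ((I 1 \<star> cap) \<bullet> (I 1 \<star> p \<star> I 1) \<bullet> (cup \<star> I 1)))"
    by (rule arg_cong[OF q_right])
  also have "\<dots> = (cap \<bullet> (I 2 \<star> cap)) \<bullet> (I 2 \<star> p \<star> I 1) \<bullet> (I 1 \<star> cup \<star> I 1)"
    by (simp add: I_ten_cmp I_ten_I cmp_assoc numeral_2_eq_2)
  also have "\<dots> = cap \<bullet> ((cap \<star> I 1) \<star> I 1) \<bullet> ((I 2 \<star> p) \<star> I 1) \<bullet> ((I 1 \<star> cup) \<star> I 1)"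
    unfolding two_caps[symmetric] by (simp add: cmp_assoc ten_assoc ten_I numeral_2_eq_2)
  also have "\<dots> = cap \<bullet> (((cap \<star> I 1) \<bullet> (I 2 \<star> p) \<bullet> (I 1 \<star> cup)) \<star> I 1)"
    by (simp add: ten_cmp_I)
  also have "(cap \<star> I 1) \<bullet> (I 2 \<star> p) \<bullet> (I 1 \<star> cup) = p \<bullet> (cap \<star> I 1) \<bullet> (I 1 \<star> cup)"
    using slide(1)[of cap p 0 1 2 1] slide(2)[of cap p 0 1 2 1] by (simp flip: cmp_assoc)
  finally show "cap \<bullet> (I 1 \<star> q) = cap \<bullet> (p \<star> I 1)" by (simp add: zigzag_left[unfolded One_nat_def])
qed

lemma cup_slides: "(q \<star> I 1) \<bullet> cup = (I 1 \<star> p) \<bullet> cup" "(I 1 \<star> q) \<bullet> cup = (p \<star> I 1) \<bullet> cup"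
proof -
  have "(q \<star> I 1) \<bullet> cup = (((I 1 \<star> cap) \<bullet> (I 1 \<star> p \<star> I 1) \<bullet> (cup \<star> I 1)) \<star> I 1) \<bullet> cup"
    by (rule arg_cong[OF q_right])
  also have "\<dots> = (I 1 \<star> cap \<star> I 1) \<bullet> (I 1 \<star> p \<star> I 2) \<bullet> (cup \<star> I 2) \<bullet> cup"
    by (simp add: ten_cmp_I ten_assoc cmp_assoc ten_I numeral_2_eq_2)
  also have "\<dots> = (I 1 \<star> cap \<star> I 1) \<bullet> (I 1 \<star> p \<star> I 2) \<bullet> (I 1 \<star> I 1 \<star> cup) \<bullet> cup"
    unfolding two_cups by (simp add: I_ten_I numeral_2_eq_2)
  also have "\<dots> = (I 1 \<star> ((cap \<star> I 1) \<bullet> (p \<star> I 2) \<bullet> (I 1 \<star> cup))) \<bullet> cup"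
    by (simp add: interchange flip: cmp_assoc)
  also have "(p \<star> I 2) \<bullet> (I 1 \<star> cup) = (I 1 \<star> cup) \<bullet> p"
    using slide(1)[of p cup 1 0 1 2] slide(2)[of p cup 1 0 1 2] by simp
  finally show "(q \<star> I 1) \<bullet> cup = (I 1 \<star> p) \<bullet> cup"
    by (simp add: zigzag_left[unfolded One_nat_def] flip: cmp_assoc)
  have "(I 1 \<star> q) \<bullet> cup = (I 1 \<star> ((cap \<star> I 1) \<bullet> (I 1 \<star> p \<star> I 1) \<bullet> (I 1 \<star> cup))) \<bullet> cup"
    by (rule arg_cong[OF q_left])
  also have "\<dots> = (I 1 \<star> cap \<star> I 1) \<bullet> (I 2 \<star> p \<star> I 1) \<bullet> (I 2 \<star> cup) \<bullet> cup"
    by (simp add: I_ten_cmp I_ten_I cmp_assoc numeral_2_eq_2)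
  also have "\<dots> = ((I 1 \<star> cap) \<star> I 1) \<bullet> ((I 2 \<star> p) \<star> I 1) \<bullet> ((cup \<star> I 1) \<star> I 1) \<bullet> cup"
    unfolding two_cups[symmetric] by (simp add: ten_assoc ten_I numeral_2_eq_2)
  also have "\<dots> = (((I 1 \<star> cap) \<bullet> (I 2 \<star> p) \<bullet> (cup \<star> I 1)) \<star> I 1) \<bullet> cup"
    by (simp add: interchange flip: cmp_assoc)
  also have "(I 2 \<star> p) \<bullet> (cup \<star> I 1) = (cup \<star> I 1) \<bullet> p"
    using slide(1)[of cup p 2 1 0 1] slide(2)[of cup p 2 1 0 1] by simp
  finally show "(I 1 \<star> q) \<bullet> cup = (p \<star> I 1) \<bullet> cup"
    by (simp add: zigzag_right[unfolded One_nat_def] flip: cmp_assoc)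
qed

lemma oriented_caps: "cap \<bullet> (p \<star> q) = cap \<bullet> (p \<star> I 1)" "cap \<bullet> (q \<star> p) = cap \<bullet> (q \<star> I 1)"
proof -
  have "cap \<bullet> (p \<star> q) = (cap \<bullet> (I 1 \<star> q)) \<bullet> (p \<star> I 1)" by (simp add: cmp_assoc interchange)
  then show "cap \<bullet> (p \<star> q) = cap \<bullet> (p \<star> I 1)" unfolding cap_slides by (simp add: cmp_assoc interchange)
  have "cap \<bullet> (q \<star> p) = (cap \<bullet> (I 1 \<star> p)) \<bullet> (q \<star> I 1)" by (simp add: cmp_assoc interchange)
  then show "cap \<bullet> (q \<star> p) = cap \<bullet> (q \<star> I 1)" unfolding cap_slides(1)[symmetric] by (simp add: cmp_assoc interchange)
qed

lemma oriented_cups: "(p \<star> q) \<bullet> cup = (p \<star> I 1) \<bullet> cup" "(q \<star> p) \<bullet> cup = (q \<star> I 1) \<bullet> cup"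
proof -
  have "(p \<star> q) \<bullet> cup = (p \<star> I 1) \<bullet> ((I 1 \<star> q) \<bullet> cup)" by (simp add: interchange flip: cmp_assoc)
  then show "(p \<star> q) \<bullet> cup = (p \<star> I 1) \<bullet> cup" unfolding cup_slides by (simp add: interchange flip: cmp_assoc)
  have "(q \<star> p) \<bullet> cup = (q \<star> I 1) \<bullet> ((I 1 \<star> p) \<bullet> cup)" by (simp add: interchange flip: cmp_assoc)
  then show "(q \<star> p) \<bullet> cup = (q \<star> I 1) \<bullet> cup" unfolding cup_slides(1)[symmetric] by (simp add: interchange flip: cmp_assoc)
qed

text \<open>A morphism is stored with its two words, since the same element of a box space can
  have several of them (the zero element has all).\<close>

definition word_arr :: "bool list \<times> bool list \<times> 'c \<Rightarrow> bool" where
  "word_arr = (\<lambda>(v, w, f). arr f \<and> dom f = length v \<and> cod f = length w \<and> pw w \<bullet> f = f \<and> f \<bullet> pw v = f)"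
definition word_dom :: "bool list \<times> bool list \<times> 'c \<Rightarrow> bool list" where "word_dom = fst"
definition word_cod :: "bool list \<times> bool list \<times> 'c \<Rightarrow> bool list" where "word_cod = (\<lambda>f. fst (snd f))"
definition word_id :: "bool list \<Rightarrow> bool list \<times> bool list \<times> 'c" where "word_id v = (v, v, pw v)"
definition word_cmp :: "bool list \<times> bool list \<times> 'c \<Rightarrow> bool list \<times> bool list \<times> 'c \<Rightarrow> bool list \<times> bool list \<times> 'c"
  where "word_cmp = (\<lambda>(v', w', g) (v, w, f). (v, w', g \<bullet> f))"
definition word_ten :: "bool list \<times> bool list \<times> 'c \<Rightarrow> bool list \<times> bool list \<times> 'c \<Rightarrow> bool list \<times> bool list \<times> 'c"
  where "word_ten = (\<lambda>(v, w, f) (v', w', g). (v @ v', w @ w', f \<star> g))"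

lemmas wdefs = word_arr_def word_dom_def word_cod_def word_id_def word_cmp_def word_ten_def

sublocale words: strict_monoidal word_arr word_dom word_cod "(@)" "[]" word_id word_cmp word_ten
proof unfold_locales
  fix f g assume "word_arr g" "word_arr f" "word_dom g = word_cod f"
  then show "word_arr (word_cmp g f)" by (auto simp: wdefs cmp_assoc) (metis cmp_assoc pw_typ)
next
  fix f g h assume "word_arr f" "word_arr g" "word_arr h" "word_dom h = word_cod g" "word_dom g = word_cod f"
  then show "word_cmp (word_cmp h g) f = word_cmp h (word_cmp g f)" by (auto simp: wdefs cmp_assoc)
qed (auto simp: wdefs pw_append interchange ten_assoc)

end

locale unitary_oriented_category = oriented_category +
  assumes uu: "u \<bullet> u' = pw (neg n)" "u' \<bullet> u = pw (pos a)"
    and u_word: "u = pw (neg n) \<bullet> u \<bullet> pw (pos a)" and u'_word: "u' = pw (pos a) \<bullet> u' \<bullet> pw (neg n)"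
    and u_click: "u = (I n \<star> cap) \<bullet> (I 1 \<star> u \<star> I 1) \<bullet> (cup \<star> I a)"
begin

lemma u_absorb [simp]: "pw (neg n) \<bullet> u = u" "u \<bullet> pw (pos a) = u" "pw (pos a) \<bullet> u' = u'" "u' \<bullet> pw (neg n) = u'"
proof -
  show "pw (neg n) \<bullet> u = u" by (subst (1 2) u_word) (simp flip: cmp_assoc)
  show "u \<bullet> pw (pos a) = u" by (subst (1 2) u_word) (simp add: cmp_assoc)
  show "pw (pos a) \<bullet> u' = u'" by (subst (1 2) u'_word) (simp flip: cmp_assoc)
  show "u' \<bullet> pw (neg n) = u'" by (subst (1 2) u'_word) (simp add: cmp_assoc)
qed

lemma u_click_oriented:
  "u = (pw (neg n) \<star> (cap \<bullet> (q \<star> p))) \<bullet> (q \<star> u \<star> p) \<bullet> (((q \<star> p) \<bullet> cup) \<star> pw (pos a))"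
proof -
  obtain k where k: "n = Suc k" using n by (cases n) auto
  obtain l where l: "a = Suc l" using a by (cases a) auto
  let ?Q = "pw (neg n)" and ?P = "pw (pos a)"
  have Q: "?Q = q \<star> pw (neg k)" "?Q = pw (neg k) \<star> q" and P: "?P = p \<star> pw (pos l)" "?P = pw (pos l) \<star> p"
    using pw_append[of "neg k" "[False]"] pw_append[of "pos l" "[True]"]
    by (simp_all add: k l replicate_append_same)
  have QQ: "?Q \<star> q = q \<star> ?Q"
    by (subst Q(1)) (simp only: ten_assoc arrs pw_typ Q(2)[symmetric])
  have 1: "(?Q \<star> cap) \<bullet> (I 1 \<star> ?Q \<star> I 1) = (?Q \<star> (cap \<bullet> (q \<star> p)))"
  proof -
    have "(?Q \<star> cap) \<bullet> (I 1 \<star> ?Q \<star> I 1) = (q \<star> pw (neg k) \<star> cap) \<bullet> (I 1 \<star> pw (neg k) \<star> (q \<star> I 1))"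
      by (subst Q(1), subst Q(2)) (simp only: ten_assoc arrs pw_typ arr_I arr_ten)
    also have "\<dots> = q \<star> pw (neg k) \<star> (cap \<bullet> (q \<star> I 1))" by (simp add: interchange)
    finally show ?thesis unfolding oriented_caps by (simp add: Q(1) ten_assoc)
  qed
  have 2: "(I 1 \<star> ?P \<star> I 1) \<bullet> (cup \<star> ?P) = (((q \<star> p) \<bullet> cup) \<star> ?P)"
  proof -
    have "(I 1 \<star> ?P \<star> I 1) \<bullet> (cup \<star> ?P) = ((I 1 \<star> p) \<star> (pw (pos l) \<star> I 1)) \<bullet> (cup \<star> pw (pos l) \<star> p)"
      by (subst P(1), subst P(2)) (simp only: ten_assoc arrs pw_typ arr_I arr_ten)
    also have "\<dots> = ((I 1 \<star> p) \<bullet> cup) \<star> pw (pos l) \<star> p" by (simp add: interchange)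
    finally show ?thesis unfolding oriented_cups cup_slides by (simp add: P(2))
  qed
  have "u = ?Q \<bullet> ((I n \<star> cap) \<bullet> (I 1 \<star> u \<star> I 1) \<bullet> (cup \<star> I a)) \<bullet> ?P"
    unfolding u_click[symmetric] by simp
  also have "\<dots> = (?Q \<bullet> (I n \<star> cap)) \<bullet> (I 1 \<star> u \<star> I 1) \<bullet> ((cup \<star> I a) \<bullet> ?P)"
    by (simp add: cmp_assoc)
  also have "?Q \<bullet> (I n \<star> cap) = ?Q \<star> cap" using slide(1)[of ?Q cap n 2 n 0] by simp
  also have "(cup \<star> I a) \<bullet> ?P = cup \<star> ?P" using slide(1)[of cup ?P 2 a 0 a] by simp
  also have "I 1 \<star> u \<star> I 1 = (I 1 \<star> ?Q \<star> I 1) \<bullet> (I 1 \<star> u \<star> I 1) \<bullet> (I 1 \<star> ?P \<star> I 1)"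
    by (simp add: interchange)
  also have "(?Q \<star> cap) \<bullet> ((I 1 \<star> ?Q \<star> I 1) \<bullet> (I 1 \<star> u \<star> I 1) \<bullet> (I 1 \<star> ?P \<star> I 1)) \<bullet> (cup \<star> ?P)
    = ((?Q \<star> cap) \<bullet> (I 1 \<star> ?Q \<star> I 1)) \<bullet> (I 1 \<star> u \<star> I 1) \<bullet> ((I 1 \<star> ?P \<star> I 1) \<bullet> (cup \<star> ?P))"
    by (simp add: cmp_assoc)
  also have "\<dots> = (?Q \<star> (cap \<bullet> (q \<star> p))) \<bullet> (I 1 \<star> u \<star> I 1) \<bullet> (((q \<star> p) \<bullet> cup) \<star> ?P)"
    unfolding 1 2 ..
  also have "?Q \<star> (cap \<bullet> (q \<star> p)) = (?Q \<star> (cap \<bullet> (q \<star> p))) \<bullet> (q \<star> ?Q \<star> p)"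
  proof -
    have "q \<star> ?Q \<star> p = ?Q \<star> (q \<star> p)" using QQ by (simp add: ten_assoc[symmetric])
    then show ?thesis by (simp add: interchange cmp_assoc)
  qed
  also have "((?Q \<star> (cap \<bullet> (q \<star> p))) \<bullet> (q \<star> ?Q \<star> p)) \<bullet> (I 1 \<star> u \<star> I 1) \<bullet> (((q \<star> p) \<bullet> cup) \<star> ?P)
     = (?Q \<star> (cap \<bullet> (q \<star> p))) \<bullet> ((q \<star> ?Q \<star> p) \<bullet> (I 1 \<star> u \<star> I 1)) \<bullet> (((q \<star> p) \<bullet> cup) \<star> ?P)"
    by (simp add: cmp_assoc)
  also have "(q \<star> ?Q \<star> p) \<bullet> (I 1 \<star> u \<star> I 1) = q \<star> u \<star> p" by (simp add: interchange)
  finally show ?thesis .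
qed

sublocale W: unitary_word_category word_arr word_dom word_cod word_id word_cmp word_ten n a
  "([], [True, False], (p \<star> q) \<bullet> cup)" "([], [False, True], (q \<star> p) \<bullet> cup)"
  "([True, False], [], cap \<bullet> (p \<star> q))" "([False, True], [], cap \<bullet> (q \<star> p))"
  "(pos a, neg n, u)" "(neg n, pos a, u')"
proof unfold_locales
  have pq: "(cap \<bullet> (p \<star> q)) \<bullet> ((p \<star> q) \<bullet> cup) = I 0" "((p \<star> q) \<bullet> cup) \<bullet> (cap \<bullet> (p \<star> q)) = p \<star> q"
     "(cap \<bullet> (q \<star> p)) \<bullet> ((q \<star> p) \<bullet> cup) = I 0" "((q \<star> p) \<bullet> cup) \<bullet> (cap \<bullet> (q \<star> p)) = q \<star> p"
    unfolding oriented_caps oriented_cups using loops arcs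
    by (simp_all add: cmp_assoc cmp_assoc[symmetric, of "p \<star> I 1" "p \<star> I 1", unfolded One_nat_def]
      cmp_assoc[symmetric, of "q \<star> I 1" "q \<star> I 1", unfolded One_nat_def] interchange)
  show "words.inverse_arrs ([], [True, False], (p \<star> q) \<bullet> cup) ([True, False], [], cap \<bullet> (p \<star> q))"
    "words.inverse_arrs ([], [False, True], (q \<star> p) \<bullet> cup) ([False, True], [], cap \<bullet> (q \<star> p))"
    unfolding words.inverse_arrs_def using pq
    by (simp_all add: wdefs numeral_2_eq_2 interchange cmp_assoc interchange flip: cmp_assoc[of "p \<star> q" "p \<star> q"] cmp_assoc[of "q \<star> p" "q \<star> p"])
  show "words.inverse_arrs (pos a, neg n, u) (neg n, pos a, u')"
    unfolding words.inverse_arrs_def by (simp add: wdefs uu)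
  show "word_cmp (word_ten ([True, False], [], cap \<bullet> (p \<star> q)) (word_id [True])) (word_ten (word_id [True]) ([], [False, True], (q \<star> p) \<bullet> cup)) = word_id [True]"
  proof -
    have c: "(cap \<star> I 1) \<bullet> (I 2 \<star> p) = p \<bullet> (cap \<star> I 1)" "(p \<star> I 2) \<bullet> (I 1 \<star> cup) = (I 1 \<star> cup) \<bullet> p"
      using slide(1)[of cap p 0 1 2 1] slide(2)[of cap p 0 1 2 1] slide(1)[of p cup 1 0 1 2] slide(2)[of p cup 1 0 1 2]
      by simp_all
    have e: "p \<star> I 1 \<star> p = (I 2 \<star> p) \<bullet> (p \<star> I 2)"
      using ten_assoc[of p "I 1" p] ten_assoc[of "I 1" "I 1" p] interchange[of "I 1" "I 1 \<star> p" p "I 1 \<star> I 1"]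
      by (simp add: ten_I numeral_2_eq_2 interchange)
    have "((cap \<bullet> (p \<star> q)) \<star> p) \<bullet> (p \<star> ((q \<star> p) \<bullet> cup))
      = ((cap \<star> I 1) \<bullet> (p \<star> I 1 \<star> p)) \<bullet> ((p \<star> I 1 \<star> p) \<bullet> (I 1 \<star> cup))"
    proof -
      have "(cap \<bullet> (p \<star> I 1)) \<star> p = (cap \<star> I 1) \<bullet> ((p \<star> I 1) \<star> p)"
        "p \<star> ((I 1 \<star> p) \<bullet> cup) = (p \<star> I 1 \<star> p) \<bullet> (I 1 \<star> cup)"
        by (simp_all add: interchange)
      then show ?thesis unfolding oriented_caps oriented_cups cup_slides
        by (simp add: ten_assoc)
    qed
    also have "\<dots> = (cap \<star> I 1) \<bullet> ((p \<star> I 1 \<star> p) \<bullet> (p \<star> I 1 \<star> p)) \<bullet> (I 1 \<star> cup)"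
      by (simp add: cmp_assoc)
    also have "(p \<star> I 1 \<star> p) \<bullet> (p \<star> I 1 \<star> p) = (I 2 \<star> p) \<bullet> (p \<star> I 2)"
      unfolding e[symmetric] by (simp add: interchange)
    also have "(cap \<star> I 1) \<bullet> ((I 2 \<star> p) \<bullet> (p \<star> I 2)) \<bullet> (I 1 \<star> cup)
      = ((cap \<star> I 1) \<bullet> (I 2 \<star> p)) \<bullet> ((p \<star> I 2) \<bullet> (I 1 \<star> cup))"
      by (simp add: cmp_assoc)
    also have "\<dots> = p \<bullet> ((cap \<star> I 1) \<bullet> (I 1 \<star> cup)) \<bullet> p"
      unfolding c by (simp add: cmp_assoc)
    also have "\<dots> = p" unfolding zigzag_left by simp
    finally show ?thesis by (simp add: wdefs)
  qed
  show "(pos a, neg n, u) =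
    word_cmp (word_ten (word_id (neg n)) ([False, True], [], cap \<bullet> (q \<star> p)))
      (word_cmp (word_ten (word_id [False]) (word_ten (pos a, neg n, u) (word_id [True])))
        (word_ten ([], [False, True], (q \<star> p) \<bullet> cup) (word_id (pos a))))"
    using u_click_oriented by (simp add: wdefs replicate_append_same)
qed (use n in \<open>auto simp: wdefs\<close>)

end

section \<open>The relations hold in the representation\<close>

abbreviation fp :: "nat \<Rightarrow> nat \<Rightarrow> nat \<Rightarrow> gen lin set" where "fp m \<equiv> free_planar (gens m)"
abbreviation J :: "nat \<Rightarrow> nat \<Rightarrow> nat \<Rightarrow> gen lin set" where "J m \<equiv> generated_ideal (gens m) (rels m 1)"

lemma boxes_gens: "set (box_list (dpow P_diag k)) \<subseteq> gens m" "set (box_list (dpow Q_diag k)) \<subseteq> gens m"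
  using dpow_points(4)[of P_diag k] dpow_points(4)[of Q_diag k] by (auto simp: gens_def)

lemma ker_diff: assumes "well_formed d" "well_formed e" "bot_points d = b" "bot_points e = b" "top_points d = t" "top_points e = t"
    "set (box_list d) \<subseteq> gens m" "set (box_list e) \<subseteq> gens m" "val m d = val m e"
  shows "lin_of d - lin_of e \<in> ker m b t"
  using assms by (auto simp: ker_def lval_diff lval_lin_of fun_eq_iff intro!: fp_diff fp_lin_of)

lemma wid_1: "wid 1 w v = wunit [True] [True] w v + wunit [False] [False] w v"
  by (auto simp: wid_def wunit_def length_1)

locale planar_m = fixes m :: nat assumes m: "2 \<le> m"
begin

lemma na: "0 < n_of m" "0 < a_of m" "n_of m + a_of m = m" using m by (auto simp: n_of_def a_of_def)

text \<open>Each relation is a computation with matrix units of size at most four, except for those on \<open>U\<close>.\<close>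

lemma rels_ker: assumes "(b, t, r) \<in> rels m 1" shows "r \<in> ker m b t"
proof -
  let ?a = "a_of m" and ?n = "n_of m"
  define Ud where "Ud = Box Gen_U ?a ?n"
  define Sd where "Sd = Box Gen_Ustar ?n ?a"
  have pts [simp]: "bot_points Ud = ?a" "top_points Ud = ?n" "bot_points Sd = ?n" "top_points Sd = ?a"
    "well_formed Ud" "well_formed Sd" "set (box_list Ud) \<subseteq> gens m" "set (box_list Sd) \<subseteq> gens m"
    by (auto simp: Ud_def Sd_def gens_def)
  have val [simp]: "val m Ud = wunit (neg ?n) (pos ?a)" "val m Sd = wunit (pos ?a) (neg ?n)"
    by (simp_all add: Ud_def Sd_def gval_def)
  have valp [simp]: "val m (dpow P_diag k) = wunit (pos k) (pos k)" "val m (dpow Q_diag k) = wunit (neg k) (neg k)" for k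
    using val_dpow[of m P_diag True k] val_dpow[of m Q_diag False k] by simp_all
  have U: "U m = lin_of Ud" "Ustar m = lin_of Sd" by (simp_all add: U_def Ustar_def Ud_def Sd_def)
  have PG [simp]: "(Gen_P, Suc 0, Suc 0) \<in> gens m" by (simp add: gens_def)
  note d = P1_diag Q1_diag U lin_of_stack lin_of_juxt lin_power_diag click_def
  have X: "lin_of (Strands 1) - (P1 + Q1) \<in> ker m 1 1"
    unfolding d ker_def by (auto simp: lval_diff lval_add lval_lin_of wid_1[unfolded One_nat_def] fun_eq_iff intro!: fp_diff fp_add fp_lin_of)
  have Z: "lin_of d \<in> ker m 1 1" if "d = Stack P_diag Q_diag \<or> d = Stack Q_diag P_diag" for d
    using that unfolding ker_def by (auto simp: lval_lin_of wunit_comp intro!: fp_lin_of)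
  have loops: "lin_of (Stack Cap (Stack (Juxt P_diag (Strands 1)) Cup)) - lin_of (Strands 0) \<in> ker m 0 0"
    "lin_of (Stack Cap (Stack (Juxt Q_diag (Strands 1)) Cup)) - lin_of (Strands 0) \<in> ker m 0 0"
    by (rule ker_diff; (simp only: val_loop val.simps(1) simp_thms)?; simp)+
  have arcs: "lin_of (Stack (Juxt P_diag (Strands 1)) (Stack Cup (Stack Cap (Juxt P_diag (Strands 1))))) - lin_of (Juxt P_diag Q_diag) \<in> ker m 2 2"
    "lin_of (Stack (Juxt Q_diag (Strands 1)) (Stack Cup (Stack Cap (Juxt Q_diag (Strands 1))))) - lin_of (Juxt Q_diag P_diag) \<in> ker m 2 2"
    by (rule ker_diff; (simp only: val_arcs)?; simp add: wunit_ten)+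
  have words: "lin_of Ud - lin_of (Stack (dpow Q_diag ?n) (Stack Ud (dpow P_diag ?a))) \<in> ker m ?a ?n"
    "lin_of Sd - lin_of (Stack (dpow P_diag ?a) (Stack Sd (dpow Q_diag ?n))) \<in> ker m ?n ?a"
    by (rule ker_diff; simp add: wunit_comp boxes_gens)+
  have inv: "lin_of (Stack Ud Sd) - lin_of (dpow Q_diag ?n) \<in> ker m ?n ?n"
    "lin_of (Stack Sd Ud) - lin_of (dpow P_diag ?a) \<in> ker m ?a ?a"
    by (rule ker_diff; simp add: wunit_comp boxes_gens)+
  have clicks: "lin_of (Stack (Juxt (Strands ?n) Cap) (Stack (Juxt (Strands 1) (Juxt Ud (Strands 1))) (Juxt Cup (Strands ?a)))) - lin_of Ud \<in> ker m ?a ?n"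
    "lin_of (Stack (Juxt (Strands ?a) Cap) (Stack (Juxt (Strands 1) (Juxt Sd (Strands 1))) (Juxt Cup (Strands ?n)))) - lin_of Sd \<in> ker m ?n ?a"
    by (rule ker_diff; (rule val_click[where x = False] val_click[where x = True])?; simp add: na)+
  have "rels m 1 \<subseteq> {(b, t, r). r \<in> ker m b t}"
    unfolding rels_def Let_def d scale_1
    using loops arcs words inv clicks X[unfolded d] Z by (simp only: insert_subset mem_Collect_eq case_prod_conv simp_thms empty_subsetI)
  then show ?thesis using assms by blast
qed

end

section \<open>The strict monoidal category of box spaces\<close>

context planar_m begin

lemma ideal_props:
  shows "J m b t \<subseteq> ker m b t" and "J m b t \<subseteq> fp m b t" and J_0: "0 \<in> J m b t"
    and J_add: "x \<in> J m b t \<Longrightarrow> y \<in> J m b t \<Longrightarrow> x + y \<in> J m b t"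
    and J_scale: "x \<in> J m b t \<Longrightarrow> lin_scale c x \<in> J m b t"
proof -
  have "\<forall>(b', t', r) \<in> rels m 1. r \<in> ker m b' t'" using rels_ker by auto
  then show k: "J m b t \<subseteq> ker m b t" using planar_ideal_ker[of m] unfolding generated_ideal_def by blast
  then show "J m b t \<subseteq> fp m b t" by (auto simp: ker_def)
qed (auto simp: generated_ideal_def planar_ideal_def)

lemma J_rel: "(b, t, r) \<in> rels m 1 \<Longrightarrow> r \<in> J m b t" by (auto simp: generated_ideal_def)

lemma J_fp: "x \<in> J m b t \<Longrightarrow> x \<in> fp m b t" using ideal_props(2) by blast

lemma J_diff: "x \<in> J m b t \<Longrightarrow> y \<in> J m b t \<Longrightarrow> x - y \<in> J m b t"
  using J_add[of x b t "lin_scale (-1) y"] J_scale[of y b t "-1"] by (simp add: scale_minus_1)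

lemma J_sum: "(\<And>i. i \<in> A \<Longrightarrow> h i \<in> J m b t) \<Longrightarrow> sum h A \<in> J m b t"
  by (induction A rule: infinite_finite_induct) (auto intro: J_add J_0)

lemma J_action:
  assumes "well_formed d" "distinct (map fst (box_list d))"
    "\<forall>(h, b, t) \<in> set (box_list d). \<sigma> h \<in> fp m b t" "\<exists>(h, b, t) \<in> set (box_list d). \<sigma> h \<in> J m b t"
  shows "tangle_action \<sigma> d \<in> J m (bot_points d) (top_points d)"
proof -
  have "tangle_action \<sigma> d \<in> K (bot_points d) (top_points d)"
    if K: "planar_ideal (gens m) K" "\<forall>(b', t', r) \<in> rels m 1. r \<in> K b' t'" for K
  proof -
    have "\<exists>(h, b, t) \<in> set (box_list d). \<sigma> h \<in> K b t" using assms(4) K unfolding generated_ideal_def by blast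
    then show ?thesis using K(1) assms(1-3) unfolding planar_ideal_def by blast
  qed
  then show ?thesis unfolding generated_ideal_def by blast
qed

lemma J_stack: assumes "x \<in> fp m k t" "y \<in> fp m b k" "x \<in> J m k t \<or> y \<in> J m b k" shows "x \<circ>\<^sub>t y \<in> J m b t"
  using J_action[of "Stack (Box 0 k t) (Box 1 b k)" "\<lambda>h. if h = 0 then x else y"] assms by auto

lemma J_juxt: assumes "x \<in> fp m b t" "y \<in> fp m b' t'" "x \<in> J m b t \<or> y \<in> J m b' t'" shows "x \<otimes>\<^sub>t y \<in> J m (b + b') (t + t')"
  using J_action[of "Juxt (Box 0 b t) (Box 1 b' t')" "\<lambda>h. if h = 0 then x else y"] assms by auto

abbreviation cl :: "nat \<Rightarrow> nat \<Rightarrow> gen lin \<Rightarrow> gen lin set" where "cl b t \<equiv> pcls m 1 b t"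

lemma cl_def: "cl b t x = {y \<in> fp m b t. y - x \<in> J m b t}"
  by (simp add: pcls_def planar_class_def)

lemma pspace_cl: "pspace m 1 b t = cl b t ` fp m b t"
  by (simp add: pspace_def planar_algebra_def pcls_def)

lemma cl_pspace [simp]: "x \<in> fp m b t \<Longrightarrow> cl b t x \<in> pspace m 1 b t" by (simp add: pspace_cl)

lemma cl_self: "x \<in> fp m b t \<Longrightarrow> x \<in> cl b t x" by (simp add: cl_def J_0)

lemma cl_cong: assumes "x - y \<in> J m b t" shows "cl b t x = cl b t y"
proof -
  have "z - x \<in> J m b t \<longleftrightarrow> z - y \<in> J m b t" for z
    using J_add[OF _ assms, of "z - x"] J_diff[OF _ assms, of "z - y"] by auto
  then show ?thesis by (simp add: cl_def)
qed

lemma cl_eq: assumes "x \<in> fp m b t" shows "cl b t x = cl b t y \<longleftrightarrow> x - y \<in> J m b t"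
proof
  assume "cl b t x = cl b t y"
  then have "x \<in> cl b t y" using cl_self[OF assms] by simp
  then show "x - y \<in> J m b t" by (simp add: cl_def)
qed (rule cl_cong)

lemma cl_op:
  assumes "x \<in> fp m b t" "y \<in> fp m b' t'"
    "\<And>x' y'. x' \<in> fp m b t \<Longrightarrow> y' \<in> fp m b' t' \<Longrightarrow> x' - x \<in> J m b t \<Longrightarrow> y' - y \<in> J m b' t' \<Longrightarrow> h x' y' - h x y \<in> J m c s"
  shows "(\<Union>x' \<in> cl b t x. \<Union>y' \<in> cl b' t' y. cl c s (h x' y')) = cl c s (h x y)"
proof -
  have "cl c s (h x' y') = cl c s (h x y)" if "x' \<in> cl b t x" "y' \<in> cl b' t' y" for x' y'
    using that assms(3) by (intro cl_cong) (simp add: cl_def)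
  then have "(\<Union>x' \<in> cl b t x. \<Union>y' \<in> cl b' t' y. cl c s (h x' y')) = (\<Union>x' \<in> cl b t x. \<Union>y' \<in> cl b' t' y. cl c s (h x y))"
    by (intro SUP_cong[OF HOL.refl])
  moreover have "cl b t x \<noteq> {}" "cl b' t' y \<noteq> {}" using cl_self[OF assms(1)] cl_self[OF assms(2)] by blast+
  ultimately show ?thesis by (simp only: UN_constant if_False)
qed

lemma pstack_cl: assumes "x \<in> fp m k t" "y \<in> fp m b k"
  shows "pstack m 1 b t (cl k t x) (cl b k y) = cl b t (x \<circ>\<^sub>t y)"
  unfolding pstack_def
proof (rule cl_op[OF assms])
  fix x' y' assume *: "x' \<in> fp m k t" "y' \<in> fp m b k" "x' - x \<in> J m k t" "y' - y \<in> J m b k"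
  have "(x' - x) \<circ>\<^sub>t y' + x \<circ>\<^sub>t (y' - y) \<in> J m b t"
    using * assms J_fp by (intro J_add J_stack) auto
  then show "x' \<circ>\<^sub>t y' - x \<circ>\<^sub>t y \<in> J m b t" by (simp add: stack_diff)
qed

lemma pjuxt_cl: assumes "x \<in> fp m b t" "y \<in> fp m b' t'"
  shows "pjuxt m 1 (b + b') (t + t') (cl b t x) (cl b' t' y) = cl (b + b') (t + t') (x \<otimes>\<^sub>t y)"
  unfolding pjuxt_def
proof (rule cl_op[OF assms])
  fix x' y' assume *: "x' \<in> fp m b t" "y' \<in> fp m b' t'" "x' - x \<in> J m b t" "y' - y \<in> J m b' t'"
  have "(x' - x) \<otimes>\<^sub>t y' + x \<otimes>\<^sub>t (y' - y) \<in> J m (b + b') (t + t')"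
    using * assms J_fp by (intro J_add J_juxt) auto
  then show "x' \<otimes>\<^sub>t y' - x \<otimes>\<^sub>t y \<in> J m (b + b') (t + t')" by (simp add: juxt_diff)
qed

lemma padd_cl: assumes "x \<in> fp m b t" "y \<in> fp m b t"
  shows "padd m 1 b t (cl b t x) (cl b t y) = cl b t (x + y)"
  unfolding padd_def
proof (rule cl_op[OF assms])
  fix x' y' assume "x' - x \<in> J m b t" "y' - y \<in> J m b t"
  then have "(x' - x) + (y' - y) \<in> J m b t" by (rule J_add)
  then show "x' + y' - (x + y) \<in> J m b t" by (simp add: algebra_simps)
qed

lemma pscale_cl: assumes "x \<in> fp m b t"
  shows "pscale m 1 b t c (cl b t x) = cl b t (lin_scale c x)"
proof -
  have "cl b t (lin_scale c x') = cl b t (lin_scale c x)" if "x' \<in> cl b t x" for x'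
    using that J_scale[of "x' - x" b t c] by (intro cl_cong) (simp add: cl_def scale_diff)
  then have "pscale m 1 b t c (cl b t x) = (\<Union>x' \<in> cl b t x. cl b t (lin_scale c x))"
    unfolding pscale_def by (intro SUP_cong[OF HOL.refl])
  moreover have "cl b t x \<noteq> {}" using cl_self[OF assms(1)] by blast
  ultimately show ?thesis by (simp only: UN_constant if_False)
qed

text \<open>The box spaces form a strict monoidal category whose objects are the numbers of strands; a class is
  stored with its numbers of bottom and top points.\<close>

definition b_arr :: "nat \<times> nat \<times> gen lin set \<Rightarrow> bool" where "b_arr = (\<lambda>(b, t, f). f \<in> pspace m 1 b t)"
definition b_dom :: "nat \<times> nat \<times> gen lin set \<Rightarrow> nat" where "b_dom = fst"
definition b_cod :: "nat \<times> nat \<times> gen lin set \<Rightarrow> nat" where "b_cod = (\<lambda>f. fst (snd f))"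
definition el :: "nat \<Rightarrow> nat \<Rightarrow> gen lin \<Rightarrow> nat \<times> nat \<times> gen lin set" where "el b t x = (b, t, cl b t x)"
definition b_id :: "nat \<Rightarrow> nat \<times> nat \<times> gen lin set" where "b_id k = el k k (lin_of (Strands k))"
definition b_cmp :: "nat \<times> nat \<times> gen lin set \<Rightarrow> nat \<times> nat \<times> gen lin set \<Rightarrow> nat \<times> nat \<times> gen lin set"
  where "b_cmp = (\<lambda>(k', t, g) (b, k, f). (b, t, pstack m 1 b t g f))"
definition b_ten :: "nat \<times> nat \<times> gen lin set \<Rightarrow> nat \<times> nat \<times> gen lin set \<Rightarrow> nat \<times> nat \<times> gen lin set"
  where "b_ten = (\<lambda>(b, t, f) (b', t', g). (b + b', t + t', pjuxt m 1 (b + b') (t + t') f g))"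

lemma el_simps [simp]: "b_dom (el b t x) = b" "b_cod (el b t x) = t" "x \<in> fp m b t \<Longrightarrow> b_arr (el b t x)"
  by (auto simp: el_def b_dom_def b_cod_def b_arr_def)

lemma el_cmp: "x \<in> fp m k t \<Longrightarrow> y \<in> fp m b k \<Longrightarrow> b_cmp (el k t x) (el b k y) = el b t (x \<circ>\<^sub>t y)"
  by (simp add: b_cmp_def el_def pstack_cl)
lemma el_ten: "x \<in> fp m b t \<Longrightarrow> y \<in> fp m b' t' \<Longrightarrow> b_ten (el b t x) (el b' t' y) = el (b + b') (t + t') (x \<otimes>\<^sub>t y)"
  by (simp add: b_ten_def el_def pjuxt_cl)

lemma b_arrE: assumes "b_arr f" obtains x where "x \<in> fp m (b_dom f) (b_cod f)" "f = el (b_dom f) (b_cod f) x"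
  using assms by (auto simp: b_arr_def pspace_cl el_def b_dom_def b_cod_def)

lemma el_eq: "x \<in> fp m b t \<Longrightarrow> el b t x = el b t y \<longleftrightarrow> x - y \<in> J m b t"
  by (simp add: el_def cl_eq)

lemma fp_strands [simp]: "lin_of (Strands k) \<in> fp m k k" by (rule fp_lin_of) auto

sublocale B: strict_monoidal b_arr b_dom b_cod "(+)" 0 b_id b_cmp b_ten
proof unfold_locales
  show "b_dom (b_cmp g f) = b_dom f" "b_cod (b_cmp g f) = b_cod g" "b_dom (b_ten f g) = b_dom f + b_dom g"
    "b_cod (b_ten f g) = b_cod f + b_cod g" for f g
    by (auto simp: b_cmp_def b_ten_def b_dom_def b_cod_def split: prod.splits)
  show "b_arr (b_cmp g f)" if h: "b_arr g" "b_arr f" "b_dom g = b_cod f" for f g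
  proof -
    obtain x y where e: "x \<in> fp m (b_dom f) (b_cod f)" "f = el (b_dom f) (b_cod f) x"
      "y \<in> fp m (b_dom g) (b_cod g)" "g = el (b_dom g) (b_cod g) y"
      using h(1,2) by (metis b_arrE)
    show ?thesis using e(1,3) h(3) by (subst e(2), subst e(4)) (simp add: el_cmp fp_stack)
  qed
  show "b_arr (b_ten f g)" if h: "b_arr f" "b_arr g" for f g
  proof -
    obtain x y where e: "x \<in> fp m (b_dom f) (b_cod f)" "f = el (b_dom f) (b_cod f) x"
      "y \<in> fp m (b_dom g) (b_cod g)" "g = el (b_dom g) (b_cod g) y"
      using h by (metis b_arrE)
    show ?thesis using e(1,3) by (subst e(2), subst e(4)) (simp add: el_ten fp_juxt)
  qed
  show "b_cmp (b_cmp h g) f = b_cmp h (b_cmp g f)"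
    if h: "b_arr h" "b_arr g" "b_arr f" "b_dom h = b_cod g" "b_dom g = b_cod f" for f g h
  proof -
    obtain x y z where e: "x \<in> fp m (b_dom h) (b_cod h)" "h = el (b_dom h) (b_cod h) x"
      "y \<in> fp m (b_dom g) (b_cod g)" "g = el (b_dom g) (b_cod g) y"
      "z \<in> fp m (b_dom f) (b_cod f)" "f = el (b_dom f) (b_cod f) z"
      using h(1-3) by (metis b_arrE)
    show ?thesis using e(1,3,5) h(4,5) by (subst (1 2) e(2), subst (1 2) e(4), subst (1 2) e(6))
      (simp add: el_cmp fp_stack lin_stack_assoc)
  qed
  show "b_cmp (b_id x) f = f" if h: "b_arr f" "b_cod f = x" for f x
  proof -
    obtain y where e: "y \<in> fp m (b_dom f) (b_cod f)" "f = el (b_dom f) (b_cod f) y" using h(1) by (rule b_arrE)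
    show ?thesis using e(1) h(2) by (subst (1 2) e(2)) (simp add: b_id_def el_cmp lin_strands)
  qed
  show "b_cmp f (b_id x) = f" if h: "b_arr f" "b_dom f = x" for f x
  proof -
    obtain y where e: "y \<in> fp m (b_dom f) (b_cod f)" "f = el (b_dom f) (b_cod f) y" using h(1) by (rule b_arrE)
    show ?thesis using e(1) h(2) by (subst (1 2) e(2)) (simp add: b_id_def el_cmp lin_strands)
  qed
  show "b_ten (b_ten f g) h = b_ten f (b_ten g h)" if h: "b_arr f" "b_arr g" "b_arr h" for f g h
  proof -
    obtain x y z where e: "x \<in> fp m (b_dom h) (b_cod h)" "h = el (b_dom h) (b_cod h) x"
      "y \<in> fp m (b_dom g) (b_cod g)" "g = el (b_dom g) (b_cod g) y"
      "z \<in> fp m (b_dom f) (b_cod f)" "f = el (b_dom f) (b_cod f) z"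
      using h(1-3) by (metis b_arrE)
    show ?thesis using e(1,3,5) by (subst (1 2) e(2), subst (1 2) e(4), subst (1 2) e(6))
      (simp add: el_ten fp_juxt lin_juxt_assoc add.assoc)
  qed
  show "b_ten (b_id x) (b_id y) = b_id (x + y)" for x y
    by (simp add: b_id_def el_ten lin_strands_add)
  show "b_ten (b_id 0) f = f" "b_ten f (b_id 0) = f" if h: "b_arr f" for f
  proof -
    obtain x where e: "x \<in> fp m (b_dom f) (b_cod f)" "f = el (b_dom f) (b_cod f) x" using h by (rule b_arrE)
    show "b_ten (b_id 0) f = f" using e(1) by (subst (1 2) e(2)) (simp add: b_id_def el_ten lin_juxt_empty)
    show "b_ten f (b_id 0) = f" using e(1) by (subst (1 2) e(2)) (simp add: b_id_def el_ten lin_juxt_empty)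
  qed
  show "b_cmp (b_ten f g) (b_ten f' g') = b_ten (b_cmp f f') (b_cmp g g')"
    if h: "b_arr f" "b_arr g" "b_arr f'" "b_arr g'" "b_dom f = b_cod f'" "b_dom g = b_cod g'" for f g f' g'
  proof -
    obtain x y x' y' where e: "x \<in> fp m (b_dom f) (b_cod f)" "f = el (b_dom f) (b_cod f) x"
      "y \<in> fp m (b_dom g) (b_cod g)" "g = el (b_dom g) (b_cod g) y"
      "x' \<in> fp m (b_dom f') (b_cod f')" "f' = el (b_dom f') (b_cod f') x'"
      "y' \<in> fp m (b_dom g') (b_cod g')" "g' = el (b_dom g') (b_cod g') y'"
      using h(1-4) by (metis b_arrE)
    show ?thesis using e(1,3,5,7) h(5,6)
      by (subst (1 2) e(2), subst (1 2) e(4), subst (1 2) e(6), subst (1 2) e(8))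
       (simp add: el_cmp el_ten fp_stack fp_juxt lin_interchange)
  qed
qed (auto simp: b_id_def)

end

section \<open>Degrees, and the relations modulo the ideal\<close>

lemma isotopic_caps_1: "isotopic (caps 1) Cap" and isotopic_cups_1: "isotopic (cups 1) Cup"
proof -
  have s: "isotopic (Juxt (Strands 1) (Juxt (Strands 0) (Strands 1))) (Strands 2)"
    using isotopic.trans[OF isotopic.juxt_cong[OF isotopic.refl isotopic.juxt_empty_left] isotopic.juxt_strands]
    by (metis one_add_one)
  show "isotopic (caps 1) Cap"
    using isotopic.trans[OF isotopic.stack_cong[OF isotopic.refl s] isotopic.stack_strands_right[of Cap, simplified]]
    by simp
  show "isotopic (cups 1) Cup"
    using isotopic.trans[OF isotopic.stack_cong[OF s isotopic.refl] isotopic.stack_strands_left[of Cup, simplified]]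
    by simp
qed

lemma Q1_left: "Q1 = (lin_of Cap \<otimes>\<^sub>t lin_of (Strands 1)) \<circ>\<^sub>t (lin_of (Strands 1) \<otimes>\<^sub>t P1 \<otimes>\<^sub>t lin_of (Strands 1)) \<circ>\<^sub>t (lin_of (Strands 1) \<otimes>\<^sub>t lin_of Cup)"
  unfolding Q1_diag P1_diag lin_of_stack lin_of_juxt Q_diag_def turn_left_def P_diag_def top_points.simps bot_points.simps
  by (intro lin_of_isotopic isotopic.stack_cong isotopic.juxt_cong isotopic.refl isotopic_caps_1 isotopic_cups_1)

lemma Q1_right: "Q1 = (lin_of (Strands 1) \<otimes>\<^sub>t lin_of Cap) \<circ>\<^sub>t (lin_of (Strands 1) \<otimes>\<^sub>t P1 \<otimes>\<^sub>t lin_of (Strands 1)) \<circ>\<^sub>t (lin_of Cup \<otimes>\<^sub>t lin_of (Strands 1))"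
proof -
  have "Q1 = lin_of (turn_right P_diag)"
    unfolding Q1_diag Q_diag_def P_diag_def by (rule lin_of_isotopic) (rule isotopic.rotate)
  also have "\<dots> = (lin_of (Strands 1) \<otimes>\<^sub>t lin_of Cap) \<circ>\<^sub>t (lin_of (Strands 1) \<otimes>\<^sub>t P1 \<otimes>\<^sub>t lin_of (Strands 1)) \<circ>\<^sub>t (lin_of Cup \<otimes>\<^sub>t lin_of (Strands 1))"
    unfolding Q1_diag P1_diag lin_of_stack lin_of_juxt turn_right_def P_diag_def top_points.simps bot_points.simps
    by (intro lin_of_isotopic isotopic.stack_cong isotopic.juxt_cong isotopic.refl isotopic_caps_1 isotopic_cups_1)
  finally show ?thesis .
qed

lemma lin_zigzag: "(lin_of Cap \<otimes>\<^sub>t lin_of (Strands 1)) \<circ>\<^sub>t (lin_of (Strands 1) \<otimes>\<^sub>t lin_of Cup) = lin_of (Strands 1)"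
  "(lin_of (Strands 1) \<otimes>\<^sub>t lin_of Cap) \<circ>\<^sub>t (lin_of Cup \<otimes>\<^sub>t lin_of (Strands 1)) = lin_of (Strands 1)"
  unfolding lin_of_stack lin_of_juxt by (rule lin_of_isotopic, rule isotopic.zigzag_left isotopic.zigzag_right)+

text \<open>The weight of a basis vector under the circle \<open>diag(z, z\<^sup>-\<^sup>1)\<close>.\<close>

fun deg :: "bool list \<Rightarrow> int" where
  "deg [] = 0"
| "deg (x # w) = (if x then 1 else -1) + deg w"

lemma deg_append: "deg (v @ w) = deg v + deg w" by (induction v) auto

lemma run_deg: "d < m \<Longrightarrow> int (run m d w) = (int d + deg w) mod int m"
proof (induction w arbitrary: d)
  case (Cons x w)
  have "int (step m d x) mod int m = (int d + (if x then 1 else -1)) mod int m"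
  proof (cases x)
    case True then show ?thesis using Cons.prems by (auto simp: algebra_simps)
  next
    case False
    show ?thesis
    proof (cases d)
      case 0
      then have "int (step m d x) = (int d - 1) + int m" using False Cons.prems by (simp add: of_nat_diff)
      then have "int (step m d x) mod int m = (int d - 1) mod int m" by (simp only: mod_add_self2)
      then show ?thesis using False by simp
    next
      case (Suc d') then show ?thesis using False by simp
    qed
  qed
  then have "(int (step m d x) + deg w) mod int m = (int d + (if x then 1 else -1) + deg w) mod int m"
    by (metis mod_add_left_eq)
  then show ?case using Cons.IH[OF step_less[OF Cons.prems]] by (simp add: add.assoc)
qed simp

definition same_deg :: "nat \<Rightarrow> bool list \<Rightarrow> bool list \<Rightarrow> bool" where
  "same_deg m v w \<longleftrightarrow> deg v mod int m = deg w mod int m"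

lemma same_deg_run: "0 < m \<Longrightarrow> same_deg m v w \<longleftrightarrow> run m 0 v = run m 0 w"
  unfolding same_deg_def using run_deg[of 0 m v] run_deg[of 0 m w] by (metis add_0 of_nat_0 of_nat_eq_iff)

lemma same_deg_simps: "same_deg m v v" "same_deg m v w \<Longrightarrow> same_deg m w v" "same_deg m v w \<Longrightarrow> same_deg m w u \<Longrightarrow> same_deg m v u"
  "same_deg m v w \<Longrightarrow> same_deg m v' w' \<Longrightarrow> same_deg m (v @ v') (w @ w')"
  unfolding same_deg_def deg_append by (auto intro: mod_add_cong)

lemma deg_replicate: "deg (replicate k x) = (if x then int k else - int k)"
  by (induction k) auto

context planar_m begin

lemma fp_gens [simp]: "P1 \<in> fp m 1 1" "Q1 \<in> fp m 1 1" "lin_of Cup \<in> fp m 0 2" "lin_of Cap \<in> fp m 2 0"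
  "U m \<in> fp m (a_of m) (n_of m)" "Ustar m \<in> fp m (n_of m) (a_of m)"
  unfolding P1_diag Q1_diag U_def Ustar_def by (rule fp_lin_of; simp add: gens_def)+

lemmas [simp] = fp_gens(1,2)[unfolded One_nat_def]

lemma rel_facts:
  defines "X \<equiv> lin_of (Strands 1)"
  shows "lin_of Cap \<circ>\<^sub>t (P1 \<otimes>\<^sub>t X) \<circ>\<^sub>t lin_of Cup - lin_of (Strands 0) \<in> J m 0 0"
    "lin_of Cap \<circ>\<^sub>t (Q1 \<otimes>\<^sub>t X) \<circ>\<^sub>t lin_of Cup - lin_of (Strands 0) \<in> J m 0 0"
    "X - (P1 + Q1) \<in> J m 1 1" "P1 \<circ>\<^sub>t Q1 \<in> J m 1 1" "Q1 \<circ>\<^sub>t P1 \<in> J m 1 1"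
    "(P1 \<otimes>\<^sub>t X) \<circ>\<^sub>t lin_of Cup \<circ>\<^sub>t lin_of Cap \<circ>\<^sub>t (P1 \<otimes>\<^sub>t X) - P1 \<otimes>\<^sub>t Q1 \<in> J m 2 2"
    "(Q1 \<otimes>\<^sub>t X) \<circ>\<^sub>t lin_of Cup \<circ>\<^sub>t lin_of Cap \<circ>\<^sub>t (Q1 \<otimes>\<^sub>t X) - Q1 \<otimes>\<^sub>t P1 \<in> J m 2 2"
    "U m - lin_power Q1 (n_of m) \<circ>\<^sub>t U m \<circ>\<^sub>t lin_power P1 (a_of m) \<in> J m (a_of m) (n_of m)"
    "Ustar m - lin_power P1 (a_of m) \<circ>\<^sub>t Ustar m \<circ>\<^sub>t lin_power Q1 (n_of m) \<in> J m (n_of m) (a_of m)"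
    "U m \<circ>\<^sub>t Ustar m - lin_power Q1 (n_of m) \<in> J m (n_of m) (n_of m)"
    "Ustar m \<circ>\<^sub>t U m - lin_power P1 (a_of m) \<in> J m (a_of m) (a_of m)"
    "click (a_of m) (n_of m) (U m) - U m \<in> J m (a_of m) (n_of m)"
  unfolding X_def by (rule J_rel; simp add: rels_def Let_def)+

definition lpw :: "bool list \<Rightarrow> gen lin" where
  "lpw w = foldr (\<lambda>x y. (if x then P1 else Q1) \<otimes>\<^sub>t y) w (lin_of (Strands 0))"

lemma lpw_simps [simp]: "lpw [] = lin_of (Strands 0)" "lpw (x # w) = (if x then P1 else Q1) \<otimes>\<^sub>t lpw w"
  by (simp_all add: lpw_def)

lemma fp_lpw [simp]: "lpw w \<in> fp m (length w) (length w)"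
proof (induction w)
  case (Cons x w) then show ?case using fp_juxt[of P1 "gens m" 1 1] fp_juxt[of Q1 "gens m" 1 1] by auto
qed simp

lemma lpw_replicate: "lpw (replicate k x) = lin_power (if x then P1 else Q1) k"
  by (induction k) auto

lemma idem: "P1 \<circ>\<^sub>t P1 - P1 \<in> J m 1 1" "Q1 \<circ>\<^sub>t Q1 - Q1 \<in> J m 1 1"
proof -
  let ?X = "lin_of (Strands 1)"
  have "P1 \<circ>\<^sub>t (?X - (P1 + Q1)) \<in> J m 1 1" "Q1 \<circ>\<^sub>t (?X - (P1 + Q1)) \<in> J m 1 1"
    using rel_facts(3) J_fp[OF rel_facts(3)] by (blast intro: J_stack fp_gens)+
  then have "P1 \<circ>\<^sub>t (?X - (P1 + Q1)) + P1 \<circ>\<^sub>t Q1 \<in> J m 1 1" "Q1 \<circ>\<^sub>t (?X - (P1 + Q1)) + Q1 \<circ>\<^sub>t P1 \<in> J m 1 1"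
    using rel_facts(4,5) by (auto intro: J_add)
  then have "P1 - P1 \<circ>\<^sub>t P1 \<in> J m 1 1" "Q1 - Q1 \<circ>\<^sub>t Q1 \<in> J m 1 1"
    using lin_strands(2)[OF fp_gens(1)] lin_strands(2)[OF fp_gens(2)]
    by (simp_all add: stack_diff stack_add_right algebra_simps)
  then show "P1 \<circ>\<^sub>t P1 - P1 \<in> J m 1 1" "Q1 \<circ>\<^sub>t Q1 - Q1 \<in> J m 1 1"
    using J_diff[OF J_0, of "P1 - P1 \<circ>\<^sub>t P1" 1 1] J_diff[OF J_0, of "Q1 - Q1 \<circ>\<^sub>t Q1" 1 1] by simp_all
qed

lemma el_cong: "x - y \<in> J m b t \<Longrightarrow> el b t x = el b t y"
  by (simp add: el_def cl_cong)

sublocale O: oriented_category b_arr b_dom b_cod b_id b_cmp b_ten "n_of m" "a_of m"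
  "el 1 1 P1" "el 1 1 Q1" "el 0 2 (lin_of Cup)" "el 2 0 (lin_of Cap)" "el (a_of m) (n_of m) (U m)" "el (n_of m) (a_of m) (Ustar m)"
proof unfold_locales
  note el = b_id_def el_cmp el_ten fp_stack fp_juxt el_eq
  note fj = fp_juxt[of P1 "gens m" 1 1 "lin_of (Strands 1)" 1 1, simplified, folded numeral_2_eq_2]
    fp_juxt[of Q1 "gens m" 1 1 "lin_of (Strands 1)" 1 1, simplified, folded numeral_2_eq_2]
    fp_juxt[of "lin_of (Strands 1)" "gens m" 1 1 P1 1 1, simplified, folded numeral_2_eq_2]
    fp_juxt[of "lin_of (Strands 1)" "gens m" 1 1 Q1 1 1, simplified, folded numeral_2_eq_2]
  have t: "b_ten (el 1 1 x) (el 1 1 y) = el 2 2 (x \<otimes>\<^sub>t y)" "x \<otimes>\<^sub>t y \<in> fp m 2 2" if "x \<in> fp m 1 1" "y \<in> fp m 1 1" for x y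
    using el_ten[OF that] fp_juxt[OF that] by (simp_all add: numeral_2_eq_2)
  have i: "b_id 1 = el 1 1 (lin_of (Strands 1))" by (simp add: b_id_def)
  have c: "b_ten (el 0 2 x) (el 1 1 y) = el 1 3 (x \<otimes>\<^sub>t y)" "x \<otimes>\<^sub>t y \<in> fp m 1 3"
    "b_ten (el 1 1 y) (el 0 2 x) = el 1 3 (y \<otimes>\<^sub>t x)" "y \<otimes>\<^sub>t x \<in> fp m 1 3" if "x \<in> fp m 0 2" "y \<in> fp m 1 1" for x y
    using el_ten[OF that] fp_juxt[OF that] el_ten[OF that(2,1)] fp_juxt[OF that(2,1)] by (simp_all add: numeral_eq_Suc)
  have c': "b_ten (el 2 0 x) (el 1 1 y) = el 3 1 (x \<otimes>\<^sub>t y)" "x \<otimes>\<^sub>t y \<in> fp m 3 1"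
    "b_ten (el 1 1 y) (el 2 0 x) = el 3 1 (y \<otimes>\<^sub>t x)" "y \<otimes>\<^sub>t x \<in> fp m 3 1" if "x \<in> fp m 2 0" "y \<in> fp m 1 1" for x y
    using el_ten[OF that] fp_juxt[OF that] el_ten[OF that(2,1)] fp_juxt[OF that(2,1)] by (simp_all add: numeral_eq_Suc)
  have t3: "b_ten (el 1 1 x) (el 2 2 y) = el 3 3 (x \<otimes>\<^sub>t y)" "x \<otimes>\<^sub>t y \<in> fp m 3 3" if "x \<in> fp m 1 1" "y \<in> fp m 2 2" for x y
    using el_ten[OF that] fp_juxt[OF that] by (simp_all add: numeral_eq_Suc)
  note all = t c c' t3 fp_gens fp_strands el_cmp fp_stack i
  show "b_cmp (b_ten (el 2 0 (lin_of Cap)) (b_id 1)) (b_ten (b_id 1) (el 0 2 (lin_of Cup))) = b_id 1"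
    "b_cmp (b_ten (b_id 1) (el 2 0 (lin_of Cap))) (b_ten (el 0 2 (lin_of Cup)) (b_id 1)) = b_id 1"
    by (simp_all only: all lin_zigzag)
  show "el 1 1 Q1 = b_cmp (b_ten (el 2 0 (lin_of Cap)) (b_id 1)) (b_cmp (b_ten (b_id 1) (b_ten (el 1 1 P1) (b_id 1))) (b_ten (b_id 1) (el 0 2 (lin_of Cup))))"
    by (subst Q1_left) (simp only: all el_cmp[OF c'(2) fp_stack[OF t3(2) c(4)]])
  show "el 1 1 Q1 = b_cmp (b_ten (b_id 1) (el 2 0 (lin_of Cap))) (b_cmp (b_ten (b_id 1) (b_ten (el 1 1 P1) (b_id 1))) (b_ten (el 0 2 (lin_of Cup)) (b_id 1)))"
    by (subst Q1_right) (simp only: all el_cmp[OF c'(4) fp_stack[OF t3(2) c(2)]])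
  show "b_cmp (el 1 1 P1) (el 1 1 P1) = el 1 1 P1" "b_cmp (el 1 1 Q1) (el 1 1 Q1) = el 1 1 Q1"
    using idem[THEN el_cong] by (simp_all only: all)
  have fpX: "lin_of Cap \<circ>\<^sub>t x \<circ>\<^sub>t lin_of Cup \<in> fp m 0 0" "x \<circ>\<^sub>t lin_of Cup \<circ>\<^sub>t lin_of Cap \<circ>\<^sub>t x \<in> fp m 2 2"
    "x \<circ>\<^sub>t lin_of Cup \<in> fp m 0 2" "lin_of Cup \<circ>\<^sub>t lin_of Cap \<circ>\<^sub>t x \<in> fp m 2 2" "lin_of Cap \<circ>\<^sub>t x \<in> fp m 2 0" if "x \<in> fp m 2 2" for x
    using that fp_gens by (meson fp_stack)+
  show "b_cmp (el 2 0 (lin_of Cap)) (b_cmp (b_ten (el 1 1 P1) (b_id 1)) (el 0 2 (lin_of Cup))) = b_id 0"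
    "b_cmp (el 2 0 (lin_of Cap)) (b_cmp (b_ten (el 1 1 Q1) (b_id 1)) (el 0 2 (lin_of Cup))) = b_id 0"
    using rel_facts(1,2)[THEN el_cong, folded b_id_def] by (simp_all only: all fpX)
  show "b_cmp (b_ten (el 1 1 P1) (b_id 1)) (b_cmp (el 0 2 (lin_of Cup)) (b_cmp (el 2 0 (lin_of Cap)) (b_ten (el 1 1 P1) (b_id 1)))) = b_ten (el 1 1 P1) (el 1 1 Q1)"
    "b_cmp (b_ten (el 1 1 Q1) (b_id 1)) (b_cmp (el 0 2 (lin_of Cup)) (b_cmp (el 2 0 (lin_of Cap)) (b_ten (el 1 1 Q1) (b_id 1)))) = b_ten (el 1 1 Q1) (el 1 1 P1)"
    using rel_facts(6,7)[THEN el_cong] by (simp_all only: all fpX)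
qed (use na in \<open>simp_all\<close>)

lemma pw_el: "O.pw w = el (length w) (length w) (lpw w)"
proof (induction w)
  case Nil show ?case unfolding O.pw.simps by (simp add: b_id_def)
next
  case (Cons x w)
  show ?case unfolding O.pw.simps Cons using el_ten[OF fp_gens(1) fp_lpw[of w]] el_ten[OF fp_gens(2) fp_lpw[of w]] by simp
qed

sublocale O: unitary_oriented_category b_arr b_dom b_cod b_id b_cmp b_ten "n_of m" "a_of m"
  "el 1 1 P1" "el 1 1 Q1" "el 0 2 (lin_of Cup)" "el 2 0 (lin_of Cap)" "el (a_of m) (n_of m) (U m)" "el (n_of m) (a_of m) (Ustar m)"
proof unfold_locales
  let ?n = "n_of m" and ?a = "a_of m"
  have p: "O.pw (neg k) = el k k (lin_power Q1 k)" "O.pw (pos k) = el k k (lin_power P1 k)"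
    "lin_power Q1 k \<in> fp m k k" "lin_power P1 k \<in> fp m k k" for k
    using pw_el[of "replicate k False"] pw_el[of "replicate k True"] lpw_replicate[of k False] lpw_replicate[of k True]
      fp_lpw[of "replicate k False"] fp_lpw[of "replicate k True"] by (simp_all only: length_replicate if_True if_False)
  show "b_cmp (el ?a ?n (U m)) (el ?n ?a (Ustar m)) = O.pw (neg ?n)"
    "b_cmp (el ?n ?a (Ustar m)) (el ?a ?n (U m)) = O.pw (pos ?a)"
    using rel_facts(10,11)[THEN el_cong] by (simp_all only: p el_cmp fp_gens fp_stack[OF fp_gens(5,6)] fp_stack[OF fp_gens(6,5)])
  show "el ?a ?n (U m) = b_cmp (O.pw (neg ?n)) (b_cmp (el ?a ?n (U m)) (O.pw (pos ?a)))"
    "el ?n ?a (Ustar m) = b_cmp (O.pw (pos ?a)) (b_cmp (el ?n ?a (Ustar m)) (O.pw (neg ?n)))"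
    by (simp_all only: p el_cmp fp_gens fp_stack[OF fp_gens(5) p(4)] fp_stack[OF fp_gens(6) p(3)])
      (rule rel_facts(8,9)[THEN el_cong])+
  have 1: "lin_of (Strands ?n) \<otimes>\<^sub>t lin_of Cap \<in> fp m (?n + 2) ?n" "lin_of Cup \<otimes>\<^sub>t lin_of (Strands ?a) \<in> fp m ?a (2 + ?a)"
    "lin_of (Strands 1) \<otimes>\<^sub>t U m \<otimes>\<^sub>t lin_of (Strands 1) \<in> fp m (2 + ?a) (?n + 2)"
    "U m \<otimes>\<^sub>t lin_of (Strands 1) \<in> fp m (?a + 1) (?n + 1)"
    using fp_juxt[OF fp_strands fp_gens(4), of ?n] fp_juxt[OF fp_gens(3) fp_strands, of ?a]
     fp_juxt[OF fp_strands fp_juxt[OF fp_gens(5) fp_strands[of 1]], of 1] fp_juxt[OF fp_gens(5) fp_strands[of 1]] by (simp_all add: numeral_2_eq_2)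
  have 2: "b_ten (b_id 1) (b_ten (el ?a ?n (U m)) (b_id 1)) = el (2 + ?a) (?n + 2) (lin_of (Strands 1) \<otimes>\<^sub>t U m \<otimes>\<^sub>t lin_of (Strands 1))"
    using el_ten[OF fp_gens(5) fp_strands[of 1]] el_ten[OF fp_strands 1(4), of 1] by (simp add: b_id_def numeral_2_eq_2)
  have 3: "b_ten (b_id ?n) (el 2 0 (lin_of Cap)) = el (?n + 2) ?n (lin_of (Strands ?n) \<otimes>\<^sub>t lin_of Cap)"
    "b_ten (el 0 2 (lin_of Cup)) (b_id ?a) = el ?a (2 + ?a) (lin_of Cup \<otimes>\<^sub>t lin_of (Strands ?a))"
    using el_ten[OF fp_strands fp_gens(4), of ?n] el_ten[OF fp_gens(3) fp_strands, of ?a] by (simp_all add: b_id_def)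
  have "el ?a ?n (click ?a ?n (U m)) = el ?a ?n (U m)"
    by (rule el_cong[OF rel_facts(12)])
  then show "el ?a ?n (U m) = b_cmp (b_ten (b_id ?n) (el 2 0 (lin_of Cap))) (b_cmp (b_ten (b_id 1) (b_ten (el ?a ?n (U m)) (b_id 1))) (b_ten (el 0 2 (lin_of Cup)) (b_id ?a)))"
    unfolding 2 3 click_def by (simp only: el_cmp[OF 1(3,2)] el_cmp[OF 1(1) fp_stack[OF 1(3,2)]])
qed

end

section \<open>Monomial elements\<close>

context unitary_oriented_category begin

definition mono where "mono v w f \<longleftrightarrow> W.S (v, w, f)"

lemma word_simps: "word_dom (v, w, f) = v" "word_cod (v, w, f) = w"
  "word_cmp (v', w', g) (v, w, f) = (v, w', g \<bullet> f)" "word_ten (v, w, f) (v', w', g) = (v @ v', w @ w', f \<star> g)"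
  by (simp_all add: wdefs)

lemma mono_arr: "mono v w f \<Longrightarrow> arr f \<and> dom f = length v \<and> cod f = length w"
  unfolding mono_def by (drule W.S_arr) (simp add: word_arr_def)

lemma mono_run: "mono v w f \<Longrightarrow> run (n + a) 0 v = run (n + a) 0 w"
  unfolding mono_def by (drule W.S_run) (simp only: word_simps)

lemma mono_exists: assumes "run (n + a) 0 v = run (n + a) 0 w" shows "\<exists>f. mono v w f"
proof -
  obtain f where f: "W.S f" "word_dom f = v" "word_cod f = w" using W.S_exists[OF assms] by blast
  obtain v' w' g where g: "f = (v', w', g)" by (cases f)
  show ?thesis using f unfolding g word_simps mono_def by blast
qed

lemma mono_unique: assumes "mono v w f" "mono v w g" shows "f = g"
  using W.S_unique[of "(v, w, f)" "(v, w, g)"] assms unfolding mono_def word_simps by blast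

lemma mono_id: "mono v v (pw v)" unfolding mono_def using W.S_I[of v] unfolding word_id_def .

lemma mono_cmp: "mono x w g \<Longrightarrow> mono v x f \<Longrightarrow> mono v w (g \<bullet> f)"
  using W.S_cmp[of "(x, w, g)" "(v, x, f)"] unfolding mono_def word_simps by blast

lemma mono_ten: "mono v w f \<Longrightarrow> mono v' w' g \<Longrightarrow> mono (v @ v') (w @ w') (f \<star> g)"
  using W.S_ten[of "(v, w, f)" "(v', w', g)"] unfolding mono_def word_simps by blast

lemma mono_gens: "mono [] [True, False] ((p \<star> I 1) \<bullet> cup)" "mono [] [False, True] ((q \<star> I 1) \<bullet> cup)"
  "mono [True, False] [] (cap \<bullet> (p \<star> I 1))" "mono [False, True] [] (cap \<bullet> (q \<star> I 1))"
  "mono (pos a) (neg n) u" "mono (neg n) (pos a) u'"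
  unfolding mono_def oriented_cups[symmetric] oriented_caps[symmetric]
  by ((rule W.S_U | rule W.S_gen, blast))+

end

context planar_m begin

text \<open>An element whose class is a product of cups, caps, \<open>U\<close>, \<open>U\<^sup>*\<close> and identities of words.\<close>

definition pmono :: "bool list \<Rightarrow> bool list \<Rightarrow> gen lin \<Rightarrow> bool" where
  "pmono v w x \<longleftrightarrow> x \<in> fp m (length v) (length w) \<and> O.mono v w (el (length v) (length w) x)"

lemma pmono_deg: "pmono v w x \<Longrightarrow> same_deg m v w"
  unfolding pmono_def same_deg_run[OF order.strict_trans2[OF pos2 m]] using O.mono_run[of v w] unfolding na(3) by blast

lemma pmono_exists: assumes "same_deg m v w" shows "\<exists>x. pmono v w x"
proof -
  obtain g where g: "O.mono v w g"
    using O.mono_exists[of v w] assms unfolding same_deg_run[OF order.strict_trans2[OF pos2 m]] na(3) by blast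
  then have "b_arr g" "b_dom g = length v" "b_cod g = length w" using O.mono_arr by blast+
  then obtain x where x: "x \<in> fp m (length v) (length w)" "g = el (length v) (length w) x" by (metis b_arrE)
  show ?thesis using g x(1) unfolding x(2) pmono_def by blast
qed

lemma pmono_unique: assumes "pmono v w x" "pmono v w y" shows "x - y \<in> J m (length v) (length w)"
proof -
  have "el (length v) (length w) x = el (length v) (length w) y"
    using O.mono_unique assms unfolding pmono_def by blast
  moreover have "x \<in> fp m (length v) (length w)" using assms unfolding pmono_def by blast
  ultimately show ?thesis using el_eq by blast
qed

lemma pmono_id: "pmono v v (lpw v)"
  unfolding pmono_def using O.mono_id[of v] fp_lpw[of v] unfolding pw_el by blast

lemma pmono_cmp: assumes "pmono u w x" "pmono v u y" shows "pmono v w (x \<circ>\<^sub>t y)"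
proof -
  have f: "x \<in> fp m (length u) (length w)" "y \<in> fp m (length v) (length u)" using assms unfolding pmono_def by blast+
  have "O.mono v w (b_cmp (el (length u) (length w) x) (el (length v) (length u) y))"
    using assms unfolding pmono_def by (blast intro: O.mono_cmp)
  then show ?thesis unfolding pmono_def el_cmp[OF f] using fp_stack[OF f] by blast
qed

lemma pmono_ten: assumes "pmono v w x" "pmono v' w' y" shows "pmono (v @ v') (w @ w') (x \<otimes>\<^sub>t y)"
proof -
  have f: "x \<in> fp m (length v) (length w)" "y \<in> fp m (length v') (length w')" using assms unfolding pmono_def by blast+
  have "O.mono (v @ v') (w @ w') (b_ten (el (length v) (length w) x) (el (length v') (length w') y))"
    using assms unfolding pmono_def by (blast intro: O.mono_ten)
  then show ?thesis unfolding pmono_def el_ten[OF f] length_append using fp_juxt[OF f] by blast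
qed

lemma fp_PQ: "P1 \<otimes>\<^sub>t lin_of (Strands 1) \<in> fp m 2 2" "Q1 \<otimes>\<^sub>t lin_of (Strands 1) \<in> fp m 2 2"
  using fp_juxt[OF fp_gens(1) fp_strands[of 1]] fp_juxt[OF fp_gens(2) fp_strands[of 1]]
  by (simp_all add: numeral_2_eq_2)

lemma el_PQ: "b_ten (el 1 1 P1) (b_id 1) = el 2 2 (P1 \<otimes>\<^sub>t lin_of (Strands 1))" "b_ten (el 1 1 Q1) (b_id 1) = el 2 2 (Q1 \<otimes>\<^sub>t lin_of (Strands 1))"
  using el_ten[OF fp_gens(1) fp_strands[of 1]] el_ten[OF fp_gens(2) fp_strands[of 1]]
  by (simp_all add: numeral_2_eq_2 b_id_def)

lemma pmono_gens: "pmono [] [True, False] ((P1 \<otimes>\<^sub>t lin_of (Strands 1)) \<circ>\<^sub>t lin_of Cup)"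
  "pmono [] [False, True] ((Q1 \<otimes>\<^sub>t lin_of (Strands 1)) \<circ>\<^sub>t lin_of Cup)"
  "pmono [True, False] [] (lin_of Cap \<circ>\<^sub>t (P1 \<otimes>\<^sub>t lin_of (Strands 1)))"
  "pmono [False, True] [] (lin_of Cap \<circ>\<^sub>t (Q1 \<otimes>\<^sub>t lin_of (Strands 1)))"
  "pmono (pos (a_of m)) (neg (n_of m)) (U m)" "pmono (neg (n_of m)) (pos (a_of m)) (Ustar m)"
proof -
  have l: "length [True, False] = 2" "length [False, True] = 2" "length ([] :: bool list) = 0" by simp_all
  note f = fp_PQ fp_gens fp_stack[OF fp_PQ(1) fp_gens(3)] fp_stack[OF fp_PQ(2) fp_gens(3)] fp_stack[OF fp_gens(4) fp_PQ(1)] fp_stack[OF fp_gens(4) fp_PQ(2)]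
  note g = O.mono_gens(1-4)[unfolded el_PQ, unfolded el_cmp[OF fp_PQ(1) fp_gens(3)] el_cmp[OF fp_PQ(2) fp_gens(3)] el_cmp[OF fp_gens(4) fp_PQ(1)] el_cmp[OF fp_gens(4) fp_PQ(2)]]
  show "pmono [] [True, False] ((P1 \<otimes>\<^sub>t lin_of (Strands 1)) \<circ>\<^sub>t lin_of Cup)"
    "pmono [] [False, True] ((Q1 \<otimes>\<^sub>t lin_of (Strands 1)) \<circ>\<^sub>t lin_of Cup)"
    "pmono [True, False] [] (lin_of Cap \<circ>\<^sub>t (P1 \<otimes>\<^sub>t lin_of (Strands 1)))"
    "pmono [False, True] [] (lin_of Cap \<circ>\<^sub>t (Q1 \<otimes>\<^sub>t lin_of (Strands 1)))"
    unfolding pmono_def l using g f by blast+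
  show "pmono (pos (a_of m)) (neg (n_of m)) (U m)" "pmono (neg (n_of m)) (pos (a_of m)) (Ustar m)"
    unfolding pmono_def length_replicate using O.mono_gens(5,6) fp_gens by blast+
qed

end

section \<open>Matrix units and faithfulness\<close>

context planar_m begin

lemma A_sym: "x - y \<in> J m b t \<Longrightarrow> y - x \<in> J m b t"
  using J_diff[OF J_0, of "x - y" b t] by simp
lemma A_trans: "x - y \<in> J m b t \<Longrightarrow> y - z \<in> J m b t \<Longrightarrow> x - z \<in> J m b t"
  using J_add[of "x - y" b t "y - z"] by simp
lemma A_add: "x - x' \<in> J m b t \<Longrightarrow> y - y' \<in> J m b t \<Longrightarrow> (x + y) - (x' + y') \<in> J m b t"
  using J_add[of "x - x'" b t "y - y'"] by (simp add: algebra_simps)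
lemma A_scale: "x - y \<in> J m b t \<Longrightarrow> lin_scale c x - lin_scale c y \<in> J m b t"
  using J_scale[of "x - y" b t c] by (simp add: scale_diff)
lemma A_sum: "(\<And>i. i \<in> A \<Longrightarrow> f i - g i \<in> J m b t) \<Longrightarrow> sum f A - sum g A \<in> J m b t"
  using J_sum[of A "\<lambda>i. f i - g i" b t] by (simp add: sum_subtractf)
lemma A_stack: assumes "x - x' \<in> J m k t" "y - y' \<in> J m b k" "x' \<in> fp m k t" "y \<in> fp m b k"
  shows "x \<circ>\<^sub>t y - x' \<circ>\<^sub>t y' \<in> J m b t"
proof -
  have "(x - x') \<circ>\<^sub>t y + x' \<circ>\<^sub>t (y - y') \<in> J m b t"
    using assms J_fp by (intro J_add J_stack[where k = k]) auto
  then show ?thesis by (simp add: stack_diff)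
qed
lemma A_juxt: assumes "x - x' \<in> J m b t" "y - y' \<in> J m b' t'" "x' \<in> fp m b t" "y \<in> fp m b' t'"
  shows "x \<otimes>\<^sub>t y - x' \<otimes>\<^sub>t y' \<in> J m (b + b') (t + t')"
proof -
  have "(x - x') \<otimes>\<^sub>t y + x' \<otimes>\<^sub>t (y - y') \<in> J m (b + b') (t + t')"
    using assms J_fp by (intro J_add J_juxt) auto
  then show ?thesis by (simp add: juxt_diff)
qed

text \<open>The matrix unit from \<open>v\<close> to \<open>w\<close>, realised by some monomial; by uniqueness its class does not
  depend on the choice.\<close>

definition e :: "bool list \<Rightarrow> bool list \<Rightarrow> gen lin" where
  "e w v = (if same_deg m v w then SOME x. pmono v w x else 0)"

lemma e_mono: "same_deg m v w \<Longrightarrow> pmono v w (e w v)"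
  using someI_ex[OF pmono_exists] by (simp add: e_def)

lemma e_fp [simp]: "e w v \<in> fp m (length v) (length w)"
  using e_mono[of v w] by (cases "same_deg m v w") (simp_all add: pmono_def e_def)

lemma e_unique: "pmono v w x \<Longrightarrow> e w v - x \<in> J m (length v) (length w)"
  using pmono_unique[OF e_mono[OF pmono_deg]] by blast

lemma e_cmp: "same_deg m u w \<Longrightarrow> same_deg m v u \<Longrightarrow> e w u \<circ>\<^sub>t e u v - e w v \<in> J m (length v) (length w)"
  by (rule A_sym[OF e_unique[OF pmono_cmp[OF e_mono e_mono]]])

lemma e_ten: assumes "same_deg m v w" "same_deg m v' w'"
  shows "e w v \<otimes>\<^sub>t e w' v' - e (w @ w') (v @ v') \<in> J m (length v + length v') (length w + length w')"
  using A_sym[OF e_unique[OF pmono_ten[OF e_mono[OF assms(1)] e_mono[OF assms(2)]]]] by simp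

lemma e_id: "e w w - lpw w \<in> J m (length w) (length w)"
  by (intro e_unique pmono_id)

lemma e_cup: "e [True, False] [] - (P1 \<otimes>\<^sub>t lin_of (Strands 1)) \<circ>\<^sub>t lin_of Cup \<in> J m 0 2"
  "e [False, True] [] - (Q1 \<otimes>\<^sub>t lin_of (Strands 1)) \<circ>\<^sub>t lin_of Cup \<in> J m 0 2"
  using e_unique[OF pmono_gens(1)] e_unique[OF pmono_gens(2)] by (simp_all add: numeral_2_eq_2)

lemma e_cap: "e [] [True, False] - lin_of Cap \<circ>\<^sub>t (P1 \<otimes>\<^sub>t lin_of (Strands 1)) \<in> J m 2 0"
  "e [] [False, True] - lin_of Cap \<circ>\<^sub>t (Q1 \<otimes>\<^sub>t lin_of (Strands 1)) \<in> J m 2 0"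
  using e_unique[OF pmono_gens(3)] e_unique[OF pmono_gens(4)] by (simp_all add: numeral_2_eq_2)

lemma e_U: "e (neg (n_of m)) (pos (a_of m)) - U m \<in> J m (a_of m) (n_of m)"
  "e (pos (a_of m)) (neg (n_of m)) - Ustar m \<in> J m (n_of m) (a_of m)"
  using e_unique[OF pmono_gens(5)] e_unique[OF pmono_gens(6)] by simp_all

lemma lpw_orth: "length u = length v \<Longrightarrow> u \<noteq> v \<Longrightarrow> lpw u \<circ>\<^sub>t lpw v \<in> J m (length u) (length u)"
proof (induction u v rule: list_induct2)
  case (Cons x u y v)
  have lv: "lpw v \<in> fp m (length u) (length u)" using fp_lpw[of v] Cons.hyps by metis
  have pq: "(if z then P1 else Q1) \<in> fp m 1 1" for z using fp_gens(1,2) by (cases z) simp_all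
  note xy = fp_stack[OF pq[of x] pq[of y]] and uv = fp_stack[OF fp_lpw[of u] lv]
  have "lpw (x # u) \<circ>\<^sub>t lpw (y # v) = ((if x then P1 else Q1) \<circ>\<^sub>t (if y then P1 else Q1)) \<otimes>\<^sub>t (lpw u \<circ>\<^sub>t lpw v)"
    unfolding lpw_simps by (rule lin_interchange[OF pq pq fp_lpw lv])
  moreover have "((if x then P1 else Q1) \<circ>\<^sub>t (if y then P1 else Q1)) \<otimes>\<^sub>t (lpw u \<circ>\<^sub>t lpw v) \<in> J m (1 + length u) (1 + length u)"
  proof (rule J_juxt[OF xy uv])
    show "(if x then P1 else Q1) \<circ>\<^sub>t (if y then P1 else Q1) \<in> J m 1 1 \<or> lpw u \<circ>\<^sub>t lpw v \<in> J m (length u) (length u)"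
      using rel_facts(4,5) Cons by (cases "x = y") auto
  qed
  ultimately show ?case by simp
qed simp

lemma e_absorb: assumes "same_deg m v w"
  shows "e w v \<circ>\<^sub>t lpw v - e w v \<in> J m (length v) (length w)" "lpw w \<circ>\<^sub>t e w v - e w v \<in> J m (length v) (length w)"
proof -
  have "e w v \<circ>\<^sub>t lpw v - e w v \<circ>\<^sub>t e v v \<in> J m (length v) (length w)"
    by (rule A_stack[OF _ A_sym[OF e_id]]) (simp_all add: J_0)
  then show "e w v \<circ>\<^sub>t lpw v - e w v \<in> J m (length v) (length w)"
    using e_cmp[OF assms same_deg_simps(1)] by (rule A_trans)
  have "lpw w \<circ>\<^sub>t e w v - e w w \<circ>\<^sub>t e w v \<in> J m (length v) (length w)"
    by (rule A_stack[OF A_sym[OF e_id]]) (simp_all add: J_0)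
  then show "lpw w \<circ>\<^sub>t e w v - e w v \<in> J m (length v) (length w)"
    using e_cmp[OF same_deg_simps(1) assms] by (rule A_trans)
qed

lemma e_orth: assumes "same_deg m u w" "same_deg m v u'" "length u = length u'" "u \<noteq> u'"
  shows "e w u \<circ>\<^sub>t e u' v \<in> J m (length v) (length w)"
proof -
  have f: "e w u \<circ>\<^sub>t lpw u \<in> fp m (length u) (length w)" "lpw u' \<circ>\<^sub>t e u' v \<in> fp m (length v) (length u)"
    using fp_stack[OF e_fp[of w u] fp_lpw] fp_stack[OF fp_lpw e_fp[of u' v]] unfolding assms(3) by blast+
  have 1: "e w u \<circ>\<^sub>t e u' v - (e w u \<circ>\<^sub>t lpw u) \<circ>\<^sub>t (lpw u' \<circ>\<^sub>t e u' v) \<in> J m (length v) (length w)"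
    using A_sym[OF e_absorb(1)[OF assms(1)]] A_sym[OF e_absorb(2)[OF assms(2)]] f e_fp[of u' v] assms(3)
    by (intro A_stack[where k = "length u"]) simp_all
  have "(lpw u \<circ>\<^sub>t lpw u') \<circ>\<^sub>t e u' v \<in> J m (length v) (length u)"
    using lpw_orth[OF assms(3,4)] J_fp e_fp[of u' v] assms(3) by (intro J_stack[where k = "length u"]) auto
  then have "e w u \<circ>\<^sub>t ((lpw u \<circ>\<^sub>t lpw u') \<circ>\<^sub>t e u' v) \<in> J m (length v) (length w)"
    using J_fp by (intro J_stack[where k = "length u"]) auto
  then have "(e w u \<circ>\<^sub>t lpw u) \<circ>\<^sub>t (lpw u' \<circ>\<^sub>t e u' v) \<in> J m (length v) (length w)" by (simp only: lin_stack_assoc)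
  from J_add[OF 1 this] show ?thesis by simp
qed

definition dp :: "wmat \<Rightarrow> bool" where "dp f \<longleftrightarrow> (\<forall>w v. f w v \<noteq> 0 \<longrightarrow> same_deg m v w)"

text \<open>A degree-preserving matrix lifted to the planar algebra, as a combination of matrix units.\<close>

definition ex :: "nat \<Rightarrow> nat \<Rightarrow> wmat \<Rightarrow> gen lin" where
  "ex b t f = (\<Sum>w\<in>words t. \<Sum>v\<in>words b. lin_scale (f w v) (e w v))"

lemma fp_ex: "ex b t f \<in> fp m b t"
  unfolding ex_def by (intro fp_sum fp_scale) (metis e_fp in_words)

lemma scale_sum_left: "lin_scale (sum h A) x = (\<Sum>i\<in>A. lin_scale (h i) x)"
  by (induction A rule: infinite_finite_induct) (auto simp: scale_add_left)

lemma dp_basic: "dp (wid k)" "dp wcup" "dp wcap" "dp (gval m l b t)"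
  "dp f \<Longrightarrow> dp g \<Longrightarrow> dp (wcomp k f g)" "dp f \<Longrightarrow> dp g \<Longrightarrow> dp (wten t' b' f g)"
proof -
  show "dp (wid k)" by (auto simp: dp_def wid_def same_deg_simps(1))
  show "dp wcup" "dp wcap" by (auto simp: dp_def wcup_def wcap_def same_deg_def split: if_splits)
  have "- int (n_of m) mod int m = int (a_of m) mod int m"
  proof -
    have "int (a_of m) = - int (n_of m) + int m" using na(3) by linarith
    then show ?thesis by simp
  qed
  then show "dp (gval m l b t)"
    by (cases l) (auto simp: dp_def gval_def wunit_def same_deg_def deg_replicate)
  show "dp (wcomp k f g)" if f: "dp f" and g: "dp g" for f g
    unfolding dp_def
  proof (intro allI impI)
    fix w v assume "wcomp k f g w v \<noteq> 0"
    then obtain u where "f w u * g u v \<noteq> 0" unfolding wcomp_def by (meson sum.neutral)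
    then have "f w u \<noteq> 0" "g u v \<noteq> 0" by auto
    then show "same_deg m v w" using f g same_deg_simps(3) unfolding dp_def by blast
  qed
  show "dp (wten t' b' f g)" if f: "dp f" and g: "dp g" for f g
    unfolding dp_def
  proof (intro allI impI)
    fix w v assume "wten t' b' f g w v \<noteq> 0"
    then have "f (take t' w) (take b' v) \<noteq> 0" "g (drop t' w) (drop b' v) \<noteq> 0" by (auto simp: wten_def)
    then have "same_deg m (take b' v @ drop b' v) (take t' w @ drop t' w)"
      using f g same_deg_simps(4) unfolding dp_def by blast
    then show "same_deg m v w" by simp
  qed
qed

lemma dp_val: "dp (val m d)" by (induction d) (auto intro: dp_basic)

lemma ex_cmp: assumes "dp f" "dp g"
  shows "ex k t f \<circ>\<^sub>t ex b k g - ex b t (wcomp k f g) \<in> J m b t"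
proof -
  define T where "T w u u' v = lin_scale (f w u * g u' v) (e w u \<circ>\<^sub>t e u' v)" for w u u' v
  have "ex k t f \<circ>\<^sub>t ex b k g = (\<Sum>w\<in>words t. \<Sum>u\<in>words k. \<Sum>u'\<in>words k. \<Sum>v\<in>words b. T w u u' v)"
    unfolding ex_def stack_sum(1) stack_scale_left unfolding stack_sum(2) stack_scale_right T_def scale_sum scale_scale
    by (simp add: mult.commute)
  also have "\<dots> = (\<Sum>w\<in>words t. \<Sum>v\<in>words b. \<Sum>u\<in>words k. \<Sum>u'\<in>words k. T w u u' v)"
  proof (intro sum.cong[OF HOL.refl])
    fix w
    have "(\<Sum>u\<in>words k. \<Sum>u'\<in>words k. \<Sum>v\<in>words b. T w u u' v) = (\<Sum>u\<in>words k. \<Sum>v\<in>words b. \<Sum>u'\<in>words k. T w u u' v)"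
      by (intro sum.cong[OF HOL.refl] sum.swap)
    then show "(\<Sum>u\<in>words k. \<Sum>u'\<in>words k. \<Sum>v\<in>words b. T w u u' v) = (\<Sum>v\<in>words b. \<Sum>u\<in>words k. \<Sum>u'\<in>words k. T w u u' v)"
      by (simp only: sum.swap[of _ "words b" "words k"])
  qed
  finally have L: "ex k t f \<circ>\<^sub>t ex b k g = (\<Sum>w\<in>words t. \<Sum>v\<in>words b. \<Sum>u\<in>words k. \<Sum>u'\<in>words k. T w u u' v)" .
  have R: "ex b t (wcomp k f g) = (\<Sum>w\<in>words t. \<Sum>v\<in>words b. \<Sum>u\<in>words k. \<Sum>u'\<in>words k.
      if u' = u then lin_scale (f w u * g u v) (e w v) else 0)"
    unfolding ex_def wcomp_def scale_sum_left by (intro sum.cong[OF HOL.refl]) (simp add: sum.delta)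
  show ?thesis unfolding L R
  proof (intro A_sum)
    fix w v u u' assume l: "w \<in> words t" "v \<in> words b" "u \<in> words k" "u' \<in> words k"
    show "T w u u' v - (if u' = u then lin_scale (f w u * g u v) (e w v) else 0) \<in> J m b t"
    proof (cases "f w u * g u' v = 0")
      case True then show ?thesis by (auto simp: T_def J_0)
    next
      case False
      then have d: "same_deg m u w" "same_deg m v u'" using assms by (auto simp: dp_def)
      show ?thesis
      proof (cases "u' = u")
        case True
        then show ?thesis using A_scale[OF e_cmp[of u w v]] d l by (simp add: T_def)
      next
        case False
        then show ?thesis using J_scale[OF e_orth[OF d]] l by (simp add: T_def)
      qed
    qed
  qed
qed

lemma ex_ten: assumes "dp f" "dp g"
  shows "ex b t f \<otimes>\<^sub>t ex b' t' g - ex (b + b') (t + t') (wten t b f g) \<in> J m (b + b') (t + t')"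
proof -
  define T where "T w v w' v' = lin_scale (f w v * g w' v') (e w v \<otimes>\<^sub>t e w' v')" for w v w' v'
  have "ex b t f \<otimes>\<^sub>t ex b' t' g = (\<Sum>w\<in>words t. \<Sum>v\<in>words b. \<Sum>w'\<in>words t'. \<Sum>v'\<in>words b'. T w v w' v')"
    unfolding ex_def juxt_sum(1) juxt_scale_left unfolding juxt_sum(2) juxt_scale_right T_def scale_sum scale_scale
    by (simp add: mult.commute)
  also have "\<dots> = (\<Sum>w\<in>words t. \<Sum>w'\<in>words t'. \<Sum>v\<in>words b. \<Sum>v'\<in>words b'. T w v w' v')"
    by (intro sum.cong[OF HOL.refl] sum.swap)
  finally have L: "ex b t f \<otimes>\<^sub>t ex b' t' g = (\<Sum>w\<in>words t. \<Sum>w'\<in>words t'. \<Sum>v\<in>words b. \<Sum>v'\<in>words b'. T w v w' v')" .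
  have R: "ex (b + b') (t + t') (wten t b f g) = (\<Sum>w\<in>words t. \<Sum>w'\<in>words t'. \<Sum>v\<in>words b. \<Sum>v'\<in>words b'.
      lin_scale (f w v * g w' v') (e (w @ w') (v @ v')))"
    unfolding ex_def sum_words_add by (intro sum.cong[OF HOL.refl]) (simp add: wten_append)
  show ?thesis unfolding L R
  proof (intro A_sum)
    fix w v w' v' assume l: "w \<in> words t" "v \<in> words b" "w' \<in> words t'" "v' \<in> words b'"
    show "T w v w' v' - lin_scale (f w v * g w' v') (e (w @ w') (v @ v')) \<in> J m (b + b') (t + t')"
    proof (cases "f w v * g w' v' = 0")
      case True then show ?thesis by (auto simp: T_def J_0)
    next
      case False
      then have d: "same_deg m v w" "same_deg m v' w'" using assms by (auto simp: dp_def)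
      then show ?thesis using A_scale[OF e_ten[OF d]] l by (simp add: T_def)
    qed
  qed
qed

lemma ex_wunit: assumes "length w0 = t" "length v0 = b" shows "ex b t (wunit w0 v0) = e w0 v0"
proof -
  have "ex b t (wunit w0 v0) = (\<Sum>w\<in>words t. \<Sum>v\<in>words b. if v = v0 then (if w = w0 then e w v else 0) else 0)"
    unfolding ex_def by (intro sum.cong[OF HOL.refl]) (auto simp: wunit_def)
  then show ?thesis using assms by (simp add: sum.delta)
qed

lemma ex_add: "ex b t (\<lambda>w v. f w v + g w v) = ex b t f + ex b t g"
  by (simp add: ex_def scale_add_left sum.distrib)
lemma ex_scale: "ex b t (\<lambda>w v. c * f w v) = lin_scale c (ex b t f)"
  by (simp add: ex_def scale_sum scale_scale)
lemma ex_0: "ex b t (\<lambda>w v. 0) = 0" by (simp add: ex_def)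

lemma span_strands: "lin_of (Strands k) - ex k k (wid k) \<in> J m k k"
proof (induction k)
  case 0
  have "ex 0 0 (wid 0) = e [] []" by (simp add: ex_def wid_def)
  then show ?case using A_sym[OF e_id[of "[]"]] by simp
next
  case (Suc k)
  have "wid 1 = (\<lambda>w v. wunit [True] [True] w v + wunit [False] [False] w v)" using wid_1 by (intro ext)
  then have "ex 1 1 (wid 1) = e [True] [True] + e [False] [False]"
    using ex_add[of 1 1 "wunit [True] [True]" "wunit [False] [False]"] by (simp add: ex_wunit)
  moreover have "(P1 + Q1) - (e [True] [True] + e [False] [False]) \<in> J m 1 1"
    using A_sym[OF e_id[of "[True]"]] A_sym[OF e_id[of "[False]"]] by (intro A_add) (simp_all add: lin_juxt_empty)
  ultimately have 1: "lin_of (Strands 1) - ex 1 1 (wid 1) \<in> J m 1 1" using A_trans[OF rel_facts(3)] by simp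
  have "lin_of (Strands 1) \<otimes>\<^sub>t lin_of (Strands k) - ex 1 1 (wid 1) \<otimes>\<^sub>t ex k k (wid k) \<in> J m (1 + k) (1 + k)"
    by (rule A_juxt[OF 1 Suc fp_ex fp_strands])
  from A_trans[OF this ex_ten[OF dp_basic(1) dp_basic(1)]]
  show ?case unfolding lin_strands_add wten_id by simp
qed

lemma span_cup: "lin_of Cup - ex 0 2 wcup \<in> J m 0 2" "lin_of Cap - ex 2 0 wcap \<in> J m 2 0"
proof -
  let ?X = "lin_of (Strands 1) :: gen lin"
  have w: "wcup = (\<lambda>w v. wunit [True, False] [] w v + wunit [False, True] [] w v)"
    "wcap = (\<lambda>w v. wunit [] [True, False] w v + wunit [] [False, True] w v)"
    by (auto simp: wcup_def wcap_def wunit_def fun_eq_iff)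
  have e: "ex 0 2 wcup = e [True, False] [] + e [False, True] []" "ex 2 0 wcap = e [] [True, False] + e [] [False, True]"
    unfolding w ex_add by (simp_all add: ex_wunit)
  have x: "?X \<otimes>\<^sub>t ?X - (P1 + Q1) \<otimes>\<^sub>t ?X \<in> J m 2 2"
    using A_juxt[OF rel_facts(3), of ?X ?X 1 1] J_0 fp_add[OF fp_gens(1,2)] by (simp add: numeral_2_eq_2)
  have f: "(P1 + Q1) \<otimes>\<^sub>t ?X \<in> fp m 2 2" "?X \<otimes>\<^sub>t ?X \<in> fp m 2 2" using fp_add[OF fp_PQ] fp_juxt[OF fp_strands[of 1] fp_strands[of 1]]
    by (simp_all add: juxt_add_left numeral_2_eq_2)
  have c: "(?X \<otimes>\<^sub>t ?X) \<circ>\<^sub>t lin_of Cup = lin_of Cup" "lin_of Cap \<circ>\<^sub>t (?X \<otimes>\<^sub>t ?X) = lin_of Cap"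
    unfolding lin_strands_add one_add_one by (simp_all only: lin_strands(1)[OF fp_gens(3)] lin_strands(2)[OF fp_gens(4)])
  have "lin_of Cup - ((P1 + Q1) \<otimes>\<^sub>t ?X) \<circ>\<^sub>t lin_of Cup \<in> J m 0 2"
    using A_stack[OF x _ f(1) fp_gens(3), of "lin_of Cup"] J_0 by (simp add: c[unfolded One_nat_def])
  then show "lin_of Cup - ex 0 2 wcup \<in> J m 0 2"
    using A_sym[OF A_add[OF e_cup]] unfolding e by (auto simp: juxt_add_left stack_add_left intro: A_trans)
  have "lin_of Cap - lin_of Cap \<circ>\<^sub>t ((P1 + Q1) \<otimes>\<^sub>t ?X) \<in> J m 2 0"
    using A_stack[OF _ x fp_gens(4) f(2), of "lin_of Cap"] J_0 by (simp add: c[unfolded One_nat_def])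
  then show "lin_of Cap - ex 2 0 wcap \<in> J m 2 0"
    using A_sym[OF A_add[OF e_cap]] unfolding e by (auto simp: juxt_add_left stack_add_right intro: A_trans)
qed

text \<open>Every diagram is modulo the ideal the lift of its own matrix: this holds for strands, cups, caps and
  boxes, and lifting respects stacking and juxtaposition because the matrix units multiply as they should.\<close>

lemma span: "well_formed d \<Longrightarrow> set (box_list d) \<subseteq> gens m \<Longrightarrow> lin_of d - ex (bot_points d) (top_points d) (val m d) \<in> J m (bot_points d) (top_points d)"
proof (induction d)
  case (Strands k) then show ?case using span_strands by simp
next
  case Cup then show ?case using span_cup by simp
next
  case Cap then show ?case using span_cup by simp
next
  case (Box l b t)
  then consider "l = Gen_P" "b = 1" "t = 1" | "l = Gen_U" "b = a_of m" "t = n_of m" | "l = Gen_Ustar" "b = n_of m" "t = a_of m"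
    by (auto simp: gens_def)
  then show ?case
  proof cases
    case 1
    have "gval m Gen_P 1 1 = wunit [True] [True]" by (simp add: gval_def)
    then show ?thesis using A_sym[OF e_id[of "[True]"]] ex_wunit[of "[True]" 1 "[True]" 1] unfolding 1 val.simps top_points.simps bot_points.simps P1_def[symmetric]
      by (simp add: lin_juxt_empty)
  next
    case 2
    have "gval m Gen_U (a_of m) (n_of m) = wunit (neg (n_of m)) (pos (a_of m))" by (simp add: gval_def)
    then show ?thesis using A_sym[OF e_U(1)] unfolding 2 val.simps top_points.simps bot_points.simps U_def[symmetric]
      by (simp add: ex_wunit)
  next
    case 3
    have "gval m Gen_Ustar (n_of m) (a_of m) = wunit (pos (a_of m)) (neg (n_of m))" by (simp add: gval_def)
    then show ?thesis using A_sym[OF e_U(2)] unfolding 3 val.simps top_points.simps bot_points.simps Ustar_def[symmetric]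
      by (simp add: ex_wunit)
  qed
next
  case (Stack d d')
  have f: "lin_of d' \<in> fp m (bot_points d') (bot_points d)" using Stack.prems by (intro fp_lin_of) auto
  have "lin_of d \<circ>\<^sub>t lin_of d' - ex (bot_points d) (top_points d) (val m d) \<circ>\<^sub>t ex (bot_points d') (bot_points d) (val m d') \<in> J m (bot_points d') (top_points d)"
    using Stack f by (intro A_stack[where k = "bot_points d"] fp_ex) auto
  from A_trans[OF this ex_cmp[OF dp_val dp_val]] show ?case by (simp add: lin_of_stack)
next
  case (Juxt d d')
  have f: "lin_of d' \<in> fp m (bot_points d') (top_points d')" using Juxt.prems by (intro fp_lin_of) auto
  have "lin_of d \<otimes>\<^sub>t lin_of d' - ex (bot_points d) (top_points d) (val m d) \<otimes>\<^sub>t ex (bot_points d') (top_points d') (val m d')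
    \<in> J m (bot_points d + bot_points d') (top_points d + top_points d')"
    using Juxt f by (intro A_juxt fp_ex) auto
  from A_trans[OF this ex_ten[OF dp_val dp_val]] show ?case by (simp add: lin_of_juxt)
qed

lemma tangle_cases: obtains d where "T = abs_tangle d"
  using Quotient_abs_rep[OF Quotient_tangle, of T] by metis

lemma span_fp: "x \<in> fp m b t \<Longrightarrow> x - ex b t (lval m x) \<in> J m b t"
proof (induction rule: fp_induct)
  case zero
  have "lval m 0 = (\<lambda>w v. 0)" by (simp add: fun_eq_iff)
  then show ?case by (simp add: ex_0 J_0)
next
  case (single T c)
  obtain d where T: "T = abs_tangle d" by (rule tangle_cases)
  have d: "well_formed d" "bot_points d = b" "top_points d = t" "set (box_list d) \<subseteq> gens m"
    using single by (simp_all add: T t_well_formed.abs_eq t_bot.abs_eq t_top.abs_eq t_boxes.abs_eq)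
  have "lval m (sgl T c) = (\<lambda>w v. c * val m d w v)" by (intro ext) (simp add: T tval.abs_eq)
  moreover have "sgl T c = lin_scale c (lin_of d)" by (simp add: T lin_of_def)
  ultimately show ?case using A_scale[OF span[OF d(1,4)], of c] d by (simp add: ex_scale)
next
  case (add x y)
  have "lval m (x + y) = (\<lambda>w v. lval m x w v + lval m y w v)" by (intro ext) (rule lval_add)
  then show ?case using A_add[OF add.IH] by (simp add: ex_add)
qed

lemma dp_lval: "x \<in> fp m b t \<Longrightarrow> dp (lval m x)"
proof (induction rule: fp_induct)
  case (single T c)
  obtain d where T: "T = abs_tangle d" by (rule tangle_cases)
  show ?case using dp_val[of d] by (auto simp: dp_def T tval.abs_eq)
next
  case (add x y) then show ?case unfolding dp_def by (metis lval_add add.right_neutral)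
qed (simp add: dp_def)

text \<open>The ideal lies in the kernel as the relations hold for matrices. Conversely \<open>x\<close> is congruent to the
  lift of its matrix, which is 0 when the matrix is.\<close>

theorem faithful: assumes "x \<in> fp m b t" shows "x \<in> J m b t \<longleftrightarrow> lval m x = (\<lambda>w v. 0)"
proof
  show "x \<in> J m b t \<Longrightarrow> lval m x = (\<lambda>w v. 0)" using ideal_props(1) by (auto simp: ker_def)
  show "lval m x = (\<lambda>w v. 0) \<Longrightarrow> x \<in> J m b t" using span_fp[OF assms] by (simp add: ex_0)
qed

lemma faithful_eq: assumes "x \<in> fp m b t" "y \<in> fp m b t" shows "x - y \<in> J m b t \<longleftrightarrow> lval m x = lval m y"
  using faithful[OF fp_diff[OF assms]] by (auto simp: lval_diff fun_eq_iff)

lemma lval_lpw: "lval m (lpw w) = wunit w w"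
proof (induction w)
  case Nil show ?case by (auto simp: lval_lin_of wid_def wunit_def fun_eq_iff)
next
  case (Cons x w)
  have "lval m P1 = wunit [True] [True]" "lval m Q1 = wunit [False] [False]" by (simp_all add: P1_diag Q1_diag lval_lin_of)
  then show ?case using Cons by (cases x) (simp_all add: lval_juxt[OF fp_gens(1)] lval_juxt[OF fp_gens(2)] wunit_ten)
qed

lemma wunit_left: "length w = k \<Longrightarrow> wcomp k (wunit w w) f x y = (if x = w then f w y else 0)"
  "length w = k \<Longrightarrow> wcomp k f (wunit w w) y x = (if x = w then f y w else 0)"
proof -
  assume k: "length w = k"
  have "wcomp k (wunit w w) f x y = (\<Sum>u\<in>words k. if u = w then (if x = w then f w y else 0) else 0)"
    unfolding wcomp_def by (intro sum.cong) (auto simp: wunit_def)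
  then show "wcomp k (wunit w w) f x y = (if x = w then f w y else 0)" using k by (simp add: sum.delta)
  have "wcomp k f (wunit w w) y x = (\<Sum>u\<in>words k. if u = w then (if x = w then f y w else 0) else 0)"
    unfolding wcomp_def by (intro sum.cong) (auto simp: wunit_def)
  then show "wcomp k f (wunit w w) y x = (if x = w then f y w else 0)" using k by (simp add: sum.delta)
qed

lemma lval_e: assumes "same_deg m v w" shows "lval m (e w v) = wunit w v"
proof -
  have u: "lval m (e y x) = (\<lambda>w' v'. lval m (e y x) y x * wunit y x w' v')" if "same_deg m x y" for x y
  proof -
    have "lval m (lpw y \<circ>\<^sub>t e y x) = lval m (e y x)" "lval m (e y x \<circ>\<^sub>t lpw x) = lval m (e y x)"
      using e_absorb[OF that] fp_stack[OF fp_lpw e_fp] fp_stack[OF e_fp fp_lpw] e_fp by (metis faithful_eq)+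
    then have "wcomp (length y) (wunit y y) (lval m (e y x)) = lval m (e y x)" "wcomp (length x) (lval m (e y x)) (wunit x x) = lval m (e y x)"
      by (simp_all add: lval_stack[OF fp_lpw] lval_stack[OF e_fp] lval_lpw)
    then have z: "lval m (e y x) w' v' = (if w' = y then lval m (e y x) y v' else 0)"
      "lval m (e y x) w' v' = (if v' = x then lval m (e y x) w' x else 0)" for w' v'
      using wunit_left[OF HOL.refl] by metis+
    show ?thesis
    proof (intro ext)
      fix w' v'
      show "lval m (e y x) w' v' = lval m (e y x) y x * wunit y x w' v'"
      proof (cases "w' = y \<and> v' = x")
        case True then show ?thesis by (simp add: wunit_def)
      next
        case False
        then have "lval m (e y x) w' v' = 0" using z(1)[of w' v'] z(2)[of w' v'] by argo
        with False show ?thesis by (auto simp: wunit_def)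
      qed
    qed
  qed
  define c where "c = lval m (e w v) w v"
  define c' where "c' = lval m (e v w) v w"
  have c: "lval m (e w v) = (\<lambda>w' v'. c * wunit w v w' v')" "lval m (e v w) = (\<lambda>w' v'. c' * wunit v w w' v')"
    using u[OF assms] u[OF same_deg_simps(2)[OF assms]] by (simp_all add: c_def c'_def)
  have "e w v \<circ>\<^sub>t e v w - lpw w \<in> J m (length w) (length w)"
    using A_trans[OF e_cmp[OF assms same_deg_simps(2)[OF assms]] e_id] .
  then have "wcomp (length v) (lval m (e w v)) (lval m (e v w)) = wunit w w"
    using faithful_eq[OF fp_stack[OF e_fp e_fp] fp_lpw] by (simp add: lval_stack[OF e_fp] lval_lpw)
  then have "wcomp (length v) (lval m (e w v)) (lval m (e v w)) w w = 1" by (simp add: wunit_def)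
  then have cc: "c \<noteq> 0" unfolding c(1) wcomp_def by auto
  have "ex (length v) (length w) (lval m (e w v)) = lin_scale c (e w v)"
    unfolding c ex_scale by (simp add: ex_wunit)
  then have "e w v - lin_scale c (e w v) \<in> J m (length v) (length w)" using span_fp[OF e_fp] by metis
  then have "lval m (e w v) w v = c * lval m (e w v) w v"
    using faithful_eq[OF e_fp fp_scale[OF e_fp]] by (metis lval_scale)
  then have "c = 1" using cc by (simp add: c_def)
  then show ?thesis using c(1) by simp
qed

lemma lval_ex: assumes "dp f" "supp b t f" shows "lval m (ex b t f) = f"
proof (rule wmat_eqI[of b t])
  fix w0 v0 :: "bool list" assume l: "length w0 = t" "length v0 = b"
  have "f w v * lval m (e w v) w0 v0 = (if v = v0 then if w = w0 then f w v else 0 else 0)" for w v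
    using assms(1) lval_e[of v w] by (cases "f w v = 0") (auto simp: dp_def wunit_def)
  then have "lval m (ex b t f) w0 v0 = (\<Sum>w\<in>words t. \<Sum>v\<in>words b. if v = v0 then if w = w0 then f w v else 0 else 0)"
    by (simp add: ex_def lval_sum lval_scale)
  also have "\<dots> = f w0 v0" using l by (simp add: sum.delta)
  finally show "lval m (ex b t f) w0 v0 = f w0 v0" .
qed (use assms supp_lval[OF fp_ex] in auto)

text \<open>The matrix of a class; the representative does not matter as the ideal lies in the kernel.\<close>

definition cval :: "gen lin set \<Rightarrow> wmat" where "cval c = lval m (SOME x. x \<in> c)"

lemma cval_cl: assumes "x \<in> fp m b t" shows "cval (cl b t x) = lval m x"
proof -
  have "(SOME y. y \<in> cl b t x) \<in> cl b t x" using cl_self[OF assms] by (rule someI)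
  then show ?thesis unfolding cval_def using faithful_eq[OF _ assms] by (auto simp: cl_def)
qed

lemma cval_inj: "c \<in> pspace m 1 b t \<Longrightarrow> c' \<in> pspace m 1 b t \<Longrightarrow> cval c = cval c' \<Longrightarrow> c = c'"
proof -
  assume "c \<in> pspace m 1 b t" "c' \<in> pspace m 1 b t" "cval c = cval c'"
  then obtain x y where x: "x \<in> fp m b t" "c = cl b t x" and y: "y \<in> fp m b t" "c' = cl b t y"
    unfolding pspace_cl by blast
  have "lval m x = lval m y" using \<open>cval c = cval c'\<close> unfolding x(2) y(2) cval_cl[OF x(1)] cval_cl[OF y(1)] .
  then show "c = c'" unfolding x(2) y(2) using faithful_eq[OF x(1) y(1)] by (intro cl_cong) blast
qed

lemma cval_type: "c \<in> pspace m 1 b t \<Longrightarrow> dp (cval c) \<and> supp b t (cval c)"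
  unfolding pspace_cl using dp_lval supp_lval by (auto simp: cval_cl)

lemma cval_surj: assumes "dp f" "supp b t f" shows "\<exists>c \<in> pspace m 1 b t. cval c = f"
  using lval_ex[OF assms] fp_ex[of b t f] cval_cl[OF fp_ex] by (intro bexI[of _ "cl b t (ex b t f)"]) auto

lemma cval_ops:
  "c \<in> pspace m 1 k t \<Longrightarrow> c' \<in> pspace m 1 b k \<Longrightarrow> pstack m 1 b t c c' \<in> pspace m 1 b t \<and> cval (pstack m 1 b t c c') = wcomp k (cval c) (cval c')"
  "c \<in> pspace m 1 b t \<Longrightarrow> c' \<in> pspace m 1 b' t' \<Longrightarrow> pjuxt m 1 (b + b') (t + t') c c' \<in> pspace m 1 (b + b') (t + t') \<and>
     cval (pjuxt m 1 (b + b') (t + t') c c') = wten t b (cval c) (cval c')"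
  "c \<in> pspace m 1 b t \<Longrightarrow> c' \<in> pspace m 1 b t \<Longrightarrow> padd m 1 b t c c' \<in> pspace m 1 b t \<and> cval (padd m 1 b t c c') = (\<lambda>w v. cval c w v + cval c' w v)"
  "c \<in> pspace m 1 b t \<Longrightarrow> pscale m 1 b t z c \<in> pspace m 1 b t \<and> cval (pscale m 1 b t z c) = (\<lambda>w v. z * cval c w v)"
  "cl b t 0 \<in> pspace m 1 b t \<and> cval (cl b t 0) = (\<lambda>w v. 0)"
  "cl k k (lin_of (Strands k)) \<in> pspace m 1 k k \<and> cval (cl k k (lin_of (Strands k))) = wid k"
proof -
  assume "c \<in> pspace m 1 k t" "c' \<in> pspace m 1 b k"
  then show "pstack m 1 b t c c' \<in> pspace m 1 b t \<and> cval (pstack m 1 b t c c') = wcomp k (cval c) (cval c')"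
    unfolding pspace_cl by (auto simp: pstack_cl fp_stack cval_cl lval_stack)
next
  assume "c \<in> pspace m 1 b t" "c' \<in> pspace m 1 b' t'"
  then show "pjuxt m 1 (b + b') (t + t') c c' \<in> pspace m 1 (b + b') (t + t') \<and>
     cval (pjuxt m 1 (b + b') (t + t') c c') = wten t b (cval c) (cval c')"
    unfolding pspace_cl by (auto simp: pjuxt_cl fp_juxt cval_cl lval_juxt)
next
  assume "c \<in> pspace m 1 b t" "c' \<in> pspace m 1 b t"
  then show "padd m 1 b t c c' \<in> pspace m 1 b t \<and> cval (padd m 1 b t c c') = (\<lambda>w v. cval c w v + cval c' w v)"
    unfolding pspace_cl by (auto simp: padd_cl fp_add cval_cl lval_add fun_eq_iff)
next
  assume "c \<in> pspace m 1 b t"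
  then show "pscale m 1 b t z c \<in> pspace m 1 b t \<and> cval (pscale m 1 b t z c) = (\<lambda>w v. z * cval c w v)"
    unfolding pspace_cl by (auto simp: pscale_cl fp_scale cval_cl lval_scale fun_eq_iff)
next
  show "cl b t 0 \<in> pspace m 1 b t \<and> cval (cl b t 0) = (\<lambda>w v. 0)" by (auto simp: cval_cl fun_eq_iff)
  show "cl k k (lin_of (Strands k)) \<in> pspace m 1 k k \<and> cval (cl k k (lin_of (Strands k))) = wid k"
    by (auto simp: cval_cl lval_lin_of)
qed

lemma cval_adjoint: assumes "c \<in> pspace m 1 b t"
  shows "padjoint m 1 t b c \<in> pspace m 1 t b \<and> cval (padjoint m 1 t b c) = (\<lambda>w v. cnj (cval c v w))"
proof -
  obtain x where x: "x \<in> fp m b t" "c = cl b t x" using assms by (auto simp: pspace_cl)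
  have "cl t b (lin_adjoint gen_star y) = cl t b (lin_adjoint gen_star x)" if "y \<in> cl b t x" for y
  proof (rule cl_cong)
    have y: "y \<in> fp m b t" "lval m y = lval m x" using that faithful_eq x by (auto simp: cl_def)
    then show "lin_adjoint gen_star y - lin_adjoint gen_star x \<in> J m t b"
      using faithful_eq[OF fp_adjoint[OF y(1)] fp_adjoint[OF x(1)]] lval_adjoint[OF y(1)] lval_adjoint[OF x(1)]
      by (simp add: fun_eq_iff)
  qed
  then have "padjoint m 1 t b c = (\<Union>y \<in> cl b t x. cl t b (lin_adjoint gen_star x))"
    unfolding padjoint_def x(2) by (intro SUP_cong[OF HOL.refl])
  moreover have "cl b t x \<noteq> {}" using cl_self[OF x(1)] by blast
  ultimately have "padjoint m 1 t b c = cl t b (lin_adjoint gen_star x)" by (simp only: UN_constant if_False)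
  then show ?thesis using x fp_adjoint[OF x(1)] by (auto simp: cval_cl lval_adjoint[OF x(1)] fun_eq_iff)
qed

end

section \<open>Strict monoidal linear categories\<close>

text \<open>With identity associators and unitors the coherence conditions become reflexivity.\<close>

locale strict_linear_monoidal_category = linear_category C for C :: "('o, 'm) lmcat" +
  assumes sUnit_closed: "Unit C \<in> Obj C"
    and sTenO_closed: "\<lbrakk>X \<in> Obj C; Y \<in> Obj C\<rbrakk> \<Longrightarrow> TenO C X Y \<in> Obj C"
    and sTenM_closed:
      "\<lbrakk>X \<in> Obj C; X' \<in> Obj C; Y \<in> Obj C; Y' \<in> Obj C; f \<in> Hom C X X'; g \<in> Hom C Y Y'\<rbrakk>
        \<Longrightarrow> TenM C X X' Y Y' f g \<in> Hom C (TenO C X Y) (TenO C X' Y')"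
    and sTenM_Id:
      "\<lbrakk>X \<in> Obj C; Y \<in> Obj C\<rbrakk> \<Longrightarrow> TenM C X X Y Y (Idm C X) (Idm C Y) = Idm C (TenO C X Y)"
    and sTenM_Comp:
      "\<lbrakk>X \<in> Obj C; X' \<in> Obj C; X'' \<in> Obj C; Y \<in> Obj C; Y' \<in> Obj C; Y'' \<in> Obj C;
        f \<in> Hom C X X'; f' \<in> Hom C X' X''; g \<in> Hom C Y Y'; g' \<in> Hom C Y' Y''\<rbrakk>
        \<Longrightarrow> TenM C X X'' Y Y'' (Comp C X X' X'' f' f) (Comp C Y Y' Y'' g' g)
            = Comp C (TenO C X Y) (TenO C X' Y') (TenO C X'' Y'')
                (TenM C X' X'' Y' Y'' f' g') (TenM C X X' Y Y' f g)"
    and sTenM_add_left: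
      "\<lbrakk>X \<in> Obj C; X' \<in> Obj C; Y \<in> Obj C; Y' \<in> Obj C;
        f \<in> Hom C X X'; f' \<in> Hom C X X'; g \<in> Hom C Y Y'\<rbrakk>
        \<Longrightarrow> TenM C X X' Y Y' (Add C X X' f f') g
            = Add C (TenO C X Y) (TenO C X' Y') (TenM C X X' Y Y' f g) (TenM C X X' Y Y' f' g)"
    and sTenM_add_right:
      "\<lbrakk>X \<in> Obj C; X' \<in> Obj C; Y \<in> Obj C; Y' \<in> Obj C;
        f \<in> Hom C X X'; g \<in> Hom C Y Y'; g' \<in> Hom C Y Y'\<rbrakk>
        \<Longrightarrow> TenM C X X' Y Y' f (Add C Y Y' g g')
            = Add C (TenO C X Y) (TenO C X' Y') (TenM C X X' Y Y' f g) (TenM C X X' Y Y' f g')"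
    and sTenM_scale_left:
      "\<lbrakk>X \<in> Obj C; X' \<in> Obj C; Y \<in> Obj C; Y' \<in> Obj C; f \<in> Hom C X X'; g \<in> Hom C Y Y'\<rbrakk>
        \<Longrightarrow> TenM C X X' Y Y' (Scale C X X' c f) g
            = Scale C (TenO C X Y) (TenO C X' Y') c (TenM C X X' Y Y' f g)"
    and sTenM_scale_right:
      "\<lbrakk>X \<in> Obj C; X' \<in> Obj C; Y \<in> Obj C; Y' \<in> Obj C; f \<in> Hom C X X'; g \<in> Hom C Y Y'\<rbrakk>
        \<Longrightarrow> TenM C X X' Y Y' f (Scale C Y Y' c g)
            = Scale C (TenO C X Y) (TenO C X' Y') c (TenM C X X' Y Y' f g)"
    and TenO_assoc: "\<lbrakk>X \<in> Obj C; Y \<in> Obj C; Z \<in> Obj C\<rbrakk> \<Longrightarrow> TenO C (TenO C X Y) Z = TenO C X (TenO C Y Z)"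
    and TenO_unit: "X \<in> Obj C \<Longrightarrow> TenO C (Unit C) X = X" "X \<in> Obj C \<Longrightarrow> TenO C X (Unit C) = X"
    and Assoc_Id: "\<lbrakk>X \<in> Obj C; Y \<in> Obj C; Z \<in> Obj C\<rbrakk> \<Longrightarrow> Assoc C X Y Z = Idm C (TenO C X (TenO C Y Z))"
    and LUnit_Id: "X \<in> Obj C \<Longrightarrow> LUnit C X = Idm C X" and RUnit_Id: "X \<in> Obj C \<Longrightarrow> RUnit C X = Idm C X"
    and TenM_assoc: "\<lbrakk>X \<in> Obj C; X' \<in> Obj C; Y \<in> Obj C; Y' \<in> Obj C; Z \<in> Obj C; Z' \<in> Obj C;
        f \<in> Hom C X X'; g \<in> Hom C Y Y'; h \<in> Hom C Z Z'\<rbrakk>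
        \<Longrightarrow> TenM C (TenO C X Y) (TenO C X' Y') Z Z' (TenM C X X' Y Y' f g) h
          = TenM C X X' (TenO C Y Z) (TenO C Y' Z') f (TenM C Y Y' Z Z' g h)"
    and TenM_unit: "\<lbrakk>X \<in> Obj C; Y \<in> Obj C; f \<in> Hom C X Y\<rbrakk> \<Longrightarrow> TenM C (Unit C) (Unit C) X Y (Idm C (Unit C)) f = f"
      "\<lbrakk>X \<in> Obj C; Y \<in> Obj C; f \<in> Hom C X Y\<rbrakk> \<Longrightarrow> TenM C X Y (Unit C) (Unit C) f (Idm C (Unit C)) = f"
begin

lemma iso_Id: "X \<in> Obj C \<Longrightarrow> is_iso C X X (Idm C X)"
  unfolding is_iso_def using Id_closed Comp_Id_left by blast

lemma is_linear_monoidal: "linear_monoidal_category C"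
  by unfold_locales
   (simp_all add: sUnit_closed sTenO_closed sTenM_closed sTenM_Id sTenM_Comp sTenM_add_left sTenM_add_right
     sTenM_scale_left sTenM_scale_right TenO_assoc TenO_unit Assoc_Id LUnit_Id RUnit_Id TenM_assoc TenM_unit
     iso_Id Id_closed Comp_Id_left Comp_Id_right)

end

section \<open>Kronecker products\<close>

lemma kron_carrier [simp]: "A \<in> carrier_mat a b \<Longrightarrow> B \<in> carrier_mat c d \<Longrightarrow> kron A B \<in> carrier_mat (a * c) (b * d)"
  by (simp add: kron_def)

lemma kron_index: "A \<in> carrier_mat a b \<Longrightarrow> B \<in> carrier_mat c d \<Longrightarrow> i < a * c \<Longrightarrow> j < b * d \<Longrightarrow>
  kron A B $$ (i, j) = A $$ (i div c, j div d) * B $$ (i mod c, j mod d)"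
  by (simp add: kron_def carrier_matD)

lemma sum_div_mod: "(\<Sum>k<b * e. h (k div e) (k mod e)) = (\<Sum>k<b. \<Sum>l<e. h k l)" for b e :: nat
proof -
  have "(\<Sum>k<b. \<Sum>l<e. h k l) = (\<Sum>(k, l)\<in>{..<b} \<times> {..<e}. h k l)" by (simp add: sum.cartesian_product)
  also have "\<dots> = (\<Sum>k<b * e. h (k div e) (k mod e))"
  proof (rule sum.reindex_bij_witness[of _ "\<lambda>k. (k div e, k mod e)" "\<lambda>(k, l). k * e + l"])
    fix x assume "x \<in> {..<b} \<times> {..<e}"
    then obtain k l where x: "x = (k, l)" "k < b" "l < e" by auto
    have "k * e + l < Suc k * e" using x by simp
    also have "\<dots> \<le> b * e" using x by (intro mult_le_mono1) simp
    finally have "k * e + l < b * e" .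
    then show "(case x of (k, l) \<Rightarrow> k * e + l) \<in> {..<b * e}" by (simp add: x)
    show "((case x of (k, l) \<Rightarrow> k * e + l) div e, (case x of (k, l) \<Rightarrow> k * e + l) mod e) = x" using x by simp
    show "h ((case x of (k, l) \<Rightarrow> k * e + l) div e) ((case x of (k, l) \<Rightarrow> k * e + l) mod e) = (case x of (k, l) \<Rightarrow> h k l)"
      using x by simp
  next
    fix k assume k: "k \<in> {..<b * e}"
    then have e: "e > 0" by (cases e) auto
    show "(case (k div e, k mod e) of (k, l) \<Rightarrow> k * e + l) = k" by simp
    have "k div e < b" using k e by (simp add: less_mult_imp_div_less)
    then show "(k div e, k mod e) \<in> {..<b} \<times> {..<e}" using e by simp
  qed
  finally show ?thesis by simp
qed

lemma mult_index_sum: "A \<in> carrier_mat a b \<Longrightarrow> B \<in> carrier_mat b c \<Longrightarrow> i < a \<Longrightarrow> j < c \<Longrightarrow>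
  (A * B) $$ (i, j) = (\<Sum>k<b. A $$ (i, k) * B $$ (k, j))"
  by (simp add: scalar_prod_def lessThan_atLeast0)

lemma div_mod_less: fixes i a c :: nat assumes "i < a * c" shows "i div c < a" "i mod c < c"
  using assms by (auto simp: less_mult_imp_div_less) (cases c; simp)

lemma kron_mult:
  assumes A: "A \<in> carrier_mat a b" and A': "A' \<in> carrier_mat b c" and B: "B \<in> carrier_mat d e" and B': "B' \<in> carrier_mat e f"
  shows "kron (A * A') (B * B') = kron A B * kron A' B'"
proof (rule eq_matI)
  note AA = mult_carrier_mat[OF A A'] and BB = mult_carrier_mat[OF B B']
  have c1: "kron A B \<in> carrier_mat (a * d) (b * e)" "kron A' B' \<in> carrier_mat (b * e) (c * f)" using assms by simp_all
  have c2: "kron (A * A') (B * B') \<in> carrier_mat (a * d) (c * f)" using kron_carrier[OF AA BB] .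
  fix i j assume "i < dim_row (kron A B * kron A' B')" "j < dim_col (kron A B * kron A' B')"
  then have ij: "i < a * d" "j < c * f" using c1 by auto
  note i = div_mod_less[OF ij(1)] and j = div_mod_less[OF ij(2)]
  have "(kron A B * kron A' B') $$ (i, j) = (\<Sum>k<b * e. (A $$ (i div d, k div e) * B $$ (i mod d, k mod e)) * (A' $$ (k div e, j div f) * B' $$ (k mod e, j mod f)))"
    using ij by (simp add: mult_index_sum[OF c1 ij] kron_index[OF A B] kron_index[OF A' B'])
  also have "\<dots> = (\<Sum>k<b. \<Sum>l<e. (A $$ (i div d, k) * B $$ (i mod d, l)) * (A' $$ (k, j div f) * B' $$ (l, j mod f)))"
    by (rule sum_div_mod)
  also have "\<dots> = kron (A * A') (B * B') $$ (i, j)"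
    using ij by (simp add: kron_index[OF AA BB] mult_index_sum[OF A A' i(1) j(1)] mult_index_sum[OF B B' i(2) j(2)] sum_product mult_ac del: index_mult_mat)
  finally show "kron (A * A') (B * B') $$ (i, j) = (kron A B * kron A' B') $$ (i, j)" by simp
qed (use assms in \<open>auto simp: kron_def\<close>)

lemma kron_one: "kron (1\<^sub>m a) (1\<^sub>m b) = 1\<^sub>m (a * b)"
proof (rule eq_matI)
  fix i j assume "i < dim_row (1\<^sub>m (a * b) :: complex mat)" "j < dim_col (1\<^sub>m (a * b) :: complex mat)"
  then have ij: "i < a * b" "j < a * b" by auto
  have "i = j \<longleftrightarrow> i div b = j div b \<and> i mod b = j mod b" by (metis div_mult_mod_eq)
  then show "kron (1\<^sub>m a) (1\<^sub>m b) $$ (i, j) = (1\<^sub>m (a * b) :: complex mat) $$ (i, j)"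
    using ij div_mod_less[OF ij(1)] div_mod_less[OF ij(2)] by (auto simp: kron_index[of _ a a _ b b])
qed (auto simp: kron_def)

lemma kron_add: 
  assumes "A \<in> carrier_mat a b" "A' \<in> carrier_mat a b" "B \<in> carrier_mat c d" "B' \<in> carrier_mat c d"
  shows "kron (A + A') B = kron A B + kron A' B" "kron A (B + B') = kron A B + kron A B'"
    "kron (z \<cdot>\<^sub>m A) B = z \<cdot>\<^sub>m kron A B" "kron A (z \<cdot>\<^sub>m B) = z \<cdot>\<^sub>m kron A B"
proof -
  have d: "i div c < a" "i mod c < c" "j div d < b" "j mod d < d" if "i < a * c" "j < b * d" for i j
    using div_mod_less that by blast+
  show "kron (A + A') B = kron A B + kron A' B" "kron A (B + B') = kron A B + kron A B'"
    "kron (z \<cdot>\<^sub>m A) B = z \<cdot>\<^sub>m kron A B" "kron A (z \<cdot>\<^sub>m B) = z \<cdot>\<^sub>m kron A B"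
    using assms d by (auto intro!: eq_matI simp: kron_def algebra_simps)
qed

lemma kron_1: assumes "A \<in> carrier_mat a b" shows "kron (1\<^sub>m 1) A = A" "kron A (1\<^sub>m 1) = A"
  using assms by (auto intro!: eq_matI simp: kron_def)

lemma kron_assoc:
  assumes A: "A \<in> carrier_mat a b" and B: "B \<in> carrier_mat c d" and C: "C \<in> carrier_mat e f"
  shows "kron (kron A B) C = kron A (kron B C)"
proof (rule eq_matI)
  have AB: "kron A B \<in> carrier_mat (a * c) (b * d)" and BC: "kron B C \<in> carrier_mat (c * e) (d * f)" using assms by simp_all
  fix i j assume "i < dim_row (kron A (kron B C))" "j < dim_col (kron A (kron B C))"
  then have ij: "i < a * (c * e)" "j < b * (d * f)" using A BC by (auto simp: kron_def)
  then have ij': "i < (a * c) * e" "j < (b * d) * f" by (simp_all add: mult.assoc)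
  note i = div_mod_less[OF ij(1)] div_mod_less[OF ij'(1)] and j = div_mod_less[OF ij(2)] div_mod_less[OF ij'(2)]
  have e: "i div (c * e) = i div e div c" "i mod (c * e) div e = i div e mod c" "i mod (c * e) mod e = i mod e"
    "j div (d * f) = j div f div d" "j mod (d * f) div f = j div f mod d" "j mod (d * f) mod f = j mod f"
    using i(4) j(4) by (simp_all add: mult.commute[of _ e] mult.commute[of _ f] div_mult2_eq mod_mult2_eq)
  show "kron (kron A B) C $$ (i, j) = kron A (kron B C) $$ (i, j)"
    using i j ij ij' by (simp add: kron_index[OF AB C] kron_index[OF A B] kron_index[OF A BC] kron_index[OF B C] e)
qed (use assms in \<open>auto simp: kron_def\<close>)

section \<open>Diagonalization\<close>

lemma mat_assoc:
  fixes A B C :: "complex mat"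
  assumes "dim_col A = dim_row B" "dim_col B = dim_row C" shows "(A * B) * C = A * (B * C)"
  by (rule assoc_mult_mat[OF carrier_matI[OF HOL.refl HOL.refl] carrier_matI[OF assms(1)[symmetric] HOL.refl] carrier_matI[OF assms(2)[symmetric] HOL.refl]])

lemma mat_one: fixes A :: "complex mat"
  shows "dim_row A = n \<Longrightarrow> 1\<^sub>m n * A = A" "dim_col A = n \<Longrightarrow> A * 1\<^sub>m n = A"
  by (rule left_mult_one_mat[OF carrier_matI[OF _ HOL.refl]] right_mult_one_mat[OF carrier_matI[OF HOL.refl]], assumption)+

lemma conj_cancel: fixes D P Q :: "complex mat"
  assumes "D \<in> carrier_mat n n" "P \<in> carrier_mat n n" "Q \<in> carrier_mat n n" "Q * P = 1\<^sub>m n"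
  shows "Q * (P * D * Q) * P = D"
proof -
  have "Q * (P * Z) = Z" if "dim_row Z = n" for Z :: "complex mat"
    using that assms mat_assoc[of Q P Z] by (simp add: mat_one)
  then show ?thesis using assms by (simp add: mat_assoc mat_one carrier_matD[OF assms(1)])
qed


text \<open>In characteristic 0 the superdiagonal entry \<open>(k + 1) a\<^sup>k\<close> of a power of a block of size at least 2
  cannot be 1 while the diagonal entry satisfies \<open>a\<^sup>k\<^sup>+\<^sup>1 = a\<close>.\<close>

lemma jordan_block_periodic:
  assumes "jordan_block n (a :: complex) ^\<^sub>m Suc k = jordan_block n a" "k > 0" shows "n \<le> 1"
proof (rule ccontr)
  assume "\<not> n \<le> 1"
  then have n: "0 < n" "1 < n" by auto
  have e: "(jordan_block n a ^\<^sub>m Suc k) $$ (0, 0) = a" "(jordan_block n a ^\<^sub>m Suc k) $$ (0, 1) = 1"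
    unfolding assms(1) using n by simp_all
  have "a ^ Suc k = a" "of_nat (Suc k) * a ^ k = 1" using e n unfolding jordan_block_pow by simp_all
  then have "a * 1 = of_nat (Suc k) * a" by (metis mult.left_commute power_Suc)
  then have "of_nat k * a = 0" by (simp add: algebra_simps)
  then have "a = 0" using assms(2) by simp
  have "a ^ k = 0" using \<open>a = 0\<close> assms(2) by (simp add: power_0_left)
  then show False using \<open>of_nat (Suc k) * a ^ k = 1\<close> by (metis mult_zero_right zero_neq_one)
qed

lemma jordan_matrix_periodic:
  assumes "jordan_matrix n_as ^\<^sub>m Suc k = jordan_matrix (n_as :: (nat \<times> complex) list)" "k > 0" shows "diagonal_mat (jordan_matrix n_as)"
  using assms(1)
proof (induction n_as)
  case Nil then show ?case by (simp add: diagonal_mat_def jordan_matrix_def)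
next
  case (Cons na n_as)
  obtain n a where na: "na = (n, a)" by force
  let ?J = "jordan_matrix n_as" and ?B = "jordan_block n a" and ?s = "sum_list (map fst n_as)"
  have D: "diag_block_mat (map (\<lambda>(n, a). jordan_block n a ^\<^sub>m Suc k) n_as) = ?J ^\<^sub>m Suc k"
    by (rule jordan_matrix_pow[symmetric])
  have dJ: "?J ^\<^sub>m Suc k \<in> carrier_mat ?s ?s" by (intro pow_carrier_mat) simp
  have p: "jordan_matrix ((n, a) # n_as) ^\<^sub>m Suc k = four_block_mat (?B ^\<^sub>m Suc k) (0\<^sub>m n ?s) (0\<^sub>m ?s n) (?J ^\<^sub>m Suc k)"
    unfolding jordan_matrix_pow[of "(n, a) # n_as"] list.map case_prod_conv diag_block_mat.simps Let_def D
    using carrier_matD[OF dJ] by (simp del: pow_mat.simps)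
  have q: "jordan_matrix ((n, a) # n_as) = four_block_mat ?B (0\<^sub>m n ?s) (0\<^sub>m ?s n) ?J" by (rule jordan_matrix_Cons)
  have eq: "four_block_mat (?B ^\<^sub>m Suc k) (0\<^sub>m n ?s) (0\<^sub>m ?s n) (?J ^\<^sub>m Suc k) = four_block_mat ?B (0\<^sub>m n ?s) (0\<^sub>m ?s n) ?J"
    using Cons.prems p q by (simp add: na)
  have B: "?B ^\<^sub>m Suc k = ?B"
  proof (rule eq_matI)
    fix i j assume "i < dim_row ?B" "j < dim_col ?B"
    then show "(?B ^\<^sub>m Suc k) $$ (i, j) = ?B $$ (i, j)"
      using arg_cong[OF eq, of "\<lambda>M. M $$ (i, j)"] by (simp del: pow_mat.simps)
  qed auto
  have J: "?J ^\<^sub>m Suc k = ?J"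
  proof (rule eq_matI)
    fix i j assume "i < dim_row ?J" "j < dim_col ?J"
    then show "(?J ^\<^sub>m Suc k) $$ (i, j) = ?J $$ (i, j)"
      using arg_cong[OF eq, of "\<lambda>M. M $$ (n + i, n + j)"] by (simp del: pow_mat.simps)
  qed auto
  have d: "diagonal_mat ?J" by (rule Cons.IH[OF J])
  have n: "n \<le> 1" by (rule jordan_block_periodic[OF B assms(2)])
  show ?case unfolding na q diagonal_mat_def using d n by (auto simp: diagonal_mat_def)
qed

text \<open>One criterion serves twice: an idempotent satisfies \<open>A\<^sup>2 = A\<close>, and the generator of a finite cyclic
  group satisfies \<open>A\<^sup>m\<^sup>+\<^sup>1 = A\<close>.\<close>

lemma periodic_diagonalizable:
  assumes A: "(A :: complex mat) \<in> carrier_mat n n" and p: "A ^\<^sub>m Suc k = A" "k > 0"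
  obtains D P Q where "D \<in> carrier_mat n n" "P \<in> carrier_mat n n" "Q \<in> carrier_mat n n" "diagonal_mat D"
    "A = P * D * Q" "P * Q = 1\<^sub>m n" "Q * P = 1\<^sub>m n"
proof -
  obtain as where "char_poly A = (\<Prod>a\<leftarrow>as. [:- a, 1:])" using char_poly_factorized[OF A] by blast
  then obtain n_as where "jordan_nf A n_as" using jordan_nf_exists[OF A] by blast
  then have "similar_mat A (jordan_matrix n_as)" by (simp add: jordan_nf_def)
  then obtain P Q where w: "similar_mat_wit A (jordan_matrix n_as) P Q" by (auto simp: similar_mat_def)
  let ?D = "jordan_matrix n_as"
  note W = similar_mat_witD2[OF A w]
  have "similar_mat_wit (A ^\<^sub>m Suc k) (?D ^\<^sub>m Suc k) P Q" by (rule similar_mat_wit_pow[OF w])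
  then have "similar_mat_wit A (?D ^\<^sub>m Suc k) P Q" using p(1) by simp
  note W' = similar_mat_witD2[OF A this]
  have 1: "Q * A * P = ?D" using conj_cancel[of ?D n P Q] W by simp
  have "Q * A * P = ?D ^\<^sub>m Suc k" using conj_cancel[of "?D ^\<^sub>m Suc k" n P Q] W W' by (simp del: pow_mat.simps)
  then have "?D ^\<^sub>m Suc k = ?D" using 1 by simp
  then have "diagonal_mat ?D" by (rule jordan_matrix_periodic[OF _ p(2)])
  then show thesis using that W by blast
qed

text \<open>Diagonalise and keep the basis vectors with eigenvalue 1.\<close>

lemma idempotent_splits:
  assumes A: "(A :: complex mat) \<in> carrier_mat n n" and p: "A * A = A"
  obtains r B K where "B \<in> carrier_mat n r" "K \<in> carrier_mat r n" "B * K = A" "K * B = 1\<^sub>m r"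
proof -
  have "A ^\<^sub>m Suc 1 = A" using A p by simp
  from periodic_diagonalizable[OF A this] obtain D P Q where D: "D \<in> carrier_mat n n" "P \<in> carrier_mat n n" "Q \<in> carrier_mat n n" "diagonal_mat D"
    "A = P * D * Q" "P * Q = 1\<^sub>m n" "Q * P = 1\<^sub>m n" by auto
  have c: "Q * (P * Z) = Z" if "dim_row Z = n" for Z :: "complex mat"
    using that D(2,3,7) mat_assoc[of Q P Z] by (simp add: mat_one)
  have "A * A = P * (D * D) * Q" using D by (simp add: mat_assoc c)
  then have "Q * A * P = D * D" using conj_cancel[of "D * D" n P Q] D p by simp
  then have DD: "D * D = D" using conj_cancel[of D n P Q] D by simp
  have d: "D $$ (i, i) = 0 \<or> D $$ (i, i) = 1" if i: "i < n" for i
  proof -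
    have "(D * D) $$ (i, i) = (\<Sum>k<n. D $$ (i, k) * D $$ (k, i))" by (rule mult_index_sum[OF D(1) D(1) i i])
    also have "\<dots> = (\<Sum>k<n. if k = i then D $$ (i, i) * D $$ (i, i) else 0)"
      using D(1,4) i by (intro sum.cong) (auto simp: diagonal_mat_def)
    finally have "D $$ (i, i) = D $$ (i, i) * D $$ (i, i)" using i DD by simp
    then show ?thesis by (metis mult_cancel_left2)
  qed
  define S where "S = {i. i < n \<and> D $$ (i, i) = 1}"
  have S: "finite S" by (simp add: S_def)
  obtain h where h: "bij_betw h {0..<card S} S" using ex_bij_betw_nat_finite[OF S] by blast
  let ?r = "card S"
  have hn: "h a < n" "D $$ (h a, h a) = 1" if "a < ?r" for a using bij_betwE[OF h] that by (auto simp: S_def)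
  have hi: "h a = h b \<longleftrightarrow> a = b" if "a < ?r" "b < ?r" for a b using h that by (auto simp: bij_betw_def inj_on_def)
  define E where "E = mat n ?r (\<lambda>(i, a). if i = h a then 1 else (0 :: complex))"
  define E' where "E' = mat ?r n (\<lambda>(a, i). if i = h a then 1 else (0 :: complex))"
  have E: "E \<in> carrier_mat n ?r" "E' \<in> carrier_mat ?r n" by (simp_all add: E_def E'_def)
  have 1: "E' * E = 1\<^sub>m ?r"
  proof (rule eq_matI)
    fix a b assume "a < dim_row (1\<^sub>m ?r :: complex mat)" "b < dim_col (1\<^sub>m ?r :: complex mat)"
    then have ab: "a < ?r" "b < ?r" by auto
    have "(E' * E) $$ (a, b) = (\<Sum>i<n. if i = h a then (if a = b then 1 else 0) else 0)"
      unfolding mult_index_sum[OF E(2,1) ab] using ab hi by (intro sum.cong) (auto simp: E_def E'_def)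
    then show "(E' * E) $$ (a, b) = (1\<^sub>m ?r :: complex mat) $$ (a, b)" using ab hn by simp
  qed (use E in auto)
  have 2: "E * E' = D"
  proof (rule eq_matI)
    fix i j assume "i < dim_row D" "j < dim_col D"
    then have ij: "i < n" "j < n" using D by auto
    have "(E * E') $$ (i, j) = (\<Sum>a\<in>{0..<?r}. if h a = i then (if i = j then 1 else 0) else 0)"
      unfolding mult_index_sum[OF E ij] lessThan_atLeast0 using ij by (intro sum.cong) (auto simp: E_def E'_def)
    also have "\<dots> = (\<Sum>x\<in>S. if x = i then (if i = j then 1 else 0) else 0)"
      by (rule sum.reindex_bij_betw[OF h])
    also have "\<dots> = D $$ (i, j)" using ij d[OF ij(1)] D(1,4) S by (auto simp: S_def diagonal_mat_def)
    finally show "(E * E') $$ (i, j) = D $$ (i, j)" .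
  qed (use D E in auto)
  have "(P * E) * (E' * Q) = P * (E * E') * Q" using D E by (simp add: mat_assoc)
  then have "(P * E) * (E' * Q) = A" using 2 D by simp
  moreover have "(E' * Q) * (P * E) = 1\<^sub>m ?r"
  proof -
    have "Q * (P * E) = E" using mat_assoc[of Q P E] D E by (simp add: mat_one)
    then show ?thesis using mat_assoc[of E' Q "P * E"] 1 D E by simp
  qed
  ultimately show thesis using that[of "P * E" ?r "E' * Q"] D E by (meson mult_carrier_mat)
qed

section \<open>Matrix algebra under dimension conditions\<close>

lemma kron_dim [simp]: "dim_row (kron A B) = dim_row A * dim_row B" "dim_col (kron A B) = dim_col A * dim_col B"
  by (simp_all add: kron_def)

lemma kron_comp:
  assumes "dim_col A = dim_row A'" "dim_col B = dim_row B'"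
  shows "kron A B * kron A' B' = kron (A * A') (B * B')"
  by (rule kron_mult[symmetric, OF carrier_matI[OF HOL.refl HOL.refl] carrier_matI[OF assms(1)[symmetric] HOL.refl]
    carrier_matI[OF HOL.refl HOL.refl] carrier_matI[OF assms(2)[symmetric] HOL.refl]])

lemma kron_assoc': "kron (kron A B) C = kron A (kron B C)"
  by (rule kron_assoc[OF carrier_matI[OF HOL.refl HOL.refl] carrier_matI[OF HOL.refl HOL.refl] carrier_matI[OF HOL.refl HOL.refl]])

lemma kron_1': "kron (1\<^sub>m 1) A = A" "kron A (1\<^sub>m 1) = A"
  by (rule kron_1[OF carrier_matI[OF HOL.refl HOL.refl]])+

lemma mat_add_distrib: fixes A B C :: "complex mat"
  assumes "dim_row A = dim_row B" "dim_col A = dim_col B"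
  shows "dim_col A = dim_row C \<Longrightarrow> (A + B) * C = A * C + B * C" "dim_col C = dim_row A \<Longrightarrow> C * (A + B) = C * A + C * B"
proof -
  note B = carrier_matI[OF assms[symmetric]]
  show "(A + B) * C = A * C + B * C" if "dim_col A = dim_row C"
    by (rule add_mult_distrib_mat[OF carrier_matI[OF HOL.refl HOL.refl] B carrier_matI[OF that[symmetric] HOL.refl]])
  show "C * (A + B) = C * A + C * B" if "dim_col C = dim_row A"
    by (rule mult_add_distrib_mat[OF carrier_matI[OF HOL.refl that] carrier_matI[OF HOL.refl HOL.refl] B])
qed

lemma mat_smult: fixes A B :: "complex mat" assumes "dim_col A = dim_row B"
  shows "(c \<cdot>\<^sub>m A) * B = c \<cdot>\<^sub>m (A * B)" "A * (c \<cdot>\<^sub>m B) = c \<cdot>\<^sub>m (A * B)"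
  by (rule mult_smult_assoc_mat[OF carrier_matI[OF HOL.refl HOL.refl] carrier_matI[OF assms[symmetric] HOL.refl]]
    mult_smult_distrib[OF carrier_matI[OF HOL.refl HOL.refl] carrier_matI[OF assms[symmetric] HOL.refl]])+

lemma Rep_simps [simp]: "Obj (Rep G) = {V. is_rep G V}"
  "Hom (Rep G) V W = {A \<in> carrier_mat (fst W) (fst V). \<forall>g \<in> carrier G. A * snd V g = snd W g * A}"
  "Idm (Rep G) V = 1\<^sub>m (fst V)" "Comp (Rep G) V W Z B A = B * A" "Zero (Rep G) V W = 0\<^sub>m (fst W) (fst V)"
  "Add (Rep G) V W = (+)" "Scale (Rep G) V W c A = c \<cdot>\<^sub>m A" "Unit (Rep G) = (1, \<lambda>g \<in> carrier G. 1\<^sub>m 1)"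
  "TenO (Rep G) V W = (fst V * fst W, \<lambda>g \<in> carrier G. kron (snd V g) (snd W g))"
  "TenM (Rep G) V V' W W' = kron" "Assoc (Rep G) V W Z = 1\<^sub>m (fst V * fst W * fst Z)"
  "LUnit (Rep G) V = 1\<^sub>m (fst V)" "RUnit (Rep G) V = 1\<^sub>m (fst V)"
  by (simp_all add: Rep_def)

lemma rep_dim: "is_rep G V \<Longrightarrow> g \<in> carrier G \<Longrightarrow> dim_row (snd V g) = fst V \<and> dim_col (snd V g) = fst V"
  by (auto simp: is_rep_def)

text \<open>For the tensor category of representations only a unit and closure under multiplication matter.\<close>

locale rep_monoid = fixes G :: "('g, 'x) monoid_scheme"
  assumes one_G: "\<one>\<^bsub>G\<^esub> \<in> carrier G" and mult_G: "g \<in> carrier G \<Longrightarrow> h \<in> carrier G \<Longrightarrow> g \<otimes>\<^bsub>G\<^esub> h \<in> carrier G"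
begin

lemma rep_tensor: assumes V: "is_rep G V" and W: "is_rep G W"
  shows "is_rep G (fst V * fst W, \<lambda>g \<in> carrier G. kron (snd V g) (snd W g))"
  using V W one_G mult_G unfolding is_rep_def
  by (auto simp: kron_one kron_mult[of _ "fst V" "fst V" _ "fst V" _ "fst W" "fst W" _ "fst W"] intro!: kron_carrier)

lemma rep_linear_category: "linear_category (Rep G)"
proof unfold_locales
  fix X Y Z f g
  assume a: "X \<in> Obj (Rep G)" "Y \<in> Obj (Rep G)" "Z \<in> Obj (Rep G)" "f \<in> Hom (Rep G) X Y" "g \<in> Hom (Rep G) Y Z"
  show "Comp (Rep G) X Y Z g f \<in> Hom (Rep G) X Z"
  proof (simp, intro conjI ballI)
    show "g * f \<in> carrier_mat (fst Z) (fst X)" using a by auto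
    fix h assume h: "h \<in> carrier G"
    have d: "dim_row (snd V h) = fst V \<and> dim_col (snd V h) = fst V" if "V \<in> {X, Y, Z}" for V using that a rep_dim[OF _ h] by auto
    have "(g * f) * snd X h = g * (f * snd X h)" using a d by (intro mat_assoc) auto
    also have "\<dots> = g * (snd Y h * f)" using a h by simp
    also have "\<dots> = (g * snd Y h) * f" using a d by (intro mat_assoc[symmetric]) auto
    also have "\<dots> = (snd Z h * g) * f" using a h by simp
    also have "\<dots> = snd Z h * (g * f)" using a d by (intro mat_assoc) auto
    finally show "(g * f) * snd X h = snd Z h * (g * f)" .
  qed
next
  fix X Y f g assume a: "X \<in> Obj (Rep G)" "Y \<in> Obj (Rep G)" "f \<in> Hom (Rep G) X Y" "g \<in> Hom (Rep G) X Y"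
  then show "Add (Rep G) X Y f g \<in> Hom (Rep G) X Y"
    using rep_dim[of G X] rep_dim[of G Y] by (auto simp: mat_add_distrib)
next
  fix X Y f c assume a: "X \<in> Obj (Rep G)" "Y \<in> Obj (Rep G)" "f \<in> Hom (Rep G) X Y"
  then show "Scale (Rep G) X Y c f \<in> Hom (Rep G) X Y"
    using rep_dim[of G X] rep_dim[of G Y] by (auto simp: mat_smult)
  show "\<exists>g \<in> Hom (Rep G) X Y. Add (Rep G) X Y f g = Zero (Rep G) X Y"
  proof (rule bexI[of _ "(-1) \<cdot>\<^sub>m f"])
    show "Add (Rep G) X Y f ((-1) \<cdot>\<^sub>m f) = Zero (Rep G) X Y" using a by (auto intro!: eq_matI)
    show "(-1) \<cdot>\<^sub>m f \<in> Hom (Rep G) X Y" using a rep_dim[of G X] rep_dim[of G Y] by (auto simp: mat_smult)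
  qed
next
  fix X assume "X \<in> Obj (Rep G)"
  then show "Idm (Rep G) X \<in> Hom (Rep G) X X" using rep_dim[of G X] by (auto simp: mat_one)
next
  fix X Y assume "X \<in> Obj (Rep G)" "Y \<in> Obj (Rep G)"
  then show "Zero (Rep G) X Y \<in> Hom (Rep G) X Y" 
    by (auto simp: is_rep_def left_mult_zero_mat[of _ "fst X"] right_mult_zero_mat[of _ "fst Y"])
qed (auto simp: mat_assoc mat_one mat_add_distrib mat_smult add_smult_distrib_left_mat add_smult_distrib_right_mat
   intro!: eq_matI simp: algebra_simps)

lemma rep_strict: "strict_linear_monoidal_category (Rep G)"
proof -
  interpret linear_category "Rep G" by (rule rep_linear_category)
  show ?thesis
  proof unfold_locales
    show "Unit (Rep G) \<in> Obj (Rep G)" using one_G mult_G by (auto simp: is_rep_def)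
    fix X X' Y Y' f g
    assume a: "X \<in> Obj (Rep G)" "X' \<in> Obj (Rep G)" "Y \<in> Obj (Rep G)" "Y' \<in> Obj (Rep G)" "f \<in> Hom (Rep G) X X'" "g \<in> Hom (Rep G) Y Y'"
    then show "TenM (Rep G) X X' Y Y' f g \<in> Hom (Rep G) (TenO (Rep G) X Y) (TenO (Rep G) X' Y')"
      using rep_dim[of G X] rep_dim[of G Y] rep_dim[of G X'] rep_dim[of G Y'] by (auto simp: kron_comp)
  next
    fix X assume "X \<in> Obj (Rep G)"
    then have "snd X \<in> extensional (carrier G)" by (auto simp: is_rep_def)
    then show "TenO (Rep G) (Unit (Rep G)) X = X" "TenO (Rep G) X (Unit (Rep G)) = X"
      by (cases X; auto simp: kron_1'[unfolded One_nat_def] extensional_def fun_eq_iff restrict_def)+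
  next
    fix X Y Z show "TenO (Rep G) (TenO (Rep G) X Y) Z = TenO (Rep G) X (TenO (Rep G) Y Z)"
      by (auto simp: kron_assoc' mult.assoc fun_eq_iff restrict_def)
  next
    fix X Y X' Y' f f' g assume "X \<in> Obj (Rep G)" "X' \<in> Obj (Rep G)" "Y \<in> Obj (Rep G)" "Y' \<in> Obj (Rep G)"
      "f \<in> Hom (Rep G) X X'" "f' \<in> Hom (Rep G) X X'" "g \<in> Hom (Rep G) Y Y'"
    then show "TenM (Rep G) X X' Y Y' (Add (Rep G) X X' f f') g
            = Add (Rep G) (TenO (Rep G) X Y) (TenO (Rep G) X' Y') (TenM (Rep G) X X' Y Y' f g) (TenM (Rep G) X X' Y Y' f' g)"
      by (simp add: kron_add(1)[of f "fst X'" "fst X" f' g "fst Y'" "fst Y" g])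
  next
    fix X Y X' Y' f g g' assume "X \<in> Obj (Rep G)" "X' \<in> Obj (Rep G)" "Y \<in> Obj (Rep G)" "Y' \<in> Obj (Rep G)"
      "f \<in> Hom (Rep G) X X'" "g \<in> Hom (Rep G) Y Y'" "g' \<in> Hom (Rep G) Y Y'"
    then show "TenM (Rep G) X X' Y Y' f (Add (Rep G) Y Y' g g')
            = Add (Rep G) (TenO (Rep G) X Y) (TenO (Rep G) X' Y') (TenM (Rep G) X X' Y Y' f g) (TenM (Rep G) X X' Y Y' f g')"
      by (simp add: kron_add(2)[of f "fst X'" "fst X" f g "fst Y'" "fst Y" g'])
  next
    fix X Y X' Y' f g c assume "X \<in> Obj (Rep G)" "X' \<in> Obj (Rep G)" "Y \<in> Obj (Rep G)" "Y' \<in> Obj (Rep G)"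
      "f \<in> Hom (Rep G) X X'" "g \<in> Hom (Rep G) Y Y'"
    then show "TenM (Rep G) X X' Y Y' (Scale (Rep G) X X' c f) g = Scale (Rep G) (TenO (Rep G) X Y) (TenO (Rep G) X' Y') c (TenM (Rep G) X X' Y Y' f g)"
      "TenM (Rep G) X X' Y Y' f (Scale (Rep G) Y Y' c g) = Scale (Rep G) (TenO (Rep G) X Y) (TenO (Rep G) X' Y') c (TenM (Rep G) X X' Y Y' f g)"
      by (simp_all add: kron_add(3,4)[of f "fst X'" "fst X" f g "fst Y'" "fst Y" g c])
  qed (auto simp: rep_tensor kron_one kron_comp kron_assoc' kron_1'[unfolded One_nat_def] mult.assoc)
qed

end

section \<open>Fully faithful and essentially surjective functors\<close>

text \<open>A quasi-inverse is chosen objectwise; on morphisms it is conjugation by the chosen isomorphisms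
  followed by the inverse of the fully faithful functor.\<close>

lemma equivalence_from_fully_faithful:
  assumes C: "linear_monoidal_category C" and D: "linear_monoidal_category D"
    and F: "linear_monoidal_functor C D F Fm \<mu> u"
    and faithful: "\<And>X Y f g. \<lbrakk>X \<in> Obj C; Y \<in> Obj C; f \<in> Hom C X Y; g \<in> Hom C X Y; Fm X Y f = Fm X Y g\<rbrakk> \<Longrightarrow> f = g"
    and full: "\<And>X Y h. \<lbrakk>X \<in> Obj C; Y \<in> Obj C; h \<in> Hom D (F X) (F Y)\<rbrakk> \<Longrightarrow> \<exists>f \<in> Hom C X Y. Fm X Y f = h"
    and ess: "\<And>V. V \<in> Obj D \<Longrightarrow> \<exists>X \<in> Obj C. \<exists>s. is_iso D (F X) V s"
  shows "monoidally_equivalent C D"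
proof -
  interpret C: linear_monoidal_category C by (rule C)
  interpret D: linear_monoidal_category D by (rule D)
  interpret F: linear_monoidal_functor C D F Fm \<mu> u by (rule F)
  obtain G where G: "\<And>V. V \<in> Obj D \<Longrightarrow> G V \<in> Obj C \<and> (\<exists>s. is_iso D (F (G V)) V s)" using ess by metis
  then obtain s where s: "\<And>V. V \<in> Obj D \<Longrightarrow> is_iso D (F (G V)) V (s V)" by metis
  then obtain t where t: "\<And>V. V \<in> Obj D \<Longrightarrow> s V \<in> Hom D (F (G V)) V \<and> t V \<in> Hom D V (F (G V)) \<and>
      Comp D (F (G V)) V (F (G V)) (t V) (s V) = Idm D (F (G V)) \<and> Comp D V (F (G V)) V (s V) (t V) = Idm D V"
    unfolding is_iso_def by metis
  have GO [simp]: "G V \<in> Obj C" if "V \<in> Obj D" for V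
    using that G by auto
  have FO [simp]: "X \<in> Obj C \<Longrightarrow> F X \<in> Obj D" for X using F.F_Obj by auto
  have sH [simp]: "s V \<in> Hom D (F (G V)) V" and tH [simp]: "t V \<in> Hom D V (F (G V))"
    and ts: "Comp D (F (G V)) V (F (G V)) (t V) (s V) = Idm D (F (G V))" and st: "Comp D V (F (G V)) V (s V) (t V) = Idm D V"
    if "V \<in> Obj D" for V using t[OF that] by auto
  define pre where "pre X Y h = (SOME f. f \<in> Hom C X Y \<and> Fm X Y f = h)" for X Y h
  have pre: "pre X Y h \<in> Hom C X Y \<and> Fm X Y (pre X Y h) = h" if "X \<in> Obj C" "Y \<in> Obj C" "h \<in> Hom D (F X) (F Y)" for X Y h
    unfolding pre_def by (rule someI_ex) (use full[OF that] in blast)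
  define cj where "cj V W h = Comp D (F (G V)) W (F (G W)) (t W) (Comp D (F (G V)) V W h (s V))" for V W h
  have conjH: "cj V W h \<in> Hom D (F (G V)) (F (G W))" if "V \<in> Obj D" "W \<in> Obj D" "h \<in> Hom D V W" for V W h
    unfolding cj_def using that by (intro D.Comp_closed[of _ W] D.Comp_closed[of _ V]) auto
  define Gm where "Gm V W h = pre (G V) (G W) (cj V W h)" for V W h
  have GmH: "Gm V W h \<in> Hom C (G V) (G W)" and FGm: "Fm (G V) (G W) (Gm V W h) = cj V W h"
    if "V \<in> Obj D" "W \<in> Obj D" "h \<in> Hom D V W" for V W h
    using pre[OF _ _ conjH[OF that]] that unfolding Gm_def by auto
  have sconj: "Comp D (F (G V)) (F (G W)) W (s W) (cj V W h) = Comp D (F (G V)) V W h (s V)"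
    if a: "V \<in> Obj D" "W \<in> Obj D" "h \<in> Hom D V W" for V W h
  proof -
    have c: "Comp D (F (G V)) V W h (s V) \<in> Hom D (F (G V)) W" using a by (intro D.Comp_closed) auto
    show ?thesis unfolding cj_def using a c D.Comp_assoc[of "F (G V)" W "F (G W)" W "Comp D (F (G V)) V W h (s V)" "t W" "s W"]
      by (simp add: st D.Comp_Id_left)
  qed
  have cancel: "h = h'" if a: "X \<in> Obj D" "W \<in> Obj D" "h \<in> Hom D X (F (G W))" "h' \<in> Hom D X (F (G W))"
     "Comp D X (F (G W)) W (s W) h = Comp D X (F (G W)) W (s W) h'" for X W h h'
  proof -
    have "Comp D X (F (G W)) (F (G W)) (Comp D (F (G W)) W (F (G W)) (t W) (s W)) k = Comp D X W (F (G W)) (t W) (Comp D X (F (G W)) W (s W) k)"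
      if "k \<in> Hom D X (F (G W))" for k
      using a that by (intro D.Comp_assoc[symmetric]) auto
    from this[OF a(3)] this[OF a(4)] show ?thesis using a by (simp add: ts D.Comp_Id_left)
  qed
  have Gfun: "linear_functor D C G Gm"
  proof unfold_locales
    fix X assume X: "X \<in> Obj D"
    show "G X \<in> Obj C" using X by simp
    have "cj X X (Idm D X) = Idm D (F (G X))"
      unfolding cj_def using X by (simp add: D.Comp_Id_left ts)
    then show "Gm X X (Idm D X) = Idm C (G X)"
      using faithful[OF GO[OF X] GO[OF X] GmH[OF X X D.Id_closed[OF X]]] C.Id_closed FGm[OF X X D.Id_closed[OF X]] F.F_Id X by auto
  next
    fix X Y f assume "X \<in> Obj D" "Y \<in> Obj D" "f \<in> Hom D X Y"
    then show "Gm X Y f \<in> Hom C (G X) (G Y)" by (rule GmH)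
  next
    fix X Y Z f g assume a: "X \<in> Obj D" "Y \<in> Obj D" "Z \<in> Obj D" "f \<in> Hom D X Y" "g \<in> Hom D Y Z"
    have gf: "Comp D X Y Z g f \<in> Hom D X Z" using a by (intro D.Comp_closed) auto
    have "cj X Z (Comp D X Y Z g f) = Comp D (F (G X)) (F (G Y)) (F (G Z)) (cj Y Z g) (cj X Y f)"
    proof (rule cancel[of "F (G X)" Z])
      have c: "Comp D (F (G X)) X Y f (s X) \<in> Hom D (F (G X)) Y" using a by (intro D.Comp_closed) auto
      show "Comp D (F (G X)) (F (G Y)) (F (G Z)) (cj Y Z g) (cj X Y f) \<in> Hom D (F (G X)) (F (G Z))"
        using a conjH by (intro D.Comp_closed[of _ "F (G Y)"]) auto
      have "Comp D (F (G X)) (F (G Z)) Z (s Z) (Comp D (F (G X)) (F (G Y)) (F (G Z)) (cj Y Z g) (cj X Y f))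
        = Comp D (F (G X)) (F (G Y)) Z (Comp D (F (G Y)) (F (G Z)) Z (s Z) (cj Y Z g)) (cj X Y f)"
        using a conjH by (intro D.Comp_assoc) auto
      also have "\<dots> = Comp D (F (G X)) (F (G Y)) Z (Comp D (F (G Y)) Y Z g (s Y)) (cj X Y f)" using a by (simp add: sconj)
      also have "\<dots> = Comp D (F (G X)) Y Z g (Comp D (F (G X)) (F (G Y)) Y (s Y) (cj X Y f))"
        using a conjH by (intro D.Comp_assoc[symmetric]) auto
      also have "\<dots> = Comp D (F (G X)) Y Z g (Comp D (F (G X)) X Y f (s X))" using a by (simp add: sconj)
      also have "\<dots> = Comp D (F (G X)) X Z (Comp D X Y Z g f) (s X)" using a by (intro D.Comp_assoc) auto
      finally show "Comp D (F (G X)) (F (G Z)) Z (s Z) (cj X Z (Comp D X Y Z g f)) =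
        Comp D (F (G X)) (F (G Z)) Z (s Z) (Comp D (F (G X)) (F (G Y)) (F (G Z)) (cj Y Z g) (cj X Y f))"
        using a gf by (simp add: sconj)
    qed (use a gf conjH in auto)
    then show "Gm X Z (Comp D X Y Z g f) = Comp C (G X) (G Y) (G Z) (Gm Y Z g) (Gm X Y f)"
      using a gf by (intro faithful[of "G X" "G Z"]) (auto intro!: GmH C.Comp_closed[of _ "G Y"] simp: FGm F.F_Comp GmH)
  next
    fix X Y f g assume a: "X \<in> Obj D" "Y \<in> Obj D" "f \<in> Hom D X Y" "g \<in> Hom D X Y"
    have c: "Comp D (F (G X)) X Y f (s X) \<in> Hom D (F (G X)) Y" "Comp D (F (G X)) X Y g (s X) \<in> Hom D (F (G X)) Y" using a by (auto intro!: D.Comp_closed[of _ X])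
    have "cj X Y (Add D X Y f g) = Add D (F (G X)) (F (G Y)) (cj X Y f) (cj X Y g)"
      unfolding cj_def using a c by (simp add: D.Comp_add_left D.Comp_add_right)
    then show "Gm X Y (Add D X Y f g) = Add C (G X) (G Y) (Gm X Y f) (Gm X Y g)"
      using a by (intro faithful[of "G X" "G Y"]) (auto intro!: GmH C.Add_closed D.Add_closed simp: FGm F.F_Add GmH D.Add_closed)
  next
    fix X Y f c assume a: "X \<in> Obj D" "Y \<in> Obj D" "f \<in> Hom D X Y"
    have k: "Comp D (F (G X)) X Y f (s X) \<in> Hom D (F (G X)) Y" using a by (auto intro!: D.Comp_closed[of _ X])
    have "cj X Y (Scale D X Y c f) = Scale D (F (G X)) (F (G Y)) c (cj X Y f)"
      unfolding cj_def using a k by (simp add: D.Comp_scale_left D.Comp_scale_right)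
    then show "Gm X Y (Scale D X Y c f) = Scale C (G X) (G Y) c (Gm X Y f)"
      using a by (intro faithful[of "G X" "G Y"]) (auto intro!: GmH C.Scale_closed D.Scale_closed simp: FGm F.F_Scale GmH D.Scale_closed)
  qed
  define \<eta> where "\<eta> X = pre X (G (F X)) (t (F X))" for X
  have \<eta>: "\<eta> X \<in> Hom C X (G (F X))" "Fm X (G (F X)) (\<eta> X) = t (F X)" if "X \<in> Obj C" for X
    unfolding \<eta>_def using pre[of X "G (F X)" "t (F X)"] that by auto
  have "natural_isomorphism C C (\<lambda>X. X) (\<lambda>X Y f. f) (\<lambda>X. G (F X)) (\<lambda>X Y f. Gm (F X) (F Y) (Fm X Y f)) \<eta>"
  proof unfold_locales
    fix X assume X: "X \<in> Obj C"
    define k where "k = pre (G (F X)) X (s (F X))"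
    have k: "k \<in> Hom C (G (F X)) X" "Fm (G (F X)) X k = s (F X)" unfolding k_def using pre[of "G (F X)" X "s (F X)"] X by auto
    have "Comp C X (G (F X)) X k (\<eta> X) = Idm C X"
      using X k \<eta>[OF X] by (intro faithful[of X X]) (auto intro!: C.Comp_closed[of _ "G (F X)"] C.Id_closed simp: F.F_Comp F.F_Id st)
    moreover have "Comp C (G (F X)) X (G (F X)) (\<eta> X) k = Idm C (G (F X))"
      using X k \<eta>[OF X] by (intro faithful[of "G (F X)" "G (F X)"]) (auto intro!: C.Comp_closed[of _ X] C.Id_closed simp: F.F_Comp F.F_Id ts)
    ultimately show "is_iso C X (G (F X)) (\<eta> X)" unfolding is_iso_def using \<eta>[OF X] k by blast
  next
    fix X Y f assume a: "X \<in> Obj C" "Y \<in> Obj C" "f \<in> Hom C X Y"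
    have Ff: "Fm X Y f \<in> Hom D (F X) (F Y)" using a F.F_Hom by blast
    have h: "Gm (F X) (F Y) (Fm X Y f) \<in> Hom C (G (F X)) (G (F Y))" using a Ff by (intro GmH) auto
    have "Comp D (F X) (F Y) (F (G (F Y))) (t (F Y)) (Fm X Y f) = Comp D (F X) (F (G (F X))) (F (G (F Y))) (cj (F X) (F Y) (Fm X Y f)) (t (F X))"
    proof (rule cancel[of "F X" "F Y"])
      have "Comp D (F X) (F (G (F Y))) (F Y) (s (F Y)) (Comp D (F X) (F Y) (F (G (F Y))) (t (F Y)) (Fm X Y f)) = Fm X Y f"
        using a Ff D.Comp_assoc[of "F X" "F Y" "F (G (F Y))" "F Y" "Fm X Y f" "t (F Y)" "s (F Y)"] by (simp add: st D.Comp_Id_left)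
      moreover have "Comp D (F X) (F (G (F Y))) (F Y) (s (F Y)) (Comp D (F X) (F (G (F X))) (F (G (F Y))) (cj (F X) (F Y) (Fm X Y f)) (t (F X))) = Fm X Y f"
        using a Ff conjH[OF _ _ Ff] D.Comp_assoc[of "F X" "F (G (F X))" "F (G (F Y))" "F Y" "t (F X)" "cj (F X) (F Y) (Fm X Y f)" "s (F Y)"]
          D.Comp_assoc[of "F X" "F (G (F X))" "F X" "F Y" "t (F X)" "s (F X)" "Fm X Y f"]
        by (simp add: sconj st D.Comp_Id_right)
      ultimately show "Comp D (F X) (F (G (F Y))) (F Y) (s (F Y)) (Comp D (F X) (F Y) (F (G (F Y))) (t (F Y)) (Fm X Y f))
        = Comp D (F X) (F (G (F Y))) (F Y) (s (F Y)) (Comp D (F X) (F (G (F X))) (F (G (F Y))) (cj (F X) (F Y) (Fm X Y f)) (t (F X)))" by simp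
    qed (use a Ff conjH[OF _ _ Ff] in \<open>auto intro!: D.Comp_closed[of _ "F Y"] D.Comp_closed[of _ "F (G (F X))"]\<close>)
    then show "Comp C X Y (G (F Y)) (\<eta> Y) f = Comp C X (G (F X)) (G (F Y)) (Gm (F X) (F Y) (Fm X Y f)) (\<eta> X)"
      using a \<eta> h Ff by (intro faithful[of X "G (F Y)"]) (auto intro!: C.Comp_closed[of _ Y] C.Comp_closed[of _ "G (F X)"] simp: F.F_Comp FGm)
  qed
  moreover have "natural_isomorphism D D (\<lambda>X. F (G X)) (\<lambda>X Y f. Fm (G X) (G Y) (Gm X Y f)) (\<lambda>X. X) (\<lambda>X Y f. f) s"
    by unfold_locales (use s in \<open>simp_all add: FGm sconj\<close>)
  ultimately show ?thesis unfolding monoidally_equivalent_def using C D F Gfun by blast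
qed

section \<open>Categories represented by matrices commuting with a group\<close>

text \<open>Objects of \<open>C\<close> have a dimension \<open>N\<close>, on which \<open>G\<close> acts by \<open>\<Theta>\<close>, and morphisms are matrices \<open>M\<close>. The
  identity of \<open>X\<close> is represented by an idempotent, not by the identity matrix; the fullness assumption
  asks for all equivariant matrices absorbed by these idempotents. The tensor product of \<open>C\<close>
  corresponds to the Kronecker product up to a reordering \<open>\<tau>\<close> of the basis, with inverse \<open>\<tau>'\<close>.
  The category axioms are not assumed: they follow from the faithfulness of \<open>M\<close>.\<close>

locale rep_embedding = rep_monoid G for G :: "('g, 'x) monoid_scheme" +
  fixes C :: "('o, 'm) lmcat" and N :: "'o \<Rightarrow> nat" and M :: "'o \<Rightarrow> 'o \<Rightarrow> 'm \<Rightarrow> complex mat"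
    and \<Theta> :: "'o \<Rightarrow> 'g \<Rightarrow> complex mat" and \<tau> \<tau>' :: "'o \<Rightarrow> 'o \<Rightarrow> complex mat"
  assumes Id_cl: "X \<in> Obj C \<Longrightarrow> Idm C X \<in> Hom C X X"
    and Comp_cl: "\<lbrakk>X \<in> Obj C; Y \<in> Obj C; Z \<in> Obj C; f \<in> Hom C X Y; g \<in> Hom C Y Z\<rbrakk> \<Longrightarrow> Comp C X Y Z g f \<in> Hom C X Z"
    and Zero_cl: "\<lbrakk>X \<in> Obj C; Y \<in> Obj C\<rbrakk> \<Longrightarrow> Zero C X Y \<in> Hom C X Y"
    and Add_cl: "\<lbrakk>X \<in> Obj C; Y \<in> Obj C; f \<in> Hom C X Y; g \<in> Hom C X Y\<rbrakk> \<Longrightarrow> Add C X Y f g \<in> Hom C X Y"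
    and Scale_cl: "\<lbrakk>X \<in> Obj C; Y \<in> Obj C; f \<in> Hom C X Y\<rbrakk> \<Longrightarrow> Scale C X Y c f \<in> Hom C X Y"
    and Unit_cl: "Unit C \<in> Obj C"
    and TenO_cl: "\<lbrakk>X \<in> Obj C; Y \<in> Obj C\<rbrakk> \<Longrightarrow> TenO C X Y \<in> Obj C"
    and TenM_cl: "\<lbrakk>X \<in> Obj C; X' \<in> Obj C; Y \<in> Obj C; Y' \<in> Obj C; f \<in> Hom C X X'; g \<in> Hom C Y Y'\<rbrakk>
        \<Longrightarrow> TenM C X X' Y Y' f g \<in> Hom C (TenO C X Y) (TenO C X' Y')"
    and TO_assoc: "\<lbrakk>X \<in> Obj C; Y \<in> Obj C; Z \<in> Obj C\<rbrakk> \<Longrightarrow> TenO C (TenO C X Y) Z = TenO C X (TenO C Y Z)"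
    and TO_unit: "X \<in> Obj C \<Longrightarrow> TenO C (Unit C) X = X" "X \<in> Obj C \<Longrightarrow> TenO C X (Unit C) = X"
    and As_Id: "\<lbrakk>X \<in> Obj C; Y \<in> Obj C; Z \<in> Obj C\<rbrakk> \<Longrightarrow> Assoc C X Y Z = Idm C (TenO C X (TenO C Y Z))"
    and LU_Id: "X \<in> Obj C \<Longrightarrow> LUnit C X = Idm C X" and RU_Id: "X \<in> Obj C \<Longrightarrow> RUnit C X = Idm C X"
    and M_dim: "\<lbrakk>X \<in> Obj C; Y \<in> Obj C; f \<in> Hom C X Y\<rbrakk> \<Longrightarrow> M X Y f \<in> carrier_mat (N Y) (N X)"
    and M_inj: "\<lbrakk>X \<in> Obj C; Y \<in> Obj C; f \<in> Hom C X Y; g \<in> Hom C X Y; M X Y f = M X Y g\<rbrakk> \<Longrightarrow> f = g"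
    and M_full: "\<lbrakk>X \<in> Obj C; Y \<in> Obj C; A \<in> carrier_mat (N Y) (N X); M Y Y (Idm C Y) * A * M X X (Idm C X) = A;
        \<And>g. g \<in> carrier G \<Longrightarrow> A * \<Theta> X g = \<Theta> Y g * A\<rbrakk> \<Longrightarrow> \<exists>f \<in> Hom C X Y. M X Y f = A"
    and M_comm: "\<lbrakk>X \<in> Obj C; Y \<in> Obj C; f \<in> Hom C X Y; s \<in> carrier G\<rbrakk> \<Longrightarrow> M X Y f * \<Theta> X s = \<Theta> Y s * M X Y f"
    and M_comp: "\<lbrakk>X \<in> Obj C; Y \<in> Obj C; Z \<in> Obj C; f \<in> Hom C X Y; g \<in> Hom C Y Z\<rbrakk>
        \<Longrightarrow> M X Z (Comp C X Y Z g f) = M Y Z g * M X Y f"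
    and M_p: "\<lbrakk>X \<in> Obj C; Y \<in> Obj C; f \<in> Hom C X Y\<rbrakk> \<Longrightarrow> M X Y f * M X X (Idm C X) = M X Y f"
      "\<lbrakk>X \<in> Obj C; Y \<in> Obj C; f \<in> Hom C X Y\<rbrakk> \<Longrightarrow> M Y Y (Idm C Y) * M X Y f = M X Y f"
    and M_zero: "\<lbrakk>X \<in> Obj C; Y \<in> Obj C\<rbrakk> \<Longrightarrow> M X Y (Zero C X Y) = 0\<^sub>m (N Y) (N X)"
    and M_add: "\<lbrakk>X \<in> Obj C; Y \<in> Obj C; f \<in> Hom C X Y; g \<in> Hom C X Y\<rbrakk> \<Longrightarrow> M X Y (Add C X Y f g) = M X Y f + M X Y g"
    and M_scale: "\<lbrakk>X \<in> Obj C; Y \<in> Obj C; f \<in> Hom C X Y\<rbrakk> \<Longrightarrow> M X Y (Scale C X Y c f) = c \<cdot>\<^sub>m M X Y f"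
    and \<Theta>_dim: "\<lbrakk>X \<in> Obj C; s \<in> carrier G\<rbrakk> \<Longrightarrow> \<Theta> X s \<in> carrier_mat (N X) (N X)"
    and \<Theta>_one: "X \<in> Obj C \<Longrightarrow> \<Theta> X \<one>\<^bsub>G\<^esub> = 1\<^sub>m (N X)"
    and \<Theta>_mult: "\<lbrakk>X \<in> Obj C; s \<in> carrier G; s' \<in> carrier G\<rbrakk> \<Longrightarrow> \<Theta> X (s \<otimes>\<^bsub>G\<^esub> s') = \<Theta> X s * \<Theta> X s'"
    and \<tau>_dim: "\<lbrakk>X \<in> Obj C; Y \<in> Obj C\<rbrakk> \<Longrightarrow> \<tau> X Y \<in> carrier_mat (N (TenO C X Y)) (N X * N Y)"
      "\<lbrakk>X \<in> Obj C; Y \<in> Obj C\<rbrakk> \<Longrightarrow> \<tau>' X Y \<in> carrier_mat (N X * N Y) (N (TenO C X Y))"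
    and \<tau>_inv: "\<lbrakk>X \<in> Obj C; Y \<in> Obj C\<rbrakk> \<Longrightarrow> \<tau> X Y * \<tau>' X Y = 1\<^sub>m (N (TenO C X Y))"
      "\<lbrakk>X \<in> Obj C; Y \<in> Obj C\<rbrakk> \<Longrightarrow> \<tau>' X Y * \<tau> X Y = 1\<^sub>m (N X * N Y)"
    and \<tau>_nat: "\<lbrakk>X \<in> Obj C; X' \<in> Obj C; Y \<in> Obj C; Y' \<in> Obj C; f \<in> Hom C X X'; g \<in> Hom C Y Y'\<rbrakk>
        \<Longrightarrow> M (TenO C X Y) (TenO C X' Y') (TenM C X X' Y Y' f g) * \<tau> X Y = \<tau> X' Y' * kron (M X X' f) (M Y Y' g)"
    and \<tau>_p: "\<lbrakk>X \<in> Obj C; Y \<in> Obj C\<rbrakk> \<Longrightarrow> M (TenO C X Y) (TenO C X Y) (Idm C (TenO C X Y)) * \<tau> X Y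
        = \<tau> X Y * kron (M X X (Idm C X)) (M Y Y (Idm C Y))"
    and \<tau>_\<Theta>: "\<lbrakk>X \<in> Obj C; Y \<in> Obj C; s \<in> carrier G\<rbrakk> \<Longrightarrow> \<Theta> (TenO C X Y) s * \<tau> X Y = \<tau> X Y * kron (\<Theta> X s) (\<Theta> Y s)"
    and \<tau>_assoc: "\<lbrakk>X \<in> Obj C; Y \<in> Obj C; Z \<in> Obj C\<rbrakk> \<Longrightarrow>
        \<tau> (TenO C X Y) Z * kron (\<tau> X Y) (1\<^sub>m (N Z)) = \<tau> X (TenO C Y Z) * kron (1\<^sub>m (N X)) (\<tau> Y Z)"
    and N_unit: "N (Unit C) = 1" and p_unit: "M (Unit C) (Unit C) (Idm C (Unit C)) = 1\<^sub>m 1"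
    and \<Theta>_unit: "s \<in> carrier G \<Longrightarrow> \<Theta> (Unit C) s = 1\<^sub>m 1"
    and \<tau>_unit: "X \<in> Obj C \<Longrightarrow> \<tau> (Unit C) X = 1\<^sub>m (N X)" "X \<in> Obj C \<Longrightarrow> \<tau> X (Unit C) = 1\<^sub>m (N X)"
    and ess: "is_rep G V \<Longrightarrow> \<exists>X \<in> Obj C. \<exists>L L'. L \<in> carrier_mat (N X) (fst V) \<and> L' \<in> carrier_mat (fst V) (N X) \<and>
        L' * L = 1\<^sub>m (fst V) \<and> L * L' = M X X (Idm C X) \<and> (\<forall>g \<in> carrier G. \<Theta> X g * L = L * snd V g)"
begin

lemma M_d [simp]: "\<lbrakk>X \<in> Obj C; Y \<in> Obj C; f \<in> Hom C X Y\<rbrakk> \<Longrightarrow> dim_row (M X Y f) = N Y"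
  "\<lbrakk>X \<in> Obj C; Y \<in> Obj C; f \<in> Hom C X Y\<rbrakk> \<Longrightarrow> dim_col (M X Y f) = N X"
  using M_dim by (blast dest: carrier_matD)+
lemma \<Theta>_d [simp]: "\<lbrakk>X \<in> Obj C; g \<in> carrier G\<rbrakk> \<Longrightarrow> dim_row (\<Theta> X g) = N X"
  "\<lbrakk>X \<in> Obj C; g \<in> carrier G\<rbrakk> \<Longrightarrow> dim_col (\<Theta> X g) = N X"
  using \<Theta>_dim by (blast dest: carrier_matD)+
lemma \<tau>_d [simp]: "\<lbrakk>X \<in> Obj C; Y \<in> Obj C\<rbrakk> \<Longrightarrow> dim_row (\<tau> X Y) = N (TenO C X Y)"
  "\<lbrakk>X \<in> Obj C; Y \<in> Obj C\<rbrakk> \<Longrightarrow> dim_col (\<tau> X Y) = N X * N Y"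
  "\<lbrakk>X \<in> Obj C; Y \<in> Obj C\<rbrakk> \<Longrightarrow> dim_row (\<tau>' X Y) = N X * N Y"
  "\<lbrakk>X \<in> Obj C; Y \<in> Obj C\<rbrakk> \<Longrightarrow> dim_col (\<tau>' X Y) = N (TenO C X Y)"
  using \<tau>_dim by (blast dest: carrier_matD)+

lemmas cl [simp] = Id_cl Comp_cl Zero_cl Add_cl Scale_cl Unit_cl TenO_cl TenM_cl

lemma \<tau>_cancel: assumes "X \<in> Obj C" "Y \<in> Obj C" "dim_col A = N (TenO C X Y)" "dim_col B = N (TenO C X Y)" "A * \<tau> X Y = B * \<tau> X Y"
  shows "A = B"
proof -
  have "(A * \<tau> X Y) * \<tau>' X Y = (B * \<tau> X Y) * \<tau>' X Y" using assms(5) by simp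
  moreover have "(Z * \<tau> X Y) * \<tau>' X Y = Z" if "dim_col Z = N (TenO C X Y)" for Z
    using assms that mat_assoc[of Z "\<tau> X Y" "\<tau>' X Y"] by (simp add: \<tau>_inv mat_one)
  ultimately show ?thesis using assms(3,4) by metis
qed

lemma \<tau>_nat': "\<lbrakk>X \<in> Obj C; X' \<in> Obj C; Y \<in> Obj C; Y' \<in> Obj C; f \<in> Hom C X X'; g \<in> Hom C Y Y'; dim_row Z = N X * N Y\<rbrakk>
        \<Longrightarrow> M (TenO C X Y) (TenO C X' Y') (TenM C X X' Y Y' f g) * (\<tau> X Y * Z) = \<tau> X' Y' * (kron (M X X' f) (M Y Y' g) * Z)"
  using \<tau>_nat[of X X' Y Y' f g] by (simp add: mat_assoc[symmetric])
lemma M_ten_inj: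
  assumes "X \<in> Obj C" "Y \<in> Obj C" "Z \<in> Obj C" "f \<in> Hom C (TenO C X Y) Z" "g \<in> Hom C (TenO C X Y) Z"
    "M (TenO C X Y) Z f * \<tau> X Y = M (TenO C X Y) Z g * \<tau> X Y"
  shows "f = g"
  using assms by (intro M_inj[of "TenO C X Y" Z f g] \<tau>_cancel[of X Y "M (TenO C X Y) Z f" "M (TenO C X Y) Z g"]) auto

lemma category: "linear_category C"
proof unfold_locales
  fix W X Y Z f g h assume a: "W \<in> Obj C" "X \<in> Obj C" "Y \<in> Obj C" "Z \<in> Obj C" "f \<in> Hom C W X" "g \<in> Hom C X Y" "h \<in> Hom C Y Z"
  then show "Comp C W Y Z h (Comp C W X Y g f) = Comp C W X Z (Comp C X Y Z h g) f"
    by (intro M_inj[of W Z]) (simp_all add: M_comp mat_assoc cl(2)[of W X Y] cl(2)[of X Y Z] cl(2)[of W Y Z] cl(2)[of W X Z])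
next
  fix X Y f assume a: "X \<in> Obj C" "Y \<in> Obj C" "f \<in> Hom C X Y"
  show "Comp C X Y Y (Idm C Y) f = f" "Comp C X X Y f (Idm C X) = f"
    using a by (intro M_inj[of X Y]; simp add: M_comp M_p cl(2)[of X Y Y] cl(2)[of X X Y])+
  show "Add C X Y (Zero C X Y) f = f" using a by (intro M_inj[of X Y]) (auto simp: M_add M_zero intro!: eq_matI)
  show "\<exists>g \<in> Hom C X Y. Add C X Y f g = Zero C X Y"
    using a by (intro bexI[of _ "Scale C X Y (-1) f"] M_inj[of X Y]) (auto simp: M_add M_zero M_scale intro!: eq_matI)
  show "Scale C X Y 1 f = f" using a by (intro M_inj[of X Y]) (auto simp: M_scale intro!: eq_matI)
  show "Scale C X Y c (Scale C X Y d f) = Scale C X Y (c * d) f" for c d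
    using a by (intro M_inj[of X Y]) (auto simp: M_scale intro!: eq_matI)
  show "Scale C X Y (c + d) f = Add C X Y (Scale C X Y c f) (Scale C X Y d f)" for c d
    using a by (intro M_inj[of X Y]) (auto simp: M_scale M_add algebra_simps intro!: eq_matI)
next
  fix X Y f g assume a: "X \<in> Obj C" "Y \<in> Obj C" "f \<in> Hom C X Y" "g \<in> Hom C X Y"
  show "Add C X Y f g = Add C X Y g f" using a by (intro M_inj[of X Y]) (auto simp: M_add intro!: eq_matI)
  show "Scale C X Y c (Add C X Y f g) = Add C X Y (Scale C X Y c f) (Scale C X Y c g)" for c
    using a by (intro M_inj[of X Y]) (auto simp: M_scale M_add algebra_simps intro!: eq_matI)
next
  fix X Y f g h assume a: "X \<in> Obj C" "Y \<in> Obj C" "f \<in> Hom C X Y" "g \<in> Hom C X Y" "h \<in> Hom C X Y"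
  then show "Add C X Y (Add C X Y f g) h = Add C X Y f (Add C X Y g h)"
    by (intro M_inj[of X Y]) (auto simp: M_add intro!: eq_matI)
next
  fix X Y Z f g g' assume a: "X \<in> Obj C" "Y \<in> Obj C" "Z \<in> Obj C" "f \<in> Hom C X Y" "g \<in> Hom C Y Z" "g' \<in> Hom C Y Z"
  then show "Comp C X Y Z (Add C Y Z g g') f = Add C X Z (Comp C X Y Z g f) (Comp C X Y Z g' f)"
    by (intro M_inj[of X Z]) (simp_all add: M_comp M_add mat_add_distrib cl(2)[of X Y Z])
next
  fix X Y Z f f' g assume a: "X \<in> Obj C" "Y \<in> Obj C" "Z \<in> Obj C" "f \<in> Hom C X Y" "f' \<in> Hom C X Y" "g \<in> Hom C Y Z"
  then show "Comp C X Y Z g (Add C X Y f f') = Add C X Z (Comp C X Y Z g f) (Comp C X Y Z g f')"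
    by (intro M_inj[of X Z]) (simp_all add: M_comp M_add mat_add_distrib cl(2)[of X Y Z])
next
  fix X Y Z f g c assume a: "X \<in> Obj C" "Y \<in> Obj C" "Z \<in> Obj C" "f \<in> Hom C X Y" "g \<in> Hom C Y Z"
  then show "Comp C X Y Z (Scale C Y Z c g) f = Scale C X Z c (Comp C X Y Z g f)" "Comp C X Y Z g (Scale C X Y c f) = Scale C X Z c (Comp C X Y Z g f)"
    by (intro M_inj[of X Z]; simp add: M_comp M_scale mat_smult cl(2)[of X Y Z])+
qed simp_all

lemma strict: "strict_linear_monoidal_category C"
proof -
  interpret linear_category C by (rule category)
  show ?thesis
  proof unfold_locales
    fix X Y assume a: "X \<in> Obj C" "Y \<in> Obj C"
    then show "TenM C X X Y Y (Idm C X) (Idm C Y) = Idm C (TenO C X Y)"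
      by (intro M_ten_inj[of X Y "TenO C X Y"]) (simp_all add: \<tau>_nat \<tau>_p)
  next
    fix X X' X'' Y Y' Y'' f f' g g'
    assume a: "X \<in> Obj C" "X' \<in> Obj C" "X'' \<in> Obj C" "Y \<in> Obj C" "Y' \<in> Obj C" "Y'' \<in> Obj C"
      "f \<in> Hom C X X'" "f' \<in> Hom C X' X''" "g \<in> Hom C Y Y'" "g' \<in> Hom C Y' Y''"
    have c [simp]: "Comp C X X' X'' f' f \<in> Hom C X X''" "Comp C Y Y' Y'' g' g \<in> Hom C Y Y''"
      "Comp C (TenO C X Y) (TenO C X' Y') (TenO C X'' Y'') (TenM C X' X'' Y' Y'' f' g') (TenM C X X' Y Y' f g) \<in> Hom C (TenO C X Y) (TenO C X'' Y'')"
      using a by (auto intro: Comp_cl)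
    have "M (TenO C X' Y') (TenO C X'' Y'') (TenM C X' X'' Y' Y'' f' g') * (M (TenO C X Y) (TenO C X' Y') (TenM C X X' Y Y' f g) * \<tau> X Y)
      = (M (TenO C X' Y') (TenO C X'' Y'') (TenM C X' X'' Y' Y'' f' g') * \<tau> X' Y') * kron (M X X' f) (M Y Y' g)"
      using a by (simp add: \<tau>_nat \<tau>_nat' mat_assoc)
    also have "\<dots> = \<tau> X'' Y'' * kron (M X' X'' f' * M X X' f) (M Y' Y'' g' * M Y Y' g)"
      using a by (simp add: \<tau>_nat \<tau>_nat' mat_assoc kron_comp)
    finally show "TenM C X X'' Y Y'' (Comp C X X' X'' f' f) (Comp C Y Y' Y'' g' g) =
       Comp C (TenO C X Y) (TenO C X' Y') (TenO C X'' Y'') (TenM C X' X'' Y' Y'' f' g') (TenM C X X' Y Y' f g)"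
      using a by (intro M_ten_inj[of X Y "TenO C X'' Y''"]) (simp_all add: \<tau>_nat \<tau>_nat' M_comp mat_assoc kron_comp)
  next
    fix X X' Y Y' f f' g assume a: "X \<in> Obj C" "X' \<in> Obj C" "Y \<in> Obj C" "Y' \<in> Obj C" "f \<in> Hom C X X'" "f' \<in> Hom C X X'" "g \<in> Hom C Y Y'"
    then show "TenM C X X' Y Y' (Add C X X' f f') g = Add C (TenO C X Y) (TenO C X' Y') (TenM C X X' Y Y' f g) (TenM C X X' Y Y' f' g)"
      by (intro M_ten_inj[of X Y "TenO C X' Y'"])
        (simp_all add: \<tau>_nat M_add mat_add_distrib kron_add(1)[OF M_dim[of X X' f] M_dim[of X X' f'] M_dim[of Y Y' g] M_dim[of Y Y' g]])
  next
    fix X X' Y Y' f g g' assume a: "X \<in> Obj C" "X' \<in> Obj C" "Y \<in> Obj C" "Y' \<in> Obj C" "f \<in> Hom C X X'" "g \<in> Hom C Y Y'" "g' \<in> Hom C Y Y'"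
    then show "TenM C X X' Y Y' f (Add C Y Y' g g') = Add C (TenO C X Y) (TenO C X' Y') (TenM C X X' Y Y' f g) (TenM C X X' Y Y' f g')"
      by (intro M_ten_inj[of X Y "TenO C X' Y'"])
        (simp_all add: \<tau>_nat M_add mat_add_distrib kron_add(2)[OF M_dim[of X X' f] M_dim[of X X' f] M_dim[of Y Y' g] M_dim[of Y Y' g']])
  next
    fix X X' Y Y' f g c assume a: "X \<in> Obj C" "X' \<in> Obj C" "Y \<in> Obj C" "Y' \<in> Obj C" "f \<in> Hom C X X'" "g \<in> Hom C Y Y'"
    then show "TenM C X X' Y Y' (Scale C X X' c f) g = Scale C (TenO C X Y) (TenO C X' Y') c (TenM C X X' Y Y' f g)"
      "TenM C X X' Y Y' f (Scale C Y Y' c g) = Scale C (TenO C X Y) (TenO C X' Y') c (TenM C X X' Y Y' f g)"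
      by (intro M_ten_inj[of X Y "TenO C X' Y'"];
        simp add: \<tau>_nat M_scale mat_smult kron_add(3,4)[OF M_dim[of X X' f] M_dim[of X X' f] M_dim[of Y Y' g] M_dim[of Y Y' g]])+
  next
    fix X X' Y Y' Z Z' f g h
    assume a: "X \<in> Obj C" "X' \<in> Obj C" "Y \<in> Obj C" "Y' \<in> Obj C" "Z \<in> Obj C" "Z' \<in> Obj C" "f \<in> Hom C X X'" "g \<in> Hom C Y Y'" "h \<in> Hom C Z Z'"
    let ?XY = "TenO C X Y" and ?XY' = "TenO C X' Y'" and ?YZ = "TenO C Y Z" and ?YZ' = "TenO C Y' Z'"
    let ?l = "TenM C ?XY ?XY' Z Z' (TenM C X X' Y Y' f g) h" and ?r = "TenM C X X' ?YZ ?YZ' f (TenM C Y Y' Z Z' g h)"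
    let ?D = "TenO C X ?YZ" and ?D' = "TenO C X' ?YZ'"
    have o: "TenO C ?XY Z = ?D" "TenO C ?XY' Z' = ?D'" using a by (simp_all add: TO_assoc)
    have lH: "?l \<in> Hom C ?D ?D'" using a TenM_cl[of ?XY ?XY' Z Z' "TenM C X X' Y Y' f g" h] o by simp
    have rH: "?r \<in> Hom C ?D ?D'" using a by simp
    have "M ?D ?D' ?l * (\<tau> ?XY Z * kron (\<tau> X Y) (1\<^sub>m (N Z))) = (M ?D ?D' ?l * \<tau> ?XY Z) * kron (\<tau> X Y) (1\<^sub>m (N Z))"
      using a lH o by (intro mat_assoc[symmetric]) auto
    also have "M ?D ?D' ?l * \<tau> ?XY Z = \<tau> ?XY' Z' * kron (M ?XY ?XY' (TenM C X X' Y Y' f g)) (M Z Z' h)"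
      using \<tau>_nat[of ?XY ?XY' Z Z' "TenM C X X' Y Y' f g" h] a o by simp
    also have "\<dots> * kron (\<tau> X Y) (1\<^sub>m (N Z)) = \<tau> ?XY' Z' * kron (M ?XY ?XY' (TenM C X X' Y Y' f g) * \<tau> X Y) (M Z Z' h)"
      using a by (simp add: mat_assoc kron_comp mat_one)
    also have "\<dots> = \<tau> ?XY' Z' * (kron (\<tau> X' Y') (1\<^sub>m (N Z')) * kron (kron (M X X' f) (M Y Y' g)) (M Z Z' h))"
      using a by (simp add: \<tau>_nat kron_comp mat_one)
    also have "\<dots> = (\<tau> ?XY' Z' * kron (\<tau> X' Y') (1\<^sub>m (N Z'))) * kron (kron (M X X' f) (M Y Y' g)) (M Z Z' h)"
      using a o by (intro mat_assoc[symmetric]) auto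
    also have "\<dots> = (\<tau> X' ?YZ' * kron (1\<^sub>m (N X')) (\<tau> Y' Z')) * kron (M X X' f) (kron (M Y Y' g) (M Z Z' h))"
      using a by (simp only: \<tau>_assoc kron_assoc')
    also have "\<dots> = \<tau> X' ?YZ' * (kron (1\<^sub>m (N X')) (\<tau> Y' Z') * kron (M X X' f) (kron (M Y Y' g) (M Z Z' h)))"
      using a o by (intro mat_assoc) auto
    also have "\<dots> = \<tau> X' ?YZ' * kron (M X X' f) (M ?YZ ?YZ' (TenM C Y Y' Z Z' g h) * \<tau> Y Z)"
      using a by (simp add: kron_comp mat_one \<tau>_nat)
    also have "\<dots> = (\<tau> X' ?YZ' * kron (M X X' f) (M ?YZ ?YZ' (TenM C Y Y' Z Z' g h))) * kron (1\<^sub>m (N X)) (\<tau> Y Z)"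
      using a by (simp add: mat_assoc kron_comp mat_one)
    also have "\<tau> X' ?YZ' * kron (M X X' f) (M ?YZ ?YZ' (TenM C Y Y' Z Z' g h)) = M ?D ?D' ?r * \<tau> X ?YZ"
      using \<tau>_nat[of X X' ?YZ ?YZ' f "TenM C Y Y' Z Z' g h"] a by simp
    also have "\<dots> * kron (1\<^sub>m (N X)) (\<tau> Y Z) = M ?D ?D' ?r * (\<tau> ?XY Z * kron (\<tau> X Y) (1\<^sub>m (N Z)))"
      using a rH by (simp add: \<tau>_assoc mat_assoc)
    finally have e: "M ?D ?D' ?l * (\<tau> ?XY Z * kron (\<tau> X Y) (1\<^sub>m (N Z))) = M ?D ?D' ?r * (\<tau> ?XY Z * kron (\<tau> X Y) (1\<^sub>m (N Z)))" .
    have "(\<tau> ?XY Z * kron (\<tau> X Y) (1\<^sub>m (N Z))) * (kron (\<tau>' X Y) (1\<^sub>m (N Z)) * \<tau>' ?XY Z) = \<tau> ?XY Z * ((kron (\<tau> X Y) (1\<^sub>m (N Z)) * kron (\<tau>' X Y) (1\<^sub>m (N Z))) * \<tau>' ?XY Z)"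
      using a o by (simp add: mat_assoc)
    also have "\<dots> = 1\<^sub>m (N ?D)" using a o by (simp add: kron_comp \<tau>_inv mat_one kron_one)
    finally have i: "(\<tau> ?XY Z * kron (\<tau> X Y) (1\<^sub>m (N Z))) * (kron (\<tau>' X Y) (1\<^sub>m (N Z)) * \<tau>' ?XY Z) = 1\<^sub>m (N ?D)" .
    have c: "A = B" if "A * T = B * T" "T * T' = 1\<^sub>m (N ?D)" "dim_col A = N ?D" "dim_col B = N ?D" "dim_row T = N ?D" "dim_col T = dim_row T'" for A B T T' :: "complex mat"
    proof -
      have "(A * T) * T' = A" "(B * T) * T' = B" using that(2-6) mat_assoc[of A T T'] mat_assoc[of B T T'] by (simp_all add: mat_one)
      then show ?thesis using that(1) by metis
    qed
    have "M ?D ?D' ?l = M ?D ?D' ?r" by (rule c[OF e i]) (use a lH rH o in auto)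
    then show "?l = ?r" using a lH rH by (intro M_inj[of ?D ?D']) simp_all
  next
    fix X Y f assume a: "X \<in> Obj C" "Y \<in> Obj C" "f \<in> Hom C X Y"
    have h: "TenM C (Unit C) (Unit C) X Y (Idm C (Unit C)) f \<in> Hom C X Y" "TenM C X Y (Unit C) (Unit C) f (Idm C (Unit C)) \<in> Hom C X Y"
      using a TenM_cl[of "Unit C" "Unit C" X Y "Idm C (Unit C)" f] TenM_cl[of X Y "Unit C" "Unit C" f "Idm C (Unit C)"] by (simp_all add: TO_unit)
    show "TenM C (Unit C) (Unit C) X Y (Idm C (Unit C)) f = f"
      using a h \<tau>_nat[of "Unit C" "Unit C" X Y "Idm C (Unit C)" f] by (intro M_inj[of X Y]) (simp_all add: TO_unit \<tau>_unit p_unit kron_1'[unfolded One_nat_def] mat_one)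
    show "TenM C X Y (Unit C) (Unit C) f (Idm C (Unit C)) = f"
      using a h \<tau>_nat[of X Y "Unit C" "Unit C" f "Idm C (Unit C)"] by (intro M_inj[of X Y]) (simp_all add: TO_unit \<tau>_unit p_unit kron_1'[unfolded One_nat_def] mat_one)
  qed (simp_all add: TO_assoc TO_unit As_Id LU_Id RU_Id)
qed

section \<open>The functor to representations\<close>

abbreviation p where "p X \<equiv> M X X (Idm C X)"

text \<open>The image of the idempotent of \<open>X\<close> carries the representation that corresponds to \<open>X\<close>; \<open>B\<close> is the
  inclusion of the image in coordinates and \<open>K\<close> the projection onto it.\<close>

definition splitting :: "'o \<Rightarrow> nat \<times> complex mat \<times> complex mat" where
  "splitting X = (SOME (r, B, K). B \<in> carrier_mat (N X) r \<and> K \<in> carrier_mat r (N X) \<and> B * K = p X \<and> K * B = 1\<^sub>m r)"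
definition r where "r X = fst (splitting X)"
definition B where "B X = fst (snd (splitting X))"
definition K where "K X = snd (snd (splitting X))"

lemma split: assumes X: "X \<in> Obj C"
  shows "B X \<in> carrier_mat (N X) (r X) \<and> K X \<in> carrier_mat (r X) (N X) \<and> B X * K X = p X \<and> K X * B X = 1\<^sub>m (r X)"
proof -
  have "\<exists>r B K. B \<in> carrier_mat (N X) r \<and> K \<in> carrier_mat r (N X) \<and> B * K = p X \<and> K * B = 1\<^sub>m r"
    using idempotent_splits[OF M_dim[OF X X Id_cl[OF X]] M_p(1)[OF X X Id_cl[OF X]]] by metis
  then have "\<exists>t. case t of (k, L, R) \<Rightarrow> L \<in> carrier_mat (N X) k \<and> R \<in> carrier_mat k (N X) \<and> L * R = p X \<and> R * L = 1\<^sub>m k" by auto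
  from someI_ex[OF this] show ?thesis unfolding r_def B_def K_def splitting_def by (auto split: prod.splits)
qed

lemma BK_d [simp]: "X \<in> Obj C \<Longrightarrow> dim_row (B X) = N X" "X \<in> Obj C \<Longrightarrow> dim_col (B X) = r X"
  "X \<in> Obj C \<Longrightarrow> dim_row (K X) = r X" "X \<in> Obj C \<Longrightarrow> dim_col (K X) = N X"
  using split by (blast dest: carrier_matD)+

lemma BK: "X \<in> Obj C \<Longrightarrow> B X * K X = p X" "X \<in> Obj C \<Longrightarrow> K X * B X = 1\<^sub>m (r X)"
  using split by blast+

lemma BK': "\<lbrakk>X \<in> Obj C; dim_row Z = N X\<rbrakk> \<Longrightarrow> B X * (K X * Z) = p X * Z"
  "\<lbrakk>X \<in> Obj C; dim_row Z = r X\<rbrakk> \<Longrightarrow> K X * (B X * Z) = Z"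
  by (simp_all add: mat_assoc[symmetric] BK mat_one)

lemma pB: assumes X: "X \<in> Obj C" shows "p X * B X = B X" "K X * p X = K X"
proof -
  have "(B X * K X) * B X = B X * (K X * B X)" "K X * (B X * K X) = (K X * B X) * K X" using X by (simp_all add: mat_assoc)
  then show "p X * B X = B X" "K X * p X = K X" using X by (simp_all add: BK mat_one)
qed

lemma pB': "\<lbrakk>X \<in> Obj C; dim_row Z = r X\<rbrakk> \<Longrightarrow> p X * (B X * Z) = B X * Z"
  "\<lbrakk>X \<in> Obj C; dim_row Z = N X\<rbrakk> \<Longrightarrow> K X * (p X * Z) = K X * Z"
  by (simp_all add: mat_assoc[symmetric] pB)

lemma Mp': "\<lbrakk>X \<in> Obj C; Y \<in> Obj C; f \<in> Hom C X Y; dim_row Z = N X\<rbrakk> \<Longrightarrow> M X Y f * (p X * Z) = M X Y f * Z"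
  "\<lbrakk>X \<in> Obj C; Y \<in> Obj C; f \<in> Hom C X Y; dim_row Z = N X\<rbrakk> \<Longrightarrow> p Y * (M X Y f * Z) = M X Y f * Z"
  by (simp_all add: mat_assoc[symmetric] M_p)

lemma p\<Theta>: "\<lbrakk>X \<in> Obj C; g \<in> carrier G\<rbrakk> \<Longrightarrow> p X * \<Theta> X g = \<Theta> X g * p X" using M_comm by simp
lemma p\<Theta>': "\<lbrakk>X \<in> Obj C; g \<in> carrier G; dim_row Z = N X\<rbrakk> \<Longrightarrow> p X * (\<Theta> X g * Z) = \<Theta> X g * (p X * Z)"
  using p\<Theta> by (simp add: mat_assoc[symmetric])
lemma M_comm': "\<lbrakk>X \<in> Obj C; Y \<in> Obj C; f \<in> Hom C X Y; g \<in> carrier G; dim_row Z = N X\<rbrakk> \<Longrightarrow> M X Y f * (\<Theta> X g * Z) = \<Theta> Y g * (M X Y f * Z)"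
  using M_comm by (simp add: mat_assoc[symmetric])

lemmas calc = mat_assoc BK BK' pB pB' M_p Mp' p\<Theta> p\<Theta>' mat_one kron_comp kron_one

definition F :: "'o \<Rightarrow> 'g rep" where "F X = (r X, \<lambda>g \<in> carrier G. K X * (\<Theta> X g * B X))"
definition Fm :: "'o \<Rightarrow> 'o \<Rightarrow> 'm \<Rightarrow> complex mat" where "Fm X Y f = K Y * (M X Y f * B X)"
definition JJ :: "'o \<Rightarrow> 'o \<Rightarrow> complex mat" where "JJ X Y = K (TenO C X Y) * (\<tau> X Y * kron (B X) (B Y))"

lemma F_simps [simp]: "fst (F X) = r X" "g \<in> carrier G \<Longrightarrow> snd (F X) g = K X * (\<Theta> X g * B X)"
  by (simp_all add: F_def)

lemma F_rep: assumes X: "X \<in> Obj C" shows "is_rep G (F X)"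
proof -
  have "K X * (\<Theta> X (g \<otimes>\<^bsub>G\<^esub> h) * B X) = K X * (\<Theta> X g * B X) * (K X * (\<Theta> X h * B X))" if "g \<in> carrier G" "h \<in> carrier G" for g h
    using X that by (simp add: calc \<Theta>_mult)
  then show ?thesis using X one_G mult_G unfolding is_rep_def
    by (auto simp: F_def \<Theta>_one calc intro!: carrier_matI)
qed

lemma Fm_dim [simp]: "\<lbrakk>X \<in> Obj C; Y \<in> Obj C\<rbrakk> \<Longrightarrow> dim_row (Fm X Y f) = r Y" "\<lbrakk>X \<in> Obj C; Y \<in> Obj C\<rbrakk> \<Longrightarrow> dim_col (Fm X Y f) = r X"
  by (simp_all add: Fm_def)
lemma JJ_dim [simp]: "\<lbrakk>X \<in> Obj C; Y \<in> Obj C\<rbrakk> \<Longrightarrow> dim_row (JJ X Y) = r (TenO C X Y)" "\<lbrakk>X \<in> Obj C; Y \<in> Obj C\<rbrakk> \<Longrightarrow> dim_col (JJ X Y) = r X * r Y"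
  by (simp_all add: JJ_def)

lemma Fm_Hom: assumes "X \<in> Obj C" "Y \<in> Obj C" "f \<in> Hom C X Y" shows "Fm X Y f \<in> Hom (Rep G) (F X) (F Y)"
  using assms by (auto simp: Fm_def calc M_comm' M_comm intro!: carrier_matI)

lemma Fm_Id: "X \<in> Obj C \<Longrightarrow> Fm X X (Idm C X) = 1\<^sub>m (r X)"
  by (simp add: Fm_def calc)

lemma BFK: assumes "X \<in> Obj C" "Y \<in> Obj C" "f \<in> Hom C X Y" shows "B Y * (Fm X Y f * K X) = M X Y f"
  using assms by (simp add: Fm_def calc)

lemma full: assumes "X \<in> Obj C" "Y \<in> Obj C" "h \<in> Hom (Rep G) (F X) (F Y)" shows "\<exists>f \<in> Hom C X Y. Fm X Y f = h"
proof -
  have h [simp]: "dim_row h = r Y" "dim_col h = r X" using assms by auto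
  have c: "h * (K X * (\<Theta> X g * B X)) = K Y * (\<Theta> Y g * B Y) * h" if "g \<in> carrier G" for g using assms that by auto
  have "B Y * (h * K X) * \<Theta> X g = \<Theta> Y g * (B Y * (h * K X))" if g: "g \<in> carrier G" for g
  proof -
    have "B Y * (h * K X) * \<Theta> X g = B Y * (h * ((K X * p X) * \<Theta> X g))" using assms g by (simp add: calc)
    also have "\<dots> = B Y * ((h * (K X * (\<Theta> X g * B X))) * K X)" using assms(1,2) g by (simp add: mat_assoc BK p\<Theta>)
    also have "\<dots> = B Y * (K Y * (\<Theta> Y g * (B Y * (h * K X))))" using assms(1,2) g by (simp add: c mat_assoc)
    also have "\<dots> = \<Theta> Y g * (B Y * (h * K X))" using assms(1,2) g by (simp add: calc)
    finally show ?thesis .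
  qed
  moreover have "p Y * (B Y * (h * K X)) * p X = B Y * (h * K X)" using assms(1,2) by (simp add: calc)
  moreover have "B Y * (h * K X) \<in> carrier_mat (N Y) (N X)" using assms(1,2) by (intro carrier_matI) auto
  ultimately obtain f where f: "f \<in> Hom C X Y" "M X Y f = B Y * (h * K X)" using M_full[OF assms(1,2)] by blast
  have "Fm X Y f = h" unfolding Fm_def f(2) using assms(1,2) by (simp add: calc)
  then show ?thesis using f by blast
qed

lemma \<tau>_p': "\<lbrakk>X \<in> Obj C; Y \<in> Obj C; dim_row Z = N X * N Y\<rbrakk> \<Longrightarrow> p (TenO C X Y) * (\<tau> X Y * Z) = \<tau> X Y * (kron (p X) (p Y) * Z)"
  using \<tau>_p by (simp add: mat_assoc[symmetric])
lemma \<tau>_\<Theta>': "\<lbrakk>X \<in> Obj C; Y \<in> Obj C; g \<in> carrier G; dim_row Z = N X * N Y\<rbrakk> \<Longrightarrow> \<Theta> (TenO C X Y) g * (\<tau> X Y * Z) = \<tau> X Y * (kron (\<Theta> X g) (\<Theta> Y g) * Z)"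
  using \<tau>_\<Theta> by (simp add: mat_assoc[symmetric])
lemma \<tau>_inv': "\<lbrakk>X \<in> Obj C; Y \<in> Obj C; dim_row Z = N (TenO C X Y)\<rbrakk> \<Longrightarrow> \<tau> X Y * (\<tau>' X Y * Z) = Z"
   "\<lbrakk>X \<in> Obj C; Y \<in> Obj C; dim_row Z = N X * N Y\<rbrakk> \<Longrightarrow> \<tau>' X Y * (\<tau> X Y * Z) = Z"
  by (simp_all add: mat_assoc[symmetric] \<tau>_inv mat_one)

lemma JJ_hom: assumes "X \<in> Obj C" "Y \<in> Obj C" shows "JJ X Y \<in> Hom (Rep G) (TenO (Rep G) (F X) (F Y)) (F (TenO C X Y))"
proof -
  have "JJ X Y * kron (snd (F X) g) (snd (F Y) g) = snd (F (TenO C X Y)) g * JJ X Y" if g: "g \<in> carrier G" for g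
    using assms g by (simp add: JJ_def calc \<tau>_p' \<tau>_\<Theta>')
  then show ?thesis using assms by (auto simp: intro!: carrier_matI)
qed

lemma JJ_iso: assumes "X \<in> Obj C" "Y \<in> Obj C" shows "is_iso (Rep G) (TenO (Rep G) (F X) (F Y)) (F (TenO C X Y)) (JJ X Y)"
proof -
  define J' where "J' = kron (K X) (K Y) * (\<tau>' X Y * B (TenO C X Y))"
  have d: "dim_row J' = r X * r Y" "dim_col J' = r (TenO C X Y)" using assms by (simp_all add: J'_def)
  have \<tau>p: "\<tau>' X Y * (p (TenO C X Y) * Z) = kron (p X) (p Y) * (\<tau>' X Y * Z)" if "dim_row Z = N (TenO C X Y)" for Z
  proof -
    have "p (TenO C X Y) * Z = p (TenO C X Y) * (\<tau> X Y * (\<tau>' X Y * Z))" using assms that by (simp add: \<tau>_inv')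
    also have "\<dots> = \<tau> X Y * (kron (p X) (p Y) * (\<tau>' X Y * Z))" using assms that by (simp add: \<tau>_p')
    finally show ?thesis using assms that by (simp add: \<tau>_inv')
  qed
  have 1: "J' * JJ X Y = 1\<^sub>m (r X * r Y)"
    using assms by (simp add: J'_def JJ_def calc \<tau>p \<tau>_inv' \<tau>_inv)
  have 2: "JJ X Y * J' = 1\<^sub>m (r (TenO C X Y))"
  proof -
    have "JJ X Y * J' = K (TenO C X Y) * (\<tau> X Y * (kron (p X) (p Y) * (\<tau>' X Y * B (TenO C X Y))))"
      using assms unfolding J'_def JJ_def by (simp add: mat_assoc) (simp add: mat_assoc[symmetric] kron_comp BK)
    also have "\<dots> = 1\<^sub>m (r (TenO C X Y))" using assms by (simp add: \<tau>_p'[symmetric] \<tau>_inv' calc)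
    finally show ?thesis .
  qed
  have "J' * snd (F (TenO C X Y)) g = kron (snd (F X) g) (snd (F Y) g) * J'" if g: "g \<in> carrier G" for g
  proof -
    have c: "JJ X Y * kron (snd (F X) g) (snd (F Y) g) = snd (F (TenO C X Y)) g * JJ X Y" using JJ_hom[OF assms] g by auto
    have s: "dim_row (snd (F X) g) = r X" "dim_col (snd (F X) g) = r X" "dim_row (snd (F Y) g) = r Y" "dim_col (snd (F Y) g) = r Y"
      "dim_row (snd (F (TenO C X Y)) g) = r (TenO C X Y)" "dim_col (snd (F (TenO C X Y)) g) = r (TenO C X Y)" using assms g by simp_all
    have "J' * snd (F (TenO C X Y)) g = J' * (snd (F (TenO C X Y)) g * (JJ X Y * J'))" using s by (simp only: 2 mat_one)
    also have "\<dots> = J' * ((snd (F (TenO C X Y)) g * JJ X Y) * J')" using assms s d by (simp only: mat_assoc JJ_dim)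
    also have "\<dots> = (J' * JJ X Y) * (kron (snd (F X) g) (snd (F Y) g) * J')" using assms s d by (simp only: c[symmetric] mat_assoc JJ_dim kron_dim index_mult_mat)
    also have "\<dots> = kron (snd (F X) g) (snd (F Y) g) * J'" using s by (simp only: 1 mat_one kron_dim index_mult_mat)
    finally show ?thesis .
  qed
  then have "J' \<in> Hom (Rep G) (F (TenO C X Y)) (TenO (Rep G) (F X) (F Y))" using d by (auto intro!: carrier_matI)
  then show ?thesis unfolding is_iso_def using JJ_hom[OF assms] 1 2 by auto
qed

lemma F_functor: "linear_monoidal_functor C (Rep G) F Fm JJ (K (Unit C))"
proof unfold_locales
  fix X assume X: "X \<in> Obj C"
  show "F X \<in> Obj (Rep G)" using F_rep[OF X] by simp
  show "Fm X X (Idm C X) = Idm (Rep G) (F X)" using Fm_Id[OF X] by simp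
next
  fix X Y f assume "X \<in> Obj C" "Y \<in> Obj C" "f \<in> Hom C X Y"
  then show "Fm X Y f \<in> Hom (Rep G) (F X) (F Y)" by (rule Fm_Hom)
next
  fix X Y Z f g assume "X \<in> Obj C" "Y \<in> Obj C" "Z \<in> Obj C" "f \<in> Hom C X Y" "g \<in> Hom C Y Z"
  then show "Fm X Z (Comp C X Y Z g f) = Comp (Rep G) (F X) (F Y) (F Z) (Fm Y Z g) (Fm X Y f)"
    by (simp add: Fm_def M_comp calc)
next
  fix X Y f g assume "X \<in> Obj C" "Y \<in> Obj C" "f \<in> Hom C X Y" "g \<in> Hom C X Y"
  then show "Fm X Y (Add C X Y f g) = Add (Rep G) (F X) (F Y) (Fm X Y f) (Fm X Y g)"
    by (simp add: Fm_def M_add mat_add_distrib)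
next
  fix X Y f c assume "X \<in> Obj C" "Y \<in> Obj C" "f \<in> Hom C X Y"
  then show "Fm X Y (Scale C X Y c f) = Scale (Rep G) (F X) (F Y) c (Fm X Y f)"
    by (simp add: Fm_def M_scale mat_smult)
next
  fix X Y assume "X \<in> Obj C" "Y \<in> Obj C"
  then show "is_iso (Rep G) (TenO (Rep G) (F X) (F Y)) (F (TenO C X Y)) (JJ X Y)" by (rule JJ_iso)
next
  fix X X' Y Y' f g assume "X \<in> Obj C" "X' \<in> Obj C" "Y \<in> Obj C" "Y' \<in> Obj C" "f \<in> Hom C X X'" "g \<in> Hom C Y Y'"
  then show "Comp (Rep G) (TenO (Rep G) (F X) (F Y)) (TenO (Rep G) (F X') (F Y')) (F (TenO C X' Y')) (JJ X' Y')
        (TenM (Rep G) (F X) (F X') (F Y) (F Y') (Fm X X' f) (Fm Y Y' g)) =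
       Comp (Rep G) (TenO (Rep G) (F X) (F Y)) (F (TenO C X Y)) (F (TenO C X' Y'))
        (Fm (TenO C X Y) (TenO C X' Y') (TenM C X X' Y Y' f g)) (JJ X Y)"
    by (simp add: JJ_def Fm_def calc \<tau>_nat' \<tau>_p')
next
  have U: "Unit C \<in> Obj C" by simp
  have d: "dim_row (K (Unit C)) = r (Unit C)" "dim_col (K (Unit C)) = 1" "dim_row (B (Unit C)) = 1" "dim_col (B (Unit C)) = r (Unit C)"
    using BK_d[OF U] by (simp_all add: N_unit)
  show "is_iso (Rep G) (Unit (Rep G)) (F (Unit C)) (K (Unit C))"
    unfolding is_iso_def
  proof (intro conjI bexI[of _ "B (Unit C)"])
    show "K (Unit C) \<in> Hom (Rep G) (Unit (Rep G)) (F (Unit C))"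
      using d U by (auto simp: \<Theta>_unit mat_one mat_assoc BK p_unit intro!: carrier_matI)
    show "B (Unit C) \<in> Hom (Rep G) (F (Unit C)) (Unit (Rep G))"
      using d U by (auto simp: \<Theta>_unit mat_one mat_assoc BK BK' p_unit intro!: carrier_matI)
  qed (use d U in \<open>auto simp: BK p_unit\<close>)
next
  fix X Y Z assume a: "X \<in> Obj C" "Y \<in> Obj C" "Z \<in> Obj C"
  let ?XY = "TenO C X Y" and ?YZ = "TenO C Y Z"
  have o: "TenO C ?XY Z = TenO C X ?YZ" using a by (rule TO_assoc)
  have "JJ ?XY Z * kron (JJ X Y) (1\<^sub>m (r Z)) = K (TenO C X ?YZ) * (\<tau> ?XY Z * kron (p ?XY * (\<tau> X Y * kron (B X) (B Y))) (B Z))"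
    using a o by (simp add: JJ_def calc)
  also have "\<dots> = K (TenO C X ?YZ) * ((\<tau> ?XY Z * kron (\<tau> X Y) (1\<^sub>m (N Z))) * kron (kron (B X) (B Y)) (B Z))"
    using a o by (simp add: \<tau>_p' calc)
  also have "\<dots> = K (TenO C X ?YZ) * ((\<tau> X ?YZ * kron (1\<^sub>m (N X)) (\<tau> Y Z)) * kron (B X) (kron (B Y) (B Z)))"
    using a by (simp only: \<tau>_assoc kron_assoc')
  also have "\<dots> = K (TenO C X ?YZ) * (\<tau> X ?YZ * kron (B X) (p ?YZ * (\<tau> Y Z * kron (B Y) (B Z))))"
    using a by (simp add: \<tau>_p' calc)
  also have "\<dots> = JJ X ?YZ * kron (1\<^sub>m (r X)) (JJ Y Z)"
    using a by (simp add: JJ_def calc)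
  finally have e: "JJ ?XY Z * kron (JJ X Y) (1\<^sub>m (r Z)) = JJ X ?YZ * kron (1\<^sub>m (r X)) (JJ Y Z)" .
  have d: "dim_row (JJ ?XY Z) = r (TenO C X ?YZ)" using a o by simp
  show "Comp (Rep G) (TenO (Rep G) (TenO (Rep G) (F X) (F Y)) (F Z)) (F (TenO C ?XY Z)) (F (TenO C X ?YZ))
        (Fm (TenO C ?XY Z) (TenO C X ?YZ) (Assoc C X Y Z))
        (Comp (Rep G) (TenO (Rep G) (TenO (Rep G) (F X) (F Y)) (F Z)) (TenO (Rep G) (F ?XY) (F Z)) (F (TenO C ?XY Z))
          (JJ ?XY Z) (TenM (Rep G) (TenO (Rep G) (F X) (F Y)) (F ?XY) (F Z) (F Z) (JJ X Y) (Idm (Rep G) (F Z)))) =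
       Comp (Rep G) (TenO (Rep G) (TenO (Rep G) (F X) (F Y)) (F Z)) (TenO (Rep G) (F X) (F ?YZ)) (F (TenO C X ?YZ))
        (JJ X ?YZ)
        (Comp (Rep G) (TenO (Rep G) (TenO (Rep G) (F X) (F Y)) (F Z)) (TenO (Rep G) (F X) (TenO (Rep G) (F Y) (F Z))) (TenO (Rep G) (F X) (F ?YZ))
          (TenM (Rep G) (F X) (F X) (TenO (Rep G) (F Y) (F Z)) (F ?YZ) (Idm (Rep G) (F X)) (JJ Y Z)) (Assoc (Rep G) (F X) (F Y) (F Z)))"
    using a e d by (simp add: o As_Id Fm_Id mat_one mult.assoc)
next
  fix X assume X: "X \<in> Obj C"
  have U: "Unit C \<in> Obj C" by simp
  have d: "dim_row (B (Unit C)) = 1" "dim_col (K (Unit C)) = 1" using BK_d[OF U] by (simp_all add: N_unit)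
  have 1: "JJ (Unit C) X * kron (K (Unit C)) (1\<^sub>m (r X)) = 1\<^sub>m (r X)"
  proof -
    have "JJ (Unit C) X * kron (K (Unit C)) (1\<^sub>m (r X)) = K X * (1\<^sub>m (N X) * kron (B (Unit C) * K (Unit C)) (B X))"
      using X U d unfolding JJ_def TO_unit(1)[OF X] \<tau>_unit(1)[OF X] by (simp add: mat_assoc kron_comp mat_one)
    also have "\<dots> = 1\<^sub>m (r X)" using X by (simp add: BK p_unit kron_1'[unfolded One_nat_def] mat_one)
    finally show ?thesis .
  qed
  have 2: "JJ X (Unit C) * kron (1\<^sub>m (r X)) (K (Unit C)) = 1\<^sub>m (r X)"
  proof -
    have "JJ X (Unit C) * kron (1\<^sub>m (r X)) (K (Unit C)) = K X * (1\<^sub>m (N X) * kron (B X) (B (Unit C) * K (Unit C)))"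
      using X U d unfolding JJ_def TO_unit(2)[OF X] \<tau>_unit(2)[OF X] by (simp add: mat_assoc kron_comp mat_one)
    also have "\<dots> = 1\<^sub>m (r X)" using X by (simp add: BK p_unit kron_1'[unfolded One_nat_def] mat_one)
    finally show ?thesis .
  qed
  show "Comp (Rep G) (TenO (Rep G) (Unit (Rep G)) (F X)) (F (TenO C (Unit C) X)) (F X) (Fm (TenO C (Unit C) X) X (LUnit C X))
        (Comp (Rep G) (TenO (Rep G) (Unit (Rep G)) (F X)) (TenO (Rep G) (F (Unit C)) (F X)) (F (TenO C (Unit C) X)) (JJ (Unit C) X)
          (TenM (Rep G) (Unit (Rep G)) (F (Unit C)) (F X) (F X) (K (Unit C)) (Idm (Rep G) (F X)))) = LUnit (Rep G) (F X)"
    using X 1 by (simp add: TO_unit LU_Id Fm_Id mat_one)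
  show "Comp (Rep G) (TenO (Rep G) (F X) (Unit (Rep G))) (F (TenO C X (Unit C))) (F X) (Fm (TenO C X (Unit C)) X (RUnit C X))
        (Comp (Rep G) (TenO (Rep G) (F X) (Unit (Rep G))) (TenO (Rep G) (F X) (F (Unit C))) (F (TenO C X (Unit C))) (JJ X (Unit C))
          (TenM (Rep G) (F X) (F X) (Unit (Rep G)) (F (Unit C)) (Idm (Rep G) (F X)) (K (Unit C)))) = RUnit (Rep G) (F X)"
    using X 2 by (simp add: TO_unit RU_Id Fm_Id mat_one)
qed

theorem equivalent: "monoidally_equivalent C (Rep G)"
proof (rule equivalence_from_fully_faithful[OF strict_linear_monoidal_category.is_linear_monoidal[OF strict]
      strict_linear_monoidal_category.is_linear_monoidal[OF rep_strict] F_functor])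
  fix X Y f g assume "X \<in> Obj C" "Y \<in> Obj C" "f \<in> Hom C X Y" "g \<in> Hom C X Y" "Fm X Y f = Fm X Y g"
  then show "f = g" using BFK[of X Y f] BFK[of X Y g] by (intro M_inj[of X Y]) auto
next
  fix X Y h assume "X \<in> Obj C" "Y \<in> Obj C" "h \<in> Hom (Rep G) (F X) (F Y)"
  then show "\<exists>f \<in> Hom C X Y. Fm X Y f = h" by (rule full)
next
  fix V assume "V \<in> Obj (Rep G)"
  then have V: "is_rep G V" by simp
  from ess[OF V] obtain X L L' where X: "X \<in> Obj C" and L: "L \<in> carrier_mat (N X) (fst V)" "L' \<in> carrier_mat (fst V) (N X)"
    "L' * L = 1\<^sub>m (fst V)" "L * L' = p X" "\<And>g. g \<in> carrier G \<Longrightarrow> \<Theta> X g * L = L * snd V g" by blast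
  have d [simp]: "dim_row L = N X" "dim_col L = fst V" "dim_row L' = fst V" "dim_col L' = N X" using L by auto
  have v: "dim_row (snd V g) = fst V" "dim_col (snd V g) = fst V" if "g \<in> carrier G" for g using rep_dim[OF V that] by auto
  have LL: "L * (L' * Z) = p X * Z" if "dim_row Z = N X" for Z using that by (simp add: mat_assoc[symmetric] L(4))
  have LL': "L' * (L * Z) = Z" if "dim_row Z = fst V" for Z using that by (simp add: mat_assoc[symmetric] L(3) mat_one)
  have pL: "p X * L = L" using X by (simp add: L(4)[symmetric] mat_assoc L(3) mat_one)
  have Lp: "L' * p X = L'" using X by (simp add: L(4)[symmetric] LL')
  have "L' * B X * (K X * (\<Theta> X g * B X)) = snd V g * (L' * B X)" if g: "g \<in> carrier G" for g
  proof -
    have "L' * B X * (K X * (\<Theta> X g * B X)) = L' * (\<Theta> X g * (p X * B X))" using X g by (simp add: calc)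
    also have "\<dots> = L' * (\<Theta> X g * (L * (L' * B X)))" using X g by (simp add: LL)
    also have "\<dots> = L' * ((\<Theta> X g * L) * (L' * B X))" using X g by (simp add: mat_assoc)
    also have "\<dots> = snd V g * (L' * B X)" using X g v[OF g] by (simp add: L(5) mat_assoc LL')
    finally show ?thesis .
  qed
  then have h1: "L' * B X \<in> Hom (Rep G) (F X) V" using X by (auto intro!: carrier_matI)
  have "K X * L * snd V g = K X * (\<Theta> X g * B X) * (K X * L)" if g: "g \<in> carrier G" for g
  proof -
    have "K X * (\<Theta> X g * B X) * (K X * L) = K X * (\<Theta> X g * (p X * L))" using X g by (simp add: mat_assoc BK')
    also have "\<dots> = K X * (L * snd V g)" using X g by (simp add: pL L(5))
    finally show ?thesis using X v[OF g] by (simp add: mat_assoc)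
  qed
  then have h2: "K X * L \<in> Hom (Rep G) V (F X)" using X by (auto intro!: carrier_matI)
  have "K X * L * (L' * B X) = 1\<^sub>m (r X)" using X by (simp add: mat_assoc LL calc)
  moreover have "L' * B X * (K X * L) = 1\<^sub>m (fst V)" using X by (simp add: mat_assoc BK' pL L(3))
  ultimately show "\<exists>X \<in> Obj C. \<exists>s. is_iso (Rep G) (F X) V s"
    unfolding is_iso_def using X h1 h2 by (intro bexI[of _ X] exI[of _ "L' * B X"] conjI bexI[of _ "K X * L"]) auto
qed

end

section \<open>Matrices indexed by lists\<close>

text \<open>Matrices whose rows and columns are labelled by lists of indices, so that a product becomes a sum
  over labels instead of positions.\<close>

definition MAT :: "'a list \<Rightarrow> 'b list \<Rightarrow> ('a \<Rightarrow> 'b \<Rightarrow> complex) \<Rightarrow> complex mat" where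
  "MAT L L' F = mat (length L) (length L') (\<lambda>(i, j). F (L ! i) (L' ! j))"

lemma MAT_dim [simp]: "dim_row (MAT L L' F) = length L" "dim_col (MAT L L' F) = length L'" "MAT L L' F \<in> carrier_mat (length L) (length L')"
  by (simp_all add: MAT_def)

lemma MAT_cong: "(\<And>x y. x \<in> set L \<Longrightarrow> y \<in> set L' \<Longrightarrow> F x y = G x y) \<Longrightarrow> MAT L L' F = MAT L L' G"
  unfolding MAT_def by (intro eq_matI) auto

lemma MAT_inj: assumes "MAT L L' F = MAT L L' G" "x \<in> set L" "y \<in> set L'" shows "F x y = G x y"
proof -
  obtain i j where i: "i < length L" "L ! i = x" and j: "j < length L'" "L' ! j = y" using assms(2,3) by (meson in_set_conv_nth)
  have "MAT L L' F $$ (i, j) = F x y" "MAT L L' G $$ (i, j) = G x y" using i j by (simp_all add: MAT_def)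
  then show ?thesis using assms(1) by simp
qed

lemma MAT_mult: assumes "distinct L'"
  shows "MAT L L' F * MAT L' L'' G = MAT L L'' (\<lambda>x z. \<Sum>y\<in>set L'. F x y * G y z)"
proof (rule eq_matI)
  fix i j assume "i < dim_row (MAT L L'' (\<lambda>x z. \<Sum>y\<in>set L'. F x y * G y z))" "j < dim_col (MAT L L'' (\<lambda>x z. \<Sum>y\<in>set L'. F x y * G y z))"
  then have ij: "i < length L" "j < length L''" by auto
  have b: "bij_betw ((!) L') {..<length L'} (set L')" using assms by (intro bij_betw_nth) auto
  have "(MAT L L' F * MAT L' L'' G) $$ (i, j) = (\<Sum>k<length L'. F (L ! i) (L' ! k) * G (L' ! k) (L'' ! j))"
    using ij by (subst mult_index_sum[OF MAT_dim(3) MAT_dim(3) ij]) (auto simp: MAT_def intro!: sum.cong)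
  also have "\<dots> = (\<Sum>y\<in>set L'. F (L ! i) y * G y (L'' ! j))" by (rule sum.reindex_bij_betw[OF b])
  finally show "(MAT L L' F * MAT L' L'' G) $$ (i, j) = MAT L L'' (\<lambda>x z. \<Sum>y\<in>set L'. F x y * G y z) $$ (i, j)"
    using ij by (simp add: MAT_def)
qed auto

lemma MAT_surj: assumes "A \<in> carrier_mat (length L) (length L')" "distinct L" "distinct L'" shows "\<exists>F. A = MAT L L' F"
proof -
  have inj: "inv_into {..<length L} ((!) L) (L ! i) = i" if "i < length L" for i
    using that assms(2) by (intro inv_into_f_f) (auto simp: inj_on_def nth_eq_iff_index_eq)
  have inj': "inv_into {..<length L'} ((!) L') (L' ! i) = i" if "i < length L'" for i
    using that assms(3) by (intro inv_into_f_f) (auto simp: inj_on_def nth_eq_iff_index_eq)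
  show ?thesis using assms(1)
    by (intro exI[of _ "\<lambda>x y. A $$ (inv_into {..<length L} ((!) L) x, inv_into {..<length L'} ((!) L') y)"] eq_matI)
      (auto simp: MAT_def inj inj')
qed

lemma MAT_one: "distinct L \<Longrightarrow> MAT L L (\<lambda>x y. if x = y then 1 else 0) = 1\<^sub>m (length L)"
  by (intro eq_matI) (auto simp: MAT_def nth_eq_iff_index_eq)

lemma MAT_ops: "MAT L L' (\<lambda>x y. F x y + G x y) = MAT L L' F + MAT L L' G" "MAT L L' (\<lambda>x y. c * F x y) = c \<cdot>\<^sub>m MAT L L' F"
  "MAT L L' (\<lambda>x y. 0) = 0\<^sub>m (length L) (length L')"
  by (auto simp: MAT_def intro!: eq_matI)

lemma MAT_map: "MAT (map h L) L' F = MAT L L' (\<lambda>x. F (h x))" "MAT L (map h' L') F' = MAT L L' (\<lambda>x y. F' x (h' y))"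
  by (auto simp: MAT_def intro!: eq_matI)

lemma kron_MAT: "kron (MAT A B F) (MAT A' B' G) = MAT (List.product A A') (List.product B B') (\<lambda>x y. F (fst x) (fst y) * G (snd x) (snd y))"
proof (rule eq_matI)
  fix i j assume "i < dim_row (MAT (List.product A A') (List.product B B') (\<lambda>x y. F (fst x) (fst y) * G (snd x) (snd y)))"
    "j < dim_col (MAT (List.product A A') (List.product B B') (\<lambda>x y. F (fst x) (fst y) * G (snd x) (snd y)))"
  then have ij: "i < length A * length A'" "j < length B * length B'" by auto
  show "kron (MAT A B F) (MAT A' B' G) $$ (i, j) = MAT (List.product A A') (List.product B B') (\<lambda>x y. F (fst x) (fst y) * G (snd x) (snd y)) $$ (i, j)"
    using ij div_mod_less[OF ij(1)] div_mod_less[OF ij(2)]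
    by (simp add: kron_index[OF MAT_dim(3) MAT_dim(3)]) (simp add: MAT_def product_nth)
qed auto

lemma product_assoc: "List.product A (List.product B C) = map (\<lambda>((x, y), z). (x, y, z)) (List.product (List.product A B) C)"
proof (rule nth_equalityI)
  fix n assume "n < length (List.product A (List.product B C))"
  then have n: "n < length A * (length B * length C)" by simp
  then have n': "n < (length A * length B) * length C" by (simp add: mult.assoc)
  note d = div_mod_less[OF n] div_mod_less[OF n']
  have e: "n div (length B * length C) = n div length C div length B" "n mod (length B * length C) div length C = n div length C mod length B"
    "n mod (length B * length C) mod length C = n mod length C"
    using d(4) by (cases "length C = 0"; simp add: mult.commute[of _ "length C"] div_mult2_eq mod_mult2_eq)+
  show "List.product A (List.product B C) ! n = map (\<lambda>((x, y), z). (x, y, z)) (List.product (List.product A B) C) ! n"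
    using n n' d by (simp add: product_nth e)
qed (simp add: mult.assoc)

definition PERM :: "'a list \<Rightarrow> 'b list \<Rightarrow> ('b \<Rightarrow> 'a) \<Rightarrow> complex mat" where
  "PERM L L' b = MAT L L' (\<lambda>z x. if z = b x then 1 else 0)"
definition PERM' :: "'a list \<Rightarrow> 'b list \<Rightarrow> ('b \<Rightarrow> 'a) \<Rightarrow> complex mat" where
  "PERM' L L' b = MAT L' L (\<lambda>x z. if z = b x then 1 else 0)"

lemma MAT_PERM: assumes "distinct L" "\<And>x. x \<in> set L' \<Longrightarrow> b x \<in> set L"
  shows "MAT R L F * PERM L L' b = MAT R L' (\<lambda>r x. F r (b x))"
  unfolding PERM_def MAT_mult[OF assms(1)]
proof (rule MAT_cong)
  fix r x assume "x \<in> set L'"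
  then have "b x \<in> set L" by (rule assms(2))
  then show "(\<Sum>y\<in>set L. F r y * (if y = b x then 1 else 0)) = F r (b x)"
    by (simp add: if_distrib[of "\<lambda>c. _ * c"] cong: if_cong)
qed

lemma PERM_MAT: assumes "distinct L'" "inj_on b (set L')" "\<And>y x. y \<in> set L' \<Longrightarrow> x \<in> set R \<Longrightarrow> F (b y) x = G y x" "b ` set L' = set L"
  shows "PERM L L' b * MAT L' R G = MAT L R F"
  unfolding PERM_def MAT_mult[OF assms(1)]
proof (rule MAT_cong)
  fix z x assume z: "z \<in> set L" "x \<in> set R"
  then obtain y where y: "y \<in> set L'" "z = b y" using assms(4) by blast
  have "(\<Sum>y'\<in>set L'. (if z = b y' then 1 else 0) * G y' x) = (\<Sum>y'\<in>set L'. if y' = y then G y x else 0)"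
    using assms(2) y by (intro sum.cong) (auto simp: inj_on_def)
  then show "(\<Sum>y'\<in>set L'. (if z = b y' then 1 else 0) * G y' x) = F z x" using y z assms(3) by simp
qed

lemma PERM_nat: assumes "distinct L" "\<And>x. x \<in> set L' \<Longrightarrow> b x \<in> set L" "distinct L2'" "inj_on b2 (set L2')" "b2 ` set L2' = set L2"
   "\<And>y x. y \<in> set L2' \<Longrightarrow> x \<in> set L' \<Longrightarrow> F (b2 y) (b x) = G y x"
  shows "MAT L2 L F * PERM L L' b = PERM L2 L2' b2 * MAT L2' L' G"
proof -
  have "MAT L2 L F * PERM L L' b = MAT L2 L' (\<lambda>r x. F r (b x))" using assms(1,2) by (rule MAT_PERM)
  also have "\<dots> = PERM L2 L2' b2 * MAT L2' L' G" using assms(3-6) by (intro PERM_MAT[symmetric]) auto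
  finally show ?thesis .
qed

lemma PERM_inv: assumes "distinct L" "distinct L'" "inj_on b (set L')" "b ` set L' = set L"
  shows "PERM L L' b * PERM' L L' b = 1\<^sub>m (length L)" "PERM' L L' b * PERM L L' b = 1\<^sub>m (length L')"
proof -
  show "PERM L L' b * PERM' L L' b = 1\<^sub>m (length L)"
    unfolding PERM'_def MAT_one[OF assms(1), symmetric] by (rule PERM_MAT) (use assms in \<open>auto simp: eq_commute\<close>)
  have "PERM' L L' b * PERM L L' b = MAT L' L' (\<lambda>x y. if b y = b x then 1 else 0)"
    unfolding PERM'_def by (rule MAT_PERM) (use assms in auto)
  also have "\<dots> = MAT L' L' (\<lambda>x y. if x = y then 1 else 0)" using assms(3) by (intro MAT_cong) (auto simp: inj_on_def)
  finally show "PERM' L L' b * PERM L L' b = 1\<^sub>m (length L')" by (simp add: MAT_one assms)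
qed

section \<open>The additive envelope of the projection category\<close>

context planar_m begin

abbreviation PC where "PC \<equiv> projection_category m 1"
abbreviation EC where "EC \<equiv> planar_category m 1"

lemma PC_simps: "X \<in> Obj PC \<longleftrightarrow> snd X \<in> pspace m 1 (fst X) (fst X) \<and> pstack m 1 (fst X) (fst X) (snd X) (snd X) = snd X \<and> padjoint m 1 (fst X) (fst X) (snd X) = snd X"
  "f \<in> Hom PC X Y \<longleftrightarrow> f \<in> pspace m 1 (fst X) (fst Y) \<and> pstack m 1 (fst X) (fst Y) (snd Y) (pstack m 1 (fst X) (fst Y) f (snd X)) = f"
  "Idm PC = snd" "Comp PC X Y Z g f' = pstack m 1 (fst X) (fst Z) g f'" "Zero PC X Y = cl (fst X) (fst Y) 0"
  "Add PC X Y = padd m 1 (fst X) (fst Y)" "Scale PC X Y = pscale m 1 (fst X) (fst Y)"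
  "Unit PC = (0, cl 0 0 (lin_of (Strands 0)))" "TenO PC = ptensor m 1"
  "TenM PC X X' Y Y' = pjuxt m 1 (fst X + fst Y) (fst X' + fst Y')"
  "Assoc PC X Y Z = snd (ptensor m 1 (ptensor m 1 X Y) Z)" "LUnit PC = snd" "RUnit PC = snd"
  by (auto simp: projection_category_def split: prod.splits)

definition pr :: "pobj \<Rightarrow> wmat" where "pr X = cval (snd X)"

lemma PObj_iff: "X \<in> Obj PC \<longleftrightarrow> snd X \<in> pspace m 1 (fst X) (fst X) \<and> wcomp (fst X) (pr X) (pr X) = pr X \<and> (\<forall>w v. cnj (pr X v w) = pr X w v)"
proof -
  have "pstack m 1 (fst X) (fst X) (snd X) (snd X) = snd X \<longleftrightarrow> wcomp (fst X) (pr X) (pr X) = pr X" if "snd X \<in> pspace m 1 (fst X) (fst X)"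
    using cval_ops(1)[OF that that] that cval_inj unfolding pr_def by metis
  moreover have "padjoint m 1 (fst X) (fst X) (snd X) = snd X \<longleftrightarrow> (\<lambda>w v. cnj (pr X v w)) = pr X" if "snd X \<in> pspace m 1 (fst X) (fst X)"
    using cval_adjoint[OF that] that cval_inj unfolding pr_def by metis
  ultimately show ?thesis unfolding PC_simps(1) by (auto simp: fun_eq_iff)
qed

lemma PHom_iff: assumes "X \<in> Obj PC" "Y \<in> Obj PC"
  shows "f \<in> Hom PC X Y \<longleftrightarrow> f \<in> pspace m 1 (fst X) (fst Y) \<and> wcomp (fst X) (cval f) (pr X) = cval f \<and> wcomp (fst Y) (pr Y) (cval f) = cval f"
proof (cases "f \<in> pspace m 1 (fst X) (fst Y)")
  case True
  note X = assms(1)[unfolded PObj_iff] and Y = assms(2)[unfolded PObj_iff]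
  note s1 = cval_ops(1)[OF True conjunct1[OF X]] and s2 = cval_ops(1)[OF conjunct1[OF Y] conjunct1[OF cval_ops(1)[OF True conjunct1[OF X]]]]
  have "pstack m 1 (fst X) (fst Y) (snd Y) (pstack m 1 (fst X) (fst Y) f (snd X)) = f \<longleftrightarrow> wcomp (fst Y) (pr Y) (wcomp (fst X) (cval f) (pr X)) = cval f"
    using s1 s2 True cval_inj unfolding pr_def by metis
  also have "\<dots> \<longleftrightarrow> wcomp (fst X) (cval f) (pr X) = cval f \<and> wcomp (fst Y) (pr Y) (cval f) = cval f"
  proof
    assume e: "wcomp (fst Y) (pr Y) (wcomp (fst X) (cval f) (pr X)) = cval f"
    have "wcomp (fst X) (cval f) (pr X) = wcomp (fst Y) (pr Y) (wcomp (fst X) (wcomp (fst X) (cval f) (pr X)) (pr X))"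
      by (subst e[symmetric]) (simp only: wcomp_assoc)
    then have a: "wcomp (fst X) (cval f) (pr X) = cval f" using X e by (simp add: wcomp_assoc)
    then show "wcomp (fst X) (cval f) (pr X) = cval f \<and> wcomp (fst Y) (pr Y) (cval f) = cval f" using e by simp
  qed simp
  finally show ?thesis using True unfolding PC_simps(2) by blast
qed (simp add: PC_simps(2))

lemma PHomD: assumes "X \<in> Obj PC" "Y \<in> Obj PC" "f \<in> Hom PC X Y"
  shows "f \<in> pspace m 1 (fst X) (fst Y)" "wcomp (fst X) (cval f) (pr X) = cval f" "wcomp (fst Y) (pr Y) (cval f) = cval f"
  using assms PHom_iff by blast+

lemma wcomp_lin: "wcomp k (\<lambda>w v. f w v + g w v) h = (\<lambda>w v. wcomp k f h w v + wcomp k g h w v)"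
  "wcomp k h (\<lambda>w v. f w v + g w v) = (\<lambda>w v. wcomp k h f w v + wcomp k h g w v)"
  "wcomp k (\<lambda>w v. c * f w v) h = (\<lambda>w v. c * wcomp k f h w v)" "wcomp k h (\<lambda>w v. c * f w v) = (\<lambda>w v. c * wcomp k h f w v)"
  by (simp_all add: wcomp_def fun_eq_iff algebra_simps sum.distrib sum_distrib_left)

lemma P_Id: assumes X: "X \<in> Obj PC" shows "snd X \<in> Hom PC X X"
  unfolding PHom_iff[OF X X] using X[unfolded PObj_iff] unfolding pr_def by blast

lemma P_Zero: assumes X: "X \<in> Obj PC" and Y: "Y \<in> Obj PC"
  shows "Zero PC X Y \<in> Hom PC X Y \<and> cval (Zero PC X Y) = (\<lambda>w v. 0)"
  unfolding PHom_iff[OF X Y] unfolding PC_simps using cval_ops(5)[of "fst X" "fst Y"] by simp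

lemma P_Comp: assumes X: "X \<in> Obj PC" and Y: "Y \<in> Obj PC" and Z: "Z \<in> Obj PC" and f: "f \<in> Hom PC X Y" and g: "g \<in> Hom PC Y Z"
  shows "Comp PC X Y Z g f \<in> Hom PC X Z \<and> cval (Comp PC X Y Z g f) = wcomp (fst Y) (cval g) (cval f)"
proof -
  note F = PHomD[OF X Y f] and H = PHomD[OF Y Z g]
  have a: "wcomp (fst X) (wcomp (fst Y) (cval g) (cval f)) (pr X) = wcomp (fst Y) (cval g) (cval f)"
    using F(2) by (simp only: wcomp_assoc)
  have b: "wcomp (fst Z) (pr Z) (wcomp (fst Y) (cval g) (cval f)) = wcomp (fst Y) (cval g) (cval f)"
    using H(3) by (simp only: wcomp_assoc[symmetric])
  show ?thesis unfolding PHom_iff[OF X Z] unfolding PC_simps using cval_ops(1)[OF H(1) F(1)] a b by auto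
qed

lemma P_Add: assumes X: "X \<in> Obj PC" and Y: "Y \<in> Obj PC" and f: "f \<in> Hom PC X Y" "f' \<in> Hom PC X Y"
  shows "Add PC X Y f f' \<in> Hom PC X Y \<and> cval (Add PC X Y f f') = (\<lambda>w v. cval f w v + cval f' w v)"
  using PHomD[OF X Y f(1)] PHomD[OF X Y f(2)] cval_ops(3)[of f "fst X" "fst Y" f']
  unfolding PHom_iff[OF X Y] unfolding PC_simps by (auto simp: wcomp_lin)

lemma P_Scale: assumes X: "X \<in> Obj PC" and Y: "Y \<in> Obj PC" and f: "f \<in> Hom PC X Y"
  shows "Scale PC X Y c f \<in> Hom PC X Y \<and> cval (Scale PC X Y c f) = (\<lambda>w v. c * cval f w v)"
  using PHomD[OF X Y f] cval_ops(4)[of f "fst X" "fst Y" c]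
  unfolding PHom_iff[OF X Y] unfolding PC_simps by (auto simp: wcomp_lin)

lemma P_TenO: assumes X: "X \<in> Obj PC" and Y: "Y \<in> Obj PC"
  shows "ptensor m 1 X Y \<in> Obj PC \<and> fst (ptensor m 1 X Y) = fst X + fst Y \<and> pr (ptensor m 1 X Y) = wten (fst X) (fst X) (pr X) (pr Y)"
proof -
  note x = X[unfolded PObj_iff] and y = Y[unfolded PObj_iff]
  note j = cval_ops(2)[OF conjunct1[OF x] conjunct1[OF y]]
  have e: "pr (ptensor m 1 X Y) = wten (fst X) (fst X) (pr X) (pr Y)" "fst (ptensor m 1 X Y) = fst X + fst Y"
    using j by (simp_all add: pr_def ptensor_def)
  show ?thesis unfolding PObj_iff e using x y j
    by (auto simp: w_interchange ptensor_def) (simp add: wten_def)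
qed

lemma P_TenM: assumes X: "X \<in> Obj PC" and X': "X' \<in> Obj PC" and Y: "Y \<in> Obj PC" and Y': "Y' \<in> Obj PC" and f: "f \<in> Hom PC X X'" and g: "g \<in> Hom PC Y Y'"
  shows "TenM PC X X' Y Y' f g \<in> Hom PC (ptensor m 1 X Y) (ptensor m 1 X' Y') \<and> cval (TenM PC X X' Y Y' f g) = wten (fst X') (fst X) (cval f) (cval g)"
proof -
  note F = PHomD[OF X X' f] and H = PHomD[OF Y Y' g]
  note j = cval_ops(2)[OF F(1) H(1)] and T = P_TenO[OF X Y] and T' = P_TenO[OF X' Y']
  show ?thesis unfolding PHom_iff[OF conjunct1[OF T] conjunct1[OF T']] using j T T' F H
    by (simp add: PC_simps w_interchange)
qed

lemma pobj_eqI: assumes "X \<in> Obj PC" "Y \<in> Obj PC" "fst X = fst Y" "pr X = pr Y" shows "X = Y"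
  using assms cval_inj[of "snd X" "fst X" "fst X" "snd Y"] unfolding PObj_iff pr_def by (auto intro: prod_eqI)

lemma PUnit: "Unit PC \<in> Obj PC" "fst (Unit PC) = 0" "pr (Unit PC) = wid 0"
proof -
  show u: "fst (Unit PC) = 0" "pr (Unit PC) = wid 0" using cval_ops(6)[of 0] by (simp_all add: PC_simps pr_def)
  show "Unit PC \<in> Obj PC" unfolding PObj_iff u using cval_ops(6)[of 0] wcomp_wid_left[OF supp_wid] by (auto simp: PC_simps wid_def)
qed

lemma supp_pr: "X \<in> Obj PC \<Longrightarrow> supp (fst X) (fst X) (pr X)" unfolding PObj_iff pr_def using cval_type by blast

lemma P_tensor_strict: assumes X: "X \<in> Obj PC"
  shows "ptensor m 1 (Unit PC) X = X" "ptensor m 1 X (Unit PC) = X"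
    "Y \<in> Obj PC \<Longrightarrow> Z \<in> Obj PC \<Longrightarrow> ptensor m 1 (ptensor m 1 X Y) Z = ptensor m 1 X (ptensor m 1 Y Z)"
proof -
  show "ptensor m 1 (Unit PC) X = X" "ptensor m 1 X (Unit PC) = X"
    using P_TenO[OF PUnit(1) X] P_TenO[OF X PUnit(1)] X
    by (auto intro!: pobj_eqI simp: PUnit wten_0_left wten_0_right[OF supp_pr[OF X]])
  show "ptensor m 1 (ptensor m 1 X Y) Z = ptensor m 1 X (ptensor m 1 Y Z)" if Y: "Y \<in> Obj PC" and Z: "Z \<in> Obj PC"
    using P_TenO[OF X Y] P_TenO[OF Y Z] P_TenO[OF _ Z, of "ptensor m 1 X Y"] P_TenO[OF X, of "ptensor m 1 Y Z"]
    by (intro pobj_eqI) (simp_all add: wten_assoc add.assoc)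
qed

lemma EC_simps: "X \<in> Obj EC \<longleftrightarrow> set X \<subseteq> Obj PC"
  "f \<in> Hom EC X Y \<longleftrightarrow> f \<in> carrier_mat (length Y) (length X) \<and> (\<forall>i < length Y. \<forall>j < length X. f $$ (i, j) \<in> Hom PC (X ! j) (Y ! i))"
  "Idm EC X = env_diag PC X X (\<lambda>i. Idm PC (X ! i))"
  "Comp EC X Y Z g f = mat (length Z) (length X) (\<lambda>(i, k). foldr (\<lambda>j. Add PC (X ! k) (Z ! i)
                 (Comp PC (X ! k) (Y ! j) (Z ! i) (g $$ (i, j)) (f $$ (j, k)))) [0..<length Y] (Zero PC (X ! k) (Z ! i)))"
  "Zero EC X Y = mat (length Y) (length X) (\<lambda>(i, j). Zero PC (X ! j) (Y ! i))"
  "Add EC X Y f g = mat (length Y) (length X) (\<lambda>(i, j). Add PC (X ! j) (Y ! i) (f $$ (i, j)) (g $$ (i, j)))"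
  "Scale EC X Y c f = mat (length Y) (length X) (\<lambda>(i, j). Scale PC (X ! j) (Y ! i) c (f $$ (i, j)))"
  "Unit EC = [Unit PC]" "TenO EC X Y = env_tensor PC X Y"
  "TenM EC X X' Y Y' f g = mat (length X' * length Y') (length X * length Y) (\<lambda>(i, j).
          TenM PC (X ! (j div length Y)) (X' ! (i div length Y')) (Y ! (j mod length Y)) (Y' ! (i mod length Y'))
            (f $$ (i div length Y', j div length Y)) (g $$ (i mod length Y', j mod length Y)))"
  "Assoc EC X Y Z = env_diag PC (env_tensor PC (env_tensor PC X Y) Z) (env_tensor PC X (env_tensor PC Y Z))
          (\<lambda>i. Assoc PC (X ! (i div (length Y * length Z))) (Y ! ((i div length Z) mod length Y)) (Z ! (i mod length Z)))"
  "LUnit EC X = env_diag PC (env_tensor PC [Unit PC] X) X (\<lambda>i. LUnit PC (X ! i))"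
  "RUnit EC X = env_diag PC (env_tensor PC X [Unit PC]) X (\<lambda>i. RUnit PC (X ! i))"
  by (simp_all add: planar_category_def additive_envelope_def)

lemma nth_P: "X \<in> Obj EC \<Longrightarrow> i < length X \<Longrightarrow> X ! i \<in> Obj PC" unfolding EC_simps using nth_mem by blast

lemma env_tensor_product: "env_tensor PC X Y = map (\<lambda>(x, y). ptensor m 1 x y) (List.product X Y)"
  unfolding env_tensor_def PC_simps by (induction X) auto

lemma env_tensor_length [simp]: "length (env_tensor PC X Y) = length X * length Y"
  by (simp add: env_tensor_product)

lemma env_tensor_nth: "k < length X * length Y \<Longrightarrow> env_tensor PC X Y ! k = ptensor m 1 (X ! (k div length Y)) (Y ! (k mod length Y))"
  by (simp add: env_tensor_product product_nth)

lemma E_TenO: assumes X: "X \<in> Obj EC" and Y: "Y \<in> Obj EC" shows "env_tensor PC X Y \<in> Obj EC"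
proof -
  have "ptensor m 1 x y \<in> Obj PC" if "x \<in> set X" "y \<in> set Y" for x y
    using that P_TenO X Y unfolding EC_simps by blast
  then show ?thesis unfolding EC_simps env_tensor_product by auto
qed

lemma E_tensor_strict: assumes X: "X \<in> Obj EC"
  shows "env_tensor PC [Unit PC] X = X" "env_tensor PC X [Unit PC] = X"
    "Y \<in> Obj EC \<Longrightarrow> Z \<in> Obj EC \<Longrightarrow> env_tensor PC (env_tensor PC X Y) Z = env_tensor PC X (env_tensor PC Y Z)"
proof -
  have x: "x \<in> Obj PC" if "x \<in> set X" for x using that X by (auto simp: EC_simps)
  show "env_tensor PC [Unit PC] X = X" unfolding env_tensor_def using x P_tensor_strict(1) by (simp add: PC_simps(9) map_idI)
  have "map (\<lambda>x. ptensor m 1 x (Unit PC)) X = X" using x P_tensor_strict(2) by (intro map_idI) auto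
  moreover have "concat (map (\<lambda>x. [h x]) X) = map h X" for h :: "pobj \<Rightarrow> pobj" by (induction X) auto
  ultimately show "env_tensor PC X [Unit PC] = X" unfolding env_tensor_def by (simp add: PC_simps(9))
  assume Y: "Y \<in> Obj EC" and Z: "Z \<in> Obj EC"
  show "env_tensor PC (env_tensor PC X Y) Z = env_tensor PC X (env_tensor PC Y Z)"
  proof (rule nth_equalityI)
    fix n assume "n < length (env_tensor PC (env_tensor PC X Y) Z)"
    then have n': "n < (length X * length Y) * length Z" and n: "n < length X * (length Y * length Z)" by (simp_all add: mult.assoc)
    note d = div_mod_less[OF n] div_mod_less[OF n']
    have d3: "n div length Z div length Y < length X" "n div length Z mod length Y < length Y" using div_mod_less[OF d(3)] by auto
    have e: "n div (length Y * length Z) = n div length Z div length Y" "n mod (length Y * length Z) div length Z = n div length Z mod length Y"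
      "n mod (length Y * length Z) mod length Z = n mod length Z"
      using d(4) by (cases "length Z = 0"; simp add: mult.commute[of _ "length Z"] div_mult2_eq mod_mult2_eq)+
    show "env_tensor PC (env_tensor PC X Y) Z ! n = env_tensor PC X (env_tensor PC Y Z) ! n"
      using n n' d d3 nth_P X Y Z by (simp add: env_tensor_nth e P_tensor_strict(3))
  qed (simp add: mult.assoc)
qed

definition idx :: "pobj list \<Rightarrow> (nat \<times> bool list) set" where "idx X = (SIGMA i:{..<length X}. words (fst (X ! i)))"
text \<open>A labelling set for the basis of a formal direct sum: a summand and a word in it. The order is
  arbitrary, which the reordering matrices of the tensor product take into account.\<close>

definition ixs :: "pobj list \<Rightarrow> (nat \<times> bool list) list" where "ixs X = (SOME L. set L = idx X \<and> distinct L)"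

lemma idx_iff: "(i, w) \<in> idx X \<longleftrightarrow> i < length X \<and> length w = fst (X ! i)" by (auto simp: idx_def)

lemma ixs: "set (ixs X) = idx X" "distinct (ixs X)"
proof -
  have "\<exists>L. set L = idx X \<and> distinct L" using finite_distinct_list[of "idx X"] by (auto simp: idx_def)
  from someI_ex[OF this] show "set (ixs X) = idx X" "distinct (ixs X)" by (simp_all add: ixs_def)
qed

lemma sum_idx: "(\<Sum>y\<in>idx X. h (fst y) (snd y)) = (\<Sum>j<length X. \<Sum>u\<in>words (fst (X ! j)). h j u)"
  unfolding idx_def by (subst sum.Sigma) (auto simp: case_prod_beta)

definition fmat :: "gen lin set mat \<Rightarrow> nat \<times> bool list \<Rightarrow> nat \<times> bool list \<Rightarrow> complex" where
  "fmat f x y = cval (f $$ (fst x, fst y)) (snd x) (snd y)"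

definition EN :: "pobj list \<Rightarrow> nat" where "EN X = length (ixs X)"
definition EM :: "pobj list \<Rightarrow> pobj list \<Rightarrow> gen lin set mat \<Rightarrow> complex mat" where "EM X Y f = MAT (ixs Y) (ixs X) (fmat f)"

definition pv :: "pobj list \<Rightarrow> nat \<times> bool list \<Rightarrow> nat \<times> bool list \<Rightarrow> complex" where
  "pv X x y = (if fst x = fst y then pr (X ! fst x) (snd x) (snd y) else 0)"

lemma E_HomD: assumes "X \<in> Obj EC" "Y \<in> Obj EC" "f \<in> Hom EC X Y" "i < length Y" "j < length X"
  shows "f $$ (i, j) \<in> Hom PC (X ! j) (Y ! i)" using assms by (simp add: EC_simps)

lemma E_Id: assumes X: "X \<in> Obj EC"
  shows "Idm EC X \<in> Hom EC X X" "EM X X (Idm EC X) = MAT (ixs X) (ixs X) (pv X)"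
proof -
  show "Idm EC X \<in> Hom EC X X" unfolding EC_simps using P_Id[OF nth_P[OF X]] P_Zero[OF nth_P[OF X] nth_P[OF X]] nth_P[OF X]
    by (auto simp: env_diag_def PC_simps(3))
  show "EM X X (Idm EC X) = MAT (ixs X) (ixs X) (pv X)"
    unfolding EM_def
  proof (rule MAT_cong)
    fix x y assume "x \<in> set (ixs X)" "y \<in> set (ixs X)"
    then have xy: "fst x < length X" "fst y < length X" using idx_iff[of "fst x" "snd x"] idx_iff[of "fst y" "snd y"] by (auto simp: ixs)
    show "fmat (Idm EC X) x y = pv X x y"
      using xy P_Zero[OF nth_P[OF X] nth_P[OF X], of "fst y" "fst x"] nth_P[OF X]
      by (auto simp: fmat_def pv_def EC_simps(3) env_diag_def PC_simps(3) pr_def)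
  qed
qed

lemma ixs_less: "x \<in> set (ixs X) \<Longrightarrow> fst x < length X \<and> length (snd x) = fst (X ! fst x)"
  using idx_iff[of "fst x" "snd x"] by (simp add: ixs)

lemma foldr_Comp: assumes X: "x \<in> Obj PC" and Z: "z \<in> Obj PC" and h: "\<And>j. j \<in> set js \<Longrightarrow> h j \<in> Hom PC x z"
  shows "foldr (\<lambda>j. Add PC x z (h j)) js (Zero PC x z) \<in> Hom PC x z \<and> cval (foldr (\<lambda>j. Add PC x z (h j)) js (Zero PC x z)) = (\<lambda>w v. \<Sum>j\<leftarrow>js. cval (h j) w v)"
  using h
proof (induction js)
  case Nil then show ?case using P_Zero[OF X Z] by simp
next
  case (Cons j js)
  then show ?case using P_Add[OF X Z, of "h j" "foldr (\<lambda>j. Add PC x z (h j)) js (Zero PC x z)"] by simp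
qed

lemma E_Comp: assumes X: "X \<in> Obj EC" and Y: "Y \<in> Obj EC" and Z: "Z \<in> Obj EC" and f: "f \<in> Hom EC X Y" and g: "g \<in> Hom EC Y Z"
  shows "Comp EC X Y Z g f \<in> Hom EC X Z" "EM X Z (Comp EC X Y Z g f) = EM Y Z g * EM X Y f"
proof -
  have c: "Comp PC (X ! k) (Y ! j) (Z ! i) (g $$ (i, j)) (f $$ (j, k)) \<in> Hom PC (X ! k) (Z ! i) \<and>
      cval (Comp PC (X ! k) (Y ! j) (Z ! i) (g $$ (i, j)) (f $$ (j, k))) = wcomp (fst (Y ! j)) (cval (g $$ (i, j))) (cval (f $$ (j, k)))"
    if "i < length Z" "j < length Y" "k < length X" for i j k
    using that by (intro P_Comp nth_P[OF X] nth_P[OF Y] nth_P[OF Z] E_HomD[OF X Y f] E_HomD[OF Y Z g])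
  have fl: "foldr (\<lambda>j. Add PC (X ! k) (Z ! i) (Comp PC (X ! k) (Y ! j) (Z ! i) (g $$ (i, j)) (f $$ (j, k)))) [0..<length Y] (Zero PC (X ! k) (Z ! i)) \<in> Hom PC (X ! k) (Z ! i) \<and>
     cval (foldr (\<lambda>j. Add PC (X ! k) (Z ! i) (Comp PC (X ! k) (Y ! j) (Z ! i) (g $$ (i, j)) (f $$ (j, k)))) [0..<length Y] (Zero PC (X ! k) (Z ! i)))
      = (\<lambda>w v. \<Sum>j\<leftarrow>[0..<length Y]. cval (Comp PC (X ! k) (Y ! j) (Z ! i) (g $$ (i, j)) (f $$ (j, k))) w v)" if "i < length Z" "k < length X" for i k
    using that c by (intro foldr_Comp nth_P[OF X] nth_P[OF Z]) auto
  show "Comp EC X Y Z g f \<in> Hom EC X Z" unfolding EC_simps(2) using fl by (simp add: EC_simps(4))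
  show "EM X Z (Comp EC X Y Z g f) = EM Y Z g * EM X Y f"
    unfolding EM_def MAT_mult[OF ixs(2)]
  proof (rule MAT_cong)
    fix x z assume "x \<in> set (ixs Z)" "z \<in> set (ixs X)"
    note xz = ixs_less[OF this(1)] ixs_less[OF this(2)]
    have "fmat (Comp EC X Y Z g f) x z = (\<Sum>j<length Y. wcomp (fst (Y ! j)) (cval (g $$ (fst x, j))) (cval (f $$ (j, fst z))) (snd x) (snd z))"
      using xz fl c by (simp add: fmat_def EC_simps(4) sum_list_distinct_conv_sum_set lessThan_atLeast0)
    also have "\<dots> = (\<Sum>y\<in>idx Y. fmat g x y * fmat f y z)"
      unfolding fmat_def wcomp_def by (rule sum_idx[symmetric])
    finally show "fmat (Comp EC X Y Z g f) x z = (\<Sum>y\<in>set (ixs Y). fmat g x y * fmat f y z)" by (simp add: ixs)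
  qed
qed

lemma E_lin: assumes X: "X \<in> Obj EC" and Y: "Y \<in> Obj EC"
  shows "Zero EC X Y \<in> Hom EC X Y" "EM X Y (Zero EC X Y) = 0\<^sub>m (EN Y) (EN X)"
    "f \<in> Hom EC X Y \<Longrightarrow> g \<in> Hom EC X Y \<Longrightarrow> Add EC X Y f g \<in> Hom EC X Y \<and> EM X Y (Add EC X Y f g) = EM X Y f + EM X Y g"
    "f \<in> Hom EC X Y \<Longrightarrow> Scale EC X Y c f \<in> Hom EC X Y \<and> EM X Y (Scale EC X Y c f) = c \<cdot>\<^sub>m EM X Y f"
proof -
  note z = P_Zero[OF nth_P[OF X] nth_P[OF Y]]
  show "Zero EC X Y \<in> Hom EC X Y" unfolding EC_simps(2) using z nth_P[OF X] by (auto simp: EC_simps(5))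
  show "EM X Y (Zero EC X Y) = 0\<^sub>m (EN Y) (EN X)" unfolding EM_def EN_def MAT_ops(3)[symmetric]
    by (rule MAT_cong) (use z nth_P[OF X] ixs_less in \<open>fastforce simp: fmat_def EC_simps(5)\<close>)
  show "Add EC X Y f g \<in> Hom EC X Y \<and> EM X Y (Add EC X Y f g) = EM X Y f + EM X Y g" if f: "f \<in> Hom EC X Y" and g: "g \<in> Hom EC X Y"
  proof
    have a: "Add PC (X ! j) (Y ! i) (f $$ (i, j)) (g $$ (i, j)) \<in> Hom PC (X ! j) (Y ! i) \<and> cval (Add PC (X ! j) (Y ! i) (f $$ (i, j)) (g $$ (i, j))) = (\<lambda>w v. cval (f $$ (i, j)) w v + cval (g $$ (i, j)) w v)"
      if "i < length Y" "j < length X" for i j using that by (intro P_Add nth_P[OF X] nth_P[OF Y] E_HomD[OF X Y f] E_HomD[OF X Y g])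
    then show "Add EC X Y f g \<in> Hom EC X Y" unfolding EC_simps(2) by (simp add: EC_simps(6))
    show "EM X Y (Add EC X Y f g) = EM X Y f + EM X Y g" unfolding EM_def MAT_ops(1)[symmetric]
    proof (rule MAT_cong)
      fix x y assume "x \<in> set (ixs Y)" "y \<in> set (ixs X)"
      then show "fmat (Add EC X Y f g) x y = fmat f x y + fmat g x y" using ixs_less a by (simp add: fmat_def EC_simps(6))
    qed
  qed
  show "Scale EC X Y c f \<in> Hom EC X Y \<and> EM X Y (Scale EC X Y c f) = c \<cdot>\<^sub>m EM X Y f" if f: "f \<in> Hom EC X Y"
  proof
    have a: "Scale PC (X ! j) (Y ! i) c (f $$ (i, j)) \<in> Hom PC (X ! j) (Y ! i) \<and> cval (Scale PC (X ! j) (Y ! i) c (f $$ (i, j))) = (\<lambda>w v. c * cval (f $$ (i, j)) w v)"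
      if "i < length Y" "j < length X" for i j using that by (intro P_Scale nth_P[OF X] nth_P[OF Y] E_HomD[OF X Y f])
    then show "Scale EC X Y c f \<in> Hom EC X Y" unfolding EC_simps(2) by (simp add: EC_simps(7))
    show "EM X Y (Scale EC X Y c f) = c \<cdot>\<^sub>m EM X Y f" unfolding EM_def MAT_ops(2)[symmetric]
    proof (rule MAT_cong)
      fix x y assume "x \<in> set (ixs Y)" "y \<in> set (ixs X)"
      then show "fmat (Scale EC X Y c f) x y = c * fmat f x y" using ixs_less a by (simp add: fmat_def EC_simps(7))
    qed
  qed
qed

lemma E_inj: assumes X: "X \<in> Obj EC" and Y: "Y \<in> Obj EC" and f: "f \<in> Hom EC X Y" and g: "g \<in> Hom EC X Y" and e: "EM X Y f = EM X Y g" shows "f = g"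
proof (rule eq_matI)
  have c: "f \<in> carrier_mat (length Y) (length X)" "g \<in> carrier_mat (length Y) (length X)" using f g by (simp_all add: EC_simps)
  fix i j assume "i < dim_row g" "j < dim_col g"
  then have ij: "i < length Y" "j < length X" using c by auto
  note F = PHomD(1)[OF nth_P[OF X ij(2)] nth_P[OF Y ij(1)] E_HomD[OF X Y f ij]] and H = PHomD(1)[OF nth_P[OF X ij(2)] nth_P[OF Y ij(1)] E_HomD[OF X Y g ij]]
  have "cval (f $$ (i, j)) = cval (g $$ (i, j))"
  proof (rule wmat_eqI)
    show "supp (fst (X ! j)) (fst (Y ! i)) (cval (f $$ (i, j)))" "supp (fst (X ! j)) (fst (Y ! i)) (cval (g $$ (i, j)))"
      using cval_type F H by blast+
    fix w v :: "bool list" assume "length w = fst (Y ! i)" "length v = fst (X ! j)"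
    then have "(i, w) \<in> set (ixs Y)" "(j, v) \<in> set (ixs X)" using ij by (simp_all add: ixs idx_iff)
    from MAT_inj[OF e[unfolded EM_def] this] show "cval (f $$ (i, j)) w v = cval (g $$ (i, j)) w v" by (simp add: fmat_def)
  qed
  then show "f $$ (i, j) = g $$ (i, j)" using cval_inj[OF F H] by blast
qed (use f g in \<open>auto simp: EC_simps\<close>)

lemma pv_sum: assumes X: "X \<in> Obj EC"
  shows "x \<in> set (ixs X) \<Longrightarrow> (\<Sum>y\<in>set (ixs X). F y * pv X y x) = (\<Sum>u\<in>words (fst (X ! fst x)). F (fst x, u) * pr (X ! fst x) u (snd x))"
    "x \<in> set (ixs X) \<Longrightarrow> (\<Sum>y\<in>set (ixs X). pv X x y * F y) = (\<Sum>u\<in>words (fst (X ! fst x)). pr (X ! fst x) (snd x) u * F (fst x, u))"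
proof -
  assume x: "x \<in> set (ixs X)"
  note l = ixs_less[OF x]
  have "(\<Sum>y\<in>set (ixs X). F y * pv X y x) = (\<Sum>j<length X. \<Sum>u\<in>words (fst (X ! j)). F (j, u) * pv X (j, u) x)"
    unfolding ixs using sum_idx[of "\<lambda>j u. F (j, u) * pv X (j, u) x" X] by simp
  also have "\<dots> = (\<Sum>j<length X. if j = fst x then \<Sum>u\<in>words (fst (X ! fst x)). F (fst x, u) * pr (X ! fst x) u (snd x) else 0)"
    by (intro sum.cong) (auto simp: pv_def)
  finally show "(\<Sum>y\<in>set (ixs X). F y * pv X y x) = (\<Sum>u\<in>words (fst (X ! fst x)). F (fst x, u) * pr (X ! fst x) u (snd x))" using l by simp
  have "(\<Sum>y\<in>set (ixs X). pv X x y * F y) = (\<Sum>j<length X. \<Sum>u\<in>words (fst (X ! j)). pv X x (j, u) * F (j, u))"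
    unfolding ixs using sum_idx[of "\<lambda>j u. pv X x (j, u) * F (j, u)" X] by simp
  also have "\<dots> = (\<Sum>j<length X. if j = fst x then \<Sum>u\<in>words (fst (X ! fst x)). pr (X ! fst x) (snd x) u * F (fst x, u) else 0)"
    by (intro sum.cong) (auto simp: pv_def)
  finally show "(\<Sum>y\<in>set (ixs X). pv X x y * F y) = (\<Sum>u\<in>words (fst (X ! fst x)). pr (X ! fst x) (snd x) u * F (fst x, u))" using l by simp
qed

lemma E_p: assumes X: "X \<in> Obj EC" and Y: "Y \<in> Obj EC" and f: "f \<in> Hom EC X Y"
  shows "EM X Y f * EM X X (Idm EC X) = EM X Y f" "EM Y Y (Idm EC Y) * EM X Y f = EM X Y f"
proof -
  show "EM X Y f * EM X X (Idm EC X) = EM X Y f" unfolding E_Id(2)[OF X] unfolding EM_def MAT_mult[OF ixs(2)]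
  proof (rule MAT_cong)
    fix x y assume x: "x \<in> set (ixs Y)" and y: "y \<in> set (ixs X)"
    note l = ixs_less[OF x] ixs_less[OF y]
    have "wcomp (fst (X ! fst y)) (cval (f $$ (fst x, fst y))) (pr (X ! fst y)) (snd x) (snd y) = cval (f $$ (fst x, fst y)) (snd x) (snd y)"
      using PHomD(2)[OF nth_P[OF X] nth_P[OF Y] E_HomD[OF X Y f]] l by simp
    then show "(\<Sum>z\<in>set (ixs X). fmat f x z * pv X z y) = fmat f x y" unfolding pv_sum(1)[OF X y] by (simp add: fmat_def wcomp_def)
  qed
  show "EM Y Y (Idm EC Y) * EM X Y f = EM X Y f" unfolding E_Id(2)[OF Y] unfolding EM_def MAT_mult[OF ixs(2)]
  proof (rule MAT_cong)
    fix x y assume x: "x \<in> set (ixs Y)" and y: "y \<in> set (ixs X)"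
    note l = ixs_less[OF x] ixs_less[OF y]
    have "wcomp (fst (Y ! fst x)) (pr (Y ! fst x)) (cval (f $$ (fst x, fst y))) (snd x) (snd y) = cval (f $$ (fst x, fst y)) (snd x) (snd y)"
      using PHomD(3)[OF nth_P[OF X] nth_P[OF Y] E_HomD[OF X Y f]] l by simp
    then show "(\<Sum>z\<in>set (ixs Y). pv Y x z * fmat f z y) = fmat f x y" unfolding pv_sum(2)[OF Y x] by (simp add: fmat_def wcomp_def)
  qed
qed

text \<open>The bijection from pairs of labels to labels of the tensor product: summands of a tensor product are
  ordered lexicographically, and words are concatenated.\<close>

definition \<beta> :: "pobj list \<Rightarrow> (nat \<times> bool list) \<times> (nat \<times> bool list) \<Rightarrow> nat \<times> bool list" where
  "\<beta> Y z = (fst (fst z) * length Y + fst (snd z), snd (fst z) @ snd (snd z))"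

lemma pair_less: "i < a \<Longrightarrow> j < b \<Longrightarrow> i * b + j < a * b" for i j a b :: nat
proof -
  assume "i < a" "j < b"
  then have "i * b + j < Suc i * b" by simp
  also have "\<dots> \<le> a * b" using \<open>i < a\<close> by (intro mult_le_mono1) simp
  finally show ?thesis .
qed

lemma pair_div [simp]: "j < b \<Longrightarrow> (i * b + j) div b = i" for i j b :: nat
  by (cases "b = 0") simp_all

lemma \<beta>_in: assumes X: "X \<in> Obj EC" and Y: "Y \<in> Obj EC" and z: "z \<in> set (List.product (ixs X) (ixs Y))"
  shows "\<beta> Y z \<in> set (ixs (env_tensor PC X Y))"
proof -
  have l: "fst (fst z) < length X" "length (snd (fst z)) = fst (X ! fst (fst z))" "fst (snd z) < length Y" "length (snd (snd z)) = fst (Y ! fst (snd z))"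
    using z ixs_less[of "fst z" X] ixs_less[of "snd z" Y] by auto
  show ?thesis unfolding ixs \<beta>_def idx_iff
    using l pair_less[OF l(1,3)] P_TenO[OF nth_P[OF X l(1)] nth_P[OF Y l(3)]] by (simp add: env_tensor_nth)
qed

lemma \<beta>_inj: "inj_on (\<beta> Y) (set (List.product (ixs X) (ixs Y)))"
proof (rule inj_onI)
  fix z z' assume z: "z \<in> set (List.product (ixs X) (ixs Y))" "z' \<in> set (List.product (ixs X) (ixs Y))" and e: "\<beta> Y z = \<beta> Y z'"
  have l: "length (snd (fst z)) = fst (X ! fst (fst z))" "fst (snd z) < length Y" "length (snd (fst z')) = fst (X ! fst (fst z'))" "fst (snd z') < length Y"
    using z ixs_less[of "fst z" X] ixs_less[of "snd z" Y] ixs_less[of "fst z'" X] ixs_less[of "snd z'" Y] by auto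
  have k: "fst (fst z) * length Y + fst (snd z) = fst (fst z') * length Y + fst (snd z')" using e by (simp add: \<beta>_def)
  have i: "fst (fst z) = fst (fst z')" using arg_cong[OF k, of "\<lambda>n. n div length Y"] l by simp
  have j: "fst (snd z) = fst (snd z')" using k i by simp
  have "snd (fst z) = snd (fst z')" "snd (snd z) = snd (snd z')" using e l i by (auto simp: \<beta>_def)
  then show "z = z'" using i j by (intro prod_eqI) auto
qed

lemma \<beta>_image: assumes X: "X \<in> Obj EC" and Y: "Y \<in> Obj EC"
  shows "\<beta> Y ` set (List.product (ixs X) (ixs Y)) = set (ixs (env_tensor PC X Y))"
proof
  show "\<beta> Y ` set (List.product (ixs X) (ixs Y)) \<subseteq> set (ixs (env_tensor PC X Y))" using \<beta>_in[OF X Y] by blast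
  show "set (ixs (env_tensor PC X Y)) \<subseteq> \<beta> Y ` set (List.product (ixs X) (ixs Y))"
  proof
    fix z assume "z \<in> set (ixs (env_tensor PC X Y))"
    note l = ixs_less[OF this]
    then have k: "fst z < length X * length Y" by simp
    let ?i = "fst z div length Y" and ?j = "fst z mod length Y"
    note d = div_mod_less[OF k]
    have w: "length (snd z) = fst (X ! ?i) + fst (Y ! ?j)" using l k P_TenO[OF nth_P[OF X d(1)] nth_P[OF Y d(2)]] by (simp add: env_tensor_nth)
    let ?x = "((?i, take (fst (X ! ?i)) (snd z)), (?j, drop (fst (X ! ?i)) (snd z)))"
    have "?x \<in> set (List.product (ixs X) (ixs Y))" using d w by (simp add: ixs idx_iff)
    moreover have "z = \<beta> Y ?x" by (simp add: \<beta>_def)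
    ultimately show "z \<in> \<beta> Y ` set (List.product (ixs X) (ixs Y))" by blast
  qed
qed

definition E\<tau> :: "pobj list \<Rightarrow> pobj list \<Rightarrow> complex mat" where "E\<tau> X Y = PERM (ixs (env_tensor PC X Y)) (List.product (ixs X) (ixs Y)) (\<beta> Y)"
definition E\<tau>' :: "pobj list \<Rightarrow> pobj list \<Rightarrow> complex mat" where "E\<tau>' X Y = PERM' (ixs (env_tensor PC X Y)) (List.product (ixs X) (ixs Y)) (\<beta> Y)"

lemma dprod: "distinct (List.product (ixs X) (ixs Y))" using ixs(2) by (intro distinct_product)

lemma E\<tau>_dim: "E\<tau> X Y \<in> carrier_mat (EN (env_tensor PC X Y)) (EN X * EN Y)" "E\<tau>' X Y \<in> carrier_mat (EN X * EN Y) (EN (env_tensor PC X Y))"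
  by (auto simp: E\<tau>_def E\<tau>'_def PERM_def PERM'_def EN_def intro!: carrier_matI)

lemma E\<tau>_inv: assumes "X \<in> Obj EC" "Y \<in> Obj EC"
  shows "E\<tau> X Y * E\<tau>' X Y = 1\<^sub>m (EN (env_tensor PC X Y))" "E\<tau>' X Y * E\<tau> X Y = 1\<^sub>m (EN X * EN Y)"
  using PERM_inv[OF ixs(2) dprod \<beta>_inj \<beta>_image[OF assms]] by (simp_all add: E\<tau>_def E\<tau>'_def EN_def)

lemma E\<tau>_MAT: assumes "X \<in> Obj EC" "Y \<in> Obj EC" "X' \<in> Obj EC" "Y' \<in> Obj EC"
    "\<And>x x' y y'. x \<in> set (ixs X) \<Longrightarrow> y \<in> set (ixs Y) \<Longrightarrow> x' \<in> set (ixs X') \<Longrightarrow> y' \<in> set (ixs Y') \<Longrightarrow> F (\<beta> Y' (x', y')) (\<beta> Y (x, y)) = A x' x * B y' y"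
  shows "MAT (ixs (env_tensor PC X' Y')) (ixs (env_tensor PC X Y)) F * E\<tau> X Y = E\<tau> X' Y' * kron (MAT (ixs X') (ixs X) A) (MAT (ixs Y') (ixs Y) B)"
  unfolding E\<tau>_def kron_MAT
  by (rule PERM_nat[OF ixs(2) \<beta>_in[OF assms(1,2)] dprod \<beta>_inj \<beta>_image[OF assms(3,4)]]) (use assms(5) in auto)

lemma E_TenM: assumes X: "X \<in> Obj EC" and X': "X' \<in> Obj EC" and Y: "Y \<in> Obj EC" and Y': "Y' \<in> Obj EC" and f: "f \<in> Hom EC X X'" and g: "g \<in> Hom EC Y Y'"
  shows "TenM EC X X' Y Y' f g \<in> Hom EC (env_tensor PC X Y) (env_tensor PC X' Y')"
    "EM (env_tensor PC X Y) (env_tensor PC X' Y') (TenM EC X X' Y Y' f g) * E\<tau> X Y = E\<tau> X' Y' * kron (EM X X' f) (EM Y Y' g)"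
proof -
  have t: "TenM PC (X ! j) (X' ! i) (Y ! j') (Y' ! i') (f $$ (i, j)) (g $$ (i', j')) \<in> Hom PC (ptensor m 1 (X ! j) (Y ! j')) (ptensor m 1 (X' ! i) (Y' ! i')) \<and>
     cval (TenM PC (X ! j) (X' ! i) (Y ! j') (Y' ! i') (f $$ (i, j)) (g $$ (i', j'))) = wten (fst (X' ! i)) (fst (X ! j)) (cval (f $$ (i, j))) (cval (g $$ (i', j')))"
    if "i < length X'" "j < length X" "i' < length Y'" "j' < length Y" for i j i' j'
    using that by (intro P_TenM nth_P[OF X] nth_P[OF X'] nth_P[OF Y] nth_P[OF Y'] E_HomD[OF X X' f] E_HomD[OF Y Y' g])
  show "TenM EC X X' Y Y' f g \<in> Hom EC (env_tensor PC X Y) (env_tensor PC X' Y')"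
    unfolding EC_simps(2)
  proof (intro conjI allI impI)
    show "TenM EC X X' Y Y' f g \<in> carrier_mat (length (env_tensor PC X' Y')) (length (env_tensor PC X Y))" by (simp add: EC_simps(10))
    fix i j assume "i < length (env_tensor PC X' Y')" "j < length (env_tensor PC X Y)"
    then have ij: "i < length X' * length Y'" "j < length X * length Y" by auto
    show "TenM EC X X' Y Y' f g $$ (i, j) \<in> Hom PC (env_tensor PC X Y ! j) (env_tensor PC X' Y' ! i)"
      using ij t[OF div_mod_less(1)[OF ij(1)] div_mod_less(1)[OF ij(2)] div_mod_less(2)[OF ij(1)] div_mod_less(2)[OF ij(2)]]
      by (simp add: EC_simps(10) env_tensor_nth)
  qed
  show "EM (env_tensor PC X Y) (env_tensor PC X' Y') (TenM EC X X' Y Y' f g) * E\<tau> X Y = E\<tau> X' Y' * kron (EM X X' f) (EM Y Y' g)"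
    unfolding EM_def
  proof (rule E\<tau>_MAT[OF X Y X' Y'])
    fix x x' y y' assume "x \<in> set (ixs X)" "y \<in> set (ixs Y)" "x' \<in> set (ixs X')" "y' \<in> set (ixs Y')"
    note l = ixs_less[OF this(1)] ixs_less[OF this(2)] ixs_less[OF this(3)] ixs_less[OF this(4)]
    show "fmat (TenM EC X X' Y Y' f g) (\<beta> Y' (x', y')) (\<beta> Y (x, y)) = fmat f x' x * fmat g y' y"
      using l t pair_less[of "fst x'" "length X'" "fst y'" "length Y'"] pair_less[of "fst x" "length X" "fst y" "length Y"]
      by (simp add: fmat_def \<beta>_def EC_simps(10) wten_append)
  qed
qed

lemma E\<tau>_p: assumes X: "X \<in> Obj EC" and Y: "Y \<in> Obj EC"
  shows "EM (env_tensor PC X Y) (env_tensor PC X Y) (Idm EC (env_tensor PC X Y)) * E\<tau> X Y = E\<tau> X Y * kron (EM X X (Idm EC X)) (EM Y Y (Idm EC Y))"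
  unfolding E_Id(2)[OF X] E_Id(2)[OF Y] E_Id(2)[OF E_TenO[OF X Y]]
proof (rule E\<tau>_MAT[OF X Y X Y])
  fix x x' y y' assume "x \<in> set (ixs X)" "y \<in> set (ixs Y)" "x' \<in> set (ixs X)" "y' \<in> set (ixs Y)"
  note l = ixs_less[OF this(1)] ixs_less[OF this(2)] ixs_less[OF this(3)] ixs_less[OF this(4)]
  have eq: "fst x' * length Y + fst y' = fst x * length Y + fst y \<longleftrightarrow> fst x' = fst x \<and> fst y' = fst y"
  proof
    assume k: "fst x' * length Y + fst y' = fst x * length Y + fst y"
    have "fst x' = fst x" using arg_cong[OF k, of "\<lambda>n. n div length Y"] l by simp
    with k show "fst x' = fst x \<and> fst y' = fst y" by simp
  qed simp
  show "pv (env_tensor PC X Y) (\<beta> Y (x', y')) (\<beta> Y (x, y)) = pv X x' x * pv Y y' y"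
    using l pair_less[of "fst x" "length X" "fst y" "length Y"] P_TenO[OF nth_P[OF X] nth_P[OF Y], of "fst x" "fst y"]
    by (auto simp: pv_def \<beta>_def eq env_tensor_nth wten_append)
qed

lemma E\<tau>_assoc: assumes X: "X \<in> Obj EC" and Y: "Y \<in> Obj EC" and Z: "Z \<in> Obj EC"
  shows "E\<tau> (env_tensor PC X Y) Z * kron (E\<tau> X Y) (1\<^sub>m (EN Z)) = E\<tau> X (env_tensor PC Y Z) * kron (1\<^sub>m (EN X)) (E\<tau> Y Z)"
proof -
  let ?XY = "env_tensor PC X Y" and ?YZ = "env_tensor PC Y Z"
  have k1: "kron (E\<tau> X Y) (1\<^sub>m (EN Z)) = PERM (List.product (ixs ?XY) (ixs Z)) (List.product (List.product (ixs X) (ixs Y)) (ixs Z)) (\<lambda>u. (\<beta> Y (fst u), snd u))"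
    unfolding E\<tau>_def PERM_def EN_def MAT_one[OF ixs(2), symmetric] kron_MAT by (rule MAT_cong) (auto simp: prod_eq_iff)
  have k2: "kron (1\<^sub>m (EN X)) (E\<tau> Y Z) = PERM (List.product (ixs X) (ixs ?YZ)) (List.product (ixs X) (List.product (ixs Y) (ixs Z))) (\<lambda>u. (fst u, \<beta> Z (snd u)))"
    unfolding E\<tau>_def PERM_def EN_def MAT_one[OF ixs(2), symmetric] kron_MAT by (rule MAT_cong) (auto simp: prod_eq_iff)
  have "E\<tau> ?XY Z * kron (E\<tau> X Y) (1\<^sub>m (EN Z)) = MAT (ixs (env_tensor PC ?XY Z)) (List.product (List.product (ixs X) (ixs Y)) (ixs Z)) (\<lambda>r u. if r = \<beta> Z (\<beta> Y (fst u), snd u) then 1 else 0)"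
    unfolding k1 unfolding E\<tau>_def PERM_def[of _ _ "\<beta> Z"]
    by (rule MAT_PERM[OF dprod]) (use \<beta>_in[OF X Y] in auto)
  also have "\<dots> = MAT (ixs (env_tensor PC X ?YZ)) (List.product (ixs X) (List.product (ixs Y) (ixs Z))) (\<lambda>r u. if r = \<beta> ?YZ (fst u, \<beta> Z (snd u)) then 1 else 0)"
    unfolding product_assoc MAT_map E_tensor_strict(3)[OF X Y Z]
    by (rule MAT_cong) (auto simp: \<beta>_def algebra_simps)
  also have "\<dots> = E\<tau> X ?YZ * kron (1\<^sub>m (EN X)) (E\<tau> Y Z)"
    unfolding k2 unfolding E\<tau>_def PERM_def[of _ _ "\<beta> ?YZ"]
    by (rule MAT_PERM[OF dprod, symmetric]) (use \<beta>_in[OF Y Z] in auto)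
  finally show ?thesis .
qed

lemma ixs_unit: "ixs [Unit PC] = [(0, [])]"
proof -
  have "idx [Unit PC] = {(0, [])}" by (auto simp: idx_def PUnit)
  then have "set (ixs [Unit PC]) = {(0, [])}" "distinct (ixs [Unit PC])" using ixs[of "[Unit PC]"] by auto
  moreover from this have "length (ixs [Unit PC]) = 1" using distinct_card[of "ixs [Unit PC]"] by simp
  then obtain y where "ixs [Unit PC] = [y]" by (auto simp: length_Suc_conv)
  ultimately show ?thesis by simp
qed

lemma E\<tau>_unit: assumes X: "X \<in> Obj EC" shows "E\<tau> [Unit PC] X = 1\<^sub>m (EN X)" "E\<tau> X [Unit PC] = 1\<^sub>m (EN X)"
proof -
  have p: "List.product [(0, [])] L = map (Pair (0, [])) L" "List.product L [(0, [])] = map (\<lambda>x. (x, (0, []))) L" for L :: "(nat \<times> bool list) list"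
    by (induction L) auto
  show "E\<tau> [Unit PC] X = 1\<^sub>m (EN X)" unfolding E\<tau>_def PERM_def ixs_unit p MAT_map E_tensor_strict[OF X] EN_def MAT_one[OF ixs(2), symmetric]
    by (rule MAT_cong) (simp add: \<beta>_def)
  show "E\<tau> X [Unit PC] = 1\<^sub>m (EN X)" unfolding E\<tau>_def PERM_def ixs_unit p MAT_map E_tensor_strict[OF X] EN_def MAT_one[OF ixs(2), symmetric]
    by (rule MAT_cong) (simp add: \<beta>_def)
qed

end

section \<open>The cyclic group\<close>

text \<open>The powers of the generator of the cyclic group.\<close>

definition gz :: "complex \<Rightarrow> nat \<Rightarrow> complex mat" where
  "gz \<zeta> k = mat 2 2 (\<lambda>(i, j). if i = j then (if i = 0 then \<zeta> ^ k else inverse \<zeta> ^ k) else 0)"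

lemma less_2: "i < 2 \<longleftrightarrow> i = 0 \<or> i = (1::nat)" by auto

lemma gz_carrier [simp]: "gz \<zeta> k \<in> carrier_mat 2 2" "dim_row (gz \<zeta> k) = 2" "dim_col (gz \<zeta> k) = 2"
  by (simp_all add: gz_def)

lemma gz_index: "gz \<zeta> k $$ (0, 0) = \<zeta> ^ k" by (simp add: gz_def)

lemma gz_mult: "gz \<zeta> k * gz \<zeta> l = gz \<zeta> (k + l)"
proof (rule eq_matI)
  fix i j assume "i < dim_row (gz \<zeta> (k + l))" "j < dim_col (gz \<zeta> (k + l))"
  then have ij: "i < 2" "j < 2" by auto
  show "(gz \<zeta> k * gz \<zeta> l) $$ (i, j) = gz \<zeta> (k + l) $$ (i, j)"
    unfolding mult_index_sum[OF gz_carrier(1) gz_carrier(1) ij] using ij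
    by (auto simp: less_2 gz_def numeral_2_eq_2 power_add)
qed auto

lemma gz_0: "gz \<zeta> 0 = 1\<^sub>m 2" by (rule eq_matI) (auto simp: gz_def)

lemma gz_1: "gz \<zeta> 1 = mat_of_rows_list 2 [[\<zeta>, 0], [0, inverse \<zeta>]]"
  by (rule eq_matI) (auto simp: gz_def mat_of_rows_list_def less_Suc_eq numeral_2_eq_2)

locale planar_rep = planar_m + fixes \<zeta> :: complex
  assumes root: "\<zeta> ^ m = 1" and primitive: "\<And>k. 0 < k \<Longrightarrow> k < m \<Longrightarrow> \<zeta> ^ k \<noteq> 1"
begin

abbreviation G where "G \<equiv> cyclic_subgroup \<zeta>"

lemma mpos: "0 < m" using m by simp

lemma z0: "\<zeta> \<noteq> 0" using root mpos by (metis power_0_left zero_neq_one less_numeral_extra(3))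

lemma gz_m: "gz \<zeta> m = gz \<zeta> 0"
  by (rule eq_matI) (auto simp: gz_def root power_inverse)

lemma cnj_z: "cnj \<zeta> = inverse \<zeta>"
proof -
  have "norm \<zeta> ^ m = 1" using root by (metis norm_one norm_power)
  then have "norm \<zeta> = 1" using mpos by (intro power_eq_imp_eq_base[of "norm \<zeta>" m 1]) auto
  then have "\<zeta> * cnj \<zeta> = 1" by (simp add: complex_norm_square[symmetric])
  then show ?thesis by (metis inverse_unique)
qed

lemma gz_SU2: "gz \<zeta> k \<in> carrier SU2"
proof -
  have a: "mat_adjoint (gz \<zeta> k) = mat 2 2 (\<lambda>(i, j). if i = j then (if i = 0 then inverse \<zeta> ^ k else \<zeta> ^ k) else 0)" (is "_ = ?A")
  proof (rule eq_matI)
    fix i j assume "i < dim_row ?A" "j < dim_col ?A"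
    then have ij: "i < 2" "j < 2" by auto
    have "cnj (inverse \<zeta>) = \<zeta>" unfolding cnj_z[symmetric] by simp
    then show "mat_adjoint (gz \<zeta> k) $$ (i, j) = ?A $$ (i, j)"
      using ij by (auto simp: less_2 mat_adjoint_def mat_of_rows_def gz_def cnj_z)
  qed (auto simp: mat_adjoint_def)
  have b: "gz \<zeta> k * mat_adjoint (gz \<zeta> k) = 1\<^sub>m 2"
  proof (rule eq_matI)
    fix i j assume "i < dim_row (1\<^sub>m 2 :: complex mat)" "j < dim_col (1\<^sub>m 2 :: complex mat)"
    then have ij: "i < 2" "j < 2" by auto
    have A: "?A \<in> carrier_mat 2 2" by simp
    have "(gz \<zeta> k * ?A) $$ (i, j) = (1\<^sub>m 2 :: complex mat) $$ (i, j)"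
      unfolding mult_index_sum[OF gz_carrier(1) A ij] using ij z0
      by (auto simp: less_2 gz_def numeral_2_eq_2 power_mult_distrib[symmetric])
    then show "(gz \<zeta> k * mat_adjoint (gz \<zeta> k)) $$ (i, j) = (1\<^sub>m 2 :: complex mat) $$ (i, j)" unfolding a .
  qed (auto simp: a)
  have "upper_triangular (gz \<zeta> k)" by (auto simp: upper_triangular_def gz_def)
  then have "det (gz \<zeta> k) = prod_list (diag_mat (gz \<zeta> k))" by (rule det_upper_triangular[OF _ gz_carrier(1)])
  also have "\<dots> = 1" using z0 by (simp add: diag_mat_def gz_def numeral_2_eq_2 power_mult_distrib[symmetric])
  finally show ?thesis using b by (simp add: SU2_def)
qed

lemma SU2_simps: "monoid.mult SU2 = times" "one SU2 = 1\<^sub>m 2" by (simp_all add: SU2_def)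

lemma inv_gz: "m_inv SU2 (gz \<zeta> 1) = gz \<zeta> (m - 1)"
proof -
  have e: "gz \<zeta> 1 * gz \<zeta> (m - 1) = 1\<^sub>m 2" "gz \<zeta> (m - 1) * gz \<zeta> 1 = 1\<^sub>m 2"
    using mpos gz_m gz_0 by (simp_all add: gz_mult)
  show ?thesis unfolding m_inv_def SU2_simps
  proof (rule the_equality)
    fix y assume y: "y \<in> carrier SU2 \<and> gz \<zeta> 1 * y = 1\<^sub>m 2 \<and> y * gz \<zeta> 1 = 1\<^sub>m 2"
    then have d: "dim_row y = 2" "dim_col y = 2" by (auto simp: SU2_def)
    have "y = (gz \<zeta> (m - 1) * gz \<zeta> 1) * y" using d by (simp only: e mat_one)
    also have "\<dots> = gz \<zeta> (m - 1) * (gz \<zeta> 1 * y)" using d by (intro mat_assoc) auto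
    also have "\<dots> = gz \<zeta> (m - 1)" using y by (simp add: mat_one)
    finally show "y = gz \<zeta> (m - 1)" .
  qed (use e gz_SU2 in blast)
qed

lemma carrier_G: "carrier G = range (gz \<zeta>)"
proof
  have c: "carrier G = generate SU2 {gz \<zeta> 1}" by (simp add: cyclic_subgroup_def gz_1[symmetric] del: One_nat_def)
  show "carrier G \<subseteq> range (gz \<zeta>)" unfolding c
  proof
    fix x assume "x \<in> generate SU2 {gz \<zeta> 1}"
    then show "x \<in> range (gz \<zeta>)"
    proof (induction rule: generate.induct)
      case one show ?case unfolding SU2_simps using gz_0 by (metis rangeI)
    next
      case (incl h) then show ?case by blast
    next
      case (inv h) then show ?case using inv_gz by auto
    next
      case (eng h1 h2) then show ?case by (auto simp: SU2_simps gz_mult)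
    qed
  qed
  show "range (gz \<zeta>) \<subseteq> carrier G" unfolding c
  proof
    fix x assume "x \<in> range (gz \<zeta>)"
    then obtain k where x: "x = gz \<zeta> k" by blast
    have "gz \<zeta> k \<in> generate SU2 {gz \<zeta> 1}" for k
    proof (induction k)
      case 0 show ?case using generate.one[of SU2] by (simp add: gz_0 SU2_simps)
    next
      case (Suc k)
      then have "gz \<zeta> k \<otimes>\<^bsub>SU2\<^esub> gz \<zeta> 1 \<in> generate SU2 {gz \<zeta> 1}" by (rule generate.eng[OF _ generate.incl]) simp
      then show ?case unfolding SU2_simps gz_mult by simp
    qed
    then show "x \<in> generate SU2 {gz \<zeta> 1}" using x by blast
  qed
qed

lemma G_ops: "monoid.mult G = times" "one G = gz \<zeta> 0" by (simp_all add: cyclic_subgroup_def SU2_def gz_0)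

lemma G_monoid: "rep_monoid G"
  by unfold_locales (auto simp: carrier_G G_ops gz_mult)

text \<open>The scalar by which a diagonal matrix acts on the basis vector of a word in a tensor power of \<open>\<complex>\<^sup>2\<close>.\<close>

definition chi :: "complex mat \<Rightarrow> bool list \<Rightarrow> complex" where "chi g w = (g $$ (0, 0)) powi deg w"

lemma chi_gz: "chi (gz \<zeta> k) w = (\<zeta> ^ k) powi deg w" by (simp add: chi_def gz_index)

lemma chi_mult: "chi (gz \<zeta> k * gz \<zeta> l) w = chi (gz \<zeta> k) w * chi (gz \<zeta> l) w"
  by (simp add: gz_mult chi_gz power_add power_int_mult_distrib)
lemma chi_append: "chi (gz \<zeta> k) (v @ w) = chi (gz \<zeta> k) v * chi (gz \<zeta> k) w"
  using z0 by (simp add: chi_gz deg_append power_int_add)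

lemma powi_periodic: assumes "z ^ m = (1 :: complex)" "a mod int m = b mod int m" shows "z powi a = z powi b"
proof -
  have z: "z \<noteq> 0" using assms(1) mpos by (metis power_0_left zero_neq_one less_numeral_extra(3))
  obtain c where "a - b = int m * c" using assms(2) by (metis dvdE mod_eq_dvd_iff)
  then have "a = int m * c + b" by simp
  then show ?thesis using z assms(1) by (simp add: power_int_add power_int_mult)
qed

text \<open>Primitivity of the root of unity is what makes equivariance detect the degree modulo \<open>m\<close> exactly.\<close>

lemma powi_primitive: assumes "\<zeta> powi a = \<zeta> powi b" shows "a mod int m = b mod int m"
proof -
  let ?r = "(a - b) mod int m"
  have "\<zeta> powi (a - b) = 1" using assms z0 by (simp add: power_int_diff)
  then have "\<zeta> powi ?r = 1" using powi_periodic[OF root, of ?r "a - b"] by simp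
  moreover have r: "0 \<le> ?r" "?r < int m" using mpos by simp_all
  ultimately have "\<zeta> ^ nat ?r = 1" by (simp add: power_int_def)
  moreover have "nat ?r < m" using r by (simp add: nat_less_iff)
  ultimately have "\<not> 0 < nat ?r" using primitive[of "nat ?r"] by blast
  then have "?r = 0" using r by simp
  then show ?thesis by (metis mod_eq_dvd_iff mod_eq_0_iff_dvd)
qed

lemma chi_same: "same_deg m v w \<Longrightarrow> chi (gz \<zeta> k) v = chi (gz \<zeta> k) w"
  unfolding chi_gz same_deg_def by (rule powi_periodic) (simp_all add: power_commutes power_mult[symmetric] mult.commute[of k] , simp add: power_mult root)

definition E\<Theta> :: "pobj list \<Rightarrow> complex mat \<Rightarrow> complex mat" where
  "E\<Theta> X g = MAT (ixs X) (ixs X) (\<lambda>x y. if x = y then chi g (snd x) else 0)"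

lemma MAT_\<Theta>: "MAT R (ixs X) F * E\<Theta> X g = MAT R (ixs X) (\<lambda>x y. F x y * chi g (snd y))"
  "E\<Theta> X g * MAT (ixs X) R' F' = MAT (ixs X) R' (\<lambda>x y. chi g (snd x) * F' x y)"
proof -
  show "MAT R (ixs X) F * E\<Theta> X g = MAT R (ixs X) (\<lambda>x y. F x y * chi g (snd y))"
    unfolding E\<Theta>_def MAT_mult[OF ixs(2)]
  proof (rule MAT_cong)
    fix x z assume "z \<in> set (ixs X)"
    moreover have "(\<Sum>y\<in>set (ixs X). F x y * (if y = z then chi g (snd y) else 0)) = (\<Sum>y\<in>set (ixs X). if y = z then F x z * chi g (snd z) else 0)"
      by (intro sum.cong) auto
    ultimately show "(\<Sum>y\<in>set (ixs X). F x y * (if y = z then chi g (snd y) else 0)) = F x z * chi g (snd z)" by simp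
  qed
  show "E\<Theta> X g * MAT (ixs X) R' F' = MAT (ixs X) R' (\<lambda>x y. chi g (snd x) * F' x y)"
    unfolding E\<Theta>_def MAT_mult[OF ixs(2)]
  proof (rule MAT_cong)
    fix x z assume "x \<in> set (ixs X)"
    moreover have "(\<Sum>y\<in>set (ixs X). (if x = y then chi g (snd x) else 0) * F' y z) = (\<Sum>y\<in>set (ixs X). if y = x then chi g (snd x) * F' x z else 0)"
      by (intro sum.cong) auto
    ultimately show "(\<Sum>y\<in>set (ixs X). (if x = y then chi g (snd x) else 0) * F' y z) = chi g (snd x) * F' x z" by simp
  qed
qed

lemma E\<Theta>_mult: "E\<Theta> X (gz \<zeta> k * gz \<zeta> l) = E\<Theta> X (gz \<zeta> k) * E\<Theta> X (gz \<zeta> l)"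
proof -
  have "E\<Theta> X (gz \<zeta> k) * E\<Theta> X (gz \<zeta> l) = MAT (ixs X) (ixs X) (\<lambda>x y. (if x = y then chi (gz \<zeta> k) (snd x) else 0) * chi (gz \<zeta> l) (snd y))"
    by (subst (1) E\<Theta>_def) (rule MAT_\<Theta>(1))
  also have "\<dots> = E\<Theta> X (gz \<zeta> k * gz \<zeta> l)" unfolding E\<Theta>_def by (rule MAT_cong) (simp add: chi_mult)
  finally show ?thesis by simp
qed

lemma E_comm: assumes X: "X \<in> Obj EC" and Y: "Y \<in> Obj EC" and f: "f \<in> Hom EC X Y"
  shows "EM X Y f * E\<Theta> X (gz \<zeta> k) = E\<Theta> Y (gz \<zeta> k) * EM X Y f"
  unfolding EM_def MAT_\<Theta>
proof (rule MAT_cong)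
  fix x y assume "x \<in> set (ixs Y)" "y \<in> set (ixs X)"
  note l = ixs_less[OF this(1)] ixs_less[OF this(2)]
  have "dp (cval (f $$ (fst x, fst y)))"
    using cval_type PHomD(1)[OF nth_P[OF X] nth_P[OF Y] E_HomD[OF X Y f]] l by blast
  then have "fmat f x y = 0 \<or> same_deg m (snd y) (snd x)" by (auto simp: dp_def fmat_def)
  then show "fmat f x y * chi (gz \<zeta> k) (snd y) = chi (gz \<zeta> k) (snd x) * fmat f x y"
    using chi_same by (auto simp: mult.commute)
qed

text \<open>Commuting with the generator forces the entries between words of different degree to
  vanish, and every such matrix is the matrix of a class.\<close>

lemma E_full: assumes X: "X \<in> Obj EC" and Y: "Y \<in> Obj EC" and A: "A \<in> carrier_mat (EN Y) (EN X)"
    and p: "EM Y Y (Idm EC Y) * A * EM X X (Idm EC X) = A" and c: "A * E\<Theta> X (gz \<zeta> 1) = E\<Theta> Y (gz \<zeta> 1) * A"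
  shows "\<exists>f \<in> Hom EC X Y. EM X Y f = A"
proof -
  obtain F where F: "A = MAT (ixs Y) (ixs X) F" using MAT_surj[OF A[unfolded EN_def] ixs(2) ixs(2)] by blast
  have dX: "dim_row (EM X X (Idm EC X)) = EN X" "dim_col (EM X X (Idm EC X)) = EN X" "dim_row (EM Y Y (Idm EC Y)) = EN Y" "dim_col (EM Y Y (Idm EC Y)) = EN Y"
    by (simp_all add: EM_def EN_def)
  have dA: "dim_row A = EN Y" "dim_col A = EN X" using A by auto
  have p1: "A * EM X X (Idm EC X) = A"
    using p dX dA mat_assoc[of "EM Y Y (Idm EC Y) * A" "EM X X (Idm EC X)" "EM X X (Idm EC X)"] E_p(1)[OF X X E_Id(1)[OF X]] by simp
  have p2: "EM Y Y (Idm EC Y) * A = A"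
    using p dX dA mat_assoc[of "EM Y Y (Idm EC Y)" "EM Y Y (Idm EC Y)" "A"] mat_assoc[of "EM Y Y (Idm EC Y)" A "EM X X (Idm EC X)"] E_p(1)[OF Y Y E_Id(1)[OF Y]] p1 by simp
  have deg: "same_deg m (snd y) (snd x)" if "x \<in> set (ixs Y)" "y \<in> set (ixs X)" "F x y \<noteq> 0" for x y
  proof -
    have "F x y * chi (gz \<zeta> 1) (snd y) = chi (gz \<zeta> 1) (snd x) * F x y"
      using MAT_inj[OF c[unfolded F MAT_\<Theta>] that(1,2)] .
    then have "\<zeta> powi deg (snd y) = \<zeta> powi deg (snd x)" using that(3) unfolding chi_gz by simp
    then show ?thesis unfolding same_deg_def by (rule powi_primitive)
  qed
  define H where "H i j w v = (if length w = fst (Y ! i) \<and> length v = fst (X ! j) then F (i, w) (j, v) else 0)" for i j w v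
  have "\<exists>h \<in> pspace m 1 (fst (X ! j)) (fst (Y ! i)). cval h = H i j" if "i < length Y" "j < length X" for i j
  proof (rule cval_surj)
    show "dp (H i j)" unfolding dp_def
    proof (intro allI impI)
      fix w v assume h: "H i j w v \<noteq> 0"
      then have l: "length w = fst (Y ! i)" "length v = fst (X ! j)" by (auto simp: H_def split: if_splits)
      then show "same_deg m v w" using deg[of "(i, w)" "(j, v)"] h that by (simp add: H_def ixs idx_iff)
    qed
    show "supp (fst (X ! j)) (fst (Y ! i)) (H i j)" by (auto simp: supp_def H_def)
  qed
  then obtain h where h: "\<And>i j. i < length Y \<Longrightarrow> j < length X \<Longrightarrow> h i j \<in> pspace m 1 (fst (X ! j)) (fst (Y ! i)) \<and> cval (h i j) = H i j"
    by metis
  define f where "f = mat (length Y) (length X) (\<lambda>(i, j). h i j)"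
  have fH: "f \<in> Hom EC X Y" unfolding EC_simps(2)
  proof (intro conjI allI impI)
    fix i j assume ij: "i < length Y" "j < length X"
    have s: "supp (fst (X ! j)) (fst (Y ! i)) (H i j)" by (auto simp: supp_def H_def)
    have "wcomp (fst (X ! j)) (H i j) (pr (X ! j)) = H i j"
    proof (rule wmat_eqI[OF supp_wcomp[OF s supp_pr[OF nth_P[OF X ij(2)]]] s])
      fix w v :: "bool list" assume l: "length w = fst (Y ! i)" "length v = fst (X ! j)"
      have i: "(i, w) \<in> set (ixs Y)" "(j, v) \<in> set (ixs X)" using l ij by (simp_all add: ixs idx_iff)
      have "(\<Sum>y\<in>set (ixs X). F (i, w) y * pv X y (j, v)) = F (i, w) (j, v)"
        using MAT_inj[OF p1[unfolded E_Id(2)[OF X] F MAT_mult[OF ixs(2)]] i] .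
      then have "(\<Sum>u\<in>words (fst (X ! j)). F (i, w) (j, u) * pr (X ! j) u v) = F (i, w) (j, v)" unfolding pv_sum(1)[OF X i(2)] by simp
      then show "wcomp (fst (X ! j)) (H i j) (pr (X ! j)) w v = H i j w v" using l by (simp add: wcomp_def H_def)
    qed
    moreover have "wcomp (fst (Y ! i)) (pr (Y ! i)) (H i j) = H i j"
    proof (rule wmat_eqI[OF supp_wcomp[OF supp_pr[OF nth_P[OF Y ij(1)]] s] s])
      fix w v :: "bool list" assume l: "length w = fst (Y ! i)" "length v = fst (X ! j)"
      have i: "(i, w) \<in> set (ixs Y)" "(j, v) \<in> set (ixs X)" using l ij by (simp_all add: ixs idx_iff)
      have "(\<Sum>y\<in>set (ixs Y). pv Y (i, w) y * F y (j, v)) = F (i, w) (j, v)"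
        using MAT_inj[OF p2[unfolded E_Id(2)[OF Y] F MAT_mult[OF ixs(2)]] i] .
      then have "(\<Sum>u\<in>words (fst (Y ! i)). pr (Y ! i) w u * F (i, u) (j, v)) = F (i, w) (j, v)" unfolding pv_sum(2)[OF Y i(1)] by simp
      then show "wcomp (fst (Y ! i)) (pr (Y ! i)) (H i j) w v = H i j w v" using l by (simp add: wcomp_def H_def)
    qed
    ultimately show "f $$ (i, j) \<in> Hom PC (X ! j) (Y ! i)" unfolding PHom_iff[OF nth_P[OF X ij(2)] nth_P[OF Y ij(1)]] using h[OF ij] ij by (simp add: f_def)
  qed (simp add: f_def)
  moreover have "EM X Y f = A" unfolding F EM_def
  proof (rule MAT_cong)
    fix x y assume "x \<in> set (ixs Y)" "y \<in> set (ixs X)"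
    note l = ixs_less[OF this(1)] ixs_less[OF this(2)]
    then show "fmat f x y = F x y" using h[of "fst x" "fst y"] by (simp add: fmat_def f_def H_def)
  qed
  ultimately show ?thesis by blast
qed

lemma roots_powers: assumes "z ^ m = (1 :: complex)" shows "\<exists>j<m. z = \<zeta> ^ j"
proof -
  have inj: "inj_on (\<lambda>j. \<zeta> ^ j) {..<m}"
  proof (rule inj_onI)
    fix i j assume ij: "i \<in> {..<m}" "j \<in> {..<m}" and e: "\<zeta> ^ i = \<zeta> ^ j"
    have "\<zeta> powi int i = \<zeta> powi int j" using e by simp
    from powi_primitive[OF this] show "i = j" using ij by simp
  qed
  have "(\<lambda>j. \<zeta> ^ j) ` {..<m} = {z. z ^ m = 1}"
  proof (rule card_subset_eq)
    show "finite {z :: complex. z ^ m = 1}" using mpos by (intro finite_roots_unity) simp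
    show "(\<lambda>j. \<zeta> ^ j) ` {..<m} \<subseteq> {z. z ^ m = 1}" by (auto simp: power_mult[symmetric] mult.commute[of _ m]) (simp add: power_mult root)
    show "card ((\<lambda>j. \<zeta> ^ j) ` {..<m}) = card {z :: complex. z ^ m = 1}"
      using card_roots_unity_eq[OF mpos] by (simp add: card_image[OF inj])
  qed
  then have "z \<in> (\<lambda>j. \<zeta> ^ j) ` {..<m}" using assms by simp
  then show ?thesis by blast
qed

lemma wid_object: "(j, cl j j (lpw (pos j))) \<in> Obj PC" "pr (j, cl j j (lpw (pos j))) = wunit (pos j) (pos j)"
proof -
  have f: "lpw (pos j) \<in> fp m j j" using fp_lpw[of "pos j"] by simp
  show p: "pr (j, cl j j (lpw (pos j))) = wunit (pos j) (pos j)" using cval_cl[OF f] by (simp add: pr_def lval_lpw)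
  show "(j, cl j j (lpw (pos j))) \<in> Obj PC" unfolding PObj_iff p using f by (auto simp: wunit_comp) (auto simp: wunit_def)
qed

text \<open>A representation of a finite cyclic group is a sum of characters \<open>\<zeta>\<^sup>j\<close>. The character \<open>\<zeta>\<^sup>j\<close> is
  realised by the projection \<open>P\<^sub>1\<^sup>\<otimes>\<^sup>j\<close>, whose matrix has rank one in degree \<open>j\<close>.\<close>

lemma E_ess: assumes V: "is_rep G V"
  shows "\<exists>X \<in> Obj EC. \<exists>L L'. L \<in> carrier_mat (EN X) (fst V) \<and> L' \<in> carrier_mat (fst V) (EN X) \<and>
        L' * L = 1\<^sub>m (fst V) \<and> L * L' = EM X X (Idm EC X) \<and> (\<forall>g \<in> carrier G. E\<Theta> X g * L = L * snd V g)"
proof -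
  define d where "d = fst V"
  define T where "T k = snd V (gz \<zeta> k)" for k
  have T: "T k \<in> carrier_mat d d" "T 0 = 1\<^sub>m d" "T (k + l) = T k * T l" for k l
    using V unfolding is_rep_def carrier_G G_ops T_def d_def gz_mult[symmetric] by auto
  have Tm: "T m = 1\<^sub>m d" using T(2) by (simp add: T_def gz_m)
  have pow: "T 1 ^\<^sub>m k = T k" for k
  proof (induction k)
    case 0 then show ?case using T(1)[of 1] T(2) by simp
  next
    case (Suc k) then show ?case using T(3)[of k 1] by simp
  qed
  have "T 1 ^\<^sub>m Suc m = T 1" unfolding pow using T(3)[of 1 m] Tm mat_one(2)[of "T 1" d] T(1)[of 1] by simp
  from periodic_diagonalizable[OF T(1) this mpos] obtain D P Q where D: "D \<in> carrier_mat d d" "P \<in> carrier_mat d d" "Q \<in> carrier_mat d d" "diagonal_mat D"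
    "T 1 = P * D * Q" "P * Q = 1\<^sub>m d" "Q * P = 1\<^sub>m d" .
  have dims [simp]: "dim_row D = d" "dim_col D = d" "dim_row P = d" "dim_col P = d" "dim_row Q = d" "dim_col Q = d" "dim_row (T k) = d" "dim_col (T k) = d" for k
    using D(1-3) T(1) by auto
  define Dk where "Dk k = MAT [0..<d] [0..<d] (\<lambda>a b. if a = b then D $$ (a, a) ^ k else 0)" for k
  have Dd [simp]: "dim_row (Dk k) = d" "dim_col (Dk k) = d" for k by (simp_all add: Dk_def)
  have D1: "D = Dk 1" using D(1,4) by (intro eq_matI) (auto simp: Dk_def MAT_def diagonal_mat_def)
  have Dmult: "Dk k * Dk 1 = Dk (Suc k)" for k
    unfolding Dk_def MAT_mult[OF distinct_upt]
  proof (rule MAT_cong)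
    fix a b assume "a \<in> set [0..<d]" "b \<in> set [0..<d]"
    moreover have "(\<Sum>y\<in>set [0..<d]. (if a = y then D $$ (a, a) ^ k else 0) * (if y = b then D $$ (y, y) ^ 1 else 0)) = (\<Sum>y\<in>set [0..<d]. if y = a then (if a = b then D $$ (a, a) ^ Suc k else 0) else 0)"
      by (intro sum.cong) auto
    ultimately show "(\<Sum>y\<in>set [0..<d]. (if a = y then D $$ (a, a) ^ k else 0) * (if y = b then D $$ (y, y) ^ 1 else 0)) = (if a = b then D $$ (a, a) ^ Suc k else 0)" by simp
  qed
  have c: "Q * (P * Z) = Z" if "dim_row Z = d" for Z using that D(7) mat_assoc[of Q P Z] by (simp add: mat_one)
  have Tk: "T k = P * Dk k * Q" for k
  proof (induction k)
    case 0
    have "Dk 0 = 1\<^sub>m d" unfolding Dk_def using MAT_one[of "[0..<d]"] by (simp cong: if_cong)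
    then show ?case using D(6) T(2) by (simp add: mat_one)
  next
    case (Suc k)
    have "T (Suc k) = (P * Dk k * Q) * (P * D * Q)" using T(3)[of k 1] Suc D(5) by simp
    also have "\<dots> = P * (Dk k * Dk 1) * Q" unfolding D1[symmetric] by (simp add: mat_assoc c)
    finally show ?case unfolding Dmult .
  qed
  have "Dk m = Q * (P * Dk m * Q) * P" by (simp add: mat_assoc c D(7) mat_one)
  also have "\<dots> = 1\<^sub>m d" unfolding Tk[symmetric] Tm by (simp add: mat_one D(7))
  finally have Dm: "Dk m = 1\<^sub>m d" .
  have "\<exists>j<m. D $$ (a, a) = \<zeta> ^ j" if "a < d" for a
  proof (rule roots_powers)
    have "Dk m $$ (a, a) = (1\<^sub>m d :: complex mat) $$ (a, a)" by (simp only: Dm)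
    then show "D $$ (a, a) ^ m = 1" using that by (simp add: Dk_def MAT_def)
  qed
  then obtain j where j: "\<And>a. a < d \<Longrightarrow> D $$ (a, a) = \<zeta> ^ j a" by metis
  define X where "X = map (\<lambda>a. (j a, cl (j a) (j a) (lpw (pos (j a))))) [0..<d]"
  have X: "X \<in> Obj EC" unfolding EC_simps X_def using wid_object(1) by auto
  have Xn: "length X = d" "\<And>a. a < d \<Longrightarrow> fst (X ! a) = j a" "\<And>a. a < d \<Longrightarrow> pr (X ! a) = wunit (pos (j a)) (pos (j a))"
    using wid_object(2) by (auto simp: X_def)
  define b where "b a = (a, pos (j a))" for a
  have bi: "b a \<in> set (ixs X)" if "a \<in> set [0..<d]" for a using that Xn by (simp add: b_def ixs idx_iff)
  define L where "L = PERM (ixs X) [0..<d] b"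
  define L' where "L' = PERM' (ixs X) [0..<d] b"
  have Ld [simp]: "dim_row L = EN X" "dim_col L = d" "dim_row L' = d" "dim_col L' = EN X" by (simp_all add: L_def L'_def PERM_def PERM'_def EN_def)
  have LL: "L' * L = 1\<^sub>m d"
  proof -
    have "L' * L = MAT [0..<d] [0..<d] (\<lambda>x y. if b y = b x then 1 else 0)"
      unfolding L_def L'_def PERM'_def by (rule MAT_PERM[OF ixs(2) bi])
    also have "\<dots> = MAT [0..<d] [0..<d] (\<lambda>x y. if x = y then 1 else 0)" by (rule MAT_cong) (auto simp: b_def)
    also have "\<dots> = 1\<^sub>m d" using MAT_one[of "[0..<d]"] by simp
    finally show ?thesis .
  qed
  have LL': "L * L' = EM X X (Idm EC X)"
    unfolding E_Id(2)[OF X] L_def L'_def PERM_def PERM'_def MAT_mult[OF distinct_upt]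
  proof (rule MAT_cong)
    fix x y assume "x \<in> set (ixs X)" "y \<in> set (ixs X)"
    then have l: "fst x < d" "fst y < d" using ixs_less[of x X] ixs_less[of y X] Xn(1) by auto
    have "(\<Sum>a\<in>set [0..<d]. (if x = b a then 1 else 0) * (if y = b a then 1 else 0)) = (\<Sum>a\<in>set [0..<d]. if a = fst x then (if x = b (fst x) \<and> y = b (fst x) then 1 else 0) else (0 :: complex))"
      by (intro sum.cong) (auto simp: b_def)
    then show "(\<Sum>a\<in>set [0..<d]. (if x = b a then 1 else 0) * (if y = b a then 1 else 0)) = pv X x y"
      using l Xn by (auto simp: pv_def b_def wunit_def prod_eq_iff)
  qed
  have \<Theta>L: "E\<Theta> X (gz \<zeta> k) * L = L * Dk k" for k
  proof -
    have "E\<Theta> X (gz \<zeta> k) * L = MAT (ixs X) [0..<d] (\<lambda>x a. chi (gz \<zeta> k) (snd x) * (if x = b a then 1 else 0))"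
      unfolding L_def PERM_def by (rule MAT_\<Theta>(2))
    also have "\<dots> = L * Dk k"
      unfolding L_def PERM_def Dk_def MAT_mult[OF distinct_upt]
    proof (rule MAT_cong)
      fix x a assume "x \<in> set (ixs X)" and a: "a \<in> set [0..<d]"
      have "chi (gz \<zeta> k) (pos (j a)) = D $$ (a, a) ^ k" using j[of a] a by (simp add: chi_gz deg_replicate power_mult[symmetric] mult.commute)
      moreover have "(\<Sum>c\<in>set [0..<d]. (if x = b c then 1 else 0) * (if c = a then D $$ (c, c) ^ k else 0)) = (\<Sum>c\<in>set [0..<d]. if c = a then (if x = b a then D $$ (a, a) ^ k else 0) else 0)"
        by (intro sum.cong) auto
      ultimately show "chi (gz \<zeta> k) (snd x) * (if x = b a then 1 else 0) = (\<Sum>c\<in>set [0..<d]. (if x = b c then 1 else 0) * (if c = a then D $$ (c, c) ^ k else 0))"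
        using a by (auto simp: b_def)
    qed
    finally show ?thesis .
  qed
  have c': "P * (Q * Z) = Z" if "dim_row Z = d" for Z using that D(6) mat_assoc[of P Q Z] by (simp add: mat_one)
  have L'L: "L' * (L * Z) = Z" if "dim_row Z = d" for Z using that LL mat_assoc[of L' L Z] by (simp add: mat_one)
  have "E\<Theta> X (gz \<zeta> k) * (L * Q) = (L * Q) * T k" for k
  proof -
    have "E\<Theta> X (gz \<zeta> k) * (L * Q) = (E\<Theta> X (gz \<zeta> k) * L) * Q" by (intro mat_assoc[symmetric]) (auto simp: E\<Theta>_def EN_def)
    also have "\<dots> = L * (Dk k * Q)" unfolding \<Theta>L by (simp add: mat_assoc)
    also have "\<dots> = (L * Q) * T k" unfolding Tk by (simp add: mat_assoc c)
    finally show ?thesis .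
  qed
  then have 3: "\<forall>g \<in> carrier G. E\<Theta> X g * (L * Q) = (L * Q) * snd V g" unfolding carrier_G T_def by blast
  have 1: "(P * L') * (L * Q) = 1\<^sub>m d" by (simp add: mat_assoc L'L D(6))
  have 2: "(L * Q) * (P * L') = EM X X (Idm EC X)" by (simp add: mat_assoc c LL')
  show ?thesis using X 1 2 3 unfolding d_def[symmetric] by (intro bexI[of _ X] exI[of _ "L * Q"] exI[of _ "P * L'"]) (auto intro!: carrier_matI)
qed

lemma embedding: "rep_embedding G EC EN EM E\<Theta> E\<tau> E\<tau>'"
proof -
  interpret rep_monoid G by (rule G_monoid)
  have U: "Unit EC \<in> Obj EC" "Unit EC = [Unit PC]" using PUnit(1) by (simp_all add: EC_simps)
  have \<Theta>d: "E\<Theta> X g \<in> carrier_mat (EN X) (EN X)" for X g by (auto simp: E\<Theta>_def EN_def intro!: carrier_matI)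
  have T: "TenO EC = env_tensor PC" by (intro ext) (simp add: EC_simps)
  show ?thesis
  proof unfold_locales
    fix X Y Z assume X: "X \<in> Obj EC" and Y: "Y \<in> Obj EC" and Z: "Z \<in> Obj EC"
    have YZ: "env_tensor PC Y Z \<in> Obj EC" and XY: "env_tensor PC X Y \<in> Obj EC" and XYZ: "env_tensor PC X (env_tensor PC Y Z) \<in> Obj EC" using E_TenO X Y Z by blast+
    show "TenO EC (TenO EC X Y) Z = TenO EC X (TenO EC Y Z)" unfolding T using E_tensor_strict(3)[OF X Y Z] .
    show "Assoc EC X Y Z = Idm EC (TenO EC X (TenO EC Y Z))"
      unfolding EC_simps(11) EC_simps(3) T E_tensor_strict(3)[OF X Y Z] env_diag_def
    proof (rule cong_mat[OF HOL.refl HOL.refl])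
      fix n k assume "n < length (env_tensor PC X (env_tensor PC Y Z))" "k < length (env_tensor PC X (env_tensor PC Y Z))"
      then have n: "n < length X * (length Y * length Z)" by simp
      note d = div_mod_less[OF n]
      note d' = div_mod_less[OF d(2)]
      have e: "n mod (length Y * length Z) div length Z = n div length Z mod length Y" "n mod (length Y * length Z) mod length Z = n mod length Z"
        using d'(2) by (cases "length Z = 0"; simp add: mult.commute[of _ "length Z"] mod_mult2_eq)+
      have "env_tensor PC X (env_tensor PC Y Z) ! n = ptensor m 1 (X ! (n div (length Y * length Z))) (ptensor m 1 (Y ! (n div length Z mod length Y)) (Z ! (n mod length Z)))"
        using n d by (simp add: env_tensor_nth e)
      moreover have "ptensor m 1 (ptensor m 1 (X ! (n div (length Y * length Z))) (Y ! (n div length Z mod length Y))) (Z ! (n mod length Z)) =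
        ptensor m 1 (X ! (n div (length Y * length Z))) (ptensor m 1 (Y ! (n div length Z mod length Y)) (Z ! (n mod length Z)))"
        using d d' unfolding e by (intro P_tensor_strict(3) nth_P[OF X] nth_P[OF Y] nth_P[OF Z])
      ultimately show "(\<lambda>(i, j). if i = j then Assoc PC (X ! (i div (length Y * length Z))) (Y ! (i div length Z mod length Y)) (Z ! (i mod length Z))
          else Zero PC (env_tensor PC X (env_tensor PC Y Z) ! j) (env_tensor PC X (env_tensor PC Y Z) ! i)) (n, k) =
        (\<lambda>(i, j). if i = j then Idm PC (env_tensor PC X (env_tensor PC Y Z) ! i)
          else Zero PC (env_tensor PC X (env_tensor PC Y Z) ! j) (env_tensor PC X (env_tensor PC Y Z) ! i)) (n, k)"
        by (auto simp: PC_simps(3,11))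
    qed
    show "E\<tau> (TenO EC X Y) Z * kron (E\<tau> X Y) (1\<^sub>m (EN Z)) = E\<tau> X (TenO EC Y Z) * kron (1\<^sub>m (EN X)) (E\<tau> Y Z)"
      unfolding T by (rule E\<tau>_assoc[OF X Y Z])
  next
    fix X assume X: "X \<in> Obj EC"
    show "TenO EC (Unit EC) X = X" "TenO EC X (Unit EC) = X" unfolding T U(2) using E_tensor_strict(1,2)[OF X] by blast+
    show "LUnit EC X = Idm EC X" "RUnit EC X = Idm EC X"
      unfolding EC_simps(12,13) EC_simps(3) E_tensor_strict[OF X] PC_simps(3,12,13) by blast+
    show "E\<Theta> X \<one>\<^bsub>G\<^esub> = 1\<^sub>m (EN X)" unfolding G_ops E\<Theta>_def EN_def MAT_one[OF ixs(2), symmetric]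
      by (rule MAT_cong) (simp add: chi_gz)
    show "E\<tau> (Unit EC) X = 1\<^sub>m (EN X)" "E\<tau> X (Unit EC) = 1\<^sub>m (EN X)" unfolding U(2) using E\<tau>_unit[OF X] by blast+
    show "E\<Theta> X (g \<otimes>\<^bsub>G\<^esub> h) = E\<Theta> X g * E\<Theta> X h" if "g \<in> carrier G" "h \<in> carrier G" for g h
      using that E\<Theta>_mult unfolding carrier_G G_ops by auto
  next
    fix X Y A assume X: "X \<in> Obj EC" and Y: "Y \<in> Obj EC" and A: "A \<in> carrier_mat (EN Y) (EN X)" "EM Y Y (Idm EC Y) * A * EM X X (Idm EC X) = A"
      "\<And>g. g \<in> carrier G \<Longrightarrow> A * E\<Theta> X g = E\<Theta> Y g * A"
    then show "\<exists>f \<in> Hom EC X Y. EM X Y f = A" by (intro E_full) (auto simp: carrier_G)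
  next
    fix X Y g assume X: "X \<in> Obj EC" and Y: "Y \<in> Obj EC" and "g \<in> carrier G"
    then obtain k where g: "g = gz \<zeta> k" by (auto simp: carrier_G)
    show "E\<Theta> (TenO EC X Y) g * E\<tau> X Y = E\<tau> X Y * kron (E\<Theta> X g) (E\<Theta> Y g)"
      unfolding T E\<Theta>_def
    proof (rule E\<tau>_MAT[OF X Y X Y])
      fix x x' y y' assume i: "x \<in> set (ixs X)" "y \<in> set (ixs Y)" "x' \<in> set (ixs X)" "y' \<in> set (ixs Y)"
      have "\<beta> Y (x', y') = \<beta> Y (x, y) \<longleftrightarrow> x' = x \<and> y' = y"
        using inj_onD[OF \<beta>_inj[of Y X], of "(x', y')" "(x, y)"] i by auto
      then show "(if \<beta> Y (x', y') = \<beta> Y (x, y) then chi g (snd (\<beta> Y (x', y'))) else 0) = (if x' = x then chi g (snd x') else 0) * (if y' = y then chi g (snd y') else 0)"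
        by (auto simp: g chi_append \<beta>_def)
    qed
  next
    show "EN (Unit EC) = 1" by (simp add: U EN_def ixs_unit)
    show "EM (Unit EC) (Unit EC) (Idm EC (Unit EC)) = 1\<^sub>m 1"
      unfolding E_Id(2)[OF U(1)] unfolding U(2) ixs_unit using MAT_one[of "[(0 :: nat, [] :: bool list)]"]
      by (simp add: MAT_def) (auto simp: pv_def PUnit wid_def intro!: eq_matI)
    show "E\<Theta> (Unit EC) g = 1\<^sub>m 1" if "g \<in> carrier G" for g unfolding E\<Theta>_def U(2) ixs_unit by (auto simp: MAT_def chi_def intro!: eq_matI)
  next
    fix X Y f g assume "X \<in> Obj EC" "Y \<in> Obj EC" "f \<in> Hom EC X Y" "g \<in> carrier G"
    then show "EM X Y f * E\<Theta> X g = E\<Theta> Y g * EM X Y f" using E_comm by (auto simp: carrier_G)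
  next
    fix X Y f g assume "X \<in> Obj EC" "Y \<in> Obj EC" "f \<in> Hom EC X Y" "g \<in> Hom EC X Y" "EM X Y f = EM X Y g"
    then show "f = g" by (rule E_inj)
  next
    fix X X' Y Y' f g assume "X \<in> Obj EC" "X' \<in> Obj EC" "Y \<in> Obj EC" "Y' \<in> Obj EC" "f \<in> Hom EC X X'" "g \<in> Hom EC Y Y'"
    then show "TenM EC X X' Y Y' f g \<in> Hom EC (TenO EC X Y) (TenO EC X' Y')"
      "EM (TenO EC X Y) (TenO EC X' Y') (TenM EC X X' Y Y' f g) * E\<tau> X Y = E\<tau> X' Y' * kron (EM X X' f) (EM Y Y' g)"
      unfolding T by (rule E_TenM)+
  next
    fix V assume "is_rep G V"
    then show "\<exists>X \<in> Obj EC. \<exists>L L'. L \<in> carrier_mat (EN X) (fst V) \<and> L' \<in> carrier_mat (fst V) (EN X) \<and>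
        L' * L = 1\<^sub>m (fst V) \<and> L * L' = EM X X (Idm EC X) \<and> (\<forall>g \<in> carrier G. E\<Theta> X g * L = L * snd V g)" by (rule E_ess)
  next
    show "Unit EC \<in> Obj EC" by (rule U(1))
  next
    fix X s show "E\<Theta> X s \<in> carrier_mat (EN X) (EN X)" by (rule \<Theta>d)
  next
    fix X assume X: "X \<in> Obj EC"
    show "Idm EC X \<in> Hom EC X X" by (rule E_Id(1)[OF X])
  next
    fix X Y assume X: "X \<in> Obj EC" and Y: "Y \<in> Obj EC"
    show "TenO EC X Y \<in> Obj EC" unfolding T by (rule E_TenO[OF X Y])
    show "Zero EC X Y \<in> Hom EC X Y" "EM X Y (Zero EC X Y) = 0\<^sub>m (EN Y) (EN X)" by (rule E_lin(1,2)[OF X Y])+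
    show "E\<tau> X Y \<in> carrier_mat (EN (TenO EC X Y)) (EN X * EN Y)" "E\<tau>' X Y \<in> carrier_mat (EN X * EN Y) (EN (TenO EC X Y))"
      unfolding T by (rule E\<tau>_dim)+
    show "E\<tau> X Y * E\<tau>' X Y = 1\<^sub>m (EN (TenO EC X Y))" "E\<tau>' X Y * E\<tau> X Y = 1\<^sub>m (EN X * EN Y)"
      unfolding T by (rule E\<tau>_inv[OF X Y])+
    show "EM (TenO EC X Y) (TenO EC X Y) (Idm EC (TenO EC X Y)) * E\<tau> X Y = E\<tau> X Y * kron (EM X X (Idm EC X)) (EM Y Y (Idm EC Y))"
      unfolding T by (rule E\<tau>_p[OF X Y])
  next
    fix X Y f assume X: "X \<in> Obj EC" and Y: "Y \<in> Obj EC" and f: "f \<in> Hom EC X Y"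
    show "EM X Y f \<in> carrier_mat (EN Y) (EN X)" by (auto simp: EM_def EN_def intro!: carrier_matI)
    show "EM X Y f * EM X X (Idm EC X) = EM X Y f" "EM Y Y (Idm EC Y) * EM X Y f = EM X Y f" by (rule E_p[OF X Y f])+
    show "Scale EC X Y c f \<in> Hom EC X Y" "EM X Y (Scale EC X Y c f) = c \<cdot>\<^sub>m EM X Y f" for c using E_lin(4)[OF X Y f] by blast+
  next
    fix X Y f g assume X: "X \<in> Obj EC" and Y: "Y \<in> Obj EC" and fg: "f \<in> Hom EC X Y" "g \<in> Hom EC X Y"
    show "Add EC X Y f g \<in> Hom EC X Y" "EM X Y (Add EC X Y f g) = EM X Y f + EM X Y g" using E_lin(3)[OF X Y fg] by blast+
  next
    fix X Y Z f g assume a: "X \<in> Obj EC" "Y \<in> Obj EC" "Z \<in> Obj EC" "f \<in> Hom EC X Y" "g \<in> Hom EC Y Z"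
    show "Comp EC X Y Z g f \<in> Hom EC X Z" "EM X Z (Comp EC X Y Z g f) = EM Y Z g * EM X Y f" by (rule E_Comp[OF a])+
  qed
qed

end

theorem mainTheorem14:
  fixes m :: nat and \<zeta> :: complex
  assumes "m \<ge> 2"
    and "\<zeta> ^ m = 1" and "\<forall>k. 0 < k \<and> k < m \<longrightarrow> \<zeta> ^ k \<noteq> 1"
  shows "monoidally_equivalent (planar_category m 1) (Rep (cyclic_subgroup \<zeta>))"
proof -
  interpret planar_rep m \<zeta> using assms by unfold_locales auto
  interpret rep_embedding "cyclic_subgroup \<zeta>" "planar_category m 1" EN EM E\<Theta> E\<tau> E\<tau>' by (rule embedding)
  show ?thesis by (rule equivalent)
qed

end
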